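(* Let $(M,\nabla)$ be a flat affine connected $n$-dimensional manifold, with connection form $\omega$ on the bundle of linear frames $P=L(M)$ and fundamental form $\theta$. Then there exists a Lie group homomorphism $$\rho:\widehat{Aut}(P,\omega)_0\longrightarrow Aut(L(\mathbb{R}^n),\omega^0)$$ determined by $(\theta,\omega)$.
   Context: $(M,\nabla)$ is flat affine if the curvature and torsion tensors of the linear connection $\nabla$ both vanish. $M$ is a real paracompact manifold. $Aut(P,\omega)$ is the Lie group of diffeomorphisms of $P=L(M)$ preserving $\omega$ (and therefore $\theta$); it is isomorphic to the group $\mathsf{Aff}(M,\nabla)$ of affine transformations of $(M,\nabla)$. $Aut(P,\omega)_0$ is its unit component and $\widehat{Aut}(P,\omega)_0$ is the universal covering Lie group of $Aut(P,\omega)_0$. Its Lie algebra is identified with $\mathfrak{a}_c(P)$, the space of natural lifts $L(X)$ to $P$ of the complete infinitesimal affine transformations $X$ of $(M,\nabla)$. $\omega^0$ is the connection form on $L(\mathbb{R}^n)$ of the usual connection $\nabla^0$ of $\mathbb{R}^n$. The group $Aut(L(\mathbb{R}^n),\omega^0)$ is isomorphic to the classical affine group $\mathsf{Aff}(\mathbb{R}^n,\nabla^0)$, with Lie algebra $\mathsf{aff}(\mathbb{R}^n)=\mathbb{R}^n\rtimes\mathsf{gl}(\mathbb{R}^n)$. "Determined by $(\theta,\omega)$" means that the derivative of $\rho$ at the identity is given by $(\theta,\omega)$, i.e. it is the map $\mathfrak{a}_c(P)\to\mathsf{aff}(\mathbb{R}^n)$, $Z\mapsto(\theta_u(Z_u),\omega_u(Z_u))$,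 for a fixed $u\in P$. *)

theory Defs
  imports "HOL-Analysis.Analysis" "HOL-Algebra.Bij"
begin

section \<open>Smooth manifolds\<close>

text \<open>
  A function is \<open>C\<^sup>k\<close> on an open set if it is differentiable there and all its directional
  derivatives are \<open>C\<^sup>k\<^sup>-\<^sup>1\<close>; this is used for finite-dimensional domains only.
\<close>

primrec Ck_on :: "nat \<Rightarrow> ('a::real_normed_vector \<Rightarrow> 'b::real_normed_vector) \<Rightarrow> 'a set \<Rightarrow> bool" where
  "Ck_on 0 f S \<longleftrightarrow> continuous_on S f"
| "Ck_on (Suc k) f S \<longleftrightarrow>
     (\<forall>x\<in>S. f differentiable (at x)) \<and> (\<forall>v. Ck_on k (\<lambda>x. frechet_derivative f (at x) v) S)"

definition smooth_on :: "'a::real_normed_vector set \<Rightarrow> ('a \<Rightarrow> 'b::real_normed_vector) \<Rightarrow> bool" where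
  "smooth_on S f \<longleftrightarrow> open S \<and> (\<forall>k. Ck_on k f S)"

text \<open>
  A chart is a pair of its domain and its coordinate map; the values of the coordinate map
  outside the domain are irrelevant.
\<close>

type_synonym ('a, 'e) chart = "'a set \<times> ('a \<Rightarrow> 'e)"

abbreviation cinv :: "('a, 'e) chart \<Rightarrow> 'e \<Rightarrow> 'a" where
  "cinv c \<equiv> inv_into (fst c) (snd c)"

record ('a, 'e) mfd =
  tops :: "'a topology"
  atlas :: "('a, 'e) chart set"

abbreviation points :: "('a, 'e) mfd \<Rightarrow> 'a set" where
  "points M \<equiv> topspace (tops M)"

definition charts_at :: "('a, 'e) mfd \<Rightarrow> 'a \<Rightarrow> ('a, 'e) chart set" where
  "charts_at M x = {c \<in> atlas M. x \<in> fst c}"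

definition paracompact_space :: "'a topology \<Rightarrow> bool" where
  "paracompact_space X \<longleftrightarrow>
     (\<forall>\<U>. (\<forall>U\<in>\<U>. openin X U) \<and> \<Union>\<U> = topspace X \<longrightarrow>
        (\<exists>\<V>. (\<forall>V\<in>\<V>. openin X V) \<and> \<Union>\<V> = topspace X \<and>
             (\<forall>V\<in>\<V>. \<exists>U\<in>\<U>. V \<subseteq> U) \<and> locally_finite_in X \<V>))"

text \<open>
  The model space is a finite-dimensional real normed space.  In contrast to the class
  \<open>euclidean_space\<close> this allows dimension 0, which is needed for discrete Lie groups.
\<close>

definition smooth_manifold :: "('a, 'e::real_normed_vector) mfd \<Rightarrow> bool" where
  "smooth_manifold M \<longleftrightarrow>
     (\<exists>B::'e set. finite B \<and> span B = UNIV) \<and>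
     Hausdorff_space (tops M) \<and> paracompact_space (tops M) \<and>
     (\<Union>c\<in>atlas M. fst c) = points M \<and>
     (\<forall>c\<in>atlas M. openin (tops M) (fst c) \<and> open (snd c ` fst c) \<and>
        homeomorphic_map (subtopology (tops M) (fst c)) (top_of_set (snd c ` fst c)) (snd c)) \<and>
     (\<forall>c\<in>atlas M. \<forall>d\<in>atlas M. smooth_on (snd c ` (fst c \<inter> fst d)) (snd d \<circ> cinv c))"

definition smooth_map ::
  "('a, 'e::real_normed_vector) mfd \<Rightarrow> ('b, 'f::real_normed_vector) mfd \<Rightarrow> ('a \<Rightarrow> 'b) \<Rightarrow> bool" where
  "smooth_map M N F \<longleftrightarrow>
     continuous_map (tops M) (tops N) F \<and>
     (\<forall>c\<in>atlas M. \<forall>d\<in>atlas N.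
        smooth_on (snd c ` {x \<in> fst c. F x \<in> fst d}) (snd d \<circ> F \<circ> cinv c))"

definition diffeomorphism ::
  "('a, 'e::real_normed_vector) mfd \<Rightarrow> ('b, 'f::real_normed_vector) mfd \<Rightarrow> ('a \<Rightarrow> 'b) \<Rightarrow> bool" where
  "diffeomorphism M N F \<longleftrightarrow>
     smooth_map M N F \<and>
     (\<exists>G. smooth_map N M G \<and> (\<forall>x\<in>points M. G (F x) = x) \<and> (\<forall>y\<in>points N. F (G y) = y))"

definition open_submfd :: "('a, 'e) mfd \<Rightarrow> 'a set \<Rightarrow> ('a, 'e) mfd" where
  "open_submfd M W =
     \<lparr>tops = subtopology (tops M) W, atlas = (\<lambda>c. (fst c \<inter> W, snd c)) ` atlas M\<rparr>"

definition prod_mfd :: "('a, 'e) mfd \<Rightarrow> ('b, 'f) mfd \<Rightarrow> ('a \<times> 'b, 'e \<times> 'f) mfd" where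
  "prod_mfd M N =
     \<lparr>tops = prod_topology (tops M) (tops N),
      atlas = (\<lambda>(c, d). (fst c \<times> fst d, map_prod (snd c) (snd d))) ` (atlas M \<times> atlas N)\<rparr>"

definition vector_mfd :: "('e::real_normed_vector, 'e) mfd" where
  "vector_mfd = \<lparr>tops = euclidean, atlas = {(UNIV, id)}\<rparr>"


section \<open>Tangent vectors\<close>

text \<open>
  A tangent vector is given by its components in the charts of the atlas, subject to the
  transformation law; the component is 0 by convention for charts not containing the foot point.
  Linear combinations of tangent vectors are thus computed chart by chart.
\<close>

type_synonym ('a, 'e) tvec = "('a, 'e) chart \<Rightarrow> 'e"

definition tangent_space :: "('a, 'e::real_normed_vector) mfd \<Rightarrow> 'a \<Rightarrow> ('a, 'e) tvec set" where
  "tangent_space M x =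
     {v. (\<forall>c. c \<notin> charts_at M x \<longrightarrow> v c = 0) \<and>
         (\<forall>c\<in>charts_at M x. \<forall>d\<in>charts_at M x.
            v d = frechet_derivative (snd d \<circ> cinv c) (at (snd c x)) (v c))}"

definition tangent_map ::
  "('a, 'e::real_normed_vector) mfd \<Rightarrow> ('b, 'f::real_normed_vector) mfd \<Rightarrow> ('a \<Rightarrow> 'b) \<Rightarrow> 'a \<Rightarrow>
   ('a, 'e) tvec \<Rightarrow> ('b, 'f) tvec" where
  "tangent_map M N F x v = (\<lambda>d.
     if d \<in> charts_at N (F x)
     then let c = (SOME c. c \<in> charts_at M x)
          in frechet_derivative (snd d \<circ> F \<circ> cinv c) (at (snd c x)) (v c)
     else 0)"

definition velocity ::
  "('a, 'e::real_normed_vector) mfd \<Rightarrow> (real \<Rightarrow> 'a) \<Rightarrow> real \<Rightarrow> ('a, 'e) tvec" where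
  "velocity M \<gamma> t = (\<lambda>d.
     if d \<in> charts_at M (\<gamma> t) then vector_derivative (snd d \<circ> \<gamma>) (at t) else 0)"

definition fun_deriv ::
  "('a, 'e::real_normed_vector) mfd \<Rightarrow> ('a \<Rightarrow> real) \<Rightarrow> 'a \<Rightarrow> ('a, 'e) tvec \<Rightarrow> real" where
  "fun_deriv M f x v = tangent_map M vector_mfd f x v (UNIV, id)"

text \<open>Fields are total functions; only the values on the open set \<open>W\<close> matter.\<close>

definition smooth_field ::
  "('a, 'e::real_normed_vector) mfd \<Rightarrow> 'a set \<Rightarrow> ('a \<Rightarrow> ('a, 'e) tvec) \<Rightarrow> bool" where
  "smooth_field M W Y \<longleftrightarrow>
     openin (tops M) W \<and> (\<forall>x\<in>W. Y x \<in> tangent_space M x) \<and>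
     (\<forall>c\<in>atlas M. smooth_on (snd c ` (fst c \<inter> W)) (\<lambda>y. Y (cinv c y) c))"

definition lie_bracket ::
  "('a, 'e::real_normed_vector) mfd \<Rightarrow> ('a \<Rightarrow> ('a, 'e) tvec) \<Rightarrow> ('a \<Rightarrow> ('a, 'e) tvec) \<Rightarrow>
   'a \<Rightarrow> ('a, 'e) tvec" where
  "lie_bracket M X Y x = (\<lambda>c.
     if c \<in> charts_at M x
     then frechet_derivative (\<lambda>y. Y (cinv c y) c) (at (snd c x)) (X x c)
        - frechet_derivative (\<lambda>y. X (cinv c y) c) (at (snd c x)) (Y x c)
     else 0)"


section \<open>Linear connections and affine transformations\<close>

text \<open>
  \<open>cov x v Y\<close> is the covariant derivative at \<open>x\<close>, in the direction \<open>v\<close>, of a vector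
  field \<open>Y\<close> defined and smooth on some open neighbourhood of \<open>x\<close>.
\<close>

type_synonym ('a, 'e) cov_deriv = "'a \<Rightarrow> ('a, 'e) tvec \<Rightarrow> ('a \<Rightarrow> ('a, 'e) tvec) \<Rightarrow> ('a, 'e) tvec"

definition linear_connection ::
  "('a, 'e::real_normed_vector) mfd \<Rightarrow> ('a, 'e) cov_deriv \<Rightarrow> bool" where
  "linear_connection M cov \<longleftrightarrow>
     (\<forall>W Y. smooth_field M W Y \<longrightarrow>
        (\<forall>x\<in>W.
           (\<forall>v\<in>tangent_space M x. cov x v Y \<in> tangent_space M x) \<and>
           (\<forall>v\<in>tangent_space M x. \<forall>w\<in>tangent_space M x. \<forall>a b.
              cov x (\<lambda>c. a *\<^sub>R v c + b *\<^sub>R w c) Y = (\<lambda>c. a *\<^sub>R cov x v Y c + b *\<^sub>R cov x w Y c)) \<and>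
           (\<forall>v\<in>tangent_space M x. \<forall>Y'. smooth_field M W Y' \<longrightarrow>
              cov x v (\<lambda>y c. Y y c + Y' y c) = (\<lambda>c. cov x v Y c + cov x v Y' c)) \<and>
           (\<forall>v\<in>tangent_space M x. \<forall>f::'a \<Rightarrow> real. smooth_map (open_submfd M W) vector_mfd f \<longrightarrow>
              cov x v (\<lambda>y c. f y *\<^sub>R Y y c)
                = (\<lambda>c. fun_deriv M f x v *\<^sub>R Y x c + f x *\<^sub>R cov x v Y c)) \<and>
           (\<forall>v\<in>tangent_space M x. \<forall>Y'. (\<forall>y\<in>W. Y' y = Y y) \<longrightarrow> cov x v Y' = cov x v Y)) \<and>
        (\<forall>X. smooth_field M W X \<longrightarrow> smooth_field M W (\<lambda>x. cov x (X x) Y)))"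

definition torsion_tensor ::
  "('a, 'e::real_normed_vector) mfd \<Rightarrow> ('a, 'e) cov_deriv \<Rightarrow>
   ('a \<Rightarrow> ('a, 'e) tvec) \<Rightarrow> ('a \<Rightarrow> ('a, 'e) tvec) \<Rightarrow> 'a \<Rightarrow> ('a, 'e) tvec" where
  "torsion_tensor M cov X Y x = (\<lambda>c. cov x (X x) Y c - cov x (Y x) X c - lie_bracket M X Y x c)"

definition curvature_tensor ::
  "('a, 'e::real_normed_vector) mfd \<Rightarrow> ('a, 'e) cov_deriv \<Rightarrow>
   ('a \<Rightarrow> ('a, 'e) tvec) \<Rightarrow> ('a \<Rightarrow> ('a, 'e) tvec) \<Rightarrow> ('a \<Rightarrow> ('a, 'e) tvec) \<Rightarrow> 'a \<Rightarrow> ('a, 'e) tvec" where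
  "curvature_tensor M cov X Y Z x = (\<lambda>c.
     cov x (X x) (\<lambda>y. cov y (Y y) Z) c - cov x (Y x) (\<lambda>y. cov y (X y) Z) c
     - cov x (lie_bracket M X Y x) Z c)"

definition flat_affine :: "('a, 'e::real_normed_vector) mfd \<Rightarrow> ('a, 'e) cov_deriv \<Rightarrow> bool" where
  "flat_affine M cov \<longleftrightarrow>
     (\<forall>W X Y Z. smooth_field M W X \<and> smooth_field M W Y \<and> smooth_field M W Z \<longrightarrow>
        (\<forall>x\<in>W. torsion_tensor M cov X Y x = (\<lambda>c. 0) \<and> curvature_tensor M cov X Y Z x = (\<lambda>c. 0)))"

text \<open>The usual connection of a vector space: differentiation of components.\<close>

definition usual_connection :: "('e::real_normed_vector, 'e) cov_deriv" where
  "usual_connection x v Y = (\<lambda>c.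
     if c = (UNIV, id) then frechet_derivative (\<lambda>y. Y y (UNIV, id)) (at x) (v (UNIV, id)) else 0)"

definition affine_transformation ::
  "('a, 'e::real_normed_vector) mfd \<Rightarrow> ('a, 'e) cov_deriv \<Rightarrow> ('a \<Rightarrow> 'a) \<Rightarrow> bool" where
  "affine_transformation M cov f \<longleftrightarrow>
     diffeomorphism M M f \<and>
     (\<forall>W Y. smooth_field M W Y \<longrightarrow>
        (\<forall>x\<in>W. \<forall>v\<in>tangent_space M x.
           tangent_map M M f x (cov x v Y) =
           cov (f x) (tangent_map M M f x v)
             (\<lambda>y. let z = inv_into (points M) f y in tangent_map M M f z (Y z))))"


section \<open>The bundle of linear frames\<close>

text \<open>
  A linear frame at \<open>x\<close> is an ordered basis \<open>u\<close> of the tangent space at \<open>x\<close>, viewed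
  also as the linear isomorphism \<open>frame_map u\<close> of \<open>\<real>\<^sup>n\<close> onto the tangent space.
\<close>

type_synonym ('m, 'n) frame = "'m \<times> ('n \<Rightarrow> ('m, real^'n) tvec)"
type_synonym ('m, 'n) frame_tvec = "(('m, 'n) frame, (real^'n) \<times> (real^'n^'n)) tvec"

definition frame_map :: "('n::finite \<Rightarrow> ('m, real^'n) tvec) \<Rightarrow> real^'n \<Rightarrow> ('m, real^'n) tvec" where
  "frame_map u \<xi> = (\<lambda>c. \<Sum>j\<in>UNIV. (\<xi> $ j) *\<^sub>R u j c)"

definition frames :: "('m, real^'n::finite) mfd \<Rightarrow> ('m, 'n) frame set" where
  "frames M = {(x, u). x \<in> points M \<and> bij_betw (frame_map u) UNIV (tangent_space M x)}"

definition frame_chart ::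
  "('m, real^'n::finite) mfd \<Rightarrow> ('m, real^'n) chart \<Rightarrow>
   (('m, 'n) frame, (real^'n) \<times> (real^'n^'n)) chart" where
  "frame_chart M c =
     ({w \<in> frames M. fst w \<in> fst c}, \<lambda>w. (snd c (fst w), \<chi> i j. snd w j c $ i))"

definition frame_bundle ::
  "('m, real^'n::finite) mfd \<Rightarrow> (('m, 'n) frame, (real^'n) \<times> (real^'n^'n)) mfd" where
  "frame_bundle M =
     \<lparr>tops = topology_generated_by
        {{w \<in> fst (frame_chart M c). snd (frame_chart M c) w \<in> V} | c V. c \<in> atlas M \<and> open V},
      atlas = frame_chart M ` atlas M\<rparr>"

definition right_action :: "('m, 'n::finite) frame \<Rightarrow> real^'n^'n \<Rightarrow> ('m, 'n) frame" where
  "right_action w a = (fst w, \<lambda>j. frame_map (snd w) (column j a))"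

text \<open>
  The fundamental vertical vector \<open>A\<^sup>*\<close> at \<open>w\<close>: the curves \<open>t \<mapsto> w exp (t A)\<close> and
  \<open>t \<mapsto> w (I + t A)\<close> have the same velocity at 0.
\<close>

definition fundamental_vector ::
  "('m, real^'n::finite) mfd \<Rightarrow> real^'n^'n \<Rightarrow> ('m, 'n) frame \<Rightarrow> ('m, 'n) frame_tvec" where
  "fundamental_vector M A w = velocity (frame_bundle M) (\<lambda>t. right_action w (mat 1 + t *\<^sub>R A)) 0"

text \<open>The fundamental form \<open>\<theta>\<^sub>w(Z) = w\<^sup>-\<^sup>1(d\<pi>(Z))\<close>.\<close>

definition fundamental_form ::
  "('m, real^'n::finite) mfd \<Rightarrow> ('m, 'n) frame \<Rightarrow> ('m, 'n) frame_tvec \<Rightarrow> real^'n" where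
  "fundamental_form M w Z = inv_into UNIV (frame_map (snd w)) (tangent_map (frame_bundle M) M fst w Z)"

text \<open>
  A connection form on the frame bundle, and its relation to the covariant derivative
  \<open>cov\<close>: for a local frame field \<open>\<sigma> = (e\<^sub>1, \<dots>, e\<^sub>n)\<close> one has
  \<open>\<nabla>\<^sub>v e\<^sub>j = \<Sum>\<^sub>i (\<sigma>\<^sup>*\<omega>)\<^sub>i\<^sub>j(v) e\<^sub>i\<close>.  Together these conditions determine \<open>\<omega>\<close> on tangent vectors.
\<close>

definition connection_form ::
  "('m, real^'n::finite) mfd \<Rightarrow> ('m, real^'n) cov_deriv \<Rightarrow>
   (('m, 'n) frame \<Rightarrow> ('m, 'n) frame_tvec \<Rightarrow> real^'n^'n) \<Rightarrow> bool" where
  "connection_form M cov \<omega> \<longleftrightarrow>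
     (\<forall>w\<in>frames M. \<forall>Z\<in>tangent_space (frame_bundle M) w. \<forall>Z'\<in>tangent_space (frame_bundle M) w. \<forall>a b.
        \<omega> w (\<lambda>c. a *\<^sub>R Z c + b *\<^sub>R Z' c) = a *\<^sub>R \<omega> w Z + b *\<^sub>R \<omega> w Z') \<and>
     (\<forall>W Z. smooth_field (frame_bundle M) W Z \<longrightarrow>
        smooth_map (open_submfd (frame_bundle M) W) vector_mfd (\<lambda>w. \<omega> w (Z w))) \<and>
     (\<forall>w\<in>frames M. \<forall>A. \<omega> w (fundamental_vector M A w) = A) \<and>
     (\<forall>w\<in>frames M. \<forall>a. invertible a \<longrightarrow> (\<forall>Z\<in>tangent_space (frame_bundle M) w.
        \<omega> (right_action w a)
          (tangent_map (frame_bundle M) (frame_bundle M) (\<lambda>w'. right_action w' a) w Z)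
        = matrix_inv a ** \<omega> w Z ** a)) \<and>
     (\<forall>W \<sigma>. openin (tops M) W \<and> smooth_map (open_submfd M W) (frame_bundle M) \<sigma> \<and>
        (\<forall>x\<in>W. fst (\<sigma> x) = x) \<longrightarrow>
        (\<forall>x\<in>W. \<forall>v\<in>tangent_space M x. \<forall>j.
           cov x v (\<lambda>y. snd (\<sigma> y) j) =
           frame_map (snd (\<sigma> x)) (column j (\<omega> (\<sigma> x) (tangent_map M (frame_bundle M) \<sigma> x v)))))"

definition natural_lift ::
  "('m, real^'n::finite) mfd \<Rightarrow> ('m \<Rightarrow> 'm) \<Rightarrow> ('m, 'n) frame \<Rightarrow> ('m, 'n) frame" where
  "natural_lift M f w = (f (fst w), \<lambda>j. tangent_map M M f (fst w) (snd w j))"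


section \<open>Complete infinitesimal affine transformations and their natural lifts\<close>

definition global_flow ::
  "('a, 'e::real_normed_vector) mfd \<Rightarrow> ('a \<Rightarrow> ('a, 'e) tvec) \<Rightarrow> (real \<Rightarrow> 'a \<Rightarrow> 'a) \<Rightarrow> bool" where
  "global_flow M X \<phi> \<longleftrightarrow>
     smooth_map (prod_mfd vector_mfd M) M (\<lambda>(t, x). \<phi> t x) \<and>
     (\<forall>x\<in>points M. \<phi> 0 x = x \<and> (\<forall>s t. \<phi> (s + t) x = \<phi> s (\<phi> t x)) \<and>
        velocity M (\<lambda>t. \<phi> t x) 0 = X x)"

text \<open>
  The natural lift \<open>L(X)\<close> is the vector field on the frame bundle generated by the natural
  lifts of the flow of \<open>X\<close>.  Fields on the frame bundle are \<open>undefined\<close> off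
  \<open>frames M\<close>, so that equality of fields is equality of functions.
\<close>

definition complete_affine_lifts ::
  "('m, real^'n::finite) mfd \<Rightarrow> ('m, real^'n) cov_deriv \<Rightarrow>
   (('m, 'n) frame \<Rightarrow> ('m, 'n) frame_tvec) set" where
  "complete_affine_lifts M cov =
     {\<lambda>w\<in>frames M. velocity (frame_bundle M) (\<lambda>t. natural_lift M (\<phi> t) w) 0 | X \<phi>.
        smooth_field M (points M) X \<and> global_flow M X \<phi> \<and>
        (\<forall>t. affine_transformation M cov (\<phi> t))}"


section \<open>Lie groups\<close>

definition lie_group :: "'g monoid \<Rightarrow> ('g, 'e::real_normed_vector) mfd \<Rightarrow> bool" where
  "lie_group G \<G> \<longleftrightarrow>
     group G \<and> smooth_manifold \<G> \<and> points \<G> = carrier G \<and>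
     smooth_map (prod_mfd \<G> \<G>) \<G> (\<lambda>(g, h). g \<otimes>\<^bsub>G\<^esub> h) \<and>
     smooth_map \<G> \<G> (\<lambda>g. inv\<^bsub>G\<^esub> g)"

definition lie_group_hom ::
  "'g monoid \<Rightarrow> ('g, 'e::real_normed_vector) mfd \<Rightarrow>
   'h monoid \<Rightarrow> ('h, 'f::real_normed_vector) mfd \<Rightarrow> ('g \<Rightarrow> 'h) \<Rightarrow> bool" where
  "lie_group_hom G \<G> H \<H> \<rho> \<longleftrightarrow> \<rho> \<in> hom G H \<and> smooth_map \<G> \<H> \<rho>"

definition unit_component :: "'g monoid \<Rightarrow> ('g, 'e) mfd \<Rightarrow> 'g set" where
  "unit_component G \<G> = connected_component_of_set (tops \<G>) \<one>\<^bsub>G\<^esub>"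

definition simply_connected_space :: "'a topology \<Rightarrow> bool" where
  "simply_connected_space X \<longleftrightarrow>
     path_connected_space X \<and>
     (\<forall>p q. pathin X p \<and> p 1 = p 0 \<and> pathin X q \<and> q 1 = q 0 \<longrightarrow>
        homotopic_with (\<lambda>r. r 1 = r 0) (top_of_set {0..1::real}) X p q)"

definition smooth_covering ::
  "('a, 'e::real_normed_vector) mfd \<Rightarrow> ('b, 'f::real_normed_vector) mfd \<Rightarrow> ('a \<Rightarrow> 'b) \<Rightarrow> bool" where
  "smooth_covering M N p \<longleftrightarrow>
     smooth_map M N p \<and> p ` points M = points N \<and>
     (\<forall>y\<in>points N. \<exists>T. y \<in> T \<and> openin (tops N) T \<and>
        (\<exists>\<V>. \<Union>\<V> = {x \<in> points M. p x \<in> T} \<and> (\<forall>V\<in>\<V>. openin (tops M) V) \<and>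
             pairwise disjnt \<V> \<and>
             (\<forall>V\<in>\<V>. diffeomorphism (open_submfd M V) (open_submfd N T) p)))"

definition universal_covering_group ::
  "'g monoid \<Rightarrow> ('g, 'e::real_normed_vector) mfd \<Rightarrow>
   'h monoid \<Rightarrow> ('h, 'f::real_normed_vector) mfd \<Rightarrow> ('g \<Rightarrow> 'h) \<Rightarrow> bool" where
  "universal_covering_group G \<G> H \<H> p \<longleftrightarrow>
     lie_group G \<G> \<and> simply_connected_space (tops \<G>) \<and> p \<in> hom G H \<and> smooth_covering \<G> \<H> p"

text \<open>
  The vector field on \<open>P\<close> induced by a vector \<open>\<xi>\<close> tangent at the unit to a group acting on
  \<open>P\<close> by \<open>q\<close>.
\<close>

definition induced_field ::
  "'g monoid \<Rightarrow> ('g, 'e::real_normed_vector) mfd \<Rightarrow> ('p, 'f::real_normed_vector) mfd \<Rightarrow>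
   ('g \<Rightarrow> 'p \<Rightarrow> 'p) \<Rightarrow> ('g, 'e) tvec \<Rightarrow> 'p \<Rightarrow> ('p, 'f) tvec" where
  "induced_field G \<G> P q \<xi> = (\<lambda>w\<in>points P. tangent_map \<G> P (\<lambda>g. q g w) \<one>\<^bsub>G\<^esub> \<xi>)"


section \<open>The Lie group of automorphisms of a linear connection\<close>

text \<open>
  Automorphisms are the bundle automorphisms of \<open>L(M)\<close> preserving the connection form and the
  fundamental form, i.e. the natural lifts of the affine transformations of \<open>M\<close>.  As in
  \<open>Bij\<close>, they are \<open>undefined\<close> off \<open>frames M\<close>.
\<close>

definition Aut ::
  "('m, real^'n::finite) mfd \<Rightarrow> (('m, 'n) frame \<Rightarrow> ('m, 'n) frame_tvec \<Rightarrow> real^'n^'n) \<Rightarrow>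
   (('m, 'n) frame \<Rightarrow> ('m, 'n) frame) set" where
  "Aut M \<omega> = {F \<in> Bij (frames M).
     diffeomorphism (frame_bundle M) (frame_bundle M) F \<and>
     (\<forall>w\<in>frames M. \<forall>a. invertible a \<longrightarrow> F (right_action w a) = right_action (F w) a) \<and>
     (\<forall>w\<in>frames M. \<forall>Z\<in>tangent_space (frame_bundle M) w.
        \<omega> (F w) (tangent_map (frame_bundle M) (frame_bundle M) F w Z) = \<omega> w Z \<and>
        fundamental_form M (F w) (tangent_map (frame_bundle M) (frame_bundle M) F w Z)
          = fundamental_form M w Z)}"

definition AutGroup ::
  "('m, real^'n::finite) mfd \<Rightarrow> (('m, 'n) frame \<Rightarrow> ('m, 'n) frame_tvec \<Rightarrow> real^'n^'n) \<Rightarrow>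
   (('m, 'n) frame \<Rightarrow> ('m, 'n) frame) monoid" where
  "AutGroup M \<omega> = (BijGroup (frames M))\<lparr>carrier := Aut M \<omega>\<rparr>"

definition compact_open :: "'a topology \<Rightarrow> 'b topology \<Rightarrow> ('a \<Rightarrow> 'b) set \<Rightarrow> ('a \<Rightarrow> 'b) topology" where
  "compact_open X Y S =
     topology_generated_by {{f \<in> S. f ` K \<subseteq> U} | K U. compactin X K \<and> openin Y U}"

text \<open>
  \<open>Aut(P, \<omega>)\<close> is a Lie transformation group of \<open>P\<close> for the compact-open topology
  (Kobayashi), and its Lie algebra is identified with \<open>a\<^sub>c(P)\<close> by sending a tangent vector at the
  unit to the vector field it induces on \<open>P\<close>.  The smooth structure of a topological
  group with these properties is unique.
\<close>

definition aut_lie_structure ::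
  "('m, real^'n::finite) mfd \<Rightarrow> ('m, real^'n) cov_deriv \<Rightarrow>
   (('m, 'n) frame \<Rightarrow> ('m, 'n) frame_tvec \<Rightarrow> real^'n^'n) \<Rightarrow>
   (('m, 'n) frame \<Rightarrow> ('m, 'n) frame, 'e::real_normed_vector) mfd \<Rightarrow> bool" where
  "aut_lie_structure M cov \<omega> \<G> \<longleftrightarrow>
     lie_group (AutGroup M \<omega>) \<G> \<and>
     tops \<G> = compact_open (tops (frame_bundle M)) (tops (frame_bundle M)) (Aut M \<omega>) \<and>
     smooth_map (prod_mfd \<G> (frame_bundle M)) (frame_bundle M) (\<lambda>(F, w). F w) \<and>
     bij_betw (induced_field (AutGroup M \<omega>) \<G> (frame_bundle M) (\<lambda>F. F))
       (tangent_space \<G> \<one>\<^bsub>AutGroup M \<omega>\<^esub>) (complete_affine_lifts M cov)"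


section \<open>The automorphism group of the usual connection\<close>

text \<open>
  The pair \<open>(b, B)\<close> with \<open>B\<close> invertible stands for the affine map \<open>x \<mapsto> B x + b\<close>.
  The isomorphism of the classical affine group onto \<open>Aut(L(\<real>\<^sup>n), \<omega>\<^sup>0)\<close> given by the natural
  lift provides a global chart of the latter, whose tangent space at the unit is thereby
  identified with \<open>aff(\<real>\<^sup>n) = \<real>\<^sup>n \<times> gl(\<real>\<^sup>n)\<close>.
\<close>

definition affine_lift ::
  "(real^'n::finite) \<times> (real^'n^'n) \<Rightarrow> (real^'n, 'n) frame \<Rightarrow> (real^'n, 'n) frame" where
  "affine_lift p = (\<lambda>w\<in>frames vector_mfd. natural_lift vector_mfd (\<lambda>x. snd p *v x + fst p) w)"

definition affine_chart ::
  "((real^'n, 'n::finite) frame \<Rightarrow> (real^'n, 'n) frame_tvec \<Rightarrow> real^'n^'n) \<Rightarrow>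
   ((real^'n, 'n) frame \<Rightarrow> (real^'n, 'n) frame, (real^'n) \<times> (real^'n^'n)) chart" where
  "affine_chart \<omega>0 = (Aut vector_mfd \<omega>0, inv_into {p. invertible (snd p)} affine_lift)"

definition affine_aut_mfd ::
  "((real^'n, 'n::finite) frame \<Rightarrow> (real^'n, 'n) frame_tvec \<Rightarrow> real^'n^'n) \<Rightarrow>
   ((real^'n, 'n) frame \<Rightarrow> (real^'n, 'n) frame, (real^'n) \<times> (real^'n^'n)) mfd" where
  "affine_aut_mfd \<omega>0 =
     \<lparr>tops = compact_open (tops (frame_bundle vector_mfd)) (tops (frame_bundle vector_mfd))
               (Aut vector_mfd \<omega>0),
      atlas = {affine_chart \<omega>0}\<rparr>"

end

theory Submission
  imports Defs
begin

text \<open>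
  Flatness and absence of torsion are the integrability conditions of the equation
  \<open>D\<^sup>-\<^sup>1 dD = (\<theta>, \<omega>)\<close> for a map \<open>D\<close> from an open set of frames to the affine group; hence near \<open>u\<close>
  there is a solution with \<open>D u = 1\<close>.  If an automorphism \<open>F\<close> preserves \<open>(\<theta>, \<omega>)\<close>, then \<open>D \<circ> F\<close> and \<open>D\<close>
  solve the same equation, so that \<open>D (F w) = D (F u) D w\<close> locally.  Therefore \<open>F \<mapsto> D (F u)\<close> is a local
  homomorphism at the unit.  It extends to the universal covering group by simple connectedness, and
  its derivative at the unit is \<open>Z \<mapsto> (\<theta>\<^sub>u(Z\<^sub>u), \<omega>\<^sub>u(Z\<^sub>u))\<close> because \<open>dD = (\<theta>, \<omega>)\<close> at \<open>u\<close>.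
\<close>

section \<open>Calculus of smooth functions\<close>

text \<open>In coordinates (z, X) of the frame bundle, X \<theta> is dz and X \<omega> is dX +
  \<Gamma>(dz) X. The ansatz D(z, X) = (f z, B z X) therefore reduces the equation for D to df = B
  dz and dB = B \<Gamma>: f is an affine coordinate system of the flat connection and B is its
  derivative. Second derivatives of f are symmetric because the torsion vanishes, those of B because
  the curvature does. This system is linear, so an iteration along rays solves it on a ball whose
  radius does not depend on the initial value. Continuing D along curves of frames may give values
  that depend on the curve, so the continuation is done in the group instead: along a curve in the
  covering group the values of the local homomorphism on small increments are multiplied up, and a
  homotopy of loops shows that the product depends on the end point alone. Smoothness is checked at
  the unit and carried elsewhere by right translation. A field in the Lie algebra reaches the
  covering group through a local inverse of the covering map.\<close>

lemma Ck_on_subset: "Ck_on k f S \<Longrightarrow> T \<subseteq> S \<Longrightarrow> Ck_on k f T"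
  by (induction k arbitrary: f) (auto intro: continuous_on_subset)

lemma Ck_on_cong:
  assumes "Ck_on k f S" "open S" "\<And>x. x \<in> S \<Longrightarrow> f x = g x"
  shows "Ck_on k g S"
  using assms(1,3)
proof (induction k arbitrary: f g)
  case 0
  then show ?case using continuous_on_cong[of S S f g] by simp
next
  case (Suc k)
  have d: "(g has_derivative frechet_derivative f (at x)) (at x)" if "x \<in> S" for x
    using has_derivative_transform_within_open[OF _ \<open>open S\<close> that, of f "frechet_derivative f (at x)" UNIV g]
      Suc.prems that by (simp add: frechet_derivative_works)
  have "frechet_derivative g (at x) = frechet_derivative f (at x)" if "x \<in> S" for x
    using frechet_derivative_at[OF d[OF that]] by simp
  then show ?case
    using Suc.prems d by (auto simp: differentiable_def intro: Suc.IH)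
qed

lemma Ck_on_continuous: "Ck_on k f S \<Longrightarrow> continuous_on S f"
proof (cases k)
  case (Suc n)
  assume "Ck_on k f S"
  then show ?thesis
    unfolding Suc by (intro continuous_at_imp_continuous_on ballI differentiable_imp_continuous_within) simp
qed simp

lemma Ck_on_Suc_imp: "Ck_on (Suc k) f S \<Longrightarrow> Ck_on k f S"
proof (induction k arbitrary: f)
  case 0
  then show ?case using Ck_on_continuous[OF 0] by simp
qed simp

lemma Ck_on_locally:
  assumes "\<And>x. x \<in> S \<Longrightarrow> \<exists>T. open T \<and> x \<in> T \<and> Ck_on k f T"
  shows "Ck_on k f S"
  using assms
proof (induction k arbitrary: f)
  case 0
  show ?case
    using 0 by (metis Ck_on.simps(1) continuous_at_imp_continuous_on continuous_on_eq_continuous_at)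
next
  case (Suc k)
  then show ?case
    by (auto intro!: Suc.IH) (meson+)
qed

lemma Ck_on_const: "Ck_on k (\<lambda>x. c) S"
  by (induction k arbitrary: c) simp_all

lemma frechet_derivative_eqI: "(f has_derivative f') (at x) \<Longrightarrow> frechet_derivative f (at x) = f'"
  using frechet_derivative_at by metis

text \<open>Accepts the derivative in whatever form a calculation produces it. Applied to a
  differential equation whose right-hand side is of class C^k, it raises the regularity of the
  solution by one.\<close>

lemma Ck_on_SucI:
  assumes "open S" "\<And>x. x \<in> S \<Longrightarrow> (f has_derivative f' x) (at x)"
    and "\<And>v. Ck_on k (\<lambda>x. f' x v) S"
  shows "Ck_on (Suc k) f S"
  unfolding Ck_on.simps
proof (intro conjI ballI allI)
  show "f differentiable (at x)" if "x \<in> S" for x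
    using assms(2)[OF that] by (auto simp: differentiable_def)
  show "Ck_on k (\<lambda>x. frechet_derivative f (at x) v) S" for v
    by (rule Ck_on_cong[OF assms(3) \<open>open S\<close>]) (simp add: frechet_derivative_eqI[OF assms(2)])
qed

lemma Ck_on_Suc_has_derivative:
  "Ck_on (Suc k) f S \<Longrightarrow> x \<in> S \<Longrightarrow> (f has_derivative frechet_derivative f (at x)) (at x)"
  by (simp add: frechet_derivative_works)

lemma Ck_on_Suc_derivative: "Ck_on (Suc k) f S \<Longrightarrow> Ck_on k (\<lambda>x. frechet_derivative f (at x) v) S"
  by simp

lemma Ck_on_bounded_linear: "bounded_linear f \<Longrightarrow> Ck_on k f S"
  by (cases k)
    (auto simp: linear_continuous_on Ck_on_const bounded_linear_imp_differentiable
      frechet_derivative_eqI[OF bounded_linear_imp_has_derivative])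

section \<open>Operations on functions of class C^k\<close>

lemma Ck_on_add:
  assumes "Ck_on k f S" "Ck_on k g S" "open S"
  shows "Ck_on k (\<lambda>x. f x + g x) S"
  using assms(1,2)
proof (induction k arbitrary: f g)
  case 0
  then show ?case by (auto intro: continuous_intros)
next
  case (Suc k)
  show ?case
    by (rule Ck_on_SucI[OF \<open>open S\<close>
          has_derivative_add[OF Suc.prems[THEN Ck_on_Suc_has_derivative]]
          Suc.IH[OF Suc.prems[THEN Ck_on_Suc_derivative]]])
qed

lemma Ck_on_sum:
  assumes "\<And>i. i \<in> I \<Longrightarrow> Ck_on k (f i) S" "open S"
  shows "Ck_on k (\<lambda>x. \<Sum>i\<in>I. f i x) S"
  using assms(1) by (induction I rule: infinite_finite_induct) (simp_all add: Ck_on_const Ck_on_add assms(2))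

text \<open>Each term of the product rule pairs a derivative with an undifferentiated factor, whose
  class is lowered by \<open>Ck_on_Suc_imp\<close>; the induction is therefore general in both
  functions.\<close>

lemma Ck_on_bounded_bilinear:
  assumes B: "bounded_bilinear B" and "Ck_on k f S" "Ck_on k g S" "open S"
  shows "Ck_on k (\<lambda>x. B (f x) (g x)) S"
  using assms(2,3)
proof (induction k arbitrary: f g)
  case 0
  then show ?case by (simp add: bounded_bilinear.continuous_on[OF B])
next
  case (Suc k)
  note d = Suc.prems[THEN Ck_on_Suc_derivative] and s = Suc.prems[THEN Ck_on_Suc_imp]
  show ?case
    by (rule Ck_on_SucI[OF \<open>open S\<close>
          bounded_bilinear.FDERIV[OF B Suc.prems[THEN Ck_on_Suc_has_derivative]]
          Ck_on_add[OF Suc.IH[OF s(1) d(2)] Suc.IH[OF d(1) s(2)] \<open>open S\<close>]])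
qed

lemma Ck_on_bounded_linear_compose:
  assumes "bounded_linear L" "Ck_on k f S" "open S"
  shows "Ck_on k (\<lambda>x. L (f x)) S"
  using assms(2)
proof (induction k arbitrary: f)
  case 0
  then show ?case using bounded_linear.continuous_on[OF assms(1)] by simp
next
  case (Suc k)
  show ?case
    by (rule Ck_on_SucI[OF \<open>open S\<close>
          bounded_linear.has_derivative[OF assms(1) Ck_on_Suc_has_derivative[OF Suc.prems]]
          Suc.IH[OF Ck_on_Suc_derivative[OF Suc.prems]]])
qed

text \<open>The inner derivative sends v to the fixed vector L v, so the derivative of the composite
  is again a directional derivative of f composed with the same affine map. No basis of the domain
  of f enters.\<close>

lemma Ck_on_compose_affine:
  assumes L: "bounded_linear L" and "Ck_on k f T" "open S" "\<And>x. x \<in> S \<Longrightarrow> L x + a \<in> T"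
  shows "Ck_on k (\<lambda>x. f (L x + a)) S"
  using assms(2)
proof (induction k arbitrary: f)
  case 0
  have "continuous_on S (\<lambda>x. L x + a)"
    by (intro continuous_intros bounded_linear.continuous_on[OF L])
  then show ?case using 0 assms(4) by (auto intro: continuous_on_compose2)
next
  case (Suc k)
  have L': "((\<lambda>x. L x + a) has_derivative L) (at x)" for x
    by (rule has_derivative_eq_rhs[OF has_derivative_add[OF bounded_linear_imp_has_derivative[OF L] has_derivative_const]]) auto
  show ?case
    by (rule Ck_on_SucI[OF \<open>open S\<close>
          has_derivative_compose[OF L' Ck_on_Suc_has_derivative[OF Suc.prems assms(4)]]
          Suc.IH[OF Ck_on_Suc_derivative[OF Suc.prems]]])
qed

text \<open>The model spaces are not of class \<open>euclidean_space\<close>, so the continuity of their coordinate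
  functionals has to be established first.\<close>

definition fin_dim :: "'a::real_normed_vector itself \<Rightarrow> bool" where
  "fin_dim _ \<longleftrightarrow> (\<exists>B::'a set. finite B \<and> span B = UNIV)"

lemma fin_dim_euclidean: "fin_dim TYPE('a::euclidean_space)"
  unfolding fin_dim_def by (intro exI[of _ Basis]) (simp add: span_Basis)

text \<open>Induction on the basis. The bound for B makes coefficients of Cauchy sequences Cauchy,
  so span B is closed and a new vector b0 has positive distance \<delta> from it. This distance
  bounds the coefficient of b0, and the bound for B handles the remainder.\<close>

lemma finite_independent_coeff_bound:
  fixes B :: "'a::real_normed_vector set"
  assumes "finite B" "independent B"
  shows "\<exists>C\<ge>0. \<forall>r. \<forall>b\<in>B. \<bar>r b\<bar> \<le> C * norm (\<Sum>b\<in>B. r b *\<^sub>R b)"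
  using assms
proof (induction B)
  case empty
  then show ?case by auto
next
  case (insert b0 B)
  then have "independent B" "b0 \<notin> span B"
    by (auto simp: independent_insert)
  with insert obtain C where C: "C \<ge> 0" "\<And>r b. b \<in> B \<Longrightarrow> \<bar>r b\<bar> \<le> C * norm (\<Sum>b\<in>B. r b *\<^sub>R b)"
    by metis
  have "closed (span B)"
    unfolding closed_sequential_limits
  proof (intro allI impI, elim conjE)
    fix x l assume x: "\<forall>n. x n \<in> span B" and l: "x \<longlonglongrightarrow> l"
    then have "\<forall>n. \<exists>r. x n = (\<Sum>b\<in>B. r b *\<^sub>R b)"
      using \<open>finite B\<close> by (auto simp: span_finite)
    then obtain r where r: "\<And>n. x n = (\<Sum>b\<in>B. r n b *\<^sub>R b)" by metis
    have "Cauchy (\<lambda>n. r n b)" if b: "b \<in> B" for b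
    proof (rule metric_CauchyI)
      fix e :: real assume "e > 0"
      \<comment> \<open>C may be 0, hence the denominator C + 1.\<close>
      then have "e / (C + 1) > 0" using C by simp
      then obtain M where M: "\<And>m n. m \<ge> M \<Longrightarrow> n \<ge> M \<Longrightarrow> norm (x m - x n) < e / (C + 1)"
        using LIMSEQ_imp_Cauchy[OF l] unfolding Cauchy_def dist_norm by metis
      have "dist (r m b) (r n b) < e" if "m \<ge> M" "n \<ge> M" for m n
      proof -
        have "x m - x n = (\<Sum>b\<in>B. (r m b - r n b) *\<^sub>R b)"
          by (simp add: r sum_subtractf scaleR_diff_left)
        then have "\<bar>r m b - r n b\<bar> \<le> C * norm (x m - x n)"
          using C(2)[OF b, of "\<lambda>b. r m b - r n b"] by simp
        also have "\<dots> \<le> (C + 1) * norm (x m - x n)" by (simp add: mult_right_mono)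
        also have "\<dots> < e" using M[OF that] C(1) by (simp add: pos_less_divide_eq mult.commute)
        finally show ?thesis by (simp add: dist_real_def)
      qed
      then show "\<exists>M. \<forall>m\<ge>M. \<forall>n\<ge>M. dist (r m b) (r n b) < e" by blast
    qed
    then have "\<forall>b\<in>B. \<exists>s. (\<lambda>n. r n b) \<longlonglongrightarrow> s"
      using Cauchy_convergent convergentD by blast
    then obtain s where "\<And>b. b \<in> B \<Longrightarrow> (\<lambda>n. r n b) \<longlonglongrightarrow> s b" by metis
    then have "x \<longlonglongrightarrow> (\<Sum>b\<in>B. s b *\<^sub>R b)"
      unfolding r[abs_def] by (intro tendsto_intros)
    with l have "l = (\<Sum>b\<in>B. s b *\<^sub>R b)" by (rule LIMSEQ_unique)
    then show "l \<in> span B" by (auto intro: span_sum span_scale span_base)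
  qed
  define \<delta> where "\<delta> = infdist b0 (span B)"
  have \<delta>: "\<delta> > 0"
    using \<open>closed (span B)\<close> \<open>b0 \<notin> span B\<close> in_closed_iff_infdist_zero[of "span B" b0] span_zero
    unfolding \<delta>_def by (metis empty_iff infdist_nonneg order_le_less)
  \<comment> \<open>The first summand bounds the coefficient of b0. The second bounds the others,
    since the part s in span B satisfies norm s \<le> (1 + norm b0 / \<delta>) * norm v.\<close>
  define K where "K = 1 / \<delta> + C * (1 + norm b0 / \<delta>)"
  show ?case
  proof (intro exI[of _ K] conjI allI ballI)
    show "K \<ge> 0" unfolding K_def using \<delta> C by simp
    fix r b assume b: "b \<in> insert b0 B"
    define s where "s = (\<Sum>b\<in>B. r b *\<^sub>R b)"
    define v where "v = (\<Sum>b\<in>insert b0 B. r b *\<^sub>R b)"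
    have v: "v = r b0 *\<^sub>R b0 + s" unfolding v_def s_def using insert by simp
    have "\<bar>r b0\<bar> * \<delta> \<le> norm v"
    proof (cases "r b0 = 0")
      case False
      have "- (s /\<^sub>R r b0) \<in> span B"
        unfolding s_def by (intro span_neg span_scale span_sum span_base)
      then have "\<delta> \<le> dist b0 (- (s /\<^sub>R r b0))"
        unfolding \<delta>_def by (rule infdist_le)
      also have "\<dots> = norm (v /\<^sub>R r b0)"
        using False by (simp add: dist_norm v scaleR_add_right)
      finally show ?thesis using False by (simp add: field_simps)
    qed simp
    then have r0: "\<bar>r b0\<bar> \<le> norm v / \<delta>" using \<delta> by (simp add: field_simps)
    have "norm s \<le> norm v + \<bar>r b0\<bar> * norm b0"
      using norm_triangle_ineq4[of v "r b0 *\<^sub>R b0"] by (simp add: v)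
    also have "\<dots> \<le> norm v + norm v / \<delta> * norm b0"
      using mult_right_mono[OF r0 norm_ge_zero] by auto
    finally have "norm s \<le> (1 + norm b0 / \<delta>) * norm v" by (simp add: algebra_simps)
    then have s: "C * norm s \<le> C * (1 + norm b0 / \<delta>) * norm v"
      using C(1) by (metis mult.assoc mult_left_mono)
    have Knv: "K * norm v = norm v / \<delta> + C * (1 + norm b0 / \<delta>) * norm v"
      by (simp add: K_def algebra_simps)
    have "0 \<le> C * (1 + norm b0 / \<delta>) * norm v" "0 \<le> norm v / \<delta>" using C \<delta> by simp_all
    then have "\<bar>r b\<bar> \<le> K * norm v"
      using b r0 s C(2)[of b r] unfolding s_def[symmetric] Knv by fastforce
    then show "\<bar>r b\<bar> \<le> K * norm (\<Sum>b\<in>insert b0 B. r b *\<^sub>R b)" unfolding v_def .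
  qed
qed

lemma fin_dim_coordinates:
  assumes "fin_dim TYPE('a::real_normed_vector)"
  obtains B :: "'a::real_normed_vector set" and \<phi> where
    "finite B" "\<And>b. b \<in> B \<Longrightarrow> bounded_linear (\<phi> b)" "\<And>x. x = (\<Sum>b\<in>B. \<phi> b x *\<^sub>R b)"
proof -
  obtain B0 :: "'a set" where B0: "finite B0" "span B0 = UNIV" using assms unfolding fin_dim_def by blast
  obtain B where B: "B \<subseteq> B0" "independent B" "B0 \<subseteq> span B"
    using maximal_independent_subset[of B0] by blast
  have "finite B" using B B0 finite_subset by blast
  have span: "x \<in> span B" for x
    using B B0 by (metis UNIV_I span_mono span_span subset_antisym top_greatest)
  define \<phi> where "\<phi> b x = representation B x b" for b x
  have rep: "x = (\<Sum>b\<in>B. \<phi> b x *\<^sub>R b)" for x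
    unfolding \<phi>_def using sum_representation_eq[OF B(2) span \<open>finite B\<close>, of x] by simp
  obtain C where C: "C \<ge> 0" "\<And>r b. b \<in> B \<Longrightarrow> \<bar>r b\<bar> \<le> C * norm (\<Sum>b\<in>B. r b *\<^sub>R b)"
    using finite_independent_coeff_bound[OF \<open>finite B\<close> B(2)] by metis
  have "bounded_linear (\<phi> b)" if "b \<in> B" for b
  proof (rule bounded_linear_intro[where K=C])
    fix x y r
    show "\<phi> b (x + y) = \<phi> b x + \<phi> b y" unfolding \<phi>_def
      by (simp add: representation_add[OF B(2) span span])
    show "\<phi> b (r *\<^sub>R x) = r *\<^sub>R \<phi> b x" unfolding \<phi>_def
      by (simp add: representation_scale[OF B(2) span])
    show "norm (\<phi> b x) \<le> norm x * C"
      using C(2)[OF that, of "\<lambda>b. \<phi> b x"] unfolding rep[of x, symmetric] by (simp add: mult.commute)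
  qed
  then show ?thesis using that[OF \<open>finite B\<close> _ rep] by blast
qed

text \<open>In the chain rule the direction in which f is differentiated varies with x. Expanding it
  in a basis of the middle space leaves scalar factors times derivatives of f in fixed directions,
  to which the induction hypothesis applies.\<close>

lemma Ck_on_compose:
  fixes g :: "'a::real_normed_vector \<Rightarrow> 'b::real_normed_vector"
  assumes "fin_dim TYPE('b)" and "Ck_on k f T" "Ck_on k g S" "open S" "open T" "\<And>x. x \<in> S \<Longrightarrow> g x \<in> T"
  shows "Ck_on k (\<lambda>x. f (g x)) S"
proof -
  obtain B :: "'b set" and \<phi> where B: "finite B" "\<And>b. b \<in> B \<Longrightarrow> bounded_linear (\<phi> b)"
    and rep: "\<And>x. x = (\<Sum>b\<in>B. \<phi> b x *\<^sub>R b)"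
    using fin_dim_coordinates[OF assms(1)] by metis
  show ?thesis using assms(2,3)
  proof (induction k arbitrary: f)
    case 0
    then show ?case using assms(6) by (auto intro: continuous_on_compose2)
  next
    case (Suc k)
    note f' = Ck_on_Suc_has_derivative[OF Suc.prems(1)] and g' = Ck_on_Suc_has_derivative[OF Suc.prems(2)]
    have d: "((\<lambda>x. f (g x)) has_derivative (\<lambda>v. \<Sum>b\<in>B.
        \<phi> b (frechet_derivative g (at x) v) *\<^sub>R frechet_derivative f (at (g x)) b)) (at x)" if "x \<in> S" for x
    proof (rule has_derivative_eq_rhs[OF has_derivative_compose[OF g'[OF that] f'[OF assms(6)[OF that]]]])
      have "linear (frechet_derivative f (at (g x)))"
        using f'[OF assms(6)[OF that]] has_derivative_linear by blast
      then have "frechet_derivative f (at (g x)) (\<Sum>b\<in>B. \<phi> b w *\<^sub>R b)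
          = (\<Sum>b\<in>B. \<phi> b w *\<^sub>R frechet_derivative f (at (g x)) b)" for w
        by (simp add: linear_sum linear_cmul)
      then show "(\<lambda>v. frechet_derivative f (at (g x)) (frechet_derivative g (at x) v)) =
          (\<lambda>v. \<Sum>b\<in>B. \<phi> b (frechet_derivative g (at x) v) *\<^sub>R frechet_derivative f (at (g x)) b)"
        unfolding rep[symmetric] by (intro ext)
    qed
    show ?case
      by (rule Ck_on_SucI[OF \<open>open S\<close> d Ck_on_sum[OF Ck_on_bounded_bilinear[OF bounded_bilinear_scaleR
              Ck_on_bounded_linear_compose[OF B(2) Ck_on_Suc_derivative[OF Suc.prems(2)] \<open>open S\<close>]
              Suc.IH[OF Ck_on_Suc_derivative[OF Suc.prems(1)] Ck_on_Suc_imp[OF Suc.prems(2)]]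
              \<open>open S\<close>] \<open>open S\<close>]])
  qed
qed

section \<open>Smooth functions on open sets\<close>

lemma smooth_onD_open: "smooth_on S f \<Longrightarrow> open S"
  by (simp add: smooth_on_def)

lemma smooth_on_subset: "smooth_on S f \<Longrightarrow> T \<subseteq> S \<Longrightarrow> open T \<Longrightarrow> smooth_on T f"
  unfolding smooth_on_def by (meson Ck_on_subset)

lemma smooth_on_cong: "smooth_on S f \<Longrightarrow> (\<And>x. x \<in> S \<Longrightarrow> f x = g x) \<Longrightarrow> smooth_on S g"
  unfolding smooth_on_def by (meson Ck_on_cong)

lemma smooth_on_continuous: "smooth_on S f \<Longrightarrow> continuous_on S f"
  using Ck_on_continuous by (auto simp: smooth_on_def)

lemma smooth_on_differentiable: "smooth_on S f \<Longrightarrow> x \<in> S \<Longrightarrow> f differentiable (at x)"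
  unfolding smooth_on_def by (metis Ck_on.simps(2))

lemma smooth_on_has_derivative:
  "smooth_on S f \<Longrightarrow> x \<in> S \<Longrightarrow> (f has_derivative frechet_derivative f (at x)) (at x)"
  using smooth_on_differentiable frechet_derivative_works by blast

lemma smooth_on_derivative: "smooth_on S f \<Longrightarrow> smooth_on S (\<lambda>x. frechet_derivative f (at x) v)"
  unfolding smooth_on_def by (metis Ck_on.simps(2))

lemma smooth_on_locally:
  assumes "\<And>x. x \<in> S \<Longrightarrow> \<exists>T. x \<in> T \<and> T \<subseteq> S \<and> smooth_on T f"
  shows "smooth_on S f"
  unfolding smooth_on_def
proof (intro conjI allI)
  show "open S" using assms by (subst open_subopen) (meson smooth_on_def)
  show "Ck_on k f S" for k using assms by (intro Ck_on_locally) (meson smooth_on_def)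
qed

lemma smooth_on_const: "open S \<Longrightarrow> smooth_on S (\<lambda>x. c)"
  by (simp add: smooth_on_def Ck_on_const)

lemma smooth_on_bounded_linear: "open S \<Longrightarrow> bounded_linear f \<Longrightarrow> smooth_on S f"
  by (simp add: smooth_on_def Ck_on_bounded_linear)

lemma smooth_on_ident: "open S \<Longrightarrow> smooth_on S (\<lambda>x. x)"
  by (simp add: smooth_on_bounded_linear)

lemma smooth_on_add: "smooth_on S f \<Longrightarrow> smooth_on S g \<Longrightarrow> smooth_on S (\<lambda>x. f x + g x)"
  by (simp add: smooth_on_def Ck_on_add)

lemma smooth_on_sum:
  "(\<And>i. i \<in> I \<Longrightarrow> smooth_on S (f i)) \<Longrightarrow> open S \<Longrightarrow> smooth_on S (\<lambda>x. \<Sum>i\<in>I. f i x)"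
  by (simp add: smooth_on_def Ck_on_sum)

lemma smooth_on_bounded_bilinear:
  "bounded_bilinear B \<Longrightarrow> smooth_on S f \<Longrightarrow> smooth_on S g \<Longrightarrow> smooth_on S (\<lambda>x. B (f x) (g x))"
  by (simp add: smooth_on_def Ck_on_bounded_bilinear)

lemmas smooth_on_scaleR = smooth_on_bounded_bilinear[OF bounded_bilinear_scaleR]

lemma smooth_on_bounded_linear_compose:
  "bounded_linear L \<Longrightarrow> smooth_on S f \<Longrightarrow> smooth_on S (\<lambda>x. L (f x))"
  by (simp add: smooth_on_def Ck_on_bounded_linear_compose)

lemma smooth_on_compose_affine:
  assumes "bounded_linear L" "smooth_on T f"
  shows "smooth_on {x. L x + a \<in> T} (\<lambda>x. f (L x + a))"
proof -
  have "continuous_on UNIV (\<lambda>x. L x + a)"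
    by (intro continuous_intros bounded_linear.continuous_on[OF assms(1)])
  then have "open {x. L x + a \<in> T}"
    using assms(2) by (auto simp: continuous_on_open_vimage smooth_on_def vimage_def)
  then show ?thesis using assms by (auto simp: smooth_on_def intro: Ck_on_compose_affine)
qed

lemma smooth_on_compose:
  fixes g :: "'a::real_normed_vector \<Rightarrow> 'b::real_normed_vector"
  assumes "fin_dim TYPE('b)" "smooth_on T f" "smooth_on S g" "\<And>x. x \<in> S \<Longrightarrow> g x \<in> T"
  shows "smooth_on S (\<lambda>x. f (g x))"
  using assms by (auto simp: smooth_on_def intro: Ck_on_compose)

lemma smooth_on_compose_preimage:
  fixes g :: "'a::real_normed_vector \<Rightarrow> 'b::real_normed_vector"
  assumes "fin_dim TYPE('b)" "smooth_on T f" "smooth_on S g"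
  shows "smooth_on {x \<in> S. g x \<in> T} (\<lambda>x. f (g x))"
proof -
  have "open {x \<in> S. g x \<in> T}"
    using continuous_open_preimage[OF smooth_on_continuous[OF assms(3)], of T] assms(2,3)
    by (auto simp: smooth_on_def vimage_def Int_def)
  then show ?thesis
    using assms by (intro smooth_on_compose[OF assms(1,2)]) (auto intro: smooth_on_subset)
qed

lemma smooth_on_Pair:
  fixes f :: "'a::real_normed_vector \<Rightarrow> 'b::real_normed_vector" and g :: "'a \<Rightarrow> 'c::real_normed_vector"
  assumes "smooth_on S f" "smooth_on S g"
  shows "smooth_on S (\<lambda>x. (f x, g x))"
proof -
  have "bounded_linear (\<lambda>y::'b. (y, 0::'c))" "bounded_linear (\<lambda>y::'c. (0::'b, y))"
    by (intro bounded_linear_Pair bounded_linear_ident bounded_linear_zero)+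
  from smooth_on_add[OF smooth_on_bounded_linear_compose[OF this(1) assms(1)]
      smooth_on_bounded_linear_compose[OF this(2) assms(2)]]
  show ?thesis by simp
qed

lemmas smooth_on_fst = smooth_on_bounded_linear_compose[OF bounded_linear_fst]
lemmas smooth_on_snd = smooth_on_bounded_linear_compose[OF bounded_linear_snd]

lemma smooth_on_vec:
  fixes f :: "'a::real_normed_vector \<Rightarrow> 'i::finite \<Rightarrow> 'b::euclidean_space"
  assumes "open S" "\<And>i. smooth_on S (\<lambda>x. f x i)"
  shows "smooth_on S (\<lambda>x. \<chi> i. f x i)"
proof -
  have ax: "bounded_linear (\<lambda>y::'b. (\<chi> j. if j = i then y else 0) :: 'b^'i)" for i
    by (rule linear_conv_bounded_linear[THEN iffD1], rule linearI) (auto simp: vec_eq_iff)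
  have "smooth_on S (\<lambda>x. \<Sum>i\<in>UNIV. (\<chi> j. if j = i then f x i else 0))"
    using assms by (intro smooth_on_sum smooth_on_bounded_linear_compose[OF ax])
  moreover have "(\<Sum>i\<in>UNIV. (\<chi> j. if j = i then f x i else 0)) = (\<chi> i. f x i)" for x
    by (simp add: vec_eq_iff sum_component)
  ultimately show ?thesis by simp
qed

lemmas smooth_on_vec_nth = smooth_on_bounded_linear_compose[OF bounded_linear_vec_nth]

lemma smooth_on_mult:
  fixes f g :: "'a::real_normed_vector \<Rightarrow> real"
  shows "smooth_on S f \<Longrightarrow> smooth_on S g \<Longrightarrow> smooth_on S (\<lambda>x. f x * g x)"
  by (rule smooth_on_bounded_bilinear[OF bounded_bilinear_mult])

lemma smooth_on_prod:
  fixes f :: "'i \<Rightarrow> 'a::real_normed_vector \<Rightarrow> real"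
  assumes "\<And>i. i \<in> I \<Longrightarrow> smooth_on S (f i)" "open S"
  shows "smooth_on S (\<lambda>x. \<Prod>i\<in>I. f i x)"
  using assms(1)
  by (induction I rule: infinite_finite_induct) (auto simp: smooth_on_const smooth_on_mult assms(2))

lemma smooth_on_matrix_mult:
  fixes f :: "'a::real_normed_vector \<Rightarrow> real^'n::finite^'m::finite" and g :: "'a \<Rightarrow> real^'k::finite^'n"
  assumes "smooth_on S f" "smooth_on S g"
  shows "smooth_on S (\<lambda>x. f x ** g x)"
  unfolding matrix_matrix_mult_def
  by (intro smooth_on_vec smooth_on_sum smooth_on_mult smooth_on_vec_nth assms smooth_onD_open[OF assms(1)])

lemma smooth_on_matrix_vector_mult:
  fixes f :: "'a::real_normed_vector \<Rightarrow> real^'n::finite^'m::finite" and g :: "'a \<Rightarrow> real^'n"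
  assumes "smooth_on S f" "smooth_on S g"
  shows "smooth_on S (\<lambda>x. f x *v g x)"
  unfolding matrix_vector_mult_def
  by (intro smooth_on_vec smooth_on_sum smooth_on_mult smooth_on_vec_nth assms smooth_onD_open[OF assms(1)])

section \<open>Integrable total differential systems\<close>

text \<open>The system d\<psi>(v) = a y v \<psi>. Differentiating its right-hand side in direction w
  along a solution gives da y w v \<psi> + a y v (a y w \<psi>), and \<open>integrable\<close> says
  that this is symmetric in v and w, as a second derivative must be.\<close>

locale total_differential_system =
  fixes a :: "'a::euclidean_space \<Rightarrow> 'a \<Rightarrow> 'b::euclidean_space \<Rightarrow> 'b"
    and da :: "'a \<Rightarrow> 'a \<Rightarrow> 'a \<Rightarrow> 'b \<Rightarrow> 'b"
    and S :: "'a set"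
  assumes bilinear: "y \<in> S \<Longrightarrow> bilinear (a y)"
    and deriv: "y \<in> S \<Longrightarrow> ((\<lambda>y. a y v \<psi>) has_derivative (\<lambda>w. da y w v \<psi>)) (at y)"
    and continuous: "continuous_on S (\<lambda>y. da y w v \<psi>)"
    and integrable: "y \<in> S \<Longrightarrow> da y v w \<psi> + a y w (a y v \<psi>) = da y w v \<psi> + a y v (a y w \<psi>)"
begin

lemma linear_a1: "y \<in> S \<Longrightarrow> linear (\<lambda>v. a y v \<psi>)"
  using bilinear by (auto simp: bilinear_def)

lemma linear_a2: "y \<in> S \<Longrightarrow> linear (\<lambda>\<psi>. a y v \<psi>)"
  using bilinear by (auto simp: bilinear_def)

text \<open>Reduces continuity and differentiability of \<open>a\<close> in all three arguments to
  finitely many functions of y alone.\<close>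

lemma a_expand:
  assumes "y \<in> S"
  shows "a y v \<psi> = (\<Sum>i\<in>Basis. \<Sum>j\<in>Basis. ((v \<bullet> i) * (\<psi> \<bullet> j)) *\<^sub>R a y i j)"
proof -
  have "a y v \<psi> = a y (\<Sum>i\<in>Basis. (v \<bullet> i) *\<^sub>R i) (\<Sum>j\<in>Basis. (\<psi> \<bullet> j) *\<^sub>R j)"
    by (simp add: euclidean_representation)
  also have "\<dots> = (\<Sum>i\<in>Basis. (v \<bullet> i) *\<^sub>R a y i (\<Sum>j\<in>Basis. (\<psi> \<bullet> j) *\<^sub>R j))"
    by (simp only: linear_sum[OF linear_a1[OF assms]] linear_cmul[OF linear_a1[OF assms]])
  also have "\<dots> = (\<Sum>i\<in>Basis. \<Sum>j\<in>Basis. ((v \<bullet> i) * (\<psi> \<bullet> j)) *\<^sub>R a y i j)"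
    by (simp only: linear_sum[OF linear_a2[OF assms]] linear_cmul[OF linear_a2[OF assms]] scaleR_sum_right scaleR_scaleR)
  finally show ?thesis .
qed

lemma da_unique:
  assumes "y \<in> S" "open S" "((\<lambda>y. a y v \<psi>) has_derivative f) (at y)"
  shows "da y w v \<psi> = f w"
  using has_derivative_unique[OF assms(3) deriv[OF assms(1)]] by simp

text \<open>The locale gives \<open>da\<close> as a derivative in y for each fixed v and \<psi>. Its
  linearity in v and \<psi> comes from differentiating \<open>a_expand\<close> termwise and from
  uniqueness of derivatives.\<close>

lemma da_expand:
  assumes "y \<in> S" "open S"
  shows "da y w v \<psi> = (\<Sum>i\<in>Basis. \<Sum>j\<in>Basis. ((v \<bullet> i) * (\<psi> \<bullet> j)) *\<^sub>R (\<Sum>k\<in>Basis. (w \<bullet> k) *\<^sub>R da y k i j))"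
proof -
  have lin: "linear (\<lambda>w. da y w i j)" for i j
    using deriv[OF assms(1)] has_derivative_linear by blast
  have "((\<lambda>y. \<Sum>i\<in>Basis. \<Sum>j\<in>Basis. ((v \<bullet> i) * (\<psi> \<bullet> j)) *\<^sub>R a y i j) has_derivative
      (\<lambda>w. \<Sum>i\<in>Basis. \<Sum>j\<in>Basis. ((v \<bullet> i) * (\<psi> \<bullet> j)) *\<^sub>R da y w i j)) (at y)"
    by (intro derivative_intros deriv assms)
  then have "((\<lambda>y. a y v \<psi>) has_derivative
      (\<lambda>w. \<Sum>i\<in>Basis. \<Sum>j\<in>Basis. ((v \<bullet> i) * (\<psi> \<bullet> j)) *\<^sub>R da y w i j)) (at y)"
    by (rule has_derivative_transform_within_open[OF _ \<open>open S\<close> \<open>y \<in> S\<close>]) (rule a_expand[symmetric])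
  from da_unique[OF assms this]
  have e: "da y w v \<psi> = (\<Sum>i\<in>Basis. \<Sum>j\<in>Basis. ((v \<bullet> i) * (\<psi> \<bullet> j)) *\<^sub>R da y w i j)" .
  have "da y w i j = (\<Sum>k\<in>Basis. (w \<bullet> k) *\<^sub>R da y k i j)" for i j
    by (subst euclidean_representation[of w, symmetric])
      (simp only: linear_sum[OF lin] linear_cmul[OF lin])
  then show ?thesis
    by (intro trans[OF e] sum.cong refl arg_cong[where f="scaleR _"])
qed

lemma linear_da:
  assumes "y \<in> S" "open S"
  shows "linear (\<lambda>w. da y w v \<psi>)" "linear (\<lambda>v. da y w v \<psi>)" "linear (\<lambda>\<psi>. da y w v \<psi>)"
proof -
  show "linear (\<lambda>w. da y w v \<psi>)"
    using deriv[OF assms(1)] has_derivative_linear by blast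
  have "(\<lambda>v. da y w v \<psi>) = (\<lambda>v. \<Sum>i\<in>Basis. \<Sum>j\<in>Basis. ((v \<bullet> i) * (\<psi> \<bullet> j)) *\<^sub>R (\<Sum>k\<in>Basis. (w \<bullet> k) *\<^sub>R da y k i j))"
    by (intro ext da_expand assms)
  moreover have "linear \<dots>"
    by (rule linearI) (simp_all add: inner_simps algebra_simps scaleR_sum_right sum.distrib)
  ultimately show "linear (\<lambda>v. da y w v \<psi>)" by simp
  have "(\<lambda>\<psi>. da y w v \<psi>) = (\<lambda>\<psi>. \<Sum>i\<in>Basis. \<Sum>j\<in>Basis. ((v \<bullet> i) * (\<psi> \<bullet> j)) *\<^sub>R (\<Sum>k\<in>Basis. (w \<bullet> k) *\<^sub>R da y k i j))"
    by (intro ext da_expand assms)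
  moreover have "linear \<dots>"
    by (rule linearI) (simp_all add: inner_simps algebra_simps scaleR_sum_right sum.distrib)
  ultimately show "linear (\<lambda>\<psi>. da y w v \<psi>)" by simp
qed

lemma continuous_on_a:
  assumes "open S" "continuous_on T Y" "continuous_on T V" "continuous_on T \<Psi>" "\<And>z. z \<in> T \<Longrightarrow> Y z \<in> S"
  shows "continuous_on T (\<lambda>z. a (Y z) (V z) (\<Psi> z))"
proof -
  have "continuous_on S (\<lambda>y. a y i j)" for i j
    using deriv has_derivative_continuous by (intro continuous_at_imp_continuous_on) blast
  then have "continuous_on T (\<lambda>z. a (Y z) i j)" for i j
    using assms(2,5) by (intro continuous_on_compose2[of S "\<lambda>y. a y i j" T Y]) auto
  then have "continuous_on T (\<lambda>z. \<Sum>i\<in>Basis. \<Sum>j\<in>Basis. ((V z \<bullet> i) * (\<Psi> z \<bullet> j)) *\<^sub>R a (Y z) i j)"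
    by (intro continuous_intros assms)
  then show ?thesis
    by (rule continuous_on_eq) (rule a_expand[OF assms(5), symmetric])
qed

lemma continuous_on_da:
  assumes "open S" "continuous_on T Y" "continuous_on T W" "continuous_on T V" "continuous_on T \<Psi>"
    "\<And>z. z \<in> T \<Longrightarrow> Y z \<in> S"
  shows "continuous_on T (\<lambda>z. da (Y z) (W z) (V z) (\<Psi> z))"
proof -
  have "continuous_on T (\<lambda>z. da (Y z) k i j)" for k i j
    using continuous assms(2,6) by (intro continuous_on_compose2[of S "\<lambda>y. da y k i j" T Y]) auto
  then have "continuous_on T (\<lambda>z. \<Sum>i\<in>Basis. \<Sum>j\<in>Basis. ((V z \<bullet> i) * (\<Psi> z \<bullet> j)) *\<^sub>R
      (\<Sum>k\<in>Basis. (W z \<bullet> k) *\<^sub>R da (Y z) k i j))"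
    by (intro continuous_intros assms)
  then show ?thesis
    by (rule continuous_on_eq) (rule da_expand[OF assms(6,1), symmetric])
qed

lemma has_derivative_a:
  assumes "open S" "Y z \<in> S"
    and Y: "(Y has_derivative Y') (at z)" and V: "(V has_derivative V') (at z)"
    and \<Psi>: "(\<Psi> has_derivative \<Psi>') (at z)"
  shows "((\<lambda>z. a (Y z) (V z) (\<Psi> z)) has_derivative
    (\<lambda>h. da (Y z) (Y' h) (V z) (\<Psi> z) + a (Y z) (V' h) (\<Psi> z) + a (Y z) (V z) (\<Psi>' h))) (at z)"
proof -
  have lin: "linear (\<lambda>w. da (Y z) w i j)" for i j using linear_da(1)[OF assms(2,1)] .
  have aij: "((\<lambda>z. a (Y z) i j) has_derivative (\<lambda>h. da (Y z) (Y' h) i j)) (at z)" for i j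
    by (rule has_derivative_compose[OF Y deriv[OF \<open>Y z \<in> S\<close>]])
  have "((\<lambda>z. \<Sum>i\<in>Basis. \<Sum>j\<in>Basis. ((V z \<bullet> i) * (\<Psi> z \<bullet> j)) *\<^sub>R a (Y z) i j) has_derivative
      (\<lambda>h. \<Sum>i\<in>Basis. \<Sum>j\<in>Basis. ((V z \<bullet> i) * (\<Psi> z \<bullet> j)) *\<^sub>R da (Y z) (Y' h) i j
        + ((V z \<bullet> i) * (\<Psi>' h \<bullet> j) + (V' h \<bullet> i) * (\<Psi> z \<bullet> j)) *\<^sub>R a (Y z) i j)) (at z)"
    by (rule has_derivative_eq_rhs, (rule derivative_intros aij V \<Psi>)+) simp
  also have "(\<lambda>h. \<Sum>i\<in>Basis. \<Sum>j\<in>Basis. ((V z \<bullet> i) * (\<Psi> z \<bullet> j)) *\<^sub>R da (Y z) (Y' h) i j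
        + ((V z \<bullet> i) * (\<Psi>' h \<bullet> j) + (V' h \<bullet> i) * (\<Psi> z \<bullet> j)) *\<^sub>R a (Y z) i j)
    = (\<lambda>h. da (Y z) (Y' h) (V z) (\<Psi> z) + a (Y z) (V' h) (\<Psi> z) + a (Y z) (V z) (\<Psi>' h))" (is "?l = ?r")
  proof
    fix h
    have "da (Y z) (Y' h) i j = (\<Sum>k\<in>Basis. (Y' h \<bullet> k) *\<^sub>R da (Y z) k i j)" for i j
      by (subst euclidean_representation[of "Y' h", symmetric])
        (simp only: linear_sum[OF lin] linear_cmul[OF lin])
    then have e: "da (Y z) (Y' h) (V z) (\<Psi> z)
      = (\<Sum>i\<in>Basis. \<Sum>j\<in>Basis. ((V z \<bullet> i) * (\<Psi> z \<bullet> j)) *\<^sub>R da (Y z) (Y' h) i j)"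
      by (intro trans[OF da_expand[OF assms(2,1)]] sum.cong refl arg_cong[where f="scaleR _"]) simp
    show "?l h = ?r h"
        unfolding e a_expand[OF assms(2), of "V' h" "\<Psi> z"] a_expand[OF assms(2), of "V z" "\<Psi>' h"]
      by (simp add: sum.distrib scaleR_add_left)
  qed
  \<comment> \<open>The expansion holds only where Y takes values in S, which is a neighbourhood of
    z by continuity of Y.\<close>
  finally show ?thesis
    by (rule has_derivative_transform_eventually)
      (use a_expand[symmetric] assms(1,2) has_derivative_continuous[OF Y] in
        \<open>auto intro!: eventually_mono[OF topological_tendstoD[OF _ \<open>open S\<close> \<open>Y z \<in> S\<close>]] simp: continuous_at\<close>)
qed

text \<open>A solution with value \<psi>0 at 0 is a fixed point: the integrand is then the
  derivative of the solution along the segment from 0 to x.\<close>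

definition picard :: "'b \<Rightarrow> ('a \<Rightarrow> 'b) \<Rightarrow> 'a \<Rightarrow> 'b" where
  "picard \<psi>0 \<phi> x = \<psi>0 + integral {0..1} (\<lambda>t. a (t *\<^sub>R x) x (\<phi> (t *\<^sub>R x)))"

text \<open>The fixed point equation controls a function along rays only. The defect measures how
  far the system fails in an arbitrary direction v, and bounding it is where integrability is
  used.\<close>

definition defect :: "('a \<Rightarrow> 'b) \<Rightarrow> 'a \<Rightarrow> 'a \<Rightarrow> 'b" where
  "defect \<phi> x v = frechet_derivative \<phi> (at x) v - a x v (\<phi> x)"


section \<open>Differentiating the Picard operator\<close>

lemma segment_in: "convex U \<Longrightarrow> 0 \<in> U \<Longrightarrow> x \<in> U \<Longrightarrow> t \<in> {0..1} \<Longrightarrow> t *\<^sub>R x \<in> U"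
  for x :: "'c::real_vector"
  using convexD_alt[of U 0 x t] by auto

context
  fixes U :: "'a set" and \<phi> :: "'a \<Rightarrow> 'b"
  assumes open_S: "open S" and U: "open U" "convex U" "0 \<in> U" "U \<subseteq> S" and \<phi>: "Ck_on 1 \<phi> U"
begin

abbreviation "\<phi>' y \<equiv> frechet_derivative \<phi> (at y)"

text \<open>The derivative in direction v of the integrand of \<open>picard\<close>, with the factor
  t from the inner map x \<mapsto> t x collected.\<close>

definition "picard_integrand x t v =
  a (t *\<^sub>R x) v (\<phi> (t *\<^sub>R x)) + t *\<^sub>R (da (t *\<^sub>R x) v x (\<phi> (t *\<^sub>R x)) + a (t *\<^sub>R x) x (\<phi>' (t *\<^sub>R x) v))"

lemma phi_deriv: "y \<in> U \<Longrightarrow> (\<phi> has_derivative \<phi>' y) (at y)"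
  using \<phi> Ck_on_Suc_has_derivative[of 0] by simp

lemma phi_cont: "continuous_on U \<phi>" "continuous_on U (\<lambda>y. \<phi>' y v)"
  using Ck_on_continuous[OF \<phi>] \<phi> by auto

lemma phi_linear: "y \<in> U \<Longrightarrow> linear (\<phi>' y)"
  using phi_deriv has_derivative_linear by blast

lemma continuous_on_compose_phi:
  assumes "continuous_on T X" "continuous_on T \<tau>" "\<And>z. z \<in> T \<Longrightarrow> X z \<in> U" "\<And>z. z \<in> T \<Longrightarrow> \<tau> z \<in> {0..1}"
  shows "continuous_on T (\<lambda>z. \<tau> z *\<^sub>R X z)" "continuous_on T (\<lambda>z. \<phi> (\<tau> z *\<^sub>R X z))"
    "continuous_on T (\<lambda>z. \<phi>' (\<tau> z *\<^sub>R X z) v)" "\<And>z. z \<in> T \<Longrightarrow> \<tau> z *\<^sub>R X z \<in> S"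
proof -
  show c: "continuous_on T (\<lambda>z. \<tau> z *\<^sub>R X z)" by (intro continuous_intros assms)
  have i: "(\<lambda>z. \<tau> z *\<^sub>R X z) ` T \<subseteq> U" using segment_in[OF U(2,3)] assms(3,4) by auto
  show "continuous_on T (\<lambda>z. \<phi> (\<tau> z *\<^sub>R X z))" "continuous_on T (\<lambda>z. \<phi>' (\<tau> z *\<^sub>R X z) v)"
    using continuous_on_compose2[OF phi_cont(1) c i] continuous_on_compose2[OF phi_cont(2) c i] .
  show "\<tau> z *\<^sub>R X z \<in> S" if "z \<in> T" for z using i U(4) that by auto
qed

lemma continuous_on_picard_integrand:
  assumes "continuous_on T X" "continuous_on T \<tau>" "\<And>z. z \<in> T \<Longrightarrow> X z \<in> U" "\<And>z. z \<in> T \<Longrightarrow> \<tau> z \<in> {0..1}"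
  shows "continuous_on T (\<lambda>z. picard_integrand (X z) (\<tau> z) v)"
  unfolding picard_integrand_def
  using continuous_on_compose_phi[OF assms]
  by (intro continuous_on_add continuous_on_scaleR continuous_on_a continuous_on_da open_S assms
      continuous_on_const) auto

lemma picard_integrable:
  assumes "x \<in> U"
  shows "(\<lambda>t. a (t *\<^sub>R x) x (\<phi> (t *\<^sub>R x))) integrable_on {0..1}"
proof -
  have "continuous_on {0..1} (\<lambda>t. a (t *\<^sub>R x) x (\<phi> (t *\<^sub>R x)))"
    using continuous_on_compose_phi[of "{0..1}" "\<lambda>_. x" "\<lambda>t. t"] assms
    by (intro continuous_on_a open_S continuous_on_const) (auto intro: continuous_intros)
  then show ?thesis by (rule integrable_continuous_real)
qed

lemma linear_picard_integrand:
  assumes "x \<in> U" "t \<in> {0..1}"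
  shows "linear (picard_integrand x t)"
proof -
  have tx: "t *\<^sub>R x \<in> U" "t *\<^sub>R x \<in> S" using segment_in[OF U(2,3)] assms U(4) by auto
  note l = linear_a1[OF tx(2)] linear_a2[OF tx(2)] linear_da[OF tx(2) open_S] phi_linear[OF tx(1)]
  show ?thesis
    unfolding picard_integrand_def
    by (rule linearI) (simp_all add: linear_add[OF l(1)] linear_add[OF l(2)] linear_add[OF l(3)] linear_add[OF l(6)]
        linear_cmul[OF l(1)] linear_cmul[OF l(2)] linear_cmul[OF l(3)] linear_cmul[OF l(6)] algebra_simps)
qed

text \<open>Differentiation under the integral sign. \<open>leibniz_rule\<close> wants a jointly
  continuous derivative with values in bounded linear maps, so the integrand is wrapped by
  \<open>Blinfun\<close> and its continuity is tested on basis vectors.\<close>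

lemma picard_has_derivative_integral:
  assumes x: "x \<in> U"
  shows "(picard \<psi>0 \<phi> has_derivative (\<lambda>v. integral {0..1} (\<lambda>t. picard_integrand x t v))) (at x)"
proof -
  define F where "F x t = Blinfun (picard_integrand x t)" for x t
  have F: "blinfun_apply (F x t) = picard_integrand x t" if "x \<in> U" "t \<in> {0..1}" for x t
    unfolding F_def using linear_picard_integrand[OF that]
    by (intro bounded_linear_Blinfun_apply) (simp add: linear_conv_bounded_linear)
  have cF: "continuous_on (U \<times> cbox 0 1) (\<lambda>(x, t). F x t)"
  proof (rule continuous_on_blinfun_componentwise)
    fix i :: 'a
    have "continuous_on (U \<times> {0..1}) (\<lambda>z. picard_integrand (fst z) (snd z) i)"
      by (rule continuous_on_picard_integrand) (auto intro: continuous_intros)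
    then show "continuous_on (U \<times> cbox 0 1) (\<lambda>z. blinfun_apply (case z of (x, t) \<Rightarrow> F x t) i)"
      unfolding cbox_interval by (rule continuous_on_eq) (auto simp: F)
  qed
  have "((\<lambda>x. integral (cbox 0 1) (\<lambda>t. a (t *\<^sub>R x) x (\<phi> (t *\<^sub>R x)))) has_derivative
      integral (cbox 0 1) (F x)) (at x within U)"
  proof (rule leibniz_rule[OF _ _ cF x U(2)])
    fix y :: 'a and t :: real assume y: "y \<in> U" and t: "t \<in> cbox 0 1"
    then have ty: "t *\<^sub>R y \<in> U" "t *\<^sub>R y \<in> S" using segment_in[OF U(2,3)] U(4) by auto
    have s: "((\<lambda>x. t *\<^sub>R x) has_derivative (\<lambda>v. t *\<^sub>R v)) (at y)"
      by (rule has_derivative_scaleR_right[OF has_derivative_ident])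
    have "((\<lambda>x. a (t *\<^sub>R x) x (\<phi> (t *\<^sub>R x))) has_derivative (\<lambda>v. da (t *\<^sub>R y) (t *\<^sub>R v) y (\<phi> (t *\<^sub>R y))
        + a (t *\<^sub>R y) v (\<phi> (t *\<^sub>R y)) + a (t *\<^sub>R y) y (\<phi>' (t *\<^sub>R y) (t *\<^sub>R v)))) (at y)"
      by (rule has_derivative_a[OF open_S ty(2) s has_derivative_ident has_derivative_compose[OF s phi_deriv[OF ty(1)]]])
    also have "(\<lambda>v. da (t *\<^sub>R y) (t *\<^sub>R v) y (\<phi> (t *\<^sub>R y))
        + a (t *\<^sub>R y) v (\<phi> (t *\<^sub>R y)) + a (t *\<^sub>R y) y (\<phi>' (t *\<^sub>R y) (t *\<^sub>R v))) = picard_integrand y t"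
      by (rule ext) (simp add: picard_integrand_def linear_cmul[OF linear_da(1)[OF ty(2) open_S]]
          linear_cmul[OF phi_linear[OF ty(1)]] linear_cmul[OF linear_a2[OF ty(2)]] scaleR_add_right)
    finally show "((\<lambda>x. a (t *\<^sub>R x) x (\<phi> (t *\<^sub>R x))) has_derivative blinfun_apply (F y t)) (at y within U)"
      using F[OF y] t by (auto intro: has_derivative_at_withinI)
  next
    fix y assume "y \<in> U"
    then show "(\<lambda>t. a (t *\<^sub>R y) y (\<phi> (t *\<^sub>R y))) integrable_on cbox 0 1"
      by (simp add: picard_integrable)
  qed
  then have "((\<lambda>x. integral {0..1} (\<lambda>t. a (t *\<^sub>R x) x (\<phi> (t *\<^sub>R x)))) has_derivative
      blinfun_apply (integral {0..1} (F x))) (at x)"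
    using at_within_open[OF x U(1)] by simp
  then have "(picard \<psi>0 \<phi> has_derivative blinfun_apply (integral {0..1} (F x))) (at x)"
    unfolding picard_def[abs_def] by (rule has_derivative_eq_rhs[OF has_derivative_add[OF has_derivative_const]]) auto
  moreover have "blinfun_apply (integral {0..1} (F x)) v = integral {0..1} (\<lambda>t. picard_integrand x t v)" for v
  proof -
    have "continuous_on {0..1::real} (\<lambda>t. (x, t))" "(\<lambda>t. (x, t)) ` {0..1::real} \<subseteq> U \<times> cbox 0 1"
      using x by (auto intro: continuous_intros)
    from continuous_on_compose2[OF cF this] have "F x integrable_on {0..1}"
      by (auto intro: integrable_continuous_real)
    from blinfun_apply_integral[OF this, of v]
    have "blinfun_apply (integral {0..1} (F x)) v = integral {0..1} (\<lambda>t. blinfun_apply (F x t) v)" .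
    also have "\<dots> = integral {0..1} (\<lambda>t. picard_integrand x t v)"
      by (rule integral_cong) (simp add: F[OF x])
    finally show ?thesis .
  qed
  ultimately show ?thesis by (metis (no_types, lifting) ext)
qed

lemma Ck_on_picard: "Ck_on 1 (picard \<psi>0 \<phi>) U"
  unfolding One_nat_def
proof (rule Ck_on_SucI[OF U(1) picard_has_derivative_integral])
  fix v
  have "continuous_on (U \<times> cbox 0 1) (\<lambda>(x, t). picard_integrand x t v)"
    unfolding case_prod_beta by (rule continuous_on_picard_integrand) (auto intro: continuous_intros)
  from integral_continuous_on_param[OF this]
  show "Ck_on 0 (\<lambda>x. integral {0..1} (\<lambda>t. picard_integrand x t v)) U" by simp
qed

text \<open>Integrating \<open>d/dt (t a(t x) v (\<phi> (t x)))\<close> and using integrability, the derivative of the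
  Picard iterate misses the right-hand side only by a linear functional of the defect.\<close>

lemma picard_derivative:
  assumes x: "x \<in> U"
  shows "frechet_derivative (picard \<psi>0 \<phi>) (at x) v = a x v (\<phi> x) +
    integral {0..1} (\<lambda>t. t *\<^sub>R (a (t *\<^sub>R x) x (defect \<phi> (t *\<^sub>R x) v) - a (t *\<^sub>R x) v (defect \<phi> (t *\<^sub>R x) x)))"
proof -
  \<comment> \<open>G is the derivative of t \<mapsto> t a(t x) v (\<phi> (t x)), so its integral is
    exactly the desired main term a x v (\<phi> x).\<close>
  define G where "G t = a (t *\<^sub>R x) v (\<phi> (t *\<^sub>R x))
    + t *\<^sub>R (da (t *\<^sub>R x) x v (\<phi> (t *\<^sub>R x)) + a (t *\<^sub>R x) v (\<phi>' (t *\<^sub>R x) x))" for t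
  have tx: "t *\<^sub>R x \<in> U" "t *\<^sub>R x \<in> S" if "t \<in> {0..1}" for t using segment_in[OF U(2,3) x that] U(4) by auto
  have "((\<lambda>t. t *\<^sub>R a (t *\<^sub>R x) v (\<phi> (t *\<^sub>R x))) has_vector_derivative G t) (at t within {0..1})"
    if t: "t \<in> {0..1}" for t
  proof -
    have s: "((\<lambda>t. t *\<^sub>R x) has_derivative (\<lambda>h. h *\<^sub>R x)) (at t)"
      by (rule has_derivative_scaleR_left[OF has_derivative_ident])
    note d = has_derivative_a[OF open_S tx(2)[OF t] s has_derivative_const
        has_derivative_compose[OF s phi_deriv[OF tx(1)[OF t]]], of v]
    have "((\<lambda>t. t *\<^sub>R a (t *\<^sub>R x) v (\<phi> (t *\<^sub>R x))) has_derivative (\<lambda>h. h *\<^sub>R G t)) (at t)"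
      by (rule has_derivative_eq_rhs[OF has_derivative_scaleR[OF has_derivative_ident d]])
        (simp add: G_def fun_eq_iff linear_cmul[OF linear_da(1)[OF tx(2)[OF t] open_S]] linear_0[OF linear_a1[OF tx(2)[OF t]]]
          linear_cmul[OF phi_linear[OF tx(1)[OF t]]] linear_cmul[OF linear_a2[OF tx(2)[OF t]]] algebra_simps)
    then show ?thesis
      by (simp add: has_vector_derivative_def has_derivative_at_withinI)
  qed
  from fundamental_theorem_of_calculus[OF _ this]
  have ftc: "(G has_integral a x v (\<phi> x)) {0..1}" by simp
  have "continuous_on {0..1} (\<lambda>t. picard_integrand x t v)"
    using x by (intro continuous_on_picard_integrand) (auto intro: continuous_intros)
  then have pi: "(\<lambda>t. picard_integrand x t v) integrable_on {0..1}" by (rule integrable_continuous_real)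
  have "frechet_derivative (picard \<psi>0 \<phi>) (at x) v = integral {0..1} (\<lambda>t. picard_integrand x t v)"
    by (simp add: frechet_derivative_eqI[OF picard_has_derivative_integral[OF x]])
  also have "\<dots> = a x v (\<phi> x) + integral {0..1} (\<lambda>t. picard_integrand x t v - G t)"
    using ftc integral_diff[OF pi has_integral_integrable[OF ftc]] by (simp add: integral_unique)
  also have "integral {0..1} (\<lambda>t. picard_integrand x t v - G t) =
    integral {0..1} (\<lambda>t. t *\<^sub>R (a (t *\<^sub>R x) x (defect \<phi> (t *\<^sub>R x) v) - a (t *\<^sub>R x) v (defect \<phi> (t *\<^sub>R x) x)))"
  proof (rule integral_cong)
    fix t :: real assume t: "t \<in> {0..1}"
    note l = linear_diff[OF linear_a2[OF tx(2)[OF t]]]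
    \<comment> \<open>Integrability trades the difference of the two \<open>da\<close> terms for
      nested values of \<open>a\<close>; these combine with the derivatives of \<phi> into the two
      defects.\<close>
    from integrable[OF tx(2)[OF t], of v x "\<phi> (t *\<^sub>R x)", THEN arg_cong[where f="scaleR t"]]
    show "picard_integrand x t v - G t =
        t *\<^sub>R (a (t *\<^sub>R x) x (defect \<phi> (t *\<^sub>R x) v) - a (t *\<^sub>R x) v (defect \<phi> (t *\<^sub>R x) x))"
      unfolding picard_integrand_def G_def defect_def l by (simp add: algebra_simps)
  qed
  finally show ?thesis .
qed

end


section \<open>Convergence of the iteration\<close>

lemma norm_integral_le:
  fixes f :: "real \<Rightarrow> 'b"
  assumes "0 \<le> K" "\<And>t. t \<in> {0..1} \<Longrightarrow> norm (f t) \<le> K"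
  shows "norm (integral {0..1} f) \<le> K"
proof (cases "f integrable_on {0..1}")
  case True
  have "norm (integral {0..1} f) \<le> integral {0..1} (\<lambda>t::real. K)"
    by (rule integral_norm_bound_integral[OF True _ assms(2)]) auto
  then show ?thesis by simp
qed (simp add: not_integrable_integral assms(1))

lemma ex_bound:
  assumes "open S" "cball 0 e \<subseteq> S"
  obtains C where "C > 0" "\<And>y v \<psi>. y \<in> cball 0 e \<Longrightarrow> norm (a y v \<psi>) \<le> C * norm v * norm \<psi>"
proof -
  have "\<exists>K\<ge>0. \<forall>y\<in>cball 0 e. norm (a y i j) \<le> K" for i j
  proof -
    have "continuous_on (cball 0 e) (\<lambda>y. a y i j)"
      using assms by (intro continuous_on_a) (auto intro: continuous_intros)
    then have "bounded ((\<lambda>y. a y i j) ` cball 0 e)"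
      by (intro compact_imp_bounded compact_continuous_image) auto
    then show ?thesis unfolding bounded_pos by (auto intro: less_imp_le)
  qed
  then obtain K where K: "\<And>i j. K i j \<ge> 0" "\<And>i j y. y \<in> cball 0 e \<Longrightarrow> norm (a y i j) \<le> K i j"
    by metis
  define C where "C = 1 + (\<Sum>i\<in>Basis. \<Sum>j\<in>Basis. K i j)"
  have "C > 0" unfolding C_def by (intro add_pos_nonneg sum_nonneg K) simp
  moreover have "norm (a y v \<psi>) \<le> C * norm v * norm \<psi>" if y: "y \<in> cball 0 e" for y v \<psi>
  proof -
    have "norm (a y v \<psi>) \<le> (\<Sum>i\<in>Basis. \<Sum>j\<in>Basis. norm (((v \<bullet> i) * (\<psi> \<bullet> j)) *\<^sub>R a y i j))"
      unfolding a_expand[OF subsetD[OF assms(2) y], of v \<psi>] by (intro sum_norm_le order_refl)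
    also have "\<dots> \<le> (\<Sum>i\<in>Basis. \<Sum>j\<in>Basis. norm v * norm \<psi> * K i j)"
      using y by (intro sum_mono) (auto simp: abs_mult intro!: mult_mono K Basis_le_norm mult_nonneg_nonneg)
    also have "\<dots> = norm v * norm \<psi> * (\<Sum>i\<in>Basis. \<Sum>j\<in>Basis. K i j)"
      by (simp add: sum_distrib_left)
    also have "\<dots> \<le> norm v * norm \<psi> * C"
      unfolding C_def by (intro mult_left_mono) auto
    finally show ?thesis by (simp add: mult_ac)
  qed
  ultimately show ?thesis using that by blast
qed

text \<open>On a small ball both the differences of successive iterates and their defects are
  bounded by geometric sequences. So the iterates converge uniformly, and their derivatives converge
  uniformly to the right-hand side at the limit. By linearity in \<psi> the radius is governed by a
  bound on \<open>a\<close> alone; hence r is chosen before \<psi>0.\<close>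

theorem ex_local_solution:
  assumes S: "open S" "0 \<in> S"
  shows "\<exists>r>0. ball 0 r \<subseteq> S \<and> (\<forall>\<psi>0. \<exists>\<psi>. \<psi> 0 = \<psi>0 \<and>
    (\<forall>x\<in>ball 0 r. (\<psi> has_derivative (\<lambda>v. a x v (\<psi> x))) (at x)))"
proof -
  obtain e where e: "e > 0" "cball 0 e \<subseteq> S" using S open_contains_cball by blast
  obtain C where C: "C > 0" "\<And>y v \<psi>. y \<in> cball 0 e \<Longrightarrow> norm (a y v \<psi>) \<le> C * norm v * norm \<psi>"
    using ex_bound[OF S(1) e(2)] by blast
  \<comment> \<open>This makes C * norm x \<le> 1/8 on the ball, enough to halve both the steps and
    the defects.\<close>
  define r where "r = min e (1 / (8 * C))"
  define U :: "'a set" where "U = ball 0 r"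
  have r: "r > 0" "r \<le> e" "C * r \<le> 1/8" using e C by (auto simp: r_def min_def field_simps)
  have UC: "U \<subseteq> cball 0 e" using r by (auto simp: U_def)
  have U: "open U" "convex U" "0 \<in> U" "U \<subseteq> S" using r UC e by (auto simp: U_def)
  have bd: "norm (a (t *\<^sub>R x) v \<psi>) \<le> C * norm v * K" if "x \<in> U" "t \<in> {0..1}" "norm \<psi> \<le> K" for x t v \<psi> K
  proof -
    have "t *\<^sub>R x \<in> cball 0 e" using segment_in[OF U(2,3)] that UC by blast
    then have "norm (a (t *\<^sub>R x) v \<psi>) \<le> C * norm v * norm \<psi>" by (rule C)
    also have "\<dots> \<le> C * norm v * K" using that C by (intro mult_left_mono) auto
    finally show ?thesis .
  qed
  have Cx: "C * norm x \<le> 1/8" if "x \<in> U" for x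
  proof -
    have "C * norm x \<le> C * r" using that C by (auto simp: U_def intro: mult_left_mono)
    then show ?thesis using r by simp
  qed
  show ?thesis
  proof (intro exI[of _ r] conjI allI)
    show "r > 0" "ball 0 r \<subseteq> S" using r U by (auto simp: U_def)
    fix \<psi>0
    define \<phi> where "\<phi> k = (picard \<psi>0 ^^ k) (\<lambda>_. \<psi>0)" for k
    have \<phi>_simps: "\<phi> 0 = (\<lambda>_. \<psi>0)" "\<phi> (Suc k) = picard \<psi>0 (\<phi> k)" for k by (simp_all add: \<phi>_def)
    define M where "M = norm \<psi>0"
    have M: "M \<ge> 0" by (simp add: M_def)
    have Ck: "Ck_on 1 (\<phi> k) U" for k
      by (induction k) (simp_all add: \<phi>_simps Ck_on_const Ck_on_picard[OF S(1) U] del: One_nat_def)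
    have step: "\<forall>x\<in>U. norm (\<phi> (Suc k) x - \<phi> k x) \<le> M * (1/2)^k" for k
    proof (induction k)
      case 0
      show ?case
      proof
        fix x assume x: "x \<in> U"
        have "norm (integral {0..1} (\<lambda>t. a (t *\<^sub>R x) x \<psi>0)) \<le> C * norm x * M"
          using bd[OF x, of _ \<psi>0 M x] C M by (intro norm_integral_le) (auto simp: M_def)
        also have "\<dots> \<le> 1/8 * M" using Cx[OF x] M by (rule mult_right_mono)
        finally show "norm (\<phi> (Suc 0) x - \<phi> 0 x) \<le> M * (1/2)^0"
          using M by (simp add: \<phi>_simps picard_def)
      qed
    next
      case (Suc k)
      show ?case
      proof
        fix x assume x: "x \<in> U"
        define K where "K = M * (1/2)^k"
        have K: "K \<ge> 0" using M by (simp add: K_def)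
        have tx: "t *\<^sub>R x \<in> U" "t *\<^sub>R x \<in> S" if "t \<in> {0..1}" for t using segment_in[OF U(2,3) x that] U(4) by auto
        have "\<phi> (Suc (Suc k)) x - \<phi> (Suc k) x
          = integral {0..1} (\<lambda>t. a (t *\<^sub>R x) x (\<phi> (Suc k) (t *\<^sub>R x))) - integral {0..1} (\<lambda>t. a (t *\<^sub>R x) x (\<phi> k (t *\<^sub>R x)))"
          by (simp only: \<phi>_simps(2)[of "Suc k"] \<phi>_simps(2)[of k] picard_def) simp
        also have "\<dots> = integral {0..1} (\<lambda>t. a (t *\<^sub>R x) x (\<phi> (Suc k) (t *\<^sub>R x)) - a (t *\<^sub>R x) x (\<phi> k (t *\<^sub>R x)))"
          by (rule integral_diff[symmetric]) (intro picard_integrable[OF S(1) U Ck x])+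
        also have "norm \<dots> \<le> C * norm x * K"
        proof (rule norm_integral_le)
          fix t :: real assume t: "t \<in> {0..1}"
          have "norm (\<phi> (Suc k) (t *\<^sub>R x) - \<phi> k (t *\<^sub>R x)) \<le> K"
            using Suc tx(1)[OF t] by (simp add: K_def)
          then show "norm (a (t *\<^sub>R x) x (\<phi> (Suc k) (t *\<^sub>R x)) - a (t *\<^sub>R x) x (\<phi> k (t *\<^sub>R x))) \<le> C * norm x * K"
            unfolding linear_diff[OF linear_a2[OF tx(2)[OF t]], symmetric] by (rule bd[OF x t])
        qed (use C K in simp)
        also have "\<dots> \<le> 1/8 * K" using Cx[OF x] K by (rule mult_right_mono)
        also have "\<dots> \<le> M * (1/2)^Suc k" using M by (simp add: K_def)
        finally show "norm (\<phi> (Suc (Suc k)) x - \<phi> (Suc k) x) \<le> M * (1/2)^Suc k" .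
      qed
    qed
    \<comment> \<open>With K the bound at stage k, the integral in \<open>picard_derivative\<close>
      contributes at most K/4, that is C M (1/2)^k, and the last step of the iteration contributes
      the same amount. The sum is 4 C M (1/2)^(k+1), which explains the constant 4.\<close>
    have def: "\<forall>x\<in>U. \<forall>v. norm (defect (\<phi> k) x v) \<le> 4 * C * M * (1/2)^k * norm v" for k
    proof (induction k)
      case 0
      have "norm (a x v \<psi>0) \<le> C * norm v * M" if "x \<in> U" for x v
        using bd[OF that, of 1 \<psi>0 M v] by (simp add: M_def)
      moreover have "C * norm v * M \<le> 4 * C * M * norm v" for v :: 'a
        using C M by (simp add: mult_ac)
      ultimately have "norm (a x v \<psi>0) \<le> 4 * C * M * norm v" if "x \<in> U" for x v
        using order_trans that by blast
      then show ?case by (auto simp: defect_def \<phi>_simps)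
    next
      case (Suc k)
      show ?case
      proof (intro ballI allI)
        fix x v assume x: "x \<in> U"
        define K where "K = 4 * C * M * (1/2)^k"
        have K: "K \<ge> 0" using C M by (simp add: K_def)
        let ?I = "integral {0..1} (\<lambda>t. t *\<^sub>R (a (t *\<^sub>R x) x (defect (\<phi> k) (t *\<^sub>R x) v)
            - a (t *\<^sub>R x) v (defect (\<phi> k) (t *\<^sub>R x) x)))"
        have "norm ?I \<le> 2 * (C * norm x) * (K * norm v)"
        proof (rule norm_integral_le)
          show "0 \<le> 2 * (C * norm x) * (K * norm v)" using C K by simp
          fix t :: real assume t: "t \<in> {0..1}"
          have d: "norm (defect (\<phi> k) (t *\<^sub>R x) w) \<le> K * norm w" for w
            using Suc segment_in[OF U(2,3) x t] by (auto simp: K_def)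
          have "norm (a (t *\<^sub>R x) x (defect (\<phi> k) (t *\<^sub>R x) v) - a (t *\<^sub>R x) v (defect (\<phi> k) (t *\<^sub>R x) x))
              \<le> C * norm x * (K * norm v) + C * norm v * (K * norm x)"
            by (rule order_trans[OF norm_triangle_ineq4 add_mono[OF bd[OF x t d] bd[OF x t d]]])
          then have "norm (a (t *\<^sub>R x) x (defect (\<phi> k) (t *\<^sub>R x) v) - a (t *\<^sub>R x) v (defect (\<phi> k) (t *\<^sub>R x) x))
              \<le> 2 * (C * norm x) * (K * norm v)"
            by (simp add: algebra_simps)
          moreover have "norm (t *\<^sub>R w) \<le> norm w" for w :: 'b
            using t by (simp add: mult_left_le_one_le)
          ultimately show "norm (t *\<^sub>R (a (t *\<^sub>R x) x (defect (\<phi> k) (t *\<^sub>R x) v) - a (t *\<^sub>R x) v (defect (\<phi> k) (t *\<^sub>R x) x)))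
              \<le> 2 * (C * norm x) * (K * norm v)"
            using order_trans by blast
        qed
        also have "\<dots> \<le> 2 * (1/8) * (K * norm v)"
          using Cx[OF x] K by (intro mult_right_mono mult_left_mono) auto
        finally have I: "norm ?I \<le> C * M * (1/2)^k * norm v" by (simp add: K_def)
        have xS: "x \<in> S" using x U by blast
        have "defect (\<phi> (Suc k)) x v = ?I - a x v (\<phi> (Suc k) x - \<phi> k x)"
          unfolding defect_def[of "\<phi> (Suc k)"] linear_diff[OF linear_a2[OF xS]]
          by (simp add: \<phi>_simps picard_derivative[OF S(1) U Ck x])
        moreover have "norm (a x v (\<phi> (Suc k) x - \<phi> k x)) \<le> C * norm v * (M * (1/2)^k)"
          using bd[OF x, of 1] step[of k] x by auto
        note order_trans[OF norm_triangle_ineq4 add_mono[OF I this]]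
        ultimately have "norm (defect (\<phi> (Suc k)) x v) \<le> C * M * (1/2)^k * norm v + C * norm v * (M * (1/2)^k)"
          by simp
        then show "norm (defect (\<phi> (Suc k)) x v) \<le> 4 * C * M * (1/2)^Suc k * norm v"
          by (simp add: algebra_simps)
      qed
    qed
    \<comment> \<open>The last factor is that of a partial geometric sum; keeping it lets the
      induction on m close.\<close>
    have tail: "norm (\<phi> (k + m) x - \<phi> k x) \<le> 2 * M * (1/2)^k * (1 - (1/2)^m)" if x: "x \<in> U" for x k m
    proof (induction m)
      case (Suc m)
      have "norm (\<phi> (k + Suc m) x - \<phi> k x) \<le> norm (\<phi> (Suc (k + m)) x - \<phi> (k + m) x) + norm (\<phi> (k + m) x - \<phi> k x)"
        using norm_triangle_ineq[of "\<phi> (Suc (k + m)) x - \<phi> (k + m) x" "\<phi> (k + m) x - \<phi> k x"] by simp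
      also have "\<dots> \<le> M * (1/2)^(k + m) + 2 * M * (1/2)^k * (1 - (1/2)^m)"
        using step[of "k + m"] x Suc by (intro add_mono) auto
      also have "\<dots> = 2 * M * (1/2)^k * (1 - (1/2)^Suc m)" by (simp add: power_add algebra_simps)
      finally show ?case .
    qed simp
    have tail': "norm (\<phi> n x - \<phi> k x) \<le> 2 * M * (1/2)^k" if "x \<in> U" "n \<ge> k" for x k n
    proof -
      have "norm (\<phi> n x - \<phi> k x) \<le> 2 * M * (1/2)^k * (1 - (1/2)^(n - k))"
        using tail[OF that(1), of k "n - k"] that(2) by simp
      also have "\<dots> \<le> 2 * M * (1/2)^k" using M by (intro mult_left_le) auto
      finally show ?thesis .
    qed
    have small: "\<forall>\<^sub>F k in sequentially. K * (1/2)^k < \<epsilon>" if "\<epsilon> > 0" for K \<epsilon> :: real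
    proof -
      have "(\<lambda>k. K * (1/2)^k) \<longlonglongrightarrow> K * 0"
        by (intro tendsto_intros LIMSEQ_realpow_zero) auto
      then show ?thesis using order_tendstoD(2)[of _ "K * 0" _ \<epsilon>] that by simp
    qed
    have "convergent (\<lambda>n. \<phi> n x)" if x: "x \<in> U" for x
    proof (rule Cauchy_convergent, rule CauchyI')
      fix \<epsilon> :: real assume "\<epsilon> > 0"
      then obtain k where k: "2 * M * (1/2)^k < \<epsilon> / 2"
        using eventually_happens[OF small[of "\<epsilon> / 2" "2 * M"]] by auto
      have "dist (\<phi> m x) (\<phi> n x) < \<epsilon>" if "m \<ge> k" "n > m" for m n
        using tail'[OF x, of k m] tail'[OF x, of k n] that k dist_triangle_half_l[of "\<phi> m x" "\<phi> k x" \<epsilon> "\<phi> n x"]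
        by (simp add: dist_norm)
      then show "\<exists>M. \<forall>m\<ge>M. \<forall>n>m. dist (\<phi> m x) (\<phi> n x) < \<epsilon>" by blast
    qed
    then obtain \<psi> where \<psi>: "\<And>x. x \<in> U \<Longrightarrow> (\<lambda>n. \<phi> n x) \<longlonglongrightarrow> \<psi> x"
      unfolding convergent_def by metis
    have lim: "norm (\<phi> k x - \<psi> x) \<le> 2 * M * (1/2)^k" if x: "x \<in> U" for x k
    proof -
      have "(\<lambda>n. norm (\<phi> n x - \<phi> k x)) \<longlonglongrightarrow> norm (\<psi> x - \<phi> k x)"
        by (intro tendsto_intros \<psi> x)
      then have "norm (\<psi> x - \<phi> k x) \<le> 2 * M * (1/2)^k"
        by (rule tendsto_upperbound) (auto intro!: eventually_sequentiallyI tail'[OF x])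
      then show ?thesis by (simp add: norm_minus_commute)
    qed
    \<comment> \<open>The derivative is stated with the limit \<psi> already known; the function g
      produced here equals \<psi> on U by uniqueness of limits.\<close>
    have "\<exists>g. \<forall>x\<in>U. (\<lambda>n. \<phi> n x) \<longlonglongrightarrow> g x \<and> (g has_derivative (\<lambda>v. a x v (\<psi> x))) (at x within U)"
    proof (rule has_derivative_sequence[where f=\<phi> and ?x0.0 = 0 and l = "\<psi> 0"])
      show "convex U" "0 \<in> U" "(\<lambda>n. \<phi> n 0) \<longlonglongrightarrow> \<psi> 0" using U \<psi> by auto
      show "(\<phi> n has_derivative frechet_derivative (\<phi> n) (at x)) (at x within U)" if "x \<in> U" for n x
        using phi_deriv[OF S(1) U Ck that] by (rule has_derivative_at_withinI)
      fix \<epsilon> :: real assume \<epsilon>: "\<epsilon> > 0"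
      \<comment> \<open>The constant 6 is 4 from the defect plus 2 from replacing \<phi> n x by its
        limit.\<close>
      have b: "norm (frechet_derivative (\<phi> n) (at x) h - a x h (\<psi> x)) \<le> 6 * C * M * (1/2)^n * norm h" if x: "x \<in> U" for x h n
      proof -
        have xS: "x \<in> S" using x U by blast
        have "frechet_derivative (\<phi> n) (at x) h - a x h (\<psi> x) = defect (\<phi> n) x h + a x h (\<phi> n x - \<psi> x)"
          by (simp add: defect_def linear_diff[OF linear_a2[OF xS]])
        moreover have "norm (a x h (\<phi> n x - \<psi> x)) \<le> C * norm h * (2 * M * (1/2)^n)"
          using bd[OF x, of 1] lim[OF x] by auto
        ultimately have "norm (frechet_derivative (\<phi> n) (at x) h - a x h (\<psi> x))
            \<le> 4 * C * M * (1/2)^n * norm h + C * norm h * (2 * M * (1/2)^n)"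
          using order_trans[OF norm_triangle_ineq add_mono[OF def[rule_format, OF x]]] by metis
        then show ?thesis by (simp add: algebra_simps)
      qed
      have "norm (frechet_derivative (\<phi> n) (at x) h - a x h (\<psi> x)) \<le> \<epsilon> * norm h"
        if "6 * C * M * (1/2)^n < \<epsilon>" "x \<in> U" for n x h
        using order_trans[OF b[OF that(2)] mult_right_mono[OF less_imp_le[OF that(1)]]] by simp
      then show "\<forall>\<^sub>F n in sequentially. \<forall>x\<in>U. \<forall>h. norm (frechet_derivative (\<phi> n) (at x) h - a x h (\<psi> x)) \<le> \<epsilon> * norm h"
        by (intro eventually_mono[OF small[OF \<epsilon>, of "6 * C * M"]]) blast
    qed
    then obtain g where g: "\<And>x. x \<in> U \<Longrightarrow> (\<lambda>n. \<phi> n x) \<longlonglongrightarrow> g x"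
      "\<And>x. x \<in> U \<Longrightarrow> (g has_derivative (\<lambda>v. a x v (\<psi> x))) (at x within U)" by blast
    have g\<psi>: "g x = \<psi> x" if "x \<in> U" for x using LIMSEQ_unique[OF g(1) \<psi>] that by blast
    \<comment> \<open>At the origin the direction is 0, so the integrand vanishes by
      linearity.\<close>
    have "\<phi> k 0 = \<psi>0" for k
      using linear_0[OF linear_a1[OF S(2)]] by (cases k) (simp_all add: \<phi>_simps picard_def)
    then have "g 0 = \<psi>0" using LIMSEQ_unique[OF g(1)[OF U(3)]] by simp
    moreover have "(g has_derivative (\<lambda>v. a x v (g x))) (at x)" if "x \<in> ball 0 r" for x
      using g(2)[of x] that g\<psi> at_within_open[OF _ U(1)] by (simp add: U_def)
    ultimately show "\<exists>\<psi>. \<psi> 0 = \<psi>0 \<and> (\<forall>x\<in>ball 0 r. (\<psi> has_derivative (\<lambda>v. a x v (\<psi> x))) (at x))" by blast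
  qed
qed

end

section \<open>Charts and tangent vectors\<close>

text \<open>The local part of \<open>smooth_manifold\<close>, which passes to open submanifolds and
  to the frame bundle by computations in charts.\<close>

definition smooth_atlas :: "('a, 'e::real_normed_vector) mfd \<Rightarrow> bool" where
  "smooth_atlas M \<longleftrightarrow> fin_dim TYPE('e) \<and> (\<Union>c\<in>atlas M. fst c) = points M \<and>
     (\<forall>c\<in>atlas M. openin (tops M) (fst c) \<and> open (snd c ` fst c) \<and>
        homeomorphic_map (subtopology (tops M) (fst c)) (top_of_set (snd c ` fst c)) (snd c)) \<and>
     (\<forall>c\<in>atlas M. \<forall>d\<in>atlas M. smooth_on (snd c ` (fst c \<inter> fst d)) (snd d \<circ> cinv c))"

lemma smooth_manifold_smooth_atlas: "smooth_manifold M \<Longrightarrow> smooth_atlas M"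
  by (simp add: smooth_manifold_def smooth_atlas_def fin_dim_def)

lemma smooth_atlas_vector_mfd: "smooth_atlas (vector_mfd :: ('e::euclidean_space, 'e) mfd)"
proof -
  have "homeomorphic_map (subtopology euclidean UNIV) (top_of_set UNIV) (id :: 'e \<Rightarrow> 'e)"
    by simp
  moreover have "smooth_on UNIV (id \<circ> inv_into UNIV (id :: 'e \<Rightarrow> 'e))"
    using smooth_on_ident[of UNIV] by (simp add: id_def comp_def inv_id[unfolded id_def])
  ultimately show ?thesis
    by (simp add: smooth_atlas_def vector_mfd_def fin_dim_euclidean)
qed

lemma charts_at_iff: "c \<in> charts_at M x \<longleftrightarrow> c \<in> atlas M \<and> x \<in> fst c"
  by (simp add: charts_at_def)

context
  fixes M :: "('a, 'e::real_normed_vector) mfd"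
  assumes M: "smooth_atlas M"
begin

lemma fin_dim_model: "fin_dim TYPE('e)"
  using M by (simp add: smooth_atlas_def)

lemma chart_inj: "c \<in> atlas M \<Longrightarrow> inj_on (snd c) (fst c)"
proof -
  assume c: "c \<in> atlas M"
  then have "homeomorphic_map (subtopology (tops M) (fst c)) (top_of_set (snd c ` fst c)) (snd c)"
    and "fst c \<subseteq> points M"
    using M openin_subset by (auto simp: smooth_atlas_def)
  then show ?thesis
    by (simp add: homeomorphic_eq_everything_map Int_absorb1)
qed

lemma chart_openin: "c \<in> atlas M \<Longrightarrow> openin (tops M) (fst c)"
  using M by (simp add: smooth_atlas_def)

lemma chart_subset: "c \<in> atlas M \<Longrightarrow> fst c \<subseteq> points M"
  using chart_openin openin_subset by blast

lemma chart_cinv: "c \<in> atlas M \<Longrightarrow> x \<in> fst c \<Longrightarrow> cinv c (snd c x) = x"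
  using chart_inj by (simp add: inv_into_f_f)

lemma cinv_image: "c \<in> atlas M \<Longrightarrow> O1 \<subseteq> fst c \<Longrightarrow> y \<in> snd c ` O1 \<Longrightarrow> cinv c y \<in> O1 \<and> snd c (cinv c y) = y"
  using chart_cinv by auto

lemma chart_image_iff:
  assumes "c \<in> atlas M" "x \<in> fst c"
  shows "snd c x \<in> snd c ` {y \<in> fst c. P y} \<longleftrightarrow> P x" and "snd c x \<in> snd c ` (fst c \<inter> B) \<longleftrightarrow> x \<in> B"
  using inj_onD[OF chart_inj[OF assms(1)] _ assms(2)] assms(2) by blast+

lemma chart_open_image:
  assumes "c \<in> atlas M" "openin (tops M) O1" "O1 \<subseteq> fst c"
  shows "open (snd c ` O1)"
proof -
  have h: "homeomorphic_map (subtopology (tops M) (fst c)) (top_of_set (snd c ` fst c)) (snd c)"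
    and o: "open (snd c ` fst c)" using M assms by (auto simp: smooth_atlas_def)
  have "openin (subtopology (tops M) (fst c)) O1"
    using assms by (auto simp: openin_subtopology)
  then have "openin (top_of_set (snd c ` fst c)) (snd c ` O1)"
    using homeomorphic_imp_open_map[OF h] by (simp add: open_map_def)
  then show ?thesis using o by (simp add: openin_open_eq)
qed

lemma chart_open_preimage:
  assumes "c \<in> atlas M" "open V"
  shows "openin (tops M) {x \<in> fst c. snd c x \<in> V}"
proof -
  have h: "homeomorphic_map (subtopology (tops M) (fst c)) (top_of_set (snd c ` fst c)) (snd c)"
    using M assms by (auto simp: smooth_atlas_def)
  have t: "topspace (subtopology (tops M) (fst c)) = fst c"
    using chart_subset[OF assms(1)] by auto
  have "openin (top_of_set (snd c ` fst c)) (snd c ` fst c \<inter> V)"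
    using assms(2) by (auto simp: openin_open)
  then have "openin (subtopology (tops M) (fst c)) {x \<in> fst c. snd c x \<in> snd c ` fst c \<inter> V}"
    using openin_continuous_map_preimage[OF homeomorphic_imp_continuous_map[OF h]] unfolding t by blast
  then show ?thesis
    using openin_trans_full[OF _ chart_openin[OF assms(1)]] by (simp cong: conj_cong)
qed

lemma ex_chart: "x \<in> points M \<Longrightarrow> \<exists>c. c \<in> charts_at M x"
proof -
  assume "x \<in> points M"
  moreover have "(\<Union>c\<in>atlas M. fst c) = points M" using M by (simp add: smooth_atlas_def)
  ultimately show ?thesis unfolding charts_at_iff by blast
qed

lemma charts_at_points: "c \<in> charts_at M x \<Longrightarrow> x \<in> points M"
  using chart_subset unfolding charts_at_iff by blast

lemma transition_smooth:
  "c \<in> atlas M \<Longrightarrow> d \<in> atlas M \<Longrightarrow> smooth_on (snd c ` (fst c \<inter> fst d)) (snd d \<circ> cinv c)"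
  using M by (simp add: smooth_atlas_def)

lemma transition_has_derivative:
  assumes "c \<in> charts_at M x" "d \<in> charts_at M x"
  shows "((snd d \<circ> cinv c) has_derivative frechet_derivative (snd d \<circ> cinv c) (at (snd c x))) (at (snd c x))"
  using assms by (intro smooth_on_has_derivative[OF transition_smooth]) (auto simp: charts_at_iff)

text \<open>The chain rule behind chart independence. The two coordinate expressions agree on the
  image of the overlap of the charts, which is open.\<close>

lemma transition_compose:
  assumes "c \<in> charts_at M x" "d \<in> charts_at M x" "((f \<circ> cinv d) has_derivative f') (at (snd d x))"
  shows "((f \<circ> cinv c) has_derivative (\<lambda>v. f' (frechet_derivative (snd d \<circ> cinv c) (at (snd c x)) v))) (at (snd c x))"
proof -
  note c = assms(1,2)[unfolded charts_at_iff]
  have "((snd d \<circ> cinv c) has_derivative frechet_derivative (snd d \<circ> cinv c) (at (snd c x))) (at (snd c x))"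
    by (rule transition_has_derivative[OF assms(1,2)])
  moreover have "((f \<circ> cinv d) has_derivative f') (at ((snd d \<circ> cinv c) (snd c x)))"
    using assms(3) c by (simp add: chart_cinv)
  ultimately have "((\<lambda>y. (f \<circ> cinv d) ((snd d \<circ> cinv c) y)) has_derivative
      (\<lambda>v. f' (frechet_derivative (snd d \<circ> cinv c) (at (snd c x)) v))) (at (snd c x))"
    by (rule has_derivative_compose)
  moreover have "open (snd c ` (fst c \<inter> fst d))"
    using smooth_onD_open[OF transition_smooth] c by blast
  ultimately show ?thesis
    by (rule has_derivative_transform_within_open) (use c in \<open>auto simp: chart_cinv\<close>)
qed

text \<open>Extends one prescribed component to all charts by the transformation law. This inverts
  evaluation in c on the tangent space at x, so that equations between tangent vectors can be tested
  in a single chart.\<close>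

definition tvec :: "('a, 'e) chart \<Rightarrow> 'a \<Rightarrow> 'e \<Rightarrow> ('a, 'e) tvec" where
  "tvec c x \<xi> = (\<lambda>d. if d \<in> charts_at M x then frechet_derivative (snd d \<circ> cinv c) (at (snd c x)) \<xi> else 0)"

lemma frechet_derivative_chart:
  assumes "c \<in> charts_at M x"
  shows "frechet_derivative (snd c \<circ> cinv c) (at (snd c x)) = (\<lambda>\<xi>. \<xi>)"
proof (rule frechet_derivative_eqI, rule has_derivative_transform_within_open[OF has_derivative_ident])
  show "open (snd c ` fst c)" using chart_open_image assms chart_openin by (auto simp: charts_at_iff)
qed (use assms in \<open>auto simp: charts_at_iff chart_cinv\<close>)

lemma tvec_chart: "c \<in> charts_at M x \<Longrightarrow> tvec c x \<xi> c = \<xi>"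
  by (simp add: tvec_def frechet_derivative_chart)

lemma tvec_in_tangent_space:
  assumes c: "c \<in> charts_at M x"
  shows "tvec c x \<xi> \<in> tangent_space M x"
  unfolding tangent_space_def
proof (intro CollectI conjI ballI allI impI)
  fix d e assume d: "d \<in> charts_at M x" and e: "e \<in> charts_at M x"
  from frechet_derivative_eqI[OF transition_compose[OF c d transition_has_derivative[OF d e]]]
  show "tvec c x \<xi> e = frechet_derivative (snd e \<circ> cinv d) (at (snd d x)) (tvec c x \<xi> d)"
    using d e by (simp add: tvec_def)
qed (simp add: tvec_def)

lemma tangent_spaceD:
  assumes "v \<in> tangent_space M x"
  shows "c \<notin> charts_at M x \<Longrightarrow> v c = 0"
    and "c \<in> charts_at M x \<Longrightarrow> d \<in> charts_at M x \<Longrightarrow>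
      v d = frechet_derivative (snd d \<circ> cinv c) (at (snd c x)) (v c)"
  using assms unfolding tangent_space_def by blast+

lemma tangent_space_eq_tvec:
  assumes "v \<in> tangent_space M x" "c \<in> charts_at M x"
  shows "v = tvec c x (v c)"
proof
  show "v d = tvec c x (v c) d" for d
    using tangent_spaceD(1)[OF assms(1), of d] tangent_spaceD(2)[OF assms, of d]
    by (cases "d \<in> charts_at M x") (simp_all only: tvec_def if_True if_False simp_thms)
qed

lemma tangent_space_eqI:
  assumes "v \<in> tangent_space M x" "w \<in> tangent_space M x" "c \<in> charts_at M x" "v c = w c"
  shows "v = w"
  using tangent_space_eq_tvec[OF assms(1,3)] tangent_space_eq_tvec[OF assms(2,3)] assms(4) by simp

lemma transition_linear:
  assumes "c \<in> charts_at M x" "d \<in> charts_at M x"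
  shows "linear (frechet_derivative (snd d \<circ> cinv c) (at (snd c x)))"
  using transition_has_derivative[OF assms] has_derivative_linear by blast

lemma tangent_space_lincomb:
  assumes "v \<in> tangent_space M x" "w \<in> tangent_space M x"
  shows "(\<lambda>c. r *\<^sub>R v c + s *\<^sub>R w c) \<in> tangent_space M x"
  unfolding tangent_space_def
proof (intro CollectI conjI ballI allI impI)
  show "r *\<^sub>R v c + s *\<^sub>R w c = 0" if "c \<notin> charts_at M x" for c
    using tangent_spaceD(1)[OF assms(1) that] tangent_spaceD(1)[OF assms(2) that] by simp
  fix c d assume cd: "c \<in> charts_at M x" "d \<in> charts_at M x"
  then have "v d = frechet_derivative (snd d \<circ> cinv c) (at (snd c x)) (v c)"
    "w d = frechet_derivative (snd d \<circ> cinv c) (at (snd c x)) (w c)"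
    using tangent_spaceD(2)[OF assms(1) cd] tangent_spaceD(2)[OF assms(2) cd] by blast+
  then show "r *\<^sub>R v d + s *\<^sub>R w d = frechet_derivative (snd d \<circ> cinv c) (at (snd c x)) (r *\<^sub>R v c + s *\<^sub>R w c)"
    by (simp only: linear_add[OF transition_linear[OF cd]] linear_cmul[OF transition_linear[OF cd]])
qed

lemma zero_in_tangent_space: "(\<lambda>c. 0) \<in> tangent_space M x"
  unfolding tangent_space_def by (simp add: linear_0[OF transition_linear])

lemma tangent_space_sum:
  assumes "\<And>i. i \<in> I \<Longrightarrow> v i \<in> tangent_space M x"
  shows "(\<lambda>c. \<Sum>i\<in>I. s i *\<^sub>R v i c) \<in> tangent_space M x"
  using assms
proof (induction I rule: infinite_finite_induct)
  case (insert i I)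
  then show ?case using tangent_space_lincomb[of "v i" x "\<lambda>c. \<Sum>i\<in>I. s i *\<^sub>R v i c" "s i" 1] by simp
qed (simp_all add: zero_in_tangent_space)

lemma tvec_linear: "c \<in> charts_at M x \<Longrightarrow> tvec c x (r *\<^sub>R \<xi> + s *\<^sub>R \<eta>) d = r *\<^sub>R tvec c x \<xi> d + s *\<^sub>R tvec c x \<eta> d"
  by (simp add: tvec_def linear_add[OF transition_linear] linear_cmul[OF transition_linear])

end

lemma smooth_atlas_open_submfd:
  assumes M: "smooth_atlas M" and W: "openin (tops M) W"
  shows "smooth_atlas (open_submfd M W)"
  unfolding smooth_atlas_def
proof (intro conjI ballI)
  have WM: "W \<subseteq> points M" using W openin_subset by blast
  show "fin_dim TYPE('b)" using fin_dim_model[OF M] .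
  have cov: "(\<Union>c\<in>atlas M. fst c) = points M" using M by (simp add: smooth_atlas_def)
  then show "(\<Union>c\<in>atlas (open_submfd M W). fst c) = points (open_submfd M W)"
    using WM unfolding open_submfd_def by fastforce
  fix c' assume "c' \<in> atlas (open_submfd M W)"
  then obtain c where c: "c \<in> atlas M" and c': "c' = (fst c \<inter> W, snd c)"
    by (auto simp: open_submfd_def)
  have o: "openin (tops M) (fst c \<inter> W)" using chart_openin[OF M c] W by blast
  then show "openin (tops (open_submfd M W)) (fst c')"
    using c' by (auto simp: open_submfd_def openin_subtopology)
  show op: "open (snd c' ` fst c')" using chart_open_image[OF M c o] c' by simp
  have h: "homeomorphic_map (subtopology (tops M) (fst c)) (top_of_set (snd c ` fst c)) (snd c)"
    using M c by (auto simp: smooth_atlas_def)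
  have st: "subtopology (tops (open_submfd M W)) (fst c') = subtopology (subtopology (tops M) (fst c)) (fst c \<inter> W)"
    using c' by (simp add: open_submfd_def subtopology_subtopology Int_commute Int_left_commute)
  have tt: "top_of_set (snd c' ` fst c') = subtopology (top_of_set (snd c ` fst c)) (snd c ` (fst c \<inter> W))"
    using c' by (simp add: subtopology_subtopology) (metis Int_absorb1 image_mono inf_le1)
  have "snd c ` (topspace (subtopology (tops M) (fst c)) \<inter> (fst c \<inter> W)) = topspace (top_of_set (snd c ` fst c)) \<inter> snd c ` (fst c \<inter> W)"
    using chart_subset[OF M c] by auto
  then show "homeomorphic_map (subtopology (tops (open_submfd M W)) (fst c')) (top_of_set (snd c' ` fst c')) (snd c')"
    unfolding st tt using homeomorphic_map_subtopologies[OF h] c' by simp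
  fix d' assume "d' \<in> atlas (open_submfd M W)"
  then obtain d where d: "d \<in> atlas M" and d': "d' = (fst d \<inter> W, snd d)"
    by (auto simp: open_submfd_def)
  have "smooth_on (snd c ` (fst c \<inter> W \<inter> (fst d \<inter> W))) (snd d \<circ> cinv c)"
  proof (rule smooth_on_subset[OF transition_smooth[OF M c d]])
    show "open (snd c ` (fst c \<inter> W \<inter> (fst d \<inter> W)))"
      using chart_openin[OF M c] chart_openin[OF M d] W by (intro chart_open_image[OF M c]) auto
  qed auto
  then show "smooth_on (snd c' ` (fst c' \<inter> fst d')) (snd d' \<circ> cinv c')"
    unfolding c' d' fst_conv snd_conv
  proof (rule smooth_on_cong)
    fix y assume "y \<in> snd c ` (fst c \<inter> W \<inter> (fst d \<inter> W))"
    then obtain x where x: "x \<in> fst c" "x \<in> W" "y = snd c x" by blast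
    \<comment> \<open>Restricting a chart also changes \<open>cinv\<close>, which is formed over the
      smaller domain; injectivity makes the two inverses agree.\<close>
    then have "inv_into (fst c \<inter> W) (snd c) y = x"
      by (intro inv_into_f_eq inj_on_subset[OF chart_inj[OF M c]]) auto
    then show "(snd d \<circ> cinv c) y = (snd d \<circ> inv_into (fst c \<inter> W) (snd c)) y"
      using x chart_cinv[OF M c] by simp
  qed
qed


section \<open>Smooth maps\<close>

text \<open>A pointwise form of smoothness, witnessed by one pair of charts. It composes and
  localizes without bookkeeping of domains, and \<open>smooth_near_charts\<close> transfers it to
  every pair of charts.\<close>

definition smooth_near ::
  "('a, 'e::real_normed_vector) mfd \<Rightarrow> ('b, 'f::real_normed_vector) mfd \<Rightarrow> ('a \<Rightarrow> 'b) \<Rightarrow> 'a \<Rightarrow> bool" where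
  "smooth_near M N F x \<longleftrightarrow> (\<exists>c\<in>charts_at M x. \<exists>d\<in>charts_at N (F x). \<exists>T. snd c x \<in> T \<and>
     T \<subseteq> snd c ` {y \<in> fst c. F y \<in> fst d} \<and> smooth_on T (snd d \<circ> F \<circ> cinv c))"

lemma smooth_nearI:
  assumes "c \<in> charts_at M x" "d \<in> charts_at N (F x)" "snd c x \<in> T"
    "T \<subseteq> snd c ` {y \<in> fst c. F y \<in> fst d}" "smooth_on T (snd d \<circ> F \<circ> cinv c)"
  shows "smooth_near M N F x"
  using assms unfolding smooth_near_def by blast

text \<open>The composite is read as five coordinate maps: the given chart to the chart that
  witnesses F, then F, a transition in the middle manifold, G, and a transition to the given target
  chart. Taking the identity for G yields independence of charts.\<close>

lemma smooth_near_compose_charts: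
  assumes M: "smooth_atlas M" and N: "smooth_atlas N" and K: "smooth_atlas K"
    and F: "smooth_near M N F x" and G: "smooth_near N K G (F x)"
    and c: "c \<in> charts_at M x" and d: "d \<in> charts_at K (G (F x))"
  shows "\<exists>T. snd c x \<in> T \<and> T \<subseteq> snd c ` {y \<in> fst c. G (F y) \<in> fst d} \<and> smooth_on T (snd d \<circ> (G \<circ> F) \<circ> cinv c)"
proof -
  obtain c1 e1 T1 where c1: "c1 \<in> charts_at M x" "e1 \<in> charts_at N (F x)" "snd c1 x \<in> T1"
    "T1 \<subseteq> snd c1 ` {y \<in> fst c1. F y \<in> fst e1}" "smooth_on T1 (snd e1 \<circ> F \<circ> cinv c1)"
    using F unfolding smooth_near_def by blast
  obtain e2 d2 T2 where e2: "e2 \<in> charts_at N (F x)" "d2 \<in> charts_at K (G (F x))" "snd e2 (F x) \<in> T2"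
    "T2 \<subseteq> snd e2 ` {y \<in> fst e2. G y \<in> fst d2}" "smooth_on T2 (snd d2 \<circ> G \<circ> cinv e2)"
    using G unfolding smooth_near_def by blast
  note a = c c1(1,2) e2(1,2) d
  note a' = a[unfolded charts_at_iff]
  define f1 where "f1 = snd c1 \<circ> cinv c"
  define f2 where "f2 = snd e1 \<circ> F \<circ> cinv c1"
  define f3 where "f3 = snd e2 \<circ> cinv e1"
  define f4 where "f4 = snd d2 \<circ> G \<circ> cinv e2"
  define f5 where "f5 = snd d \<circ> cinv d2"
  note f = f1_def f2_def f3_def f4_def f5_def
  define S1 where "S1 = snd c ` (fst c \<inter> fst c1)"
  define S3 where "S3 = snd e1 ` (fst e1 \<inter> fst e2)"
  define S5 where "S5 = snd d2 ` (fst d2 \<inter> fst d)"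
  have s1: "smooth_on S1 f1" and s3: "smooth_on S3 f3" and s5: "smooth_on S5 f5"
    unfolding f S1_def S3_def S5_def using transition_smooth[OF M] transition_smooth[OF N] transition_smooth[OF K] a' by auto
  note fd = fin_dim_model[OF M] fin_dim_model[OF N] fin_dim_model[OF K]
  note t1 = smooth_on_compose_preimage[OF fd(1) c1(5)[folded f2_def] s1]
  note t2 = smooth_on_compose_preimage[OF fd(2) s3 t1]
  note t3 = smooth_on_compose_preimage[OF fd(2) e2(5)[folded f4_def] t2]
  note t4 = smooth_on_compose_preimage[OF fd(3) s5 t3]
  define T where "T = {x \<in> {x \<in> {x \<in> {x \<in> S1. f1 x \<in> T1}. f2 (f1 x) \<in> S3}. f3 (f2 (f1 x)) \<in> T2}. f4 (f3 (f2 (f1 x))) \<in> S5}"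
  \<comment> \<open>The conditions defining T speak of coordinates only. Since charts are injective,
    they show step by step that the points themselves lie in the required chart domains.\<close>
  have key: "F z \<in> fst e1 \<and> F z \<in> fst e2 \<and> G (F z) \<in> fst d2 \<and> G (F z) \<in> fst d \<and>
      f5 (f4 (f3 (f2 (f1 (snd c z))))) = snd d (G (F z))"
    if z: "z \<in> fst c" "z \<in> fst c1" and y: "snd c z \<in> T" for z
  proof -
    have 1: "f1 (snd c z) = snd c1 z" using z a' by (simp add: f1_def chart_cinv[OF M])
    note chM = chart_image_iff[OF M, THEN iffD1] and chN = chart_image_iff[OF N, THEN iffD1]
      and chK = chart_image_iff[OF K, THEN iffD1]
    from y have y': "f1 (snd c z) \<in> T1" "f2 (f1 (snd c z)) \<in> S3" "f3 (f2 (f1 (snd c z))) \<in> T2"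
      "f4 (f3 (f2 (f1 (snd c z)))) \<in> S5" by (simp_all add: T_def)
    have 2: "F z \<in> fst e1" by (rule chM(1)[OF _ z(2) subsetD[OF c1(4) y'(1)[unfolded 1]]]) (use a' in simp)
    have 3: "f2 (snd c1 z) = snd e1 (F z)" using z a' by (simp add: f2_def chart_cinv[OF M])
    have 4: "F z \<in> fst e2" by (rule chN(2)[OF _ 2 y'(2)[unfolded 1 3 S3_def]]) (use a' in simp)
    have 5: "f3 (snd e1 (F z)) = snd e2 (F z)" using 2 a' by (simp add: f3_def chart_cinv[OF N])
    have 6: "G (F z) \<in> fst d2" by (rule chN(1)[OF _ 4 subsetD[OF e2(4) y'(3)[unfolded 1 3 5]]]) (use a' in simp)
    have 7: "f4 (snd e2 (F z)) = snd d2 (G (F z))" using 4 a' by (simp add: f4_def chart_cinv[OF N])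
    have 8: "G (F z) \<in> fst d" by (rule chK(2)[OF _ 6 y'(4)[unfolded 1 3 5 7 S5_def]]) (use a' in simp)
    have 9: "f5 (snd d2 (G (F z))) = snd d (G (F z))" using 6 a' by (simp add: f5_def chart_cinv[OF K])
    show ?thesis using 2 4 6 8 9 by (simp add: 1 3 5 7)
  qed
  have pre: "\<exists>z. z \<in> fst c \<and> z \<in> fst c1 \<and> y = snd c z" if "y \<in> T" for y
    using that unfolding T_def S1_def by blast
  show ?thesis
  proof (intro exI[of _ T] conjI)
    have "f1 (snd c x) = snd c1 x" "f2 (snd c1 x) = snd e1 (F x)" "f3 (snd e1 (F x)) = snd e2 (F x)"
      "f4 (snd e2 (F x)) = snd d2 (G (F x))"
      using a' by (simp_all add: f chart_cinv[OF M] chart_cinv[OF N])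
    then show "snd c x \<in> T"
      using a' c1(3) e2(3) by (simp add: T_def S1_def S3_def S5_def)
    show "T \<subseteq> snd c ` {y \<in> fst c. G (F y) \<in> fst d}"
      using pre key by blast
    show "smooth_on T (snd d \<circ> (G \<circ> F) \<circ> cinv c)"
      unfolding T_def
    proof (rule smooth_on_cong[OF t4], fold T_def)
      fix y assume y: "y \<in> T"
      then obtain z where z: "z \<in> fst c" "z \<in> fst c1" "y = snd c z" using pre by blast
      then show "f5 (f4 (f3 (f2 (f1 y)))) = (snd d \<circ> (G \<circ> F) \<circ> cinv c) y"
        using key[of z] y a' by (simp add: chart_cinv[OF M])
    qed
  qed
qed

lemma smooth_near_id:
  assumes M: "smooth_atlas M" and x: "x \<in> points M"
  shows "smooth_near M M (\<lambda>x. x) x"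
proof -
  obtain c where c: "c \<in> charts_at M x" using ex_chart[OF M x] by blast
  then have c': "c \<in> atlas M" "x \<in> fst c" by (auto simp: charts_at_iff)
  have "smooth_on (snd c ` (fst c \<inter> fst c)) (snd c \<circ> cinv c)" by (rule transition_smooth[OF M c'(1) c'(1)])
  then show ?thesis
    using c' by (intro smooth_nearI[where F="\<lambda>x. x" and T="snd c ` fst c", OF c c]) (auto simp: comp_def)
qed

lemma smooth_near_compose:
  assumes M: "smooth_atlas M" and N: "smooth_atlas N" and K: "smooth_atlas K"
    and F: "smooth_near M N F x" and G: "smooth_near N K G (F x)"
  shows "smooth_near M K (\<lambda>x. G (F x)) x"
proof -
  obtain c d where "c \<in> charts_at M x" "d \<in> charts_at K (G (F x))"
    using F G unfolding smooth_near_def by blast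
  with smooth_near_compose_charts[OF assms this] show ?thesis
    unfolding smooth_near_def comp_def by blast
qed

lemma smooth_near_charts:
  assumes M: "smooth_atlas M" and N: "smooth_atlas N"
    and F: "smooth_near M N F x" and c: "c \<in> charts_at M x" and d: "d \<in> charts_at N (F x)"
  shows "\<exists>T. snd c x \<in> T \<and> T \<subseteq> snd c ` {y \<in> fst c. F y \<in> fst d} \<and> smooth_on T (snd d \<circ> F \<circ> cinv c)"
  using smooth_near_compose_charts[OF M N N F smooth_near_id[OF N charts_at_points[OF N d]] c d]
  by (simp add: comp_def)

lemma smooth_near_has_derivative:
  assumes M: "smooth_atlas M" and N: "smooth_atlas N"
    and F: "smooth_near M N F x" and c: "c \<in> charts_at M x" and d: "d \<in> charts_at N (F x)"
  shows "((snd d \<circ> F \<circ> cinv c) has_derivative frechet_derivative (snd d \<circ> F \<circ> cinv c) (at (snd c x))) (at (snd c x))"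
  using smooth_near_charts[OF assms] smooth_on_has_derivative by blast

lemma smooth_near_cong:
  assumes M: "smooth_atlas M" and F: "smooth_near M N F x"
    and W: "openin (tops M) W" "x \<in> W" "\<And>y. y \<in> W \<Longrightarrow> G y = F y"
  shows "smooth_near M N G x"
proof -
  obtain c d T where c: "c \<in> charts_at M x" "d \<in> charts_at N (F x)" "snd c x \<in> T"
    "T \<subseteq> snd c ` {y \<in> fst c. F y \<in> fst d}" "smooth_on T (snd d \<circ> F \<circ> cinv c)"
    using F unfolding smooth_near_def by blast
  then have c': "c \<in> atlas M" "x \<in> fst c" by (auto simp: charts_at_iff)
  define T' where "T' = T \<inter> snd c ` (fst c \<inter> W)"
  have sm: "smooth_on T' (snd d \<circ> F \<circ> cinv c)"
    unfolding T'_def using chart_open_image[OF M c'(1), of "fst c \<inter> W"] chart_openin[OF M c'(1)] W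
    by (intro smooth_on_subset[OF c(5)] open_Int smooth_onD_open[OF c(5)]) auto
  have z: "\<exists>z. z \<in> fst c \<and> z \<in> W \<and> F z \<in> fst d \<and> y = snd c z" if "y \<in> T'" for y
  proof -
    from that obtain z where z: "z \<in> fst c" "z \<in> W" "y = snd c z" unfolding T'_def by blast
    moreover have "F z \<in> fst d"
      using subsetD[OF c(4), of y] chart_image_iff(1)[OF M c'(1) z(1), of "\<lambda>y. F y \<in> fst d"] z(3) that
      unfolding T'_def by simp
    ultimately show ?thesis by blast
  qed
  show ?thesis
  proof (rule smooth_nearI[OF c(1), of d _ _ T'])
    show "d \<in> charts_at N (G x)" "snd c x \<in> T'" using W c c' by (auto simp: T'_def)
    show "T' \<subseteq> snd c ` {y \<in> fst c. G y \<in> fst d}" using z W(3) by fastforce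
    show "smooth_on T' (snd d \<circ> G \<circ> cinv c)"
      by (rule smooth_on_cong[OF sm]) (use z W(3) chart_cinv[OF M c'(1)] in fastforce)
  qed
qed

lemma smooth_mapD:
  assumes M: "smooth_atlas M" and N: "smooth_atlas N" and F: "smooth_map M N F" and x: "x \<in> points M"
  shows "smooth_near M N F x"
proof -
  obtain c where c: "c \<in> charts_at M x" using ex_chart[OF M x] by blast
  have "F x \<in> points N" using F x by (auto simp: smooth_map_def continuous_map_def)
  then obtain d where d: "d \<in> charts_at N (F x)" using ex_chart[OF N] by blast
  show ?thesis
    using F c d by (intro smooth_nearI[where F=F and T="snd c ` {y \<in> fst c. F y \<in> fst d}", OF c d])
      (auto simp: smooth_map_def charts_at_iff)
qed

text \<open>Continuity comes for free: around each point the map is a continuous coordinate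
  expression between chart homeomorphisms.\<close>

lemma smooth_mapI:
  assumes M: "smooth_atlas M" and N: "smooth_atlas N" and F: "\<And>x. x \<in> points M \<Longrightarrow> smooth_near M N F x"
  shows "smooth_map M N F"
  unfolding smooth_map_def
proof (intro conjI ballI)
  show "continuous_map (tops M) (tops N) F"
    unfolding continuous_map_def
  proof (intro conjI allI impI funcsetI)
    show "F x \<in> points N" if "x \<in> points M" for x
      using F[OF that] charts_at_points[OF N] by (auto simp: smooth_near_def)
    fix V assume V: "openin (tops N) V"
    show "openin (tops M) {x \<in> points M. F x \<in> V}"
    proof (rule openin_subopen[THEN iffD2], intro ballI)
      fix x assume x: "x \<in> {x \<in> points M. F x \<in> V}"
      then have "smooth_near M N F x" using F by simp
      then obtain c d T where c: "c \<in> charts_at M x" "d \<in> charts_at N (F x)" "snd c x \<in> T"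
        "T \<subseteq> snd c ` {y \<in> fst c. F y \<in> fst d}" "smooth_on T (snd d \<circ> F \<circ> cinv c)"
        unfolding smooth_near_def by blast
      then have c': "c \<in> atlas M" "x \<in> fst c" "d \<in> atlas N" "F x \<in> fst d" by (auto simp: charts_at_iff)
      define T' where "T' = T \<inter> (snd d \<circ> F \<circ> cinv c) -` (snd d ` (fst d \<inter> V))"
      have "open (snd d ` (fst d \<inter> V))"
        using chart_open_image[OF N c'(3)] chart_openin[OF N c'(3)] V by blast
      then have "open T'"
        unfolding T'_def using smooth_on_continuous[OF c(5)] smooth_onD_open[OF c(5)] by (intro continuous_open_preimage)
      then have "openin (tops M) {y \<in> fst c. snd c y \<in> T'}" by (rule chart_open_preimage[OF M c'(1)])
      moreover have "x \<in> {y \<in> fst c. snd c y \<in> T'}"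
        using c c' x by (simp add: T'_def chart_cinv[OF M c'(1)])
      moreover have "{y \<in> fst c. snd c y \<in> T'} \<subseteq> {x \<in> points M. F x \<in> V}"
      proof clarify
        fix y assume y: "y \<in> fst c" "snd c y \<in> T'"
        then have "snd c y \<in> T" by (simp add: T'_def)
        then have "F y \<in> fst d"
          using subsetD[OF c(4)] chart_image_iff(1)[OF M c'(1) y(1), of "\<lambda>y. F y \<in> fst d"] by simp
        moreover have "snd d (F y) \<in> snd d ` (fst d \<inter> V)"
          using y by (simp add: T'_def chart_cinv[OF M c'(1)])
        ultimately have "F y \<in> V" using chart_image_iff(2)[OF N c'(3)] by simp
        then show "y \<in> points M \<and> F y \<in> V" using y chart_subset[OF M c'(1)] by blast
      qed
      ultimately show "\<exists>T. openin (tops M) T \<and> x \<in> T \<and> T \<subseteq> {x \<in> points M. F x \<in> V}" by blast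
    qed
  qed
  fix c d assume c: "c \<in> atlas M" and d: "d \<in> atlas N"
  show "smooth_on (snd c ` {x \<in> fst c. F x \<in> fst d}) (snd d \<circ> F \<circ> cinv c)"
  proof (rule smooth_on_locally)
    fix y assume "y \<in> snd c ` {x \<in> fst c. F x \<in> fst d}"
    then obtain x where x: "x \<in> fst c" "F x \<in> fst d" "y = snd c x" by blast
    have xc: "c \<in> charts_at M x" "d \<in> charts_at N (F x)" using x c d by (auto simp: charts_at_iff)
    then show "\<exists>T. y \<in> T \<and> T \<subseteq> snd c ` {x \<in> fst c. F x \<in> fst d} \<and> smooth_on T (snd d \<circ> F \<circ> cinv c)"
      using smooth_near_charts[OF M N F[OF charts_at_points[OF M xc(1)]] xc] x(3) by simp
  qed
qed

lemma smooth_near_open_submfd: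
  assumes M: "smooth_atlas M" and W: "openin (tops M) W" "x \<in> W" and F: "smooth_near M N F x"
  shows "smooth_near (open_submfd M W) N F x"
proof -
  obtain c d T where c: "c \<in> charts_at M x" "d \<in> charts_at N (F x)" "snd c x \<in> T"
    "T \<subseteq> snd c ` {y \<in> fst c. F y \<in> fst d}" "smooth_on T (snd d \<circ> F \<circ> cinv c)"
    using F unfolding smooth_near_def by blast
  then have c': "c \<in> atlas M" "x \<in> fst c" by (auto simp: charts_at_iff)
  define T' where "T' = T \<inter> snd c ` (fst c \<inter> W)"
  have sm: "smooth_on T' (snd d \<circ> F \<circ> cinv c)"
    unfolding T'_def using chart_open_image[OF M c'(1), of "fst c \<inter> W"] chart_openin[OF M c'(1)] W
    by (intro smooth_on_subset[OF c(5)] open_Int smooth_onD_open[OF c(5)]) auto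
  have z: "\<exists>z. z \<in> fst c \<and> z \<in> W \<and> F z \<in> fst d \<and> y = snd c z" if "y \<in> T'" for y
  proof -
    from that obtain z where z: "z \<in> fst c" "z \<in> W" "y = snd c z" unfolding T'_def by blast
    moreover have "F z \<in> fst d"
      using subsetD[OF c(4), of y] chart_image_iff(1)[OF M c'(1) z(1), of "\<lambda>y. F y \<in> fst d"] z(3) that
      unfolding T'_def by simp
    ultimately show ?thesis by blast
  qed
  show ?thesis
  proof (rule smooth_nearI[where c="(fst c \<inter> W, snd c)" and T=T' and F=F, OF _ c(2)])
    show "(fst c \<inter> W, snd c) \<in> charts_at (open_submfd M W) x"
      using c' W by (auto simp: charts_at_iff open_submfd_def)
    show "snd (fst c \<inter> W, snd c) x \<in> T'" using c c' W by (auto simp: T'_def)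
    show "T' \<subseteq> snd (fst c \<inter> W, snd c) ` {y \<in> fst (fst c \<inter> W, snd c). F y \<in> fst d}" using z by fastforce
    show "smooth_on T' (snd d \<circ> F \<circ> cinv (fst c \<inter> W, snd c))"
    proof (rule smooth_on_cong[OF sm])
      fix y assume "y \<in> T'"
      then obtain x where x: "x \<in> fst c" "x \<in> W" "y = snd c x" using z by blast
      then have "inv_into (fst c \<inter> W) (snd c) y = x"
        by (intro inv_into_f_eq inj_on_subset[OF chart_inj[OF M c'(1)]]) auto
      then show "(snd d \<circ> F \<circ> cinv c) y = (snd d \<circ> F \<circ> cinv (fst c \<inter> W, snd c)) y"
        using x chart_cinv[OF M c'(1)] by simp
    qed
  qed
qed

lemma smooth_map_open_submfdI:
  assumes "smooth_atlas M" "smooth_atlas N" "openin (tops M) W" "\<And>x. x \<in> W \<Longrightarrow> smooth_near M N F x"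
  shows "smooth_map (open_submfd M W) N F"
  using assms smooth_near_open_submfd[OF assms(1,3)]
  by (intro smooth_mapI smooth_atlas_open_submfd) (auto simp: open_submfd_def)

text \<open>\<open>tangent_map\<close> is defined with an arbitrary chart at x; the transformation
  law for v lets any chart c compute it.\<close>

lemma tangent_map_has_derivative:
  assumes M: "smooth_atlas M" and v: "v \<in> tangent_space M x"
    and c: "c \<in> charts_at M x" and d: "d \<in> charts_at N (F x)"
    and f': "((snd d \<circ> F \<circ> cinv c) has_derivative f') (at (snd c x))"
  shows "tangent_map M N F x v d = f' (v c)"
proof -
  define c' where "c' = (SOME c. c \<in> charts_at M x)"
  have c': "c' \<in> charts_at M x" unfolding c'_def using c by (rule someI)
  have "tangent_map M N F x v d = frechet_derivative (snd d \<circ> F \<circ> cinv c') (at (snd c' x)) (v c')"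
    using d by (simp add: tangent_map_def Let_def c'_def[symmetric])
  also have "\<dots> = f' (frechet_derivative (snd c \<circ> cinv c') (at (snd c' x)) (v c'))"
    using frechet_derivative_eqI[OF transition_compose[OF M c' c f']] by simp
  also have "frechet_derivative (snd c \<circ> cinv c') (at (snd c' x)) (v c') = v c"
    using tangent_spaceD(2)[OF M v c' c] by simp
  finally show ?thesis .
qed

lemma tangent_map_chart:
  assumes "smooth_atlas M" "smooth_atlas N" "smooth_near M N F x" "v \<in> tangent_space M x"
    "c \<in> charts_at M x" "d \<in> charts_at N (F x)"
  shows "tangent_map M N F x v d = frechet_derivative (snd d \<circ> F \<circ> cinv c) (at (snd c x)) (v c)"
  using assms by (intro tangent_map_has_derivative smooth_near_has_derivative)

lemma tangent_map_in_tangent_space: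
  assumes M: "smooth_atlas M" and N: "smooth_atlas N" and F: "smooth_near M N F x" and v: "v \<in> tangent_space M x"
  shows "tangent_map M N F x v \<in> tangent_space N (F x)"
  unfolding tangent_space_def
proof (intro CollectI conjI ballI allI impI)
  obtain c where c: "c \<in> charts_at M x" using F unfolding smooth_near_def by blast
  then have c': "c \<in> atlas M" "x \<in> fst c" by (auto simp: charts_at_iff)
  fix d e assume d: "d \<in> charts_at N (F x)" and e: "e \<in> charts_at N (F x)"
  then have d': "d \<in> atlas N" "F x \<in> fst d" by (auto simp: charts_at_iff)
  obtain T where T: "snd c x \<in> T" "T \<subseteq> snd c ` {y \<in> fst c. F y \<in> fst d}" "smooth_on T (snd d \<circ> F \<circ> cinv c)"
    using smooth_near_charts[OF M N F c d] by blast
  have x: "(snd d \<circ> F \<circ> cinv c) (snd c x) = snd d (F x)" using c' by (simp add: chart_cinv[OF M])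
  have "((\<lambda>y. (snd e \<circ> cinv d) ((snd d \<circ> F \<circ> cinv c) y)) has_derivative
     (\<lambda>v. frechet_derivative (snd e \<circ> cinv d) (at (snd d (F x))) (frechet_derivative (snd d \<circ> F \<circ> cinv c) (at (snd c x)) v)))
     (at (snd c x))"
    by (rule has_derivative_compose[OF smooth_on_has_derivative[OF T(3,1)]])
      (use transition_has_derivative[OF N d e] in \<open>simp only: x\<close>)
  then have "((snd e \<circ> F \<circ> cinv c) has_derivative
     (\<lambda>v. frechet_derivative (snd e \<circ> cinv d) (at (snd d (F x))) (frechet_derivative (snd d \<circ> F \<circ> cinv c) (at (snd c x)) v)))
     (at (snd c x))"
    by (rule has_derivative_transform_within_open[OF _ smooth_onD_open[OF T(3)] T(1)])
      (use T(2) in \<open>auto simp: chart_cinv[OF M c'(1)] chart_cinv[OF N d'(1)]\<close>)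
  from tangent_map_has_derivative[OF M v c e this] tangent_map_chart[OF M N F v c d]
  show "tangent_map M N F x v e = frechet_derivative (snd e \<circ> cinv d) (at (snd d (F x))) (tangent_map M N F x v d)"
    by simp
qed (simp add: tangent_map_def)

lemma tangent_map_compose:
  assumes M: "smooth_atlas M" and N: "smooth_atlas N" and K: "smooth_atlas K"
    and F: "smooth_near M N F x" and G: "smooth_near N K G (F x)" and v: "v \<in> tangent_space M x"
  shows "tangent_map M K (\<lambda>x. G (F x)) x v = tangent_map N K G (F x) (tangent_map M N F x v)"
proof -
  note v' = tangent_map_in_tangent_space[OF M N F v]
  obtain c d e where c: "c \<in> charts_at M x" and d: "d \<in> charts_at N (F x)" and e: "e \<in> charts_at K (G (F x))"
    using F G unfolding smooth_near_def by blast
  note c' = c[unfolded charts_at_iff] and d' = d[unfolded charts_at_iff]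
  obtain T where T: "snd c x \<in> T" "T \<subseteq> snd c ` {y \<in> fst c. F y \<in> fst d}" "smooth_on T (snd d \<circ> F \<circ> cinv c)"
    using smooth_near_charts[OF M N F c d] by blast
  have x: "(snd d \<circ> F \<circ> cinv c) (snd c x) = snd d (F x)" using c' by (simp add: chart_cinv[OF M])
  have "((\<lambda>y. (snd e \<circ> G \<circ> cinv d) ((snd d \<circ> F \<circ> cinv c) y)) has_derivative
     (\<lambda>v. frechet_derivative (snd e \<circ> G \<circ> cinv d) (at (snd d (F x))) (frechet_derivative (snd d \<circ> F \<circ> cinv c) (at (snd c x)) v)))
     (at (snd c x))"
    by (rule has_derivative_compose[OF smooth_on_has_derivative[OF T(3,1)]])
      (use smooth_near_has_derivative[OF N K G d e] in \<open>simp only: x\<close>)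
  then have "((snd e \<circ> (\<lambda>x. G (F x)) \<circ> cinv c) has_derivative
     (\<lambda>v. frechet_derivative (snd e \<circ> G \<circ> cinv d) (at (snd d (F x))) (frechet_derivative (snd d \<circ> F \<circ> cinv c) (at (snd c x)) v)))
     (at (snd c x))"
    by (rule has_derivative_transform_within_open[OF _ smooth_onD_open[OF T(3)] T(1)])
      (use T(2) c' d' in \<open>auto simp: chart_cinv[OF M] chart_cinv[OF N]\<close>)
  from tangent_map_has_derivative[OF M v c _ this, where N = K] e
  have "tangent_map M K (\<lambda>x. G (F x)) x v e = tangent_map N K G (F x) (tangent_map M N F x v) e"
    using tangent_map_chart[OF N K G v' d e] tangent_map_chart[OF M N F v c d] by simp
  then show ?thesis
    using tangent_space_eqI[OF K _ _ e] tangent_map_in_tangent_space[OF M K smooth_near_compose[OF M N K F G] v]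
      tangent_map_in_tangent_space[OF N K G v'] by simp
qed

lemma prod_chart_image_iff:
  assumes "inj_on f A" "inj_on g B" "b \<in> B"
  shows "(z, g b) \<in> map_prod f g ` {w \<in> A \<times> B. P w} \<longleftrightarrow> (\<exists>a\<in>A. z = f a \<and> P (a, b))"
  using inj_onD[OF assms(2)] assms(3) by (fastforce simp: image_iff)

text \<open>In product charts, fixing the second argument is composition with the affine map sending
  a to (a, \<open>snd k y\<close>).\<close>

lemma smooth_near_prod_left:
  assumes M: "smooth_atlas M" and N: "smooth_atlas N" and K: "smooth_atlas K"
    and \<Phi>: "smooth_map (prod_mfd M N) K \<Phi>" and x: "x \<in> points M" and y: "y \<in> points N"
  shows "smooth_near M K (\<lambda>x. \<Phi> (x, y)) x"
proof -
  obtain c where c: "c \<in> charts_at M x" using ex_chart[OF M x] by blast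
  obtain k where k: "k \<in> charts_at N y" using ex_chart[OF N y] by blast
  have "\<Phi> (x, y) \<in> points K" using \<Phi> x y by (auto simp: smooth_map_def continuous_map_def prod_mfd_def)
  then obtain d where d: "d \<in> charts_at K (\<Phi> (x, y))" using ex_chart[OF K] by blast
  note c' = c[unfolded charts_at_iff] and k' = k[unfolded charts_at_iff] and d' = d[unfolded charts_at_iff]
  note inj = chart_inj[OF M, of c] chart_inj[OF N, of k]
  let ?S = "map_prod (snd c) (snd k) ` {w \<in> fst c \<times> fst k. \<Phi> w \<in> fst d}"
  have ca: "(fst c \<times> fst k, map_prod (snd c) (snd k)) \<in> atlas (prod_mfd M N)"
    using c' k' by (force simp: prod_mfd_def)
  have sm: "smooth_on ?S (snd d \<circ> \<Phi> \<circ> inv_into (fst c \<times> fst k) (map_prod (snd c) (snd k)))"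
    using \<Phi> ca d' unfolding smooth_map_def by fastforce
  have L: "bounded_linear (\<lambda>a. (a, 0) :: 'b \<times> 'd)"
    by (intro bounded_linear_Pair bounded_linear_ident bounded_linear_zero)
  have s: "smooth_on {a. (a, snd k y) \<in> ?S} (\<lambda>a. (snd d \<circ> \<Phi> \<circ> inv_into (fst c \<times> fst k) (map_prod (snd c) (snd k))) (a, snd k y))"
    using smooth_on_compose_affine[OF L sm, of "(0, snd k y)"] by simp
  have S: "{a. (a, snd k y) \<in> ?S} = snd c ` {a \<in> fst c. \<Phi> (a, y) \<in> fst d}"
    using prod_chart_image_iff[of "snd c" "fst c" "snd k" "fst k" y _ "\<lambda>w. \<Phi> w \<in> fst d"] inj c' k' by auto
  have ii: "inj_on (map_prod (snd c) (snd k)) (fst c \<times> fst k)"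
    using inj c' k' by (simp add: map_prod_inj_on)
  show ?thesis
  proof (rule smooth_nearI[where F="\<lambda>x. \<Phi> (x, y)", OF c d])
    show "smooth_on (snd c ` {a \<in> fst c. \<Phi> (a, y) \<in> fst d}) (snd d \<circ> (\<lambda>x. \<Phi> (x, y)) \<circ> cinv c)"
    proof (rule smooth_on_cong[OF s[unfolded S]])
      fix z assume "z \<in> snd c ` {a \<in> fst c. \<Phi> (a, y) \<in> fst d}"
      then obtain a where a: "a \<in> fst c" "z = snd c a" by blast
      then have "inv_into (fst c \<times> fst k) (map_prod (snd c) (snd k)) (z, snd k y) = (a, y)"
        using k' by (intro inv_into_f_eq[OF ii]) auto
      then show "(snd d \<circ> \<Phi> \<circ> inv_into (fst c \<times> fst k) (map_prod (snd c) (snd k))) (z, snd k y)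
          = (snd d \<circ> (\<lambda>x. \<Phi> (x, y)) \<circ> cinv c) z"
        using a c' by (simp add: chart_cinv[OF M])
    qed
  qed (use c' d' in auto)
qed

section \<open>Christoffel symbols\<close>

lemma bounded_bilinear_matrix_mult:
  "bounded_bilinear ((**) :: real^'n::finite^'m::finite \<Rightarrow> real^'k::finite^'n \<Rightarrow> real^'k^'m)"
  by (rule bilinear_conv_bounded_bilinear[THEN iffD1])
    (auto simp: bilinear_def matrix_matrix_mult_def vec_eq_iff algebra_simps sum.distrib sum_distrib_left intro!: linearI)

lemma bounded_bilinear_matrix_vector_mult:
  "bounded_bilinear ((*v) :: real^'n::finite^'m::finite \<Rightarrow> real^'n \<Rightarrow> real^'m)"
  by (rule bilinear_conv_bounded_bilinear[THEN iffD1])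
    (auto simp: bilinear_def matrix_vector_mult_def vec_eq_iff algebra_simps sum.distrib sum_distrib_left intro!: linearI)

lemmas matrix_linear_simps =
  bounded_bilinear.add_left[OF bounded_bilinear_matrix_mult]
  bounded_bilinear.add_right[OF bounded_bilinear_matrix_mult]
  bounded_bilinear.scaleR_left[OF bounded_bilinear_matrix_mult]
  bounded_bilinear.scaleR_right[OF bounded_bilinear_matrix_mult]
  bounded_bilinear.add_left[OF bounded_bilinear_matrix_vector_mult]
  bounded_bilinear.add_right[OF bounded_bilinear_matrix_vector_mult]
  bounded_bilinear.scaleR_left[OF bounded_bilinear_matrix_vector_mult]
  bounded_bilinear.scaleR_right[OF bounded_bilinear_matrix_vector_mult]

text \<open>As for composition, a basis expansion replaces the moving direction Y x by fixed
  ones.\<close>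

lemma smooth_on_derivative_apply:
  fixes f :: "'a::real_normed_vector \<Rightarrow> 'b::real_normed_vector"
  assumes "fin_dim TYPE('a)" "smooth_on S f" "smooth_on S Y"
  shows "smooth_on S (\<lambda>x. frechet_derivative f (at x) (Y x))"
proof -
  obtain B :: "'a set" and \<phi> where B: "finite B" "\<And>b. b \<in> B \<Longrightarrow> bounded_linear (\<phi> b)"
    and rep: "\<And>x. x = (\<Sum>b\<in>B. \<phi> b x *\<^sub>R b)"
    using fin_dim_coordinates[OF assms(1)] by metis
  have "smooth_on S (\<lambda>x. \<Sum>b\<in>B. \<phi> b (Y x) *\<^sub>R frechet_derivative f (at x) b)"
    using assms B(2) by (intro smooth_on_sum smooth_on_scaleR smooth_on_derivative
        smooth_on_bounded_linear_compose[OF B(2)] smooth_onD_open[OF assms(2)])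
  moreover have "(\<Sum>b\<in>B. \<phi> b (Y x) *\<^sub>R frechet_derivative f (at x) b) = frechet_derivative f (at x) (Y x)"
    if "x \<in> S" for x
  proof -
    have "linear (frechet_derivative f (at x))"
      using smooth_on_has_derivative[OF assms(2) that] has_derivative_linear by blast
    then have "frechet_derivative f (at x) (\<Sum>b\<in>B. \<phi> b (Y x) *\<^sub>R b) = (\<Sum>b\<in>B. \<phi> b (Y x) *\<^sub>R frechet_derivative f (at x) b)"
      by (simp add: linear_sum linear_cmul)
    then show ?thesis unfolding rep[symmetric] by (rule sym)
  qed
  ultimately show ?thesis by (rule smooth_on_cong)
qed

lemma smooth_field_cong:
  assumes M: "smooth_atlas M" and Y: "smooth_field M W Y" and eq: "\<And>x. x \<in> W \<Longrightarrow> Y x = Y' x"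
  shows "smooth_field M W Y'"
  unfolding smooth_field_def
proof (intro conjI ballI)
  show "openin (tops M) W" using Y by (simp add: smooth_field_def)
  show "Y' x \<in> tangent_space M x" if "x \<in> W" for x
    using Y eq[OF that] that unfolding smooth_field_def by metis
  fix c assume c: "c \<in> atlas M"
  then have "smooth_on (snd c ` (fst c \<inter> W)) (\<lambda>y. Y (cinv c y) c)" using Y by (simp add: smooth_field_def)
  then show "smooth_on (snd c ` (fst c \<inter> W)) (\<lambda>y. Y' (cinv c y) c)"
    by (rule smooth_on_cong) (use eq in \<open>auto simp: chart_cinv[OF M c]\<close>)
qed

lemma smooth_field_tvec:
  assumes M: "smooth_atlas M" and c: "c \<in> atlas M" and W: "openin (tops M) W" "W \<subseteq> fst c"
    and Y: "smooth_on (snd c ` W) Y"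
  shows "smooth_field M W (\<lambda>x. tvec M c x (Y (snd c x)))"
  unfolding smooth_field_def
proof (intro conjI ballI)
  show "tvec M c x (Y (snd c x)) \<in> tangent_space M x" if "x \<in> W" for x
    by (rule tvec_in_tangent_space[OF M]) (use c W that in \<open>auto simp: charts_at_iff\<close>)
  fix d assume d: "d \<in> atlas M"
  have o: "openin (tops M) (fst d \<inter> W)" using chart_openin[OF M d] W by blast
  have cd: "smooth_on (snd d ` (fst d \<inter> W)) (snd c \<circ> cinv d)"
    by (rule smooth_on_subset[OF transition_smooth[OF M d c] _ chart_open_image[OF M d o]]) (use W in auto)
  have oc: "open (snd c ` (fst d \<inter> W))"
    using W by (intro chart_open_image[OF M c o]) auto
  have "smooth_on (snd c ` (fst d \<inter> W)) (snd d \<circ> cinv c)"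
    by (rule smooth_on_subset[OF transition_smooth[OF M c d] _ oc]) (use W in auto)
  moreover have "smooth_on (snd c ` (fst d \<inter> W)) Y"
    by (rule smooth_on_subset[OF Y _ oc]) auto
  ultimately have "smooth_on (snd c ` (fst d \<inter> W)) (\<lambda>z. frechet_derivative (snd d \<circ> cinv c) (at z) (Y z))"
    by (rule smooth_on_derivative_apply[OF fin_dim_model[OF M]])
  from smooth_on_compose[OF fin_dim_model[OF M] this cd]
  have "smooth_on (snd d ` (fst d \<inter> W))
      (\<lambda>y. frechet_derivative (snd d \<circ> cinv c) (at ((snd c \<circ> cinv d) y)) (Y ((snd c \<circ> cinv d) y)))"
    using chart_cinv[OF M d] by fastforce
  then show "smooth_on (snd d ` (fst d \<inter> W)) (\<lambda>y. tvec M c (cinv d y) (Y (snd c (cinv d y))) d)"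
  proof (rule smooth_on_cong)
    fix y assume "y \<in> snd d ` (fst d \<inter> W)"
    then have "cinv d y \<in> fst d" using chart_cinv[OF M d] by fastforce
    then show "frechet_derivative (snd d \<circ> cinv c) (at ((snd c \<circ> cinv d) y)) (Y ((snd c \<circ> cinv d) y))
        = tvec M c (cinv d y) (Y (snd c (cinv d y))) d"
      by (simp add: tvec_def[OF M] charts_at_iff d)
  qed
qed (use W in auto)

lemma smooth_near_vectorI:
  fixes f :: "'e::real_normed_vector \<Rightarrow> 'f::euclidean_space"
  assumes M: "smooth_atlas M" and c: "c \<in> charts_at M x" and f: "smooth_on T f" "snd c x \<in> T" "T \<subseteq> snd c ` fst c"
  shows "smooth_near M vector_mfd (\<lambda>x. f (snd c x)) x"
proof (rule smooth_nearI[where F="\<lambda>x. f (snd c x)" and d="(UNIV, id)" and T=T, OF c])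
  show "smooth_on T (snd (UNIV, id) \<circ> (\<lambda>x. f (snd c x)) \<circ> cinv c)"
    by (rule smooth_on_cong[OF f(1)]) (use f(3) c chart_cinv[OF M] in \<open>auto simp: charts_at_iff\<close>)
qed (use f in \<open>auto simp: charts_at_iff vector_mfd_def\<close>)

lemma fun_deriv_chart:
  fixes f :: "'e::real_normed_vector \<Rightarrow> real"
  assumes M: "smooth_atlas M" and c: "c \<in> charts_at M x" and f: "(f has_derivative f') (at (snd c x))"
    and v: "v \<in> tangent_space M x"
  shows "fun_deriv M (\<lambda>x. f (snd c x)) x v = f' (v c)"
  unfolding fun_deriv_def
proof (rule tangent_map_has_derivative[OF M v c])
  have "open (snd c ` fst c)"
    using c chart_open_image[OF M] chart_openin[OF M] by (auto simp: charts_at_iff)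
  then show "((snd (UNIV, id) \<circ> (\<lambda>x. f (snd c x)) \<circ> cinv c) has_derivative f') (at (snd c x))"
    by (rule has_derivative_transform_within_open[OF f]) (use c chart_cinv[OF M] in \<open>auto simp: charts_at_iff\<close>)
qed (simp add: charts_at_iff vector_mfd_def)

text \<open>The Christoffel symbols as a bilinear map at z: the covariant derivative of the field
  with constant components \<eta>, in direction \<xi>, read in the chart c.\<close>

definition christoffel :: "('m, real^'n::finite) mfd \<Rightarrow> ('m, real^'n) cov_deriv \<Rightarrow> ('m, real^'n) chart \<Rightarrow>
    real^'n \<Rightarrow> real^'n \<Rightarrow> real^'n \<Rightarrow> real^'n" where
  "christoffel M cov c z \<xi> \<eta> = cov (cinv c z) (tvec M c (cinv c z) \<xi>) (\<lambda>x. tvec M c x \<eta>) c"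

locale manifold_connection =
  fixes M :: "('m, real^'n::finite) mfd" and cov :: "('m, real^'n) cov_deriv"
  assumes M: "smooth_atlas M" and cov: "linear_connection M cov"
begin

lemma
  assumes "smooth_field M W Y" "x \<in> W"
  shows cov_in_tangent_space: "v \<in> tangent_space M x \<Longrightarrow> cov x v Y \<in> tangent_space M x"
    and cov_linear: "v \<in> tangent_space M x \<Longrightarrow> w \<in> tangent_space M x \<Longrightarrow>
        cov x (\<lambda>c. a *\<^sub>R v c + b *\<^sub>R w c) Y = (\<lambda>c. a *\<^sub>R cov x v Y c + b *\<^sub>R cov x w Y c)"
    and cov_add: "v \<in> tangent_space M x \<Longrightarrow> smooth_field M W Y' \<Longrightarrow>
        cov x v (\<lambda>y c. Y y c + Y' y c) = (\<lambda>c. cov x v Y c + cov x v Y' c)"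
    and cov_leibniz: "v \<in> tangent_space M x \<Longrightarrow> smooth_map (open_submfd M W) vector_mfd f \<Longrightarrow>
        cov x v (\<lambda>y c. f y *\<^sub>R Y y c) = (\<lambda>c. fun_deriv M f x v *\<^sub>R Y x c + f x *\<^sub>R cov x v Y c)"
    and cov_local: "v \<in> tangent_space M x \<Longrightarrow> (\<And>y. y \<in> W \<Longrightarrow> Y' y = Y y) \<Longrightarrow> cov x v Y' = cov x v Y"
proof -
  note A = cov[unfolded linear_connection_def, THEN spec, THEN spec, THEN mp, OF assms(1), THEN conjunct1,
      THEN bspec, OF assms(2)]
  show "v \<in> tangent_space M x \<Longrightarrow> cov x v Y \<in> tangent_space M x"
    using A[THEN conjunct1] by blast
  show "v \<in> tangent_space M x \<Longrightarrow> w \<in> tangent_space M x \<Longrightarrow>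
      cov x (\<lambda>c. a *\<^sub>R v c + b *\<^sub>R w c) Y = (\<lambda>c. a *\<^sub>R cov x v Y c + b *\<^sub>R cov x w Y c)"
    using A[THEN conjunct2, THEN conjunct1] by blast
  show "v \<in> tangent_space M x \<Longrightarrow> smooth_field M W Y' \<Longrightarrow>
      cov x v (\<lambda>y c. Y y c + Y' y c) = (\<lambda>c. cov x v Y c + cov x v Y' c)"
    using A[THEN conjunct2, THEN conjunct2, THEN conjunct1] by blast
  show "v \<in> tangent_space M x \<Longrightarrow> smooth_map (open_submfd M W) vector_mfd f \<Longrightarrow>
      cov x v (\<lambda>y c. f y *\<^sub>R Y y c) = (\<lambda>c. fun_deriv M f x v *\<^sub>R Y x c + f x *\<^sub>R cov x v Y c)"
    using A[THEN conjunct2, THEN conjunct2, THEN conjunct2, THEN conjunct1] by blast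
  show "v \<in> tangent_space M x \<Longrightarrow> (\<And>y. y \<in> W \<Longrightarrow> Y' y = Y y) \<Longrightarrow> cov x v Y' = cov x v Y"
    using A[THEN conjunct2, THEN conjunct2, THEN conjunct2, THEN conjunct2] by blast
qed

lemma cov_smooth_field: "smooth_field M W Y \<Longrightarrow> smooth_field M W X \<Longrightarrow> smooth_field M W (\<lambda>x. cov x (X x) Y)"
  using cov[unfolded linear_connection_def, THEN spec, THEN spec, THEN mp, THEN conjunct2] by blast

context
  fixes c assumes c: "c \<in> atlas M"
begin

abbreviation "\<Gamma> \<equiv> christoffel M cov c"

lemma chart_at: "x \<in> fst c \<Longrightarrow> c \<in> charts_at M x"
  using c by (simp add: charts_at_iff)

lemma open_chart: "open (snd c ` fst c)"
  using chart_open_image[OF M c chart_openin[OF M c]] by simp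

lemma smooth_field_const: "smooth_field M (fst c) (\<lambda>x. tvec M c x \<eta>)"
  using smooth_field_tvec[OF M c chart_openin[OF M c] subset_refl smooth_on_const[OF open_chart]] .

lemma tvec_in: "x \<in> fst c \<Longrightarrow> tvec M c x \<xi> \<in> tangent_space M x"
  using tvec_in_tangent_space[OF M chart_at] .

lemma tvec_comb: "x \<in> fst c \<Longrightarrow> tvec M c x (r *\<^sub>R \<xi> + s *\<^sub>R \<eta>) = (\<lambda>d. r *\<^sub>R tvec M c x \<xi> d + s *\<^sub>R tvec M c x \<eta> d)"
  using tvec_linear[OF M chart_at] by blast

lemma christoffel_cov: "x \<in> fst c \<Longrightarrow> v \<in> tangent_space M x \<Longrightarrow>
    cov x v (\<lambda>x. tvec M c x \<eta>) c = \<Gamma> (snd c x) (v c) \<eta>"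
  unfolding christoffel_def using chart_cinv[OF M c] tangent_space_eq_tvec[OF M _ chart_at] by metis

lemma christoffel_smooth: "smooth_on (snd c ` fst c) (\<lambda>z. \<Gamma> z \<xi> \<eta>)"
proof -
  have "smooth_field M (fst c) (\<lambda>x. cov x (tvec M c x \<xi>) (\<lambda>x. tvec M c x \<eta>))"
    by (rule cov_smooth_field[OF smooth_field_const smooth_field_const])
  then have "smooth_on (snd c ` (fst c \<inter> fst c)) (\<lambda>y. cov (cinv c y) (tvec M c (cinv c y) \<xi>) (\<lambda>x. tvec M c x \<eta>) c)"
    using c unfolding smooth_field_def by blast
  then show ?thesis by (simp add: christoffel_def[abs_def])
qed

lemma smooth_map_component:
  fixes f :: "real^'n \<Rightarrow> real"
  assumes "smooth_on (snd c ` fst c) f"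
  shows "smooth_map (open_submfd M (fst c)) vector_mfd (\<lambda>x. f (snd c x))"
  by (intro smooth_map_open_submfdI M smooth_atlas_vector_mfd chart_openin[OF M c]
      smooth_near_vectorI[OF M chart_at assms]) auto

lemma fun_deriv_component:
  fixes f :: "real^'n \<Rightarrow> real"
  assumes "smooth_on (snd c ` fst c) f" "x \<in> fst c" "v \<in> tangent_space M x"
  shows "fun_deriv M (\<lambda>x. f (snd c x)) x v = frechet_derivative f (at (snd c x)) (v c)"
  by (rule fun_deriv_chart[OF M chart_at[OF assms(2)] smooth_on_has_derivative[OF assms(1)] assms(3)]) (use assms(2) in simp)

lemma cov_sum:
  fixes f :: "'i \<Rightarrow> real^'n \<Rightarrow> real"
  assumes "finite I" "x \<in> fst c" "v \<in> tangent_space M x" "\<And>i. smooth_on (snd c ` fst c) (f i)"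
  shows "smooth_field M (fst c) (\<lambda>y d. \<Sum>i\<in>I. f i (snd c y) *\<^sub>R tvec M c y (e i) d)"
    and "cov x v (\<lambda>y d. \<Sum>i\<in>I. f i (snd c y) *\<^sub>R tvec M c y (e i) d) c =
      (\<Sum>i\<in>I. frechet_derivative (f i) (at (snd c x)) (v c) *\<^sub>R e i + f i (snd c x) *\<^sub>R \<Gamma> (snd c x) (v c) (e i))"
proof -
  have smf: "smooth_field M (fst c) (\<lambda>y d. \<Sum>i\<in>J. f i (snd c y) *\<^sub>R tvec M c y (e i) d)" if "finite J" for J
  proof -
    have a: "smooth_field M (fst c) (\<lambda>y. tvec M c y (\<Sum>i\<in>J. f i (snd c y) *\<^sub>R e i))"
      by (intro smooth_field_tvec[OF M c chart_openin[OF M c] subset_refl] smooth_on_sum smooth_on_scaleR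
          assms(4) smooth_on_const open_chart)
    have b: "tvec M c y (\<Sum>i\<in>J. f i (snd c y) *\<^sub>R e i) d = (\<Sum>i\<in>J. f i (snd c y) *\<^sub>R tvec M c y (e i) d)"
      if "y \<in> fst c" for y d
    proof (cases "d \<in> charts_at M y")
      case True
      note lin = transition_linear[OF M chart_at[OF that] True]
      show ?thesis using True by (simp add: tvec_def[OF M] linear_sum[OF lin] linear_cmul[OF lin])
    qed (simp add: tvec_def[OF M])
    show ?thesis by (rule smooth_field_cong[OF M a]) (rule ext, rule b)
  qed
  show "smooth_field M (fst c) (\<lambda>y d. \<Sum>i\<in>I. f i (snd c y) *\<^sub>R tvec M c y (e i) d)"
    by (rule smf[OF assms(1)])
  show "cov x v (\<lambda>y d. \<Sum>i\<in>I. f i (snd c y) *\<^sub>R tvec M c y (e i) d) c =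
      (\<Sum>i\<in>I. frechet_derivative (f i) (at (snd c x)) (v c) *\<^sub>R e i + f i (snd c x) *\<^sub>R \<Gamma> (snd c x) (v c) (e i))"
    using assms(1)
  proof (induction I)
    case empty
    \<comment> \<open>The zero field is written as 0 times a constant field, so that the Leibniz
      rule determines its derivative.\<close>
    have "cov x v (\<lambda>y d. 0 *\<^sub>R tvec M c y 0 d) =
        (\<lambda>d. fun_deriv M (\<lambda>x. 0) x v *\<^sub>R tvec M c x 0 d + 0 *\<^sub>R cov x v (\<lambda>x. tvec M c x 0) d)"
      using smooth_map_component[OF smooth_on_const[OF open_chart]]
      by (rule cov_leibniz[OF smooth_field_const assms(2,3)])
    then show ?case
      using fun_deriv_component[OF smooth_on_const[OF open_chart] assms(2,3), of 0] by simp
  next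
    case (insert i I)
    have "cov x v (\<lambda>y d. f i (snd c y) *\<^sub>R tvec M c y (e i) d) c =
        frechet_derivative (f i) (at (snd c x)) (v c) *\<^sub>R e i + f i (snd c x) *\<^sub>R \<Gamma> (snd c x) (v c) (e i)"
      using cov_leibniz[OF smooth_field_const assms(2,3) smooth_map_component[OF assms(4)]]
        fun_deriv_component[OF assms(4,2,3)] christoffel_cov[OF assms(2,3)] tvec_chart[OF M chart_at[OF assms(2)]]
      by simp
    moreover have "smooth_field M (fst c) (\<lambda>y d. f i (snd c y) *\<^sub>R tvec M c y (e i) d)"
      using smf[of "{i}"] by simp
    ultimately show ?case
      using cov_add[OF _ assms(2,3) smf[OF insert(1)], of "\<lambda>y d. f i (snd c y) *\<^sub>R tvec M c y (e i) d"] insert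
      by simp
  qed
qed

lemma linear_christoffel1:
  assumes "z \<in> snd c ` fst c"
  shows "linear (\<lambda>\<xi>. \<Gamma> z \<xi> \<eta>)"
proof -
  obtain x where x: "x \<in> fst c" "z = snd c x" using assms by blast
  have "\<Gamma> z (r *\<^sub>R \<xi> + s *\<^sub>R \<xi>') \<eta> = r *\<^sub>R \<Gamma> z \<xi> \<eta> + s *\<^sub>R \<Gamma> z \<xi>' \<eta>" for r s \<xi> \<xi>'
    unfolding christoffel_def x(2) chart_cinv[OF M c x(1)] tvec_comb[OF x(1)]
    using cov_linear[OF smooth_field_const x(1) tvec_in[OF x(1)] tvec_in[OF x(1)]] by simp
  from this[of 1 _ 1] this[of _ _ 0] show ?thesis by (intro linearI) simp_all
qed

lemma
  assumes Y: "smooth_on (snd c ` fst c) Y" and x: "x \<in> fst c" and v: "v \<in> tangent_space M x"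
  shows cov_tvec_aux: "cov x v (\<lambda>x. tvec M c x (Y (snd c x))) c = frechet_derivative Y (at (snd c x)) (v c)
    + (\<Sum>j\<in>UNIV. Y (snd c x) $ j *\<^sub>R \<Gamma> (snd c x) (v c) (axis j 1))"
proof -
  have Yj: "smooth_on (snd c ` fst c) (\<lambda>z. Y z $ j)" for j by (rule smooth_on_vec_nth[OF Y])
  have exp: "w = (\<Sum>j\<in>UNIV. w $ j *\<^sub>R axis j 1)" for w :: "real^'n"
    using basis_expansion[of w] by (simp add: scalar_mult_eq_scaleR)
  have "tvec M c y (Y (snd c y)) d = (\<Sum>j\<in>UNIV. Y (snd c y) $ j *\<^sub>R tvec M c y (axis j 1) d)"
    if "y \<in> fst c" for y d
  proof (cases "d \<in> charts_at M y")
    case True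
    note lin = transition_linear[OF M chart_at[OF that] True]
    show ?thesis using True
      by (subst exp[of "Y (snd c y)"]) (simp add: tvec_def[OF M] linear_sum[OF lin] linear_cmul[OF lin])
  qed (simp add: tvec_def[OF M])
  then have "cov x v (\<lambda>x. tvec M c x (Y (snd c x))) = cov x v (\<lambda>y d. \<Sum>j\<in>UNIV. Y (snd c y) $ j *\<^sub>R tvec M c y (axis j 1) d)"
    by (intro cov_local[OF cov_sum(1)[OF finite x v Yj] x v]) auto
  then have "cov x v (\<lambda>x. tvec M c x (Y (snd c x))) c = cov x v (\<lambda>y d. \<Sum>j\<in>UNIV. Y (snd c y) $ j *\<^sub>R tvec M c y (axis j 1) d) c"
    by simp
  also have "\<dots> = (\<Sum>j\<in>UNIV. frechet_derivative (\<lambda>z. Y z $ j) (at (snd c x)) (v c) *\<^sub>R axis j 1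
      + Y (snd c x) $ j *\<^sub>R \<Gamma> (snd c x) (v c) (axis j 1))"
    by (rule cov_sum(2)[OF finite x v Yj])
  also have "(\<lambda>j. frechet_derivative (\<lambda>z. Y z $ j) (at (snd c x)) (v c)) = (\<lambda>j. frechet_derivative Y (at (snd c x)) (v c) $ j)"
  proof -
    have "(Y has_derivative frechet_derivative Y (at (snd c x))) (at (snd c x))"
      using smooth_on_has_derivative[OF Y] x by simp
    from frechet_derivative_eqI[OF bounded_linear.has_derivative[OF bounded_linear_vec_nth this]]
    show ?thesis by simp
  qed
  also have "(\<Sum>j\<in>UNIV. frechet_derivative Y (at (snd c x)) (v c) $ j *\<^sub>R axis j 1
      + Y (snd c x) $ j *\<^sub>R \<Gamma> (snd c x) (v c) (axis j 1)) = frechet_derivative Y (at (snd c x)) (v c)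
      + (\<Sum>j\<in>UNIV. Y (snd c x) $ j *\<^sub>R \<Gamma> (snd c x) (v c) (axis j 1))"
    unfolding sum.distrib exp[symmetric] ..
  finally show ?thesis .
qed

text \<open>The case of a field with constant components in \<open>cov_tvec_aux\<close>.\<close>

lemma christoffel_expand:
  assumes "z \<in> snd c ` fst c"
  shows "\<Gamma> z \<xi> \<eta> = (\<Sum>j\<in>UNIV. \<eta> $ j *\<^sub>R \<Gamma> z \<xi> (axis j 1))"
proof -
  obtain x where x: "x \<in> fst c" "z = snd c x" using assms by blast
  show ?thesis
    using cov_tvec_aux[OF smooth_on_const[OF open_chart] x(1) tvec_in[OF x(1)], of \<xi> \<eta>]
      christoffel_cov[OF x(1) tvec_in[OF x(1)], of \<xi> \<eta>] tvec_chart[OF M chart_at[OF x(1)], of \<xi>] x(2)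
    by simp
qed

lemma linear_christoffel2:
  assumes "z \<in> snd c ` fst c"
  shows "linear (\<Gamma> z \<xi>)"
proof -
  have "\<Gamma> z \<xi> = (\<lambda>\<eta>. \<Sum>j\<in>UNIV. \<eta> $ j *\<^sub>R \<Gamma> z \<xi> (axis j 1))"
    by (rule ext) (rule christoffel_expand[OF assms])
  moreover have "linear \<dots>"
    by (rule linearI) (simp_all add: scaleR_add_left sum.distrib scaleR_sum_right)
  ultimately show ?thesis by simp
qed

lemma cov_tvec:
  assumes Y: "smooth_on (snd c ` fst c) Y" and x: "x \<in> fst c" and v: "v \<in> tangent_space M x"
  shows "cov x v (\<lambda>x. tvec M c x (Y (snd c x))) c =
    frechet_derivative Y (at (snd c x)) (v c) + \<Gamma> (snd c x) (v c) (Y (snd c x))"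
  using cov_tvec_aux[OF assms] christoffel_expand[of "snd c x" "v c" "Y (snd c x)"] x by simp


text \<open>The connection matrix: the gl(n)-valued 1-form of the coordinate frame, evaluated on
  v.\<close>

definition "\<Gamma>m z v = matrix (\<Gamma> z v)"

lemma christoffel_matrix_vector:
  "z \<in> snd c ` fst c \<Longrightarrow> \<Gamma>m z v *v \<eta> = \<Gamma> z v \<eta>"
  using linear_christoffel2 by (simp add: \<Gamma>m_def matrix_works)

lemma christoffel_matrix_smooth: "smooth_on (snd c ` fst c) (\<lambda>z. \<Gamma>m z v)"
  unfolding \<Gamma>m_def matrix_def
  by (intro smooth_on_vec smooth_on_vec_nth open_chart christoffel_smooth)

lemma christoffel_matrix_linear: "z \<in> snd c ` fst c \<Longrightarrow> linear (\<Gamma>m z)"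
  unfolding \<Gamma>m_def matrix_def
  by (rule linearI) (simp_all add: vec_eq_iff linear_add[OF linear_christoffel1] linear_cmul[OF linear_christoffel1])

definition "d\<Gamma>m z w v = frechet_derivative (\<lambda>z. \<Gamma>m z v) (at z) w"

lemma christoffel_matrix_has_derivative:
  "z \<in> snd c ` fst c \<Longrightarrow> ((\<lambda>z. \<Gamma>m z v) has_derivative (\<lambda>w. d\<Gamma>m z w v)) (at z)"
  unfolding d\<Gamma>m_def using smooth_on_has_derivative[OF christoffel_matrix_smooth] by simp

lemma christoffel_derivative:
  assumes z: "z \<in> snd c ` fst c"
  shows "frechet_derivative (\<lambda>z. \<Gamma> z v \<eta>) (at z) w = d\<Gamma>m z w v *v \<eta>"
proof -
  have "bounded_linear (\<lambda>A :: real^'n^'n. A *v \<eta>)"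
    by (rule bounded_bilinear.bounded_linear_left[OF bounded_bilinear_matrix_vector_mult])
  from bounded_linear.has_derivative[OF this christoffel_matrix_has_derivative[OF z]]
  have "((\<lambda>z. \<Gamma>m z v *v \<eta>) has_derivative (\<lambda>w. d\<Gamma>m z w v *v \<eta>)) (at z)" .
  then have "((\<lambda>z. \<Gamma> z v \<eta>) has_derivative (\<lambda>w. d\<Gamma>m z w v *v \<eta>)) (at z)"
    by (rule has_derivative_transform_within_open[OF _ open_chart z]) (rule christoffel_matrix_vector)
  then show ?thesis by (simp add: frechet_derivative_eqI)
qed

end

end

section \<open>Vanishing torsion and curvature in terms of Christoffel symbols\<close>

locale flat_manifold = manifold_connection M cov
  for M :: "('m, real^'n::finite) mfd" and cov :: "('m, real^'n) cov_deriv" +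
  assumes flat: "flat_affine M cov"
begin

context
  fixes c assumes c: "c \<in> atlas M"
begin

lemma lie_bracket_chart:
  assumes "x \<in> fst c"
  shows "lie_bracket M (\<lambda>x. tvec M c x \<xi>) (\<lambda>x. tvec M c x \<eta>) x c = 0"
proof -
  have const: "frechet_derivative (\<lambda>y. tvec M c (cinv c y) \<zeta> c) (at (snd c x)) = (\<lambda>_. 0)" for \<zeta>
  proof (rule frechet_derivative_eqI, rule has_derivative_transform_within_open[OF has_derivative_const[of \<zeta>] open_chart[OF c]])
    fix y assume "y \<in> snd c ` fst c"
    then show "\<zeta> = tvec M c (cinv c y) \<zeta> c"
      using tvec_chart[OF M chart_at[OF c]] chart_cinv[OF M c] by fastforce
  qed (use assms in auto)
  show ?thesis by (simp add: lie_bracket_def const)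
qed

lemma torsion_free:
  assumes "x \<in> fst c"
  shows "cov x (tvec M c x \<xi>) (\<lambda>x. tvec M c x \<eta>) d - cov x (tvec M c x \<eta>) (\<lambda>x. tvec M c x \<xi>) d
    = lie_bracket M (\<lambda>x. tvec M c x \<xi>) (\<lambda>x. tvec M c x \<eta>) x d"
proof -
  have "torsion_tensor M cov (\<lambda>x. tvec M c x \<xi>) (\<lambda>x. tvec M c x \<eta>) x = (\<lambda>d. 0)"
    using flat smooth_field_const[OF c] assms unfolding flat_affine_def by blast
  from fun_cong[OF this, of d] show ?thesis by (simp add: torsion_tensor_def)
qed

lemma christoffel_symmetric:
  assumes "z \<in> snd c ` fst c"
  shows "christoffel M cov c z \<xi> \<eta> = christoffel M cov c z \<eta> \<xi>"
proof -
  obtain x where x: "x \<in> fst c" "z = snd c x" using assms by blast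
  show ?thesis
    using torsion_free[OF x(1), of \<xi> \<eta> c] lie_bracket_chart[OF x(1), of \<xi> \<eta>] chart_cinv[OF M c x(1)]
    by (simp add: christoffel_def x(2))
qed

text \<open>By the absence of torsion the bracket of two coordinate fields is a tangent vector, so that it
  vanishes in every chart as soon as it vanishes in one.\<close>

lemma lie_bracket_zero:
  assumes x: "x \<in> fst c"
  shows "lie_bracket M (\<lambda>x. tvec M c x \<xi>) (\<lambda>x. tvec M c x \<eta>) x = (\<lambda>d. 0)"
proof -
  note t = cov_in_tangent_space[OF smooth_field_const[OF c] x tvec_in[OF c x]]
  have "lie_bracket M (\<lambda>x. tvec M c x \<xi>) (\<lambda>x. tvec M c x \<eta>) x
    = (\<lambda>d. 1 *\<^sub>R cov x (tvec M c x \<xi>) (\<lambda>x. tvec M c x \<eta>) d + (-1) *\<^sub>R cov x (tvec M c x \<eta>) (\<lambda>x. tvec M c x \<xi>) d)"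
    using torsion_free[OF x, of \<xi> \<eta>] by auto
  also have "\<dots> \<in> tangent_space M x" by (rule tangent_space_lincomb[OF M t t])
  finally show ?thesis
    by (rule tangent_space_eqI[OF M _ zero_in_tangent_space[OF M] chart_at[OF c x]]) (rule lie_bracket_chart[OF x])
qed

text \<open>Curvature on three coordinate fields. The inner covariant derivative is again a field
  given by its components, namely \<Gamma> z \<eta> \<zeta>, so \<open>cov_tvec\<close> computes the
  outer one. The bracket term disappears because the bracket is the zero tangent vector in all
  charts.\<close>

lemma christoffel_flat:
  assumes z: "z \<in> snd c ` fst c"
  shows "frechet_derivative (\<lambda>z. christoffel M cov c z \<eta> \<zeta>) (at z) \<xi> + christoffel M cov c z \<xi> (christoffel M cov c z \<eta> \<zeta>)
    = frechet_derivative (\<lambda>z. christoffel M cov c z \<xi> \<zeta>) (at z) \<eta> + christoffel M cov c z \<eta> (christoffel M cov c z \<xi> \<zeta>)"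
proof -
  obtain x where x: "x \<in> fst c" "z = snd c x" using z by blast
  define F where "F \<xi> = (\<lambda>x. tvec M c x \<xi>)" for \<xi>
  note sf = smooth_field_const[OF c, folded F_def]
  have Fin: "F \<xi> y \<in> tangent_space M y" if "y \<in> fst c" for y \<xi>
    using tvec_in[OF c that] by (simp add: F_def)
  have second: "cov x (F \<xi> x) (\<lambda>y. cov y (F \<eta> y) (F \<zeta>)) c =
    frechet_derivative (\<lambda>z. christoffel M cov c z \<eta> \<zeta>) (at z) \<xi> + christoffel M cov c z \<xi> (christoffel M cov c z \<eta> \<zeta>)" for \<xi> \<eta>
  proof -
    have "cov y (F \<eta> y) (F \<zeta>) = tvec M c y (christoffel M cov c (snd c y) \<eta> \<zeta>)" if y: "y \<in> fst c" for y
      using tangent_space_eq_tvec[OF M cov_in_tangent_space[OF sf y Fin[OF y]] chart_at[OF c y]]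
        christoffel_cov[OF c y Fin[OF y], folded F_def] tvec_chart[OF M chart_at[OF c y]]
      by (simp add: F_def)
    then have "cov x (F \<xi> x) (\<lambda>y. cov y (F \<eta> y) (F \<zeta>)) = cov x (F \<xi> x) (\<lambda>y. tvec M c y (christoffel M cov c (snd c y) \<eta> \<zeta>))"
      by (intro cov_local[OF smooth_field_tvec[OF M c chart_openin[OF M c] subset_refl christoffel_smooth[OF c]] x(1) Fin[OF x(1)]])
    then show ?thesis
      using cov_tvec[OF c christoffel_smooth[OF c] x(1) Fin[OF x(1)], of \<xi> \<eta> \<zeta>]
        tvec_chart[OF M chart_at[OF c x(1)], of \<xi>] x(2)
      by (simp add: F_def)
  qed
  \<comment> \<open>Differentiation along the zero vector gives 0, by linearity with both
    coefficients 0.\<close>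
  have "cov x (\<lambda>d. 0 *\<^sub>R F \<xi> x d + 0 *\<^sub>R F \<xi> x d) (F \<zeta>) = (\<lambda>d. 0 *\<^sub>R cov x (F \<xi> x) (F \<zeta>) d + 0 *\<^sub>R cov x (F \<xi> x) (F \<zeta>) d)"
    by (rule cov_linear[OF sf x(1) Fin[OF x(1)] Fin[OF x(1)]])
  then have zero: "cov x (\<lambda>d. 0) (F \<zeta>) = (\<lambda>d. 0)" by simp
  have "curvature_tensor M cov (F \<xi>) (F \<eta>) (F \<zeta>) x = (\<lambda>d. 0)"
    using flat sf x(1) unfolding flat_affine_def by blast
  from fun_cong[OF this, of c] show ?thesis
    unfolding curvature_tensor_def lie_bracket_zero[OF x(1), folded F_def] zero second by simp
qed

lemma christoffel_matrix_flat:
  assumes z: "z \<in> snd c ` fst c"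
  shows "d\<Gamma>m c z v w + \<Gamma>m c z v ** \<Gamma>m c z w = d\<Gamma>m c z w v + \<Gamma>m c z w ** \<Gamma>m c z v"
  unfolding matrix_eq
proof
  fix \<zeta>
  show "(d\<Gamma>m c z v w + \<Gamma>m c z v ** \<Gamma>m c z w) *v \<zeta> = (d\<Gamma>m c z w v + \<Gamma>m c z w ** \<Gamma>m c z v) *v \<zeta>"
    using christoffel_flat[OF z, of w \<zeta> v]
    by (simp add: matrix_vector_mult_add_rdistrib matrix_vector_mul_assoc[symmetric]
        christoffel_matrix_vector[OF c z] christoffel_derivative[OF c z])
qed

text \<open>The system df = B dz, dB = B \<Gamma> for the pair \<psi> = (f, B). Integrability of its
  first component is the symmetry of \<Gamma>, that of its second is
  \<open>christoffel_matrix_flat\<close>.\<close>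

lemma ex_development:
  fixes B0 :: "real^'n^'n"
  assumes z0: "z0 \<in> snd c ` fst c" and B0: "invertible B0"
  shows "\<exists>r>0. \<exists>f B. ball z0 r \<subseteq> snd c ` fst c \<and> f z0 = 0 \<and> B z0 = B0 \<and>
    smooth_on (ball z0 r) f \<and> smooth_on (ball z0 r) B \<and>
    (\<forall>z\<in>ball z0 r. invertible (B z) \<and> (f has_derivative (\<lambda>v. B z *v v)) (at z) \<and>
      (B has_derivative (\<lambda>v. B z ** \<Gamma>m c z v)) (at z))"
proof -
  \<comment> \<open>The chart image translated so that z0 becomes the origin, from which the Picard
    iteration starts.\<close>
  define S where "S = {y. z0 + y \<in> snd c ` fst c}"
  have "open S"
    using open_chart[OF c] unfolding S_def
    by (intro open_vimage[of _ "\<lambda>y. z0 + y", unfolded vimage_def]) (auto intro: continuous_intros)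
  interpret total_differential_system "\<lambda>y v (\<psi> :: (real^'n) \<times> (real^'n^'n)). (snd \<psi> *v v, snd \<psi> ** \<Gamma>m c (z0 + y) v)"
    "\<lambda>y w v \<psi>. (0, snd \<psi> ** d\<Gamma>m c (z0 + y) w v)" S
  proof
    fix y assume "y \<in> S"
    then have y: "z0 + y \<in> snd c ` fst c" by (simp add: S_def)
    note lin = christoffel_matrix_linear[OF c y]
    show "bilinear (\<lambda>v (\<psi> :: (real^'n) \<times> (real^'n^'n)). (snd \<psi> *v v, snd \<psi> ** \<Gamma>m c (z0 + y) v))"
      unfolding bilinear_def
      by (auto intro!: linearI simp: linear_add[OF lin] linear_cmul[OF lin] matrix_linear_simps)
    fix v w and \<psi> :: "(real^'n) \<times> (real^'n^'n)"
    have "bounded_linear (\<lambda>A. snd \<psi> ** A)"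
      by (rule bounded_bilinear.bounded_linear_right[OF bounded_bilinear_matrix_mult])
    moreover have "((\<lambda>y. z0 + y) has_derivative (\<lambda>w. w)) (at y)"
      by (auto intro!: derivative_eq_intros)
    note has_derivative_compose[OF this christoffel_matrix_has_derivative[OF c y]]
    ultimately have "((\<lambda>y. snd \<psi> ** \<Gamma>m c (z0 + y) v) has_derivative (\<lambda>w. snd \<psi> ** d\<Gamma>m c (z0 + y) w v)) (at y)"
      by (rule bounded_linear.has_derivative)
    then show "((\<lambda>y. (snd \<psi> *v v, snd \<psi> ** \<Gamma>m c (z0 + y) v)) has_derivative
        (\<lambda>w. (0, snd \<psi> ** d\<Gamma>m c (z0 + y) w v))) (at y)"
      by (intro has_derivative_Pair has_derivative_const)
    show "(0, snd \<psi> ** d\<Gamma>m c (z0 + y) v w) +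
        (snd (snd \<psi> *v v, snd \<psi> ** \<Gamma>m c (z0 + y) v) *v w,
         snd (snd \<psi> *v v, snd \<psi> ** \<Gamma>m c (z0 + y) v) ** \<Gamma>m c (z0 + y) w) =
        (0, snd \<psi> ** d\<Gamma>m c (z0 + y) w v) +
        (snd (snd \<psi> *v w, snd \<psi> ** \<Gamma>m c (z0 + y) w) *v v,
         snd (snd \<psi> *v w, snd \<psi> ** \<Gamma>m c (z0 + y) w) ** \<Gamma>m c (z0 + y) v)"
      using christoffel_matrix_flat[OF y, of v w, THEN arg_cong[where f="\<lambda>A. snd \<psi> ** A"]]
      by (simp add: matrix_vector_mul_assoc[symmetric] christoffel_matrix_vector[OF c y]
          christoffel_symmetric[OF y, of v w] matrix_add_ldistrib matrix_mul_assoc)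
  next
    fix v w and \<psi> :: "(real^'n) \<times> (real^'n^'n)"
    have "smooth_on (snd c ` fst c) (\<lambda>z. snd \<psi> ** d\<Gamma>m c z w v)"
      unfolding d\<Gamma>m_def[OF c]
      by (intro smooth_on_matrix_mult smooth_on_const open_chart[OF c] smooth_on_derivative
          christoffel_matrix_smooth[OF c])
    note cont = smooth_on_continuous[OF this]
    have "continuous_on S (\<lambda>y. snd \<psi> ** d\<Gamma>m c (z0 + y) w v)"
      by (rule continuous_on_compose2[OF cont]) (auto simp: S_def intro: continuous_intros)
    then show "continuous_on S (\<lambda>y. (0, snd \<psi> ** d\<Gamma>m c (z0 + y) w v))"
      by (rule continuous_on_Pair[OF continuous_on_const])
  qed
  have "0 \<in> S" using z0 by (simp add: S_def)
  from ex_local_solution[OF \<open>open S\<close> this] obtain r where r12: "r > 0" "ball 0 r \<subseteq> S" and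
    ex: "\<forall>\<psi>0 :: (real^'n) \<times> (real^'n^'n). \<exists>\<psi>. \<psi> 0 = \<psi>0 \<and> (\<forall>y\<in>ball 0 r.
      (\<psi> has_derivative (\<lambda>v. (snd (\<psi> y) *v v, snd (\<psi> y) ** \<Gamma>m c (z0 + y) v))) (at y))"
    by (elim exE conjE) (rule that)
  from ex[THEN spec, of "(0, B0)"] obtain \<psi> where r34: "\<psi> 0 = (0, B0)" "\<forall>y\<in>ball 0 r.
      (\<psi> has_derivative (\<lambda>v. (snd (\<psi> y) *v v, snd (\<psi> y) ** \<Gamma>m c (z0 + y) v))) (at y)"
    by (elim exE conjE) (rule that)
  note r = r12 r34(1) r34(2)[THEN bspec]
  define f where "f z = fst (\<psi> (z - z0))" for z
  define B where "B z = snd (\<psi> (z - z0))" for z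
  have ballS: "ball z0 r \<subseteq> snd c ` fst c"
  proof
    fix z assume "z \<in> ball z0 r"
    then have "z - z0 \<in> ball 0 r" by (simp add: dist_norm norm_minus_commute)
    then show "z \<in> snd c ` fst c" using r(2) by (auto simp: S_def)
  qed
  have d: "((\<lambda>z. \<psi> (z - z0)) has_derivative (\<lambda>v. (B z *v v, B z ** \<Gamma>m c z v))) (at z)" if "z \<in> ball z0 r" for z
  proof -
    have "z - z0 \<in> ball 0 r" using that by (simp add: dist_norm norm_minus_commute)
    note r' = r(4)[OF this]
    have "((\<lambda>z. z - z0) has_derivative (\<lambda>v. v)) (at z)"
      by (auto intro!: derivative_eq_intros)
    from has_derivative_compose[OF this r'] show ?thesis by (simp add: B_def)
  qed
  have df: "(f has_derivative (\<lambda>v. B z *v v)) (at z)" and dB: "(B has_derivative (\<lambda>v. B z ** \<Gamma>m c z v)) (at z)"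
    if "z \<in> ball z0 r" for z
    using has_derivative_fst[OF d[OF that]] has_derivative_snd[OF d[OF that]]
    unfolding f_def[abs_def] B_def[abs_def] by simp_all
  \<comment> \<open>Bootstrapping: if B is of class C^k then so is its derivative B \<Gamma>, hence
    B is of class C^(k+1).\<close>
  have CB: "Ck_on k B (ball z0 r)" for k
  proof (induction k)
    case 0
    show ?case
      by (simp only: Ck_on.simps) (intro continuous_at_imp_continuous_on ballI has_derivative_continuous[OF dB])
  next
    case (Suc k)
    have "Ck_on k (\<lambda>z. \<Gamma>m c z v) (ball z0 r)" for v
      using christoffel_matrix_smooth[OF c, of v] Ck_on_subset[OF _ ballS] unfolding smooth_on_def by blast
    from Ck_on_SucI[OF open_ball dB Ck_on_bounded_bilinear[OF bounded_bilinear_matrix_mult Suc this open_ball]]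
    show ?case .
  qed
  then have sB: "smooth_on (ball z0 r) B" by (simp add: smooth_on_def)
  have "smooth_on (ball z0 r) (\<lambda>z. B z *v v)" for v
    by (rule smooth_on_matrix_vector_mult[OF sB smooth_on_const[OF open_ball]])
  then have "Ck_on k (\<lambda>z. B z *v v) (ball z0 r)" for k v by (simp add: smooth_on_def)
  from Ck_on_SucI[OF open_ball df this] have "Ck_on (Suc k) f (ball z0 r)" for k .
  then have sf: "smooth_on (ball z0 r) f"
    unfolding smooth_on_def using Ck_on_Suc_imp by blast
  \<comment> \<open>B is invertible at z0; continuity of the determinant allows the ball to be
    shrunk until B is invertible throughout.\<close>
  have "continuous_on (ball z0 r) (\<lambda>z. det (B z))"
    unfolding det_def by (intro continuous_intros smooth_on_continuous[OF sB] continuous_on_component)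
  then have "open ((\<lambda>z. det (B z)) -` (- {0}) \<inter> ball z0 r)"
    using continuous_on_open_vimage[OF open_ball] by blast
  moreover have "z0 \<in> (\<lambda>z. det (B z)) -` (- {0}) \<inter> ball z0 r"
    using B0 r by (simp add: B_def invertible_det_nz)
  ultimately obtain s where s: "s > 0" "ball z0 s \<subseteq> (\<lambda>z. det (B z)) -` (- {0}) \<inter> ball z0 r"
    using open_contains_ball by blast
  show ?thesis
  proof (intro exI[of _ s] exI[of _ f] exI[of _ B] conjI ballI)
    have sub: "ball z0 s \<subseteq> ball z0 r" using s by blast
    show "smooth_on (ball z0 s) f" "smooth_on (ball z0 s) B"
      using smooth_on_subset[OF sf sub] smooth_on_subset[OF sB sub] by simp_all
    show "ball z0 s \<subseteq> snd c ` fst c" using sub ballS by blast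
    show "f z0 = 0" "B z0 = B0" using r by (simp_all add: f_def B_def)
    fix z assume z: "z \<in> ball z0 s"
    show "invertible (B z)" using s(2) z by (auto simp: invertible_det_nz)
    show "(f has_derivative (\<lambda>v. B z *v v)) (at z)" "(B has_derivative (\<lambda>v. B z ** \<Gamma>m c z v)) (at z)"
      using df dB sub z by blast+
  qed (rule s)
qed

end

end

section \<open>The frame bundle\<close>

definition fmat :: "('m, real^'n::finite) chart \<Rightarrow> ('m, 'n) frame \<Rightarrow> real^'n^'n" where
  "fmat c w = (\<chi> i j. snd w j c $ i)"

text \<open>An explicit inverse of \<open>frame_chart M c\<close>, used to evaluate
  \<open>cinv\<close> of frame charts.\<close>

definition local_frame :: "('m, real^'n::finite) mfd \<Rightarrow> ('m, real^'n) chart \<Rightarrow> (real^'n) \<times> (real^'n^'n) \<Rightarrow> ('m, 'n) frame" where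
  "local_frame M c = (\<lambda>(z, X). (cinv c z, \<lambda>j. tvec M c (cinv c z) (column j X)))"

definition jacobian :: "('m, real^'n::finite) chart \<Rightarrow> ('m, real^'n) chart \<Rightarrow> real^'n \<Rightarrow> real^'n^'n" where
  "jacobian c d z = matrix (frechet_derivative (snd d \<circ> cinv c) (at z))"

lemma frame_chart_simps:
  "fst (frame_chart M c) = {w \<in> frames M. fst w \<in> fst c}"
  "snd (frame_chart M c) w = (snd c (fst w), fmat c w)"
  by (simp_all add: frame_chart_def fmat_def)

lemma frame_map_chart: "frame_map (snd w) \<xi> c = fmat c w *v \<xi>"
  by (simp add: frame_map_def fmat_def matrix_vector_mult_def vec_eq_iff sum_component mult.commute)

lemma frame_map_axis: "frame_map u (axis j 1) = u j"
proof
  fix c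
  have "frame_map u (axis j 1) c = (\<Sum>k\<in>UNIV. if k = j then u k c else 0)"
    unfolding frame_map_def by (intro sum.cong) (auto simp: axis_def)
  then show "frame_map u (axis j 1) c = u j c" by simp
qed

lemma column_fmat: "column j (fmat c w) = snd w j c"
  by (simp add: column_def fmat_def vec_eq_iff)

lemma column_matrix_mult: "column j (A ** B) = A *v column j B"
  by (simp add: column_def matrix_matrix_mult_def matrix_vector_mult_def)

lemma matrix_eq_columnsI: "(\<And>j. column j A = column j B) \<Longrightarrow> A = B"
  by (simp add: column_def vec_eq_iff)

lemma points_frame_bundle_aux: "points (frame_bundle M) = {w \<in> frames M. \<exists>c\<in>atlas M. fst w \<in> fst c}"
proof -
  have "points (frame_bundle M) = \<Union>{{w \<in> fst (frame_chart M c). snd (frame_chart M c) w \<in> V} | c V. c \<in> atlas M \<and> open V}"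
    by (simp add: frame_bundle_def topology_generated_by_topspace)
  also have "\<dots> = (\<Union>c\<in>atlas M. fst (frame_chart M c))"
    by (intro equalityI subsetI) (blast, use open_UNIV in blast)
  finally show ?thesis by (auto simp: frame_chart_simps(1))
qed

lemma matrix_inv_mult:
  fixes A :: "real^'n::finite^'n"
  assumes "invertible A"
  shows "A ** matrix_inv A = mat 1" "matrix_inv A ** A = mat 1"
  using someI_ex[OF assms[unfolded invertible_def]] unfolding matrix_inv_def by blast+

lemma smooth_on_compose_fst:
  fixes T :: "'b::real_normed_vector set"
  assumes "smooth_on S g" "open T"
  shows "smooth_on (S \<times> T) (\<lambda>p. g (fst p))"
  by (rule smooth_on_subset[OF smooth_on_compose_affine[OF bounded_linear_fst assms(1), of 0, unfolded add_0_right]])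
    (use assms smooth_onD_open in \<open>auto intro: open_Times\<close>)

lemma open_invertible: "open {X :: real^'n::finite^'n. invertible X}"
proof -
  have "continuous_on UNIV (\<lambda>X :: real^'n^'n. det X)"
    unfolding det_def by (intro continuous_intros)
  then have "open ((\<lambda>X :: real^'n^'n. det X) -` (- {0}))"
    by (intro open_vimage) auto
  then show ?thesis by (simp add: vimage_def invertible_det_nz Collect_neg_eq)
qed

context
  fixes M :: "('m, real^'n::finite) mfd"
  assumes M: "smooth_atlas M"
begin

lemma points_frame_bundle: "points (frame_bundle M) = frames M"
proof -
  have "\<exists>c\<in>atlas M. fst w \<in> fst c" if "w \<in> frames M" for w :: "('m, 'n) frame"
  proof -
    have "fst w \<in> points M" using that by (auto simp: frames_def)
    from ex_chart[OF M this] show ?thesis unfolding charts_at_iff by blast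
  qed
  then show ?thesis unfolding points_frame_bundle_aux by blast
qed

text \<open>A tangent vector is determined by its component in c, where \<open>frame_map u\<close>
  becomes multiplication by the matrix \<open>fmat c (x, u)\<close>. Bijectivity is thus a property
  of one matrix.\<close>

lemma frames_iff:
  assumes c: "c \<in> charts_at M x"
  shows "(x, u) \<in> frames M \<longleftrightarrow> (\<forall>j. u j \<in> tangent_space M x) \<and> invertible (fmat c (x, u))"
proof -
  have fm: "frame_map u \<xi> c = fmat c (x, u) *v \<xi>" for \<xi> using frame_map_chart[of "(x, u)"] by simp
  have x: "x \<in> points M" by (rule charts_at_points[OF M c])
  show ?thesis
  proof
    assume "(x, u) \<in> frames M"
    then have b: "bij_betw (frame_map u) UNIV (tangent_space M x)" by (simp add: frames_def)
    have t: "frame_map u \<xi> \<in> tangent_space M x" for \<xi> using b by (auto simp: bij_betw_def)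
    have "u j \<in> tangent_space M x" for j using t[of "axis j 1"] by (simp add: frame_map_axis)
    moreover have "inj ((*v) (fmat c (x, u)))"
    proof (rule injI)
      fix \<xi> \<eta> assume "fmat c (x, u) *v \<xi> = fmat c (x, u) *v \<eta>"
      then have "frame_map u \<xi> = frame_map u \<eta>"
        by (intro tangent_space_eqI[OF M t t c]) (simp add: fm)
      then show "\<xi> = \<eta>" using b by (auto simp: bij_betw_def dest: injD)
    qed
    then have "invertible (fmat c (x, u))"
      using matrix_left_invertible_injective invertible_left_inverse by blast
    ultimately show "(\<forall>j. u j \<in> tangent_space M x) \<and> invertible (fmat c (x, u))" by blast
  next
    assume a: "(\<forall>j. u j \<in> tangent_space M x) \<and> invertible (fmat c (x, u))"
    note inv = matrix_inv_mult[OF a[THEN conjunct2]]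
    have t: "frame_map u \<xi> \<in> tangent_space M x" for \<xi>
      unfolding frame_map_def using a by (intro tangent_space_sum[OF M]) auto
    have "bij_betw (frame_map u) UNIV (tangent_space M x)"
    proof (rule bij_betw_byWitness[where f'="\<lambda>v. matrix_inv (fmat c (x, u)) *v v c"])
      show "\<forall>\<xi>\<in>UNIV. matrix_inv (fmat c (x, u)) *v frame_map u \<xi> c = \<xi>"
        by (simp add: fm matrix_vector_mul_assoc inv)
      show "\<forall>v\<in>tangent_space M x. frame_map u (matrix_inv (fmat c (x, u)) *v v c) = v"
        by (auto intro!: tangent_space_eqI[OF M t _ c] simp: fm matrix_vector_mul_assoc inv)
    qed (use t in auto)
    then show "(x, u) \<in> frames M" using x by (simp add: frames_def)
  qed
qed

lemma
  assumes "w \<in> frames M"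
  shows frames_tangent: "snd w j \<in> tangent_space M (fst w)"
    and frames_invertible: "c \<in> charts_at M (fst w) \<Longrightarrow> invertible (fmat c w)"
    and frames_points: "fst w \<in> points M"
proof -
  show p: "fst w \<in> points M" using assms by (auto simp: frames_def)
  obtain d where "d \<in> charts_at M (fst w)" using ex_chart[OF M p] by blast
  from frames_iff[OF this, of "snd w"] show "snd w j \<in> tangent_space M (fst w)" using assms by simp
  show "c \<in> charts_at M (fst w) \<Longrightarrow> invertible (fmat c w)" using frames_iff[of c "fst w" "snd w"] assms by simp
qed

lemma fmat_transition:
  assumes "w \<in> frames M" "c \<in> charts_at M (fst w)" "d \<in> charts_at M (fst w)"
  shows "fmat d w = jacobian c d (snd c (fst w)) ** fmat c w"
proof (rule matrix_eq_columnsI)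
  fix j
  note lin = transition_linear[OF M assms(2,3)]
  show "column j (fmat d w) = column j (jacobian c d (snd c (fst w)) ** fmat c w)"
    using tangent_spaceD(2)[OF M frames_tangent[OF assms(1)] assms(2,3)] lin
    by (simp add: column_matrix_mult column_fmat jacobian_def matrix_works)
qed

context
  fixes c assumes c: "c \<in> atlas M"
begin

lemma local_frame_in:
  assumes "z \<in> snd c ` fst c" "invertible X"
  shows "local_frame M c (z, X) \<in> fst (frame_chart M c)" "snd (frame_chart M c) (local_frame M c (z, X)) = (z, X)"
    "fst (local_frame M c (z, X)) = cinv c z"
proof -
  define x where "x = cinv c z"
  have x: "x \<in> fst c" "snd c x = z" using assms(1) chart_cinv[OF M c] by (auto simp: x_def)
  then have xc: "c \<in> charts_at M x" using c by (simp add: charts_at_iff)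
  have f: "fmat c (x, \<lambda>j. tvec M c x (column j X)) = X"
    by (rule matrix_eq_columnsI) (simp add: column_fmat tvec_chart[OF M xc])
  have lf: "local_frame M c (z, X) = (x, \<lambda>j. tvec M c x (column j X))"
    by (simp add: local_frame_def x_def)
  have "(x, \<lambda>j. tvec M c x (column j X)) \<in> frames M"
    using frames_iff[OF xc] tvec_in_tangent_space[OF M xc] assms(2) f by auto
  then show "local_frame M c (z, X) \<in> fst (frame_chart M c)" "snd (frame_chart M c) (local_frame M c (z, X)) = (z, X)"
    "fst (local_frame M c (z, X)) = cinv c z"
    using x f by (simp_all add: frame_chart_simps lf x_def)
qed

lemma local_frame_chart:
  assumes "w \<in> fst (frame_chart M c)"
  shows "local_frame M c (snd (frame_chart M c) w) = w" "snd c (fst w) \<in> snd c ` fst c" "invertible (fmat c w)"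
proof -
  have w: "w \<in> frames M" "fst w \<in> fst c" using assms by (simp_all add: frame_chart_simps)
  then have wc: "c \<in> charts_at M (fst w)" using c by (simp add: charts_at_iff)
  have "snd w = (\<lambda>j. tvec M c (fst w) (snd w j c))"
    using tangent_space_eq_tvec[OF M frames_tangent[OF w(1)] wc] by blast
  then show "local_frame M c (snd (frame_chart M c) w) = w"
    using chart_cinv[OF M c w(2)] by (simp add: local_frame_def frame_chart_simps column_fmat prod_eq_iff)
  show "snd c (fst w) \<in> snd c ` fst c" "invertible (fmat c w)"
    using w frames_invertible[OF w(1) wc] by auto
qed

lemma frame_chart_inj: "inj_on (snd (frame_chart M c)) (fst (frame_chart M c))"
  by (rule inj_on_inverseI) (rule local_frame_chart)

lemma frame_chart_image:
  "snd (frame_chart M c) ` {w \<in> fst (frame_chart M c). fst w \<in> A} = snd c ` (fst c \<inter> A) \<times> {X. invertible X}"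
proof (intro equalityI subsetI)
  fix p assume "p \<in> snd (frame_chart M c) ` {w \<in> fst (frame_chart M c). fst w \<in> A}"
  then show "p \<in> snd c ` (fst c \<inter> A) \<times> {X. invertible X}"
    using local_frame_chart(3) by (auto simp: frame_chart_simps)
next
  fix p :: "(real^'n) \<times> (real^'n^'n)" assume "p \<in> snd c ` (fst c \<inter> A) \<times> {X. invertible X}"
  then obtain x X where x: "x \<in> fst c" "x \<in> A" "p = (snd c x, X)" "invertible X" by auto
  then have "local_frame M c p \<in> {w \<in> fst (frame_chart M c). fst w \<in> A}" "p = snd (frame_chart M c) (local_frame M c p)"
    using local_frame_in[of "snd c x" X] chart_cinv[OF M c] by auto
  then show "p \<in> snd (frame_chart M c) ` {w \<in> fst (frame_chart M c). fst w \<in> A}"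
    by (rule image_eqI[rotated])
qed

lemma frame_chart_range: "snd (frame_chart M c) ` fst (frame_chart M c) = snd c ` fst c \<times> {X. invertible X}"
  using frame_chart_image[of UNIV] by simp

lemma cinv_frame_chart:
  fixes p :: "(real^'n) \<times> (real^'n^'n)"
  assumes "p \<in> snd c ` fst c \<times> {X. invertible X}"
  shows "cinv (frame_chart M c) p = local_frame M c p"
  using assms local_frame_in by (intro inv_into_f_eq[OF frame_chart_inj]) auto

lemma frame_transition:
  fixes p :: "(real^'n) \<times> (real^'n^'n)"
  assumes d: "d \<in> atlas M" and p: "p \<in> snd c ` (fst c \<inter> fst d) \<times> {X. invertible X}"
  shows "(snd (frame_chart M d) \<circ> cinv (frame_chart M c)) p = ((snd d \<circ> cinv c) (fst p), jacobian c d (fst p) ** snd p)"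
proof -
  obtain x X where x: "x \<in> fst c" "x \<in> fst d" "p = (snd c x, X)" "invertible X" using p by auto
  note lf = local_frame_in[of "snd c x" X]
  have w: "local_frame M c p \<in> frames M" "fst (local_frame M c p) = x"
    "snd (frame_chart M c) (local_frame M c p) = p"
    using lf x chart_cinv[OF M c] by (auto simp: frame_chart_simps)
  then have "fmat c (local_frame M c p) = X" using x by (simp add: frame_chart_simps)
  then show ?thesis
    using fmat_transition[OF w(1), of c d] w x c d chart_cinv[OF M c] p cinv_frame_chart[of p]
    by (auto simp: frame_chart_simps charts_at_iff)
qed

lemma frame_transition_smooth:
  assumes d: "d \<in> atlas M"
  shows "smooth_on (snd c ` (fst c \<inter> fst d) \<times> {X. invertible X}) (snd (frame_chart M d) \<circ> cinv (frame_chart M c))"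
proof (rule smooth_on_cong)
  let ?S = "snd c ` (fst c \<inter> fst d)"
  note t = transition_smooth[OF M c d]
  have o: "open (?S \<times> {X :: real^'n^'n. invertible X})"
    by (intro open_Times smooth_onD_open[OF t] open_invertible)
  have j: "smooth_on ?S (jacobian c d)"
    unfolding jacobian_def[abs_def] matrix_def
    by (intro smooth_on_vec smooth_on_vec_nth smooth_on_derivative t smooth_onD_open[OF t])
  show "smooth_on (?S \<times> {X :: real^'n^'n. invertible X}) (\<lambda>p. ((snd d \<circ> cinv c) (fst p), jacobian c d (fst p) ** snd p))"
  proof (rule smooth_on_Pair)
    show "smooth_on (?S \<times> {X :: real^'n^'n. invertible X}) (\<lambda>p. (snd d \<circ> cinv c) (fst p))"
      by (rule smooth_on_compose_fst[OF t open_invertible])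
    show "smooth_on (?S \<times> {X :: real^'n^'n. invertible X}) (\<lambda>p. jacobian c d (fst p) ** snd p)"
      by (rule smooth_on_matrix_mult[OF smooth_on_compose_fst[OF j open_invertible]
            smooth_on_bounded_linear[OF o bounded_linear_snd]])
  qed
qed (use frame_transition[OF d] in auto)

end

text \<open>Induction over the generation of the topology. Injectivity of the chart makes images
  commute with intersections, and for a generating set the image is a preimage under a continuous
  transition map.\<close>

lemma frame_bundle_open_image:
  assumes "openin (tops (frame_bundle M)) U" and c: "c \<in> atlas M"
  shows "open (snd (frame_chart M c) ` (fst (frame_chart M c) \<inter> U))"
proof -
  let ?k = "frame_chart M c"
  have "generate_topology_on {{w \<in> fst (frame_chart M c). snd (frame_chart M c) w \<in> V} | c V. c \<in> atlas M \<and> open V} U"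
    using assms(1) by (simp add: frame_bundle_def openin_topology_generated_by_iff)
  then show ?thesis
  proof (induction U rule: generate_topology_on.induct)
    case (Int a b)
    have "snd ?k ` (fst ?k \<inter> (a \<inter> b)) = snd ?k ` (fst ?k \<inter> a) \<inter> snd ?k ` (fst ?k \<inter> b)"
      using inj_onD[OF frame_chart_inj[OF c]] by blast
    then show ?case using Int by (simp add: open_Int)
  next
    case (UN K)
    have "snd ?k ` (fst ?k \<inter> \<Union>K) = (\<Union>a\<in>K. snd ?k ` (fst ?k \<inter> a))" by blast
    then show ?case using UN by auto
  next
    case (Basis s)
    then obtain d V where d: "d \<in> atlas M" "open V" "s = {w \<in> fst (frame_chart M d). snd (frame_chart M d) w \<in> V}" by blast
    let ?S = "snd c ` (fst c \<inter> fst d) \<times> {X. invertible X}"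
    let ?t = "snd (frame_chart M d) \<circ> cinv ?k"
    have "snd ?k ` (fst ?k \<inter> s) = ?t -` V \<inter> ?S"
    proof (intro equalityI subsetI)
      fix p assume "p \<in> snd ?k ` (fst ?k \<inter> s)"
      then obtain w where w: "w \<in> fst ?k" "w \<in> s" "p = snd ?k w" by blast
      then have "cinv ?k p = w" using frame_chart_inj[OF c] by (simp add: inv_into_f_f)
      moreover have "p \<in> ?S"
        using w d(3) unfolding frame_chart_image[OF c, symmetric] by (auto simp: frame_chart_simps)
      ultimately show "p \<in> ?t -` V \<inter> ?S" using w d(3) by simp
    next
      fix p assume p: "p \<in> ?t -` V \<inter> ?S"
      then obtain w where w: "w \<in> fst ?k" "fst w \<in> fst d" "p = snd ?k w"
        unfolding frame_chart_image[OF c, symmetric] by blast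
      then have "cinv ?k p = w" using frame_chart_inj[OF c] by (simp add: inv_into_f_f)
      then show "p \<in> snd ?k ` (fst ?k \<inter> s)"
        using p w d(3) by (auto simp: frame_chart_simps)
    qed
    moreover have "open (?t -` V \<inter> ?S)"
      using frame_transition_smooth[OF c d(1)] d(2)
      by (intro continuous_on_open_vimage[THEN iffD1, rule_format] smooth_on_continuous) (auto dest: smooth_onD_open)
    ultimately show ?case by simp
  qed simp
qed

text \<open>The generating sets make the frame charts continuous, and
  \<open>frame_bundle_open_image\<close> makes them open.\<close>

lemma smooth_atlas_frame_bundle: "smooth_atlas (frame_bundle M)"
  unfolding smooth_atlas_def
proof (intro conjI ballI)
  show "fin_dim TYPE((real^'n) \<times> (real^'n^'n))" by (rule fin_dim_euclidean)
  show "(\<Union>k\<in>atlas (frame_bundle M). fst k) = points (frame_bundle M)"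
    unfolding points_frame_bundle_aux by (simp add: frame_bundle_def frame_chart_simps(1)) blast
  fix k assume "k \<in> atlas (frame_bundle M)"
  then obtain c where c: "c \<in> atlas M" and k: "k = frame_chart M c" by (auto simp: frame_bundle_def)
  have gen: "openin (tops (frame_bundle M)) {w \<in> fst k. snd k w \<in> V}" if "open V" for V
    unfolding frame_bundle_def mfd.simps k using c that by (intro topology_generated_by_Basis) blast
  show o: "openin (tops (frame_bundle M)) (fst k)" using gen[of UNIV] by simp
  show op: "open (snd k ` fst k)" using frame_bundle_open_image[OF o c] k by simp
  have ts: "topspace (subtopology (tops (frame_bundle M)) (fst k)) = fst k"
    using openin_subset[OF o] by auto
  show "homeomorphic_map (subtopology (tops (frame_bundle M)) (fst k)) (top_of_set (snd k ` fst k)) (snd k)"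
  proof (rule bijective_open_imp_homeomorphic_map)
    have "continuous_map (subtopology (tops (frame_bundle M)) (fst k)) euclidean (snd k)"
      unfolding continuous_map_def ts
    proof (intro conjI allI impI)
      fix V :: "((real^'n) \<times> (real^'n^'n)) set" assume "openin euclidean V"
      then show "openin (subtopology (tops (frame_bundle M)) (fst k)) {w \<in> fst k. snd k w \<in> V}"
        using gen[of V] by (auto simp: openin_subtopology)
    qed auto
    then show "continuous_map (subtopology (tops (frame_bundle M)) (fst k)) (top_of_set (snd k ` fst k)) (snd k)"
      using ts by (simp add: continuous_map_in_subtopology)
    show "open_map (subtopology (tops (frame_bundle M)) (fst k)) (top_of_set (snd k ` fst k)) (snd k)"
      unfolding open_map_def
    proof (intro allI impI)
      fix U assume "openin (subtopology (tops (frame_bundle M)) (fst k)) U"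
      then have "openin (tops (frame_bundle M)) U" "U \<subseteq> fst k"
        using openin_trans_full[OF _ o] openin_subset[of "subtopology (tops (frame_bundle M)) (fst k)" U] ts by auto
      then have "open (snd k ` U)" using frame_bundle_open_image[OF _ c, of U] k by (simp add: Int_absorb1)
      then show "openin (top_of_set (snd k ` fst k)) (snd k ` U)"
        using \<open>U \<subseteq> fst k\<close> by (auto simp: openin_open)
    qed
    show "snd k ` topspace (subtopology (tops (frame_bundle M)) (fst k)) = topspace (top_of_set (snd k ` fst k))"
      unfolding ts by simp
    show "inj_on (snd k) (topspace (subtopology (tops (frame_bundle M)) (fst k)))"
      unfolding ts using frame_chart_inj[OF c] k by simp
  qed
  fix l assume "l \<in> atlas (frame_bundle M)"
  then obtain d where d: "d \<in> atlas M" and l: "l = frame_chart M d" by (auto simp: frame_bundle_def)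
  have "fst k \<inter> fst l = {w \<in> fst (frame_chart M c). fst w \<in> fst d}"
    by (auto simp: k l frame_chart_simps)
  then show "smooth_on (snd k ` (fst k \<inter> fst l)) (snd l \<circ> cinv k)"
    using frame_transition_smooth[OF c d] frame_chart_image[OF c] k l by simp
qed

lemma frame_chart_at:
  "c \<in> charts_at M (fst w) \<Longrightarrow> w \<in> frames M \<Longrightarrow> frame_chart M c \<in> charts_at (frame_bundle M) w"
  by (simp add: charts_at_iff frame_bundle_def frame_chart_simps)

end

section \<open>The fundamental form and the connection form in coordinates\<close>

lemma fmat_right_action: "fmat c (right_action w a) = fmat c w ** a"
  by (rule matrix_eq_columnsI) (simp add: column_fmat column_matrix_mult right_action_def frame_map_chart)

lemma fst_right_action: "fst (right_action w a) = fst w"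
  by (simp add: right_action_def)

lemma column_mat_one: "column j (mat 1 :: real^'n::finite^'n) = axis j 1"
  by (simp add: column_def mat_def axis_def vec_eq_iff)

lemma column_add: "column j (A + B) = column j A + column j B"
  by (simp add: column_def vec_eq_iff)

lemma right_action_one: "right_action w (mat 1) = w"
  by (simp add: right_action_def column_mat_one frame_map_axis prod_eq_iff)

context
  fixes M :: "('m, real^'n::finite) mfd"
  assumes M: "smooth_atlas M"
begin

private abbreviation (input) "P \<equiv> frame_bundle M"

private lemma P: "smooth_atlas P"
  by (rule smooth_atlas_frame_bundle[OF M])

lemma charts_at_frame_bundle:
  assumes "k \<in> charts_at P w"
  obtains c where "c \<in> charts_at M (fst w)" "k = frame_chart M c" "w \<in> frames M"
  using assms by (auto simp: charts_at_iff frame_bundle_def frame_chart_simps)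

lemma open_frame_range: "c \<in> atlas M \<Longrightarrow> open (snd c ` fst c \<times> {X :: real^'n^'n. invertible X})"
  by (intro open_Times open_invertible chart_open_image[OF M _ chart_openin[OF M]]) auto

lemma fst_cinv_frame_chart:
  fixes p :: "(real^'n) \<times> (real^'n^'n)"
  assumes "c \<in> atlas M" "p \<in> snd c ` fst c \<times> {X. invertible X}"
  shows "fst p = (snd c \<circ> fst \<circ> cinv (frame_chart M c)) p"
  using assms local_frame_in(3)[OF M assms(1), of "fst p" "snd p"] cinv_frame_chart[OF M assms]
    chart_cinv[OF M assms(1)] by auto

lemma
  assumes w: "w \<in> frames M" and c: "c \<in> charts_at M (fst w)"
  shows fst_has_derivative: "((snd c \<circ> fst \<circ> cinv (frame_chart M c)) has_derivative fst) (at (snd (frame_chart M c) w))"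
    and smooth_near_fst: "smooth_near P M fst w"
proof -
  note c' = c[unfolded charts_at_iff]
  note k = frame_chart_at[OF M c w]
  have kw: "snd (frame_chart M c) w \<in> snd c ` fst c \<times> {X. invertible X}"
    using c' frames_invertible[OF M w c] by (simp add: frame_chart_simps)
  note op = open_frame_range[OF c'[THEN conjunct1]]
  show "((snd c \<circ> fst \<circ> cinv (frame_chart M c)) has_derivative fst) (at (snd (frame_chart M c) w))"
    by (rule has_derivative_transform_within_open[OF bounded_linear_imp_has_derivative[OF bounded_linear_fst] op kw])
      (rule fst_cinv_frame_chart[OF c'[THEN conjunct1]])
  show "smooth_near P M fst w"
  proof (rule smooth_nearI[where F=fst, OF k c kw])
    show "snd c ` fst c \<times> {X. invertible X} \<subseteq> snd (frame_chart M c) ` {y \<in> fst (frame_chart M c). fst y \<in> fst c}"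
      using frame_chart_image[OF M c'[THEN conjunct1], of "fst c"] by simp
    show "smooth_on (snd c ` fst c \<times> {X. invertible X}) (snd c \<circ> fst \<circ> cinv (frame_chart M c))"
      by (rule smooth_on_cong[OF smooth_on_bounded_linear[OF op bounded_linear_fst]])
        (rule fst_cinv_frame_chart[OF c'[THEN conjunct1]])
  qed
qed

text \<open>In frame coordinates (z, X) this is X \<theta> = dz.\<close>

lemma fundamental_form_chart:
  assumes w: "w \<in> frames M" and c: "c \<in> charts_at M (fst w)" and Z: "Z \<in> tangent_space P w"
  shows "fmat c w *v fundamental_form M w Z = fst (Z (frame_chart M c))"
proof -
  let ?V = "tangent_map P M fst w Z"
  have V: "?V \<in> tangent_space M (fst w)"
    by (rule tangent_map_in_tangent_space[OF P M smooth_near_fst[OF w c] Z])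
  have "bij_betw (frame_map (snd w)) UNIV (tangent_space M (fst w))"
    using w by (auto simp: frames_def)
  then have "frame_map (snd w) (fundamental_form M w Z) = ?V"
    unfolding fundamental_form_def using V by (intro f_inv_into_f) (auto simp: bij_betw_def)
  then have "fmat c w *v fundamental_form M w Z = ?V c"
    using frame_map_chart[of w "fundamental_form M w Z" c] by simp
  also have "\<dots> = fst (Z (frame_chart M c))"
    by (rule tangent_map_has_derivative[OF P Z frame_chart_at[OF M c w] c fst_has_derivative[OF w c]])
  finally show ?thesis .
qed

lemma vertical_curve_has_derivative:
  "((\<lambda>t. (z, X ** (mat 1 + t *\<^sub>R A))) has_derivative (\<lambda>h. h *\<^sub>R (0, X ** A))) (at 0)"
  for z :: "real^'n" and X A :: "real^'n^'n"
proof -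
  have "((\<lambda>t. (z, X) + t *\<^sub>R (0, X ** A)) has_derivative (\<lambda>h. h *\<^sub>R (0, X ** A))) (at 0)"
    by (auto intro!: derivative_eq_intros)
  then show ?thesis by (simp add: matrix_linear_simps)
qed

lemma fundamental_vector_chart:
  assumes w: "w \<in> frames M" and c: "c \<in> charts_at M (fst w)"
  shows "fundamental_vector M A w (frame_chart M c) = (0, fmat c w ** A)"
proof -
  have "snd (frame_chart M c) \<circ> (\<lambda>t. right_action w (mat 1 + t *\<^sub>R A))
      = (\<lambda>t. (snd c (fst w), fmat c w ** (mat 1 + t *\<^sub>R A)))"
    by (simp add: fun_eq_iff frame_chart_simps fst_right_action fmat_right_action)
  then have "vector_derivative (snd (frame_chart M c) \<circ> (\<lambda>t. right_action w (mat 1 + t *\<^sub>R A))) (at 0) = (0, fmat c w ** A)"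
    using vertical_curve_has_derivative by (intro vector_derivative_at) (simp add: has_vector_derivative_def)
  then show ?thesis
    using frame_chart_at[OF M c w] by (simp add: fundamental_vector_def velocity_def right_action_one)
qed

text \<open>The transformation law holds because the same curve is differentiated in two charts:
  once through the transition map and once through its explicit second coordinate
  expression.\<close>

lemma fundamental_vector_in:
  assumes w: "w \<in> frames M"
  shows "fundamental_vector M A w \<in> tangent_space P w"
  unfolding tangent_space_def
proof (intro CollectI conjI ballI allI impI)
  show "fundamental_vector M A w k = 0" if "k \<notin> charts_at P w" for k
    using that by (simp add: fundamental_vector_def velocity_def right_action_one)
  fix k l assume k: "k \<in> charts_at P w" and l: "l \<in> charts_at P w"
  obtain c where c: "c \<in> charts_at M (fst w)" "k = frame_chart M c" using charts_at_frame_bundle[OF k] by blast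
  obtain d where d: "d \<in> charts_at M (fst w)" "l = frame_chart M d" using charts_at_frame_bundle[OF l] by blast
  note c' = c(1)[unfolded charts_at_iff] and d' = d(1)[unfolded charts_at_iff]
  define z where "z = snd c (fst w)"
  define X where "X = fmat c w"
  define \<alpha> where "\<alpha> t = (z, X ** (mat 1 + t *\<^sub>R A))" for t :: real
  define g where "g = snd l \<circ> cinv k"
  define S where "S = snd c ` (fst c \<inter> fst d) \<times> {X :: real^'n^'n. invertible X}"
  have \<alpha>0: "\<alpha> 0 = snd k w" by (simp add: \<alpha>_def z_def X_def c frame_chart_simps)
  have \<alpha>': "(\<alpha> has_derivative (\<lambda>h. h *\<^sub>R (0, X ** A))) (at t)" for t
  proof -
    have "((\<lambda>t. (z, X) + t *\<^sub>R (0, X ** A)) has_derivative (\<lambda>h. h *\<^sub>R (0, X ** A))) (at t)"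
      by (auto intro!: derivative_eq_intros)
    then show ?thesis by (simp add: \<alpha>_def[abs_def] matrix_linear_simps)
  qed
  have "open S"
    unfolding S_def using c' d' smooth_onD_open[OF transition_smooth[OF M]] by (intro open_Times open_invertible) blast
  moreover have "continuous_on UNIV \<alpha>"
    using \<alpha>' has_derivative_continuous by (intro continuous_at_imp_continuous_on) blast
  ultimately have o: "open (\<alpha> -` S)" by (intro open_vimage)
  have "\<alpha> 0 \<in> S"
    using c' d' frames_invertible[OF M w c(1)] by (auto simp: S_def \<alpha>_def z_def X_def)
  have "(g has_derivative frechet_derivative g (at (snd k w))) (at (\<alpha> 0))"
    unfolding \<alpha>0 g_def by (rule transition_has_derivative[OF P k l])
  from has_derivative_compose[OF \<alpha>' this]
  have 1: "((\<lambda>t. g (\<alpha> t)) has_derivative (\<lambda>h. frechet_derivative g (at (snd k w)) (h *\<^sub>R (0, X ** A)))) (at 0)" .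
  have "((\<lambda>t. ((snd d \<circ> cinv c) z, fmat d w ** (mat 1 + t *\<^sub>R A))) has_derivative (\<lambda>h. h *\<^sub>R (0, fmat d w ** A))) (at 0)"
    by (rule vertical_curve_has_derivative)
  then have 2: "((\<lambda>t. g (\<alpha> t)) has_derivative (\<lambda>h. h *\<^sub>R (0, fmat d w ** A))) (at 0)"
  proof (rule has_derivative_transform_within_open[OF _ o])
    fix t assume "t \<in> \<alpha> -` S"
    then have "g (\<alpha> t) = ((snd d \<circ> cinv c) z, jacobian c d z ** (X ** (mat 1 + t *\<^sub>R A)))"
      using frame_transition[OF M c'[THEN conjunct1] d'[THEN conjunct1], of "\<alpha> t"]
      by (simp add: g_def c(2) d(2) S_def) (simp add: \<alpha>_def)
    then show "((snd d \<circ> cinv c) z, fmat d w ** (mat 1 + t *\<^sub>R A)) = g (\<alpha> t)"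
      using fmat_transition[OF M w c(1) d(1)] by (simp add: z_def X_def matrix_mul_assoc)
  qed (use \<open>\<alpha> 0 \<in> S\<close> in simp)
  from fun_cong[OF has_derivative_unique[OF 1 2], of 1]
  show "fundamental_vector M A w l = frechet_derivative (snd l \<circ> cinv k) (at (snd k w)) (fundamental_vector M A w k)"
    unfolding c(2) d(2) fundamental_vector_chart[OF w c(1)] fundamental_vector_chart[OF w d(1)]
    by (simp add: g_def X_def c(2) d(2))
qed

text \<open>The section of frames with constant coordinates through \<open>w\<close> computes the connection form on
  a complement of the vertical vectors.\<close>

lemma connection_form_chart:
  assumes \<omega>: "connection_form M cov \<omega>"
    and w: "w \<in> frames M" and c: "c \<in> charts_at M (fst w)" and Z: "Z \<in> tangent_space P w"
  shows "fmat c w *v column j (\<omega> w Z) = column j (snd (Z (frame_chart M c)))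
    + christoffel M cov c (snd c (fst w)) (fst (Z (frame_chart M c))) (column j (fmat c w))"
proof -
  let ?k = "frame_chart M c"
  define X where "X = fmat c w"
  define v where "v = fst (Z ?k)"
  define A where "A = snd (Z ?k)"
  define \<sigma> where "\<sigma> x = (x, \<lambda>j. tvec M c x (column j X))" for x
  note c' = c[unfolded charts_at_iff]
  have X: "invertible X" unfolding X_def by (rule frames_invertible[OF M w c])
  have \<sigma>lf: "\<sigma> x = local_frame M c (snd c x, X)" if "x \<in> fst c" for x
    using that c' by (simp add: \<sigma>_def local_frame_def chart_cinv[OF M])
  have \<sigma>in: "\<sigma> x \<in> fst ?k" "snd ?k (\<sigma> x) = (snd c x, X)" if "x \<in> fst c" for x
    using local_frame_in[OF M, of c "snd c x" X] that c' X \<sigma>lf by auto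
  have \<sigma>w: "\<sigma> (fst w) = w"
    using \<sigma>lf[of "fst w"] local_frame_chart(1)[OF M, of c w] w c' by (simp add: frame_chart_simps X_def)
  have chart: "(snd ?k \<circ> \<sigma> \<circ> cinv c) z = (z, X)" if "z \<in> snd c ` fst c" for z
    using that \<sigma>in(2) c' by (auto simp: chart_cinv[OF M])
  have oc: "open (snd c ` fst c)" using c' chart_open_image[OF M _ chart_openin[OF M]] by blast
  have L: "bounded_linear (\<lambda>z. (z, 0) :: (real^'n) \<times> (real^'n^'n))"
    by (intro bounded_linear_Pair bounded_linear_ident bounded_linear_zero)
  have "smooth_on (snd c ` fst c) (\<lambda>z. (z, X))"
    by (intro smooth_on_Pair smooth_on_ident smooth_on_const oc)
  then have sm: "smooth_on (snd c ` fst c) (snd ?k \<circ> \<sigma> \<circ> cinv c)"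
    by (rule smooth_on_cong) (simp only: chart)
  have near: "smooth_near M P \<sigma> x" if x: "x \<in> fst c" for x
  proof (rule smooth_nearI[where F=\<sigma> and T="snd c ` fst c", OF _ _ _ _ sm])
    show "c \<in> charts_at M x" "?k \<in> charts_at P (\<sigma> x)"
      using x c' \<sigma>in(1)[OF x] by (auto simp: charts_at_iff frame_bundle_def)
    show "snd c ` fst c \<subseteq> snd c ` {y \<in> fst c. \<sigma> y \<in> fst ?k}" using \<sigma>in(1) by auto
  qed (use x in auto)
  have d\<sigma>: "((snd ?k \<circ> \<sigma> \<circ> cinv c) has_derivative (\<lambda>v. (v, 0))) (at (snd c (fst w)))"
  proof (rule has_derivative_transform_within_open[OF _ oc])
    show "((\<lambda>z. (z, X)) has_derivative (\<lambda>v. (v, 0))) (at (snd c (fst w)))"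
      by (auto intro!: derivative_eq_intros)
  qed (use c' chart in auto)
  define V where "V = tvec M c (fst w) v"
  have V: "V \<in> tangent_space M (fst w)" "V c = v"
    unfolding V_def by (rule tvec_in_tangent_space[OF M c], rule tvec_chart[OF M c])
  let ?H = "tangent_map M P \<sigma> (fst w) V"
  have k: "?k \<in> charts_at P w" by (rule frame_chart_at[OF M c w])
  have H: "?H \<in> tangent_space P w"
    using tangent_map_in_tangent_space[OF M P near V(1)] c' \<sigma>w by simp
  have Hk: "?H ?k = (v, 0)"
    using tangent_map_has_derivative[OF M V(1) c _ d\<sigma>, of P] k \<sigma>w V(2) by simp
  have "smooth_map (open_submfd M (fst c)) P \<sigma>"
    using c' near by (intro smooth_map_open_submfdI M P chart_openin[OF M]) auto
  moreover have "openin (tops M) (fst c)" "\<forall>x\<in>fst c. fst (\<sigma> x) = x"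
    using c' chart_openin[OF M] by (auto simp: \<sigma>_def)
  ultimately have "cov (fst w) V (\<lambda>y. snd (\<sigma> y) j) = frame_map (snd (\<sigma> (fst w))) (column j (\<omega> (\<sigma> (fst w)) ?H))"
    using \<omega>[unfolded connection_form_def, THEN conjunct2, THEN conjunct2, THEN conjunct2, THEN conjunct2,
        THEN spec, THEN spec, THEN mp, THEN bspec, THEN bspec, THEN spec, of "fst c" \<sigma> "fst w" V j] V c' by blast
  then have "cov (fst w) V (\<lambda>y. snd (\<sigma> y) j) c = X *v column j (\<omega> w ?H)"
    using \<sigma>w frame_map_chart[of w] by (simp add: X_def)
  moreover have "cov (fst w) V (\<lambda>y. snd (\<sigma> y) j) c = christoffel M cov c (snd c (fst w)) v (column j X)"
    using c' by (simp add: christoffel_def V_def \<sigma>_def chart_cinv[OF M])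
  ultimately have \<omega>H: "X *v column j (\<omega> w ?H) = christoffel M cov c (snd c (fst w)) v (column j X)" by simp
  \<comment> \<open>The matrix is chosen so that this vertical vector has components (0, A), the
    part of Z that the lift with components (v, 0) misses.\<close>
  let ?F = "fundamental_vector M (matrix_inv X ** A) w"
  have F: "?F \<in> tangent_space P w" by (rule fundamental_vector_in[OF w])
  have "Z = (\<lambda>d. 1 *\<^sub>R ?H d + 1 *\<^sub>R ?F d)"
  proof (rule tangent_space_eqI[OF P Z tangent_space_lincomb[OF P H F] k])
    show "Z ?k = 1 *\<^sub>R ?H ?k + 1 *\<^sub>R ?F ?k"
      unfolding Hk fundamental_vector_chart[OF w c]
      by (simp add: v_def A_def X_def[symmetric] matrix_mul_assoc matrix_inv_mult[OF X] prod_eq_iff)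
  qed
  moreover have "\<omega> w (\<lambda>d. 1 *\<^sub>R ?H d + 1 *\<^sub>R ?F d) = 1 *\<^sub>R \<omega> w ?H + 1 *\<^sub>R \<omega> w ?F"
    using \<omega>[unfolded connection_form_def, THEN conjunct1] w H F by blast
  moreover have "\<omega> w ?F = matrix_inv X ** A"
    using \<omega>[unfolded connection_form_def, THEN conjunct2, THEN conjunct2, THEN conjunct1] w by blast
  ultimately have "\<omega> w Z = \<omega> w ?H + matrix_inv X ** A" by simp
  then have "X *v column j (\<omega> w Z) = X *v column j (\<omega> w ?H) + X *v (matrix_inv X *v column j A)"
    by (simp only: column_add matrix_linear_simps column_matrix_mult)
  then show ?thesis
    by (simp add: \<omega>H matrix_vector_mul_assoc matrix_mul_assoc matrix_inv_mult[OF X] X_def[symmetric] v_def[symmetric] A_def[symmetric])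
qed

end

section \<open>The developing map on frames\<close>

lemma Ck_on_inverse:
  fixes f :: "'a::real_normed_vector \<Rightarrow> real"
  assumes "Ck_on k f S" "open S" "\<And>x. x \<in> S \<Longrightarrow> f x \<noteq> 0"
  shows "Ck_on k (\<lambda>x. inverse (f x)) S"
  using assms(1)
proof (induction k)
  case 0
  then show ?case using assms(3) by (auto intro: continuous_intros)
next
  case (Suc k)
  note I = Suc.IH[OF Ck_on_Suc_imp[OF Suc.prems]]
  note m = Ck_on_bounded_bilinear[OF bounded_bilinear_mult _ _ assms(2)]
  have "Ck_on k (\<lambda>x. - (inverse (f x) * frechet_derivative f (at x) v * inverse (f x))) S" for v
    by (rule Ck_on_bounded_linear_compose[OF bounded_linear_minus[OF bounded_linear_ident]
          m[OF m[OF I Ck_on_Suc_derivative[OF Suc.prems]] I] assms(2)])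
  from Ck_on_SucI[OF assms(2) Deriv.has_derivative_inverse[OF assms(3) Ck_on_Suc_has_derivative[OF Suc.prems]] this]
  show ?case .
qed

text \<open>By Cramer's rule the entries of the inverse are quotients of determinants, which are
  polynomials in the entries of X.\<close>

lemma smooth_on_matrix_inv: "smooth_on {X :: real^'n::finite^'n. invertible X} matrix_inv"
proof -
  let ?S = "{X :: real^'n^'n. invertible X}"
  have sdet: "smooth_on ?S (\<lambda>X. det (\<chi> i j. h i j X))" if "\<And>i j. smooth_on ?S (h i j)" for h :: "'n \<Rightarrow> 'n \<Rightarrow> real^'n^'n \<Rightarrow> real"
  proof -
    have "smooth_on ?S (\<lambda>X. \<Sum>p | p permutes UNIV. of_int (sign p) * (\<Prod>i\<in>UNIV. h i (p i) X))"
      by (intro smooth_on_sum smooth_on_mult smooth_on_prod that smooth_on_const open_invertible)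
    then show ?thesis by (simp add: det_def)
  qed
  have nth: "smooth_on ?S (\<lambda>X. X $ i $ j)" for i j
    by (intro smooth_on_vec_nth smooth_on_ident open_invertible)
  have "smooth_on ?S (\<lambda>X. inverse (det (\<chi> i j. X $ i $ j)))"
    using sdet[of "\<lambda>i j X. X $ i $ j", OF nth] unfolding smooth_on_def
    by (auto intro!: Ck_on_inverse simp: invertible_det_nz)
  moreover have "smooth_on ?S (\<lambda>X. det (\<chi> i j. if j = k then axis l 1 $ i else X $ i $ j))" for k l
  proof (rule sdet)
    show "smooth_on ?S (\<lambda>X. if j = k then axis l 1 $ i else X $ i $ j)" for i j
      by (cases "j = k") (simp_all add: nth smooth_on_const open_invertible)
  qed
  ultimately have "smooth_on ?S (\<lambda>X. \<chi> k l. det (\<chi> i j. if j = k then axis l 1 $ i else X $ i $ j) * inverse (det (\<chi> i j. X $ i $ j)))"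
    by (intro smooth_on_vec smooth_on_mult open_invertible)
  then show ?thesis
  proof (rule smooth_on_cong)
    fix X :: "real^'n^'n" assume "X \<in> ?S"
    then have X: "invertible X" by simp
    have "matrix_inv X *v axis l 1 = (\<chi> k. det (\<chi> i j. if j = k then axis l 1 $ i else X $ i $ j) / det X)" for l
      using X cramer[of X "matrix_inv X *v axis l 1" "axis l 1"]
      by (simp add: invertible_det_nz matrix_vector_mul_assoc matrix_inv_mult)
    then have "column l (matrix_inv X) = (\<chi> k. det (\<chi> i j. if j = k then axis l 1 $ i else X $ i $ j) / det X)" for l
      by (simp add: matrix_vector_mult_basis)
    then show "(\<chi> k l. det (\<chi> i j. if j = k then axis l 1 $ i else X $ i $ j) * inverse (det (\<chi> i j. X $ i $ j))) = matrix_inv X"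
      by (simp add: column_def vec_eq_iff divide_inverse)
  qed
qed

text \<open>Differentiability of the inverse is already known, so the formula follows by
  differentiating the product G y ** \<open>matrix_inv\<close> (G y) = 1.\<close>

lemma has_derivative_matrix_inv:
  fixes G :: "'a::real_normed_vector \<Rightarrow> real^'n::finite^'n"
  assumes G: "(G has_derivative G') (at x)" and inv: "\<And>y. y \<in> N \<Longrightarrow> invertible (G y)" and N: "open N" "x \<in> N"
  shows "((\<lambda>y. matrix_inv (G y)) has_derivative (\<lambda>h. - (matrix_inv (G x) ** G' h ** matrix_inv (G x)))) (at x)"
proof -
  define I where "I y = matrix_inv (G y)" for y
  obtain I' where I: "(I has_derivative I') (at x)"
    using has_derivative_compose[OF G smooth_on_has_derivative[OF smooth_on_matrix_inv]] inv N(2)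
    unfolding I_def[abs_def] by blast
  have GI: "G y ** I y = mat 1" "I y ** G y = mat 1" if "y \<in> N" for y
    using matrix_inv_mult[OF inv[OF that]] by (simp_all add: I_def)
  have "((\<lambda>y. G y ** I y) has_derivative (\<lambda>h. G x ** I' h + G' h ** I x)) (at x)"
    by (rule bounded_bilinear.FDERIV[OF bounded_bilinear_matrix_mult G I])
  moreover have "((\<lambda>y. G y ** I y) has_derivative (\<lambda>h. 0)) (at x)"
    by (rule has_derivative_transform_within_open[OF has_derivative_const[of "mat 1"] N]) (simp add: GI)
  ultimately have "G x ** I' h + G' h ** I x = 0" for h
    using has_derivative_unique by (metis (no_types, lifting))
  then have "I x ** (G x ** I' h) = I x ** (- (G' h ** I x))" for h
    by (metis add_eq_0_iff2)
  then have "I' = (\<lambda>h. - (I x ** G' h ** I x))"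
    by (simp add: fun_eq_iff matrix_mul_assoc GI[OF N(2)] bounded_bilinear.minus_right[OF bounded_bilinear_matrix_mult])
  then show ?thesis using I by (simp add: I_def[abs_def])
qed

definition aff_mult :: "(real^'n::finite) \<times> (real^'n^'n) \<Rightarrow> (real^'n) \<times> (real^'n^'n) \<Rightarrow> (real^'n) \<times> (real^'n^'n)" where
  "aff_mult p q = (fst p + snd p *v fst q, snd p ** snd q)"

text \<open>A map \<open>D\<close> into the affine group with \<open>D\<^sup>-\<^sup>1 dD = (\<theta>, \<omega>)\<close> on \<open>U\<close>.\<close>

definition development :: "('m, real^'n::finite) mfd \<Rightarrow> (('m, 'n) frame \<Rightarrow> ('m, 'n) frame_tvec \<Rightarrow> real^'n^'n) \<Rightarrow>
    ('m, real^'n) chart \<Rightarrow> ('m, 'n) frame set \<Rightarrow> (('m, 'n) frame \<Rightarrow> (real^'n) \<times> (real^'n^'n)) \<Rightarrow> bool" where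
  "development M \<omega> c U D \<longleftrightarrow> c \<in> atlas M \<and> openin (tops (frame_bundle M)) U \<and> U \<subseteq> fst (frame_chart M c) \<and>
     smooth_on (snd (frame_chart M c) ` U) (D \<circ> cinv (frame_chart M c)) \<and>
     (\<forall>w\<in>U. invertible (snd (D w)) \<and> (\<forall>Z\<in>tangent_space (frame_bundle M) w.
        frechet_derivative (D \<circ> cinv (frame_chart M c)) (at (snd (frame_chart M c) w)) (Z (frame_chart M c))
        = (snd (D w) *v fundamental_form M w Z, snd (D w) ** \<omega> w Z)))"

text \<open>With f and B from \<open>ex_development\<close> and D(z, X) = (f z, B z X), the
  differential is (B dz, B dX + B \<Gamma>(dz) X). Since dz = X \<theta> and dX + \<Gamma>(dz) X = X
  \<omega>, this is (B X \<theta>, B X \<omega>). The initial matrix B z0 is inverse to the matrix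
  of u, which normalizes D u to the unit.\<close>

lemma (in flat_manifold) ex_frame_development:
  assumes \<omega>: "connection_form M cov \<omega>" and u: "u \<in> frames M"
  shows "\<exists>c U D. u \<in> U \<and> development M \<omega> c U D \<and> D u = (0, mat 1)"
proof -
  note P = smooth_atlas_frame_bundle[OF M]
  obtain c where cu: "c \<in> charts_at M (fst u)" using ex_chart[OF M frames_points[OF M u]] by blast
  note c = cu[unfolded charts_at_iff, THEN conjunct1]
  let ?k = "frame_chart M c"
  define z0 where "z0 = snd c (fst u)"
  note Xu = frames_invertible[OF M u cu]
  have "z0 \<in> snd c ` fst c" "invertible (matrix_inv (fmat c u))"
    using cu matrix_inv_mult[OF Xu] by (auto simp: z0_def charts_at_iff invertible_def)
  from ex_development[OF c this] obtain r f B where r: "r > 0" "ball z0 r \<subseteq> snd c ` fst c"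
    and f0: "f z0 = 0" "B z0 = matrix_inv (fmat c u)"
    and sm: "smooth_on (ball z0 r) f" "smooth_on (ball z0 r) B"
    and d: "\<forall>z\<in>ball z0 r. invertible (B z) \<and> (f has_derivative (\<lambda>v. B z *v v)) (at z) \<and>
      (B has_derivative (\<lambda>v. B z ** \<Gamma>m c z v)) (at z)"
    by blast
  \<comment> \<open>All frames over the coordinate ball: D is linear in X, so the matrix coordinate
    needs no bound.\<close>
  define U where "U = {w \<in> fst ?k. snd ?k w \<in> ball z0 r \<times> UNIV}"
  define Dc where "Dc p = (f (fst p), B (fst p) ** snd p)" for p :: "(real^'n) \<times> (real^'n^'n)"
  define D where "D w = Dc (snd ?k w)" for w
  have k: "?k \<in> atlas (frame_bundle M)" using c by (simp add: frame_bundle_def)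
  have oU: "openin (tops (frame_bundle M)) U"
    unfolding U_def by (rule chart_open_preimage[OF P k]) (intro open_Times open_ball open_UNIV)
  have Uk: "U \<subseteq> fst ?k" by (auto simp: U_def)
  have oi: "open (snd ?k ` U)" by (rule chart_open_image[OF P k oU Uk])
  have DDc: "Dc p = (D \<circ> cinv ?k) p" if "p \<in> snd ?k ` U" for p
    using that cinv_image[OF P k Uk] by (simp add: D_def)
  have sub: "snd ?k ` U \<subseteq> ball z0 r \<times> UNIV" by (auto simp: U_def)
  have "smooth_on (ball z0 r \<times> (UNIV :: (real^'n^'n) set)) Dc"
    unfolding Dc_def[abs_def]
    by (rule smooth_on_Pair[OF smooth_on_compose_fst[OF sm(1) open_UNIV] smooth_on_matrix_mult[OF
            smooth_on_compose_fst[OF sm(2) open_UNIV] smooth_on_bounded_linear[OF _ bounded_linear_snd]]])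
      (intro open_Times open_ball open_UNIV)
  from smooth_on_subset[OF this sub oi] have smD: "smooth_on (snd ?k ` U) (D \<circ> cinv ?k)"
    by (rule smooth_on_cong) (rule DDc)
  have "invertible (snd (D w)) \<and> (\<forall>Z\<in>tangent_space (frame_bundle M) w.
        frechet_derivative (D \<circ> cinv ?k) (at (snd ?k w)) (Z ?k)
        = (snd (D w) *v fundamental_form M w Z, snd (D w) ** \<omega> w Z))" if w: "w \<in> U" for w
  proof -
    define z where "z = snd c (fst w)"
    define X where "X = fmat c w"
    have wf: "w \<in> frames M" "fst w \<in> fst c" "z \<in> ball z0 r" using w by (auto simp: U_def frame_chart_simps z_def)
    then have wc: "c \<in> charts_at M (fst w)" using c by (simp add: charts_at_iff)
    have zc: "z \<in> snd c ` fst c" using wf(3) r(2) by blast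
    have kw: "snd ?k w = (z, X)" by (simp add: frame_chart_simps z_def X_def)
    note X = frames_invertible[OF M wf(1) wc, folded X_def]
    have Dw: "D w = (f z, B z ** X)" by (simp add: D_def Dc_def kw)
    note dz = d[THEN bspec, OF wf(3)]
    have "(Dc has_derivative (\<lambda>q. (B z *v fst q, B z ** snd q + B z ** \<Gamma>m c z (fst q) ** X))) (at (z, X))"
      unfolding Dc_def[abs_def]
    proof (rule has_derivative_Pair)
      have fst': "(fst has_derivative fst) (at (z, X))" "(snd has_derivative snd) (at (z, X))"
        by (intro bounded_linear_imp_has_derivative bounded_linear_fst bounded_linear_snd)+
      show "((\<lambda>p. f (fst p)) has_derivative (\<lambda>q. B z *v fst q)) (at (z, X))"
        by (rule has_derivative_compose[OF fst'(1)]) (use dz in simp)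
      have "((\<lambda>p. B (fst p)) has_derivative (\<lambda>q. B z ** \<Gamma>m c z (fst q))) (at (z, X))"
        by (rule has_derivative_compose[OF fst'(1)]) (use dz in simp)
      from bounded_bilinear.FDERIV[OF bounded_bilinear_matrix_mult this fst'(2)]
      show "((\<lambda>p. B (fst p) ** snd p) has_derivative (\<lambda>q. B z ** snd q + B z ** \<Gamma>m c z (fst q) ** X)) (at (z, X))"
        by simp
    qed
    then have "((D \<circ> cinv ?k) has_derivative (\<lambda>q. (B z *v fst q, B z ** snd q + B z ** \<Gamma>m c z (fst q) ** X))) (at (z, X))"
      by (rule has_derivative_transform_within_open[OF _ oi imageI[OF w, of "snd ?k", unfolded kw] DDc])
    note D' = frechet_derivative_eqI[OF this]
    have "frechet_derivative (D \<circ> cinv ?k) (at (snd ?k w)) (Z ?k)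
        = (snd (D w) *v fundamental_form M w Z, snd (D w) ** \<omega> w Z)" if Z: "Z \<in> tangent_space (frame_bundle M) w" for Z
    proof -
      have "X ** \<omega> w Z = snd (Z ?k) + \<Gamma>m c z (fst (Z ?k)) ** X"
        by (rule matrix_eq_columnsI)
          (simp add: column_add column_matrix_mult christoffel_matrix_vector[OF c zc]
            connection_form_chart[OF M \<omega> wf(1) wc Z, folded z_def X_def])
      then have "B z ** X ** \<omega> w Z = B z ** snd (Z ?k) + B z ** \<Gamma>m c z (fst (Z ?k)) ** X"
        by (simp add: matrix_mul_assoc[symmetric] matrix_add_ldistrib)
      moreover have "(B z ** X) *v fundamental_form M w Z = B z *v fst (Z ?k)"
        using fundamental_form_chart[OF M wf(1) wc Z] by (simp add: X_def matrix_vector_mul_assoc[symmetric])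
      ultimately show ?thesis by (simp add: kw D' Dw)
    qed
    moreover have "invertible (B z ** X)" using dz X by (simp add: invertible_mult)
    ultimately show ?thesis by (simp add: Dw)
  qed
  moreover have "D u = (0, mat 1)"
    using f0 by (simp add: D_def Dc_def frame_chart_simps z0_def[symmetric] matrix_inv_mult[OF Xu])
  moreover have "u \<in> U" using r(1) u cu by (simp add: U_def frame_chart_simps z0_def charts_at_iff)
  ultimately show ?thesis
    unfolding development_def using c oU Uk smD by blast
qed

text \<open>Both \<open>D\<close> and \<open>D \<circ> F\<close> have the logarithmic derivative \<open>(\<theta>, \<omega>)\<close>.\<close>

lemma development_automorphism:
  fixes F :: "('m, 'n::finite) frame \<Rightarrow> ('m, 'n) frame"
  assumes M: "smooth_atlas M" and D: "development M \<omega> c U D"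
    and N: "open N" "convex N" "N \<subseteq> snd (frame_chart M c) ` U"
    and FN: "\<And>w. w \<in> U \<Longrightarrow> snd (frame_chart M c) w \<in> N \<Longrightarrow> F w \<in> U \<and> smooth_near (frame_bundle M) (frame_bundle M) F w"
    and pres: "\<And>w Z. w \<in> U \<Longrightarrow> Z \<in> tangent_space (frame_bundle M) w \<Longrightarrow>
      \<omega> (F w) (tangent_map (frame_bundle M) (frame_bundle M) F w Z) = \<omega> w Z \<and>
      fundamental_form M (F w) (tangent_map (frame_bundle M) (frame_bundle M) F w Z) = fundamental_form M w Z"
    and u: "u \<in> U" "snd (frame_chart M c) u \<in> N" "D u = (0, mat 1)"
    and w: "w \<in> U" "snd (frame_chart M c) w \<in> N"
  shows "D (F w) = aff_mult (D (F u)) (D w)"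
proof -
  let ?k = "frame_chart M c" and ?P = "frame_bundle M"
  note P = smooth_atlas_frame_bundle[OF M]
  note D' = D[unfolded development_def]
  have k: "?k \<in> atlas ?P" using D' by (simp add: frame_bundle_def)
  have Uk: "U \<subseteq> fst ?k" and smD: "smooth_on (snd ?k ` U) (D \<circ> cinv ?k)" using D' by blast+
  have kU: "?k \<in> charts_at ?P w" if "w \<in> U" for w using k Uk that by (auto simp: charts_at_iff)
  define G where "G p = D (cinv ?k p)" for p
  define E where "E p = D (F (cinv ?k p))" for p
  define Z where "Z p q = tvec ?P ?k (cinv ?k p) q" for p q
  define t where "t p q = fundamental_form M (cinv ?k p) (Z p q)" for p q
  define m where "m p q = \<omega> (cinv ?k p) (Z p q)" for p q
  have pN: "cinv ?k p \<in> U" "snd ?k (cinv ?k p) = p" "F (cinv ?k p) \<in> U" "smooth_near ?P ?P F (cinv ?k p)" if "p \<in> N" for p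
  proof -
    show p: "cinv ?k p \<in> U" "snd ?k (cinv ?k p) = p"
      using cinv_image[OF P k Uk subsetD[OF N(3) that]] by blast+
    show "F (cinv ?k p) \<in> U" "smooth_near ?P ?P F (cinv ?k p)"
      using FN[OF p(1)] that unfolding p(2) by blast+
  qed
  have ZT: "Z p q \<in> tangent_space ?P (cinv ?k p)" "Z p q ?k = q" if "p \<in> N" for p q
    using tvec_in_tangent_space[OF P kU[OF pN(1)[OF that]]] tvec_chart[OF P kU[OF pN(1)[OF that]]] by (simp_all add: Z_def)
  have logD: "((D \<circ> cinv ?k) has_derivative frechet_derivative (D \<circ> cinv ?k) (at (snd ?k w))) (at (snd ?k w))"
    "Z \<in> tangent_space ?P w \<Longrightarrow> frechet_derivative (D \<circ> cinv ?k) (at (snd ?k w)) (Z ?k)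
      = (snd (D w) *v fundamental_form M w Z, snd (D w) ** \<omega> w Z)"
    "invertible (snd (D w))" if "w \<in> U" for w Z
    using smooth_on_has_derivative[OF smD] D' that by blast+
  have G': "(G has_derivative (\<lambda>q. (snd (G p) *v t p q, snd (G p) ** m p q))) (at p)" if p: "p \<in> N" for p
  proof (rule has_derivative_eq_rhs)
    show "(G has_derivative frechet_derivative (D \<circ> cinv ?k) (at p)) (at p)"
      using logD(1)[OF pN(1)[OF p]] pN(2)[OF p] by (simp add: G_def[abs_def] comp_def)
    show "frechet_derivative (D \<circ> cinv ?k) (at p) = (\<lambda>q. (snd (G p) *v t p q, snd (G p) ** m p q))"
      using logD(2)[OF pN(1)[OF p] ZT(1)[OF p]] pN(2)[OF p] ZT(2)[OF p] by (simp add: G_def t_def m_def fun_eq_iff)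
  qed
  have E': "(E has_derivative (\<lambda>q. (snd (E p) *v t p q, snd (E p) ** m p q))) (at p)" if p: "p \<in> N" for p
  proof -
    define w where "w = cinv ?k p"
    note pw = pN[OF p, folded w_def]
    have kF: "?k \<in> charts_at ?P (F w)" by (rule kU[OF pw(3)])
    have "((snd ?k \<circ> F \<circ> cinv ?k) has_derivative frechet_derivative (snd ?k \<circ> F \<circ> cinv ?k) (at (snd ?k w))) (at p)"
      using smooth_near_has_derivative[OF P P pw(4) kU[OF pw(1)] kF] pw(2) by simp
    moreover have "((D \<circ> cinv ?k) has_derivative frechet_derivative (D \<circ> cinv ?k) (at (snd ?k (F w)))) (at ((snd ?k \<circ> F \<circ> cinv ?k) p))"
      using logD(1)[OF pw(3)] by (simp add: w_def)
    ultimately have "((\<lambda>p. (D \<circ> cinv ?k) ((snd ?k \<circ> F \<circ> cinv ?k) p)) has_derivative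
        (\<lambda>q. frechet_derivative (D \<circ> cinv ?k) (at (snd ?k (F w))) (frechet_derivative (snd ?k \<circ> F \<circ> cinv ?k) (at (snd ?k w)) q))) (at p)"
      by (rule has_derivative_compose)
    moreover have "frechet_derivative (snd ?k \<circ> F \<circ> cinv ?k) (at (snd ?k w)) q = tangent_map ?P ?P F w (Z p q) ?k" for q
      using tangent_map_chart[OF P P pw(4) _ kU[OF pw(1)] kF, of "Z p q"] ZT[OF p, of q] by (simp add: w_def)
    moreover have "frechet_derivative (D \<circ> cinv ?k) (at (snd ?k (F w))) (tangent_map ?P ?P F w (Z p q) ?k)
        = (snd (E p) *v t p q, snd (E p) ** m p q)" for q
      using logD(2)[OF pw(3) tangent_map_in_tangent_space[OF P P pw(4)], of "Z p q"] pres[OF pw(1), of "Z p q"] ZT(1)[OF p, of q]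
      by (simp add: w_def E_def t_def m_def)
    ultimately have "((\<lambda>p. (D \<circ> cinv ?k) ((snd ?k \<circ> F \<circ> cinv ?k) p)) has_derivative
        (\<lambda>q. (snd (E p) *v t p q, snd (E p) ** m p q))) (at p)" by simp
    then show ?thesis
    proof (rule has_derivative_transform_within_open[OF _ N(1) p])
      fix p assume "p \<in> N"
      then have "F (cinv ?k p) \<in> fst ?k" using pN(3) Uk by blast
      then show "(D \<circ> cinv ?k) ((snd ?k \<circ> F \<circ> cinv ?k) p) = E p"
        using chart_cinv[OF P k] by (simp add: E_def)
    qed
  qed
  \<comment> \<open>The linear parts of E and G solve the same equation dY = Y m. The two terms in
    the derivative of this quotient cancel, and convexity of N makes the quotient constant.\<close>
  define K where "K p = snd (E p) ** matrix_inv (snd (G p))" for p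
  have invG: "invertible (snd (G p))" if "p \<in> N" for p using logD(3)[OF pN(1)[OF that]] by (simp add: G_def)
  have "(K has_derivative (\<lambda>q. 0)) (at p within N)" if p: "p \<in> N" for p
  proof -
    note I = matrix_inv_mult[OF invG[OF p]]
    have "((\<lambda>p. matrix_inv (snd (G p))) has_derivative
        (\<lambda>q. - (matrix_inv (snd (G p)) ** (snd (G p) ** m p q) ** matrix_inv (snd (G p))))) (at p)"
      using has_derivative_matrix_inv[OF has_derivative_snd[OF G'[OF p]] invG N(1) p] by simp
    from bounded_bilinear.FDERIV[OF bounded_bilinear_matrix_mult has_derivative_snd[OF E'[OF p]] this]
    have "(K has_derivative (\<lambda>q. snd (E p) ** (- (matrix_inv (snd (G p)) ** (snd (G p) ** m p q) ** matrix_inv (snd (G p))))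
        + snd (E p) ** m p q ** matrix_inv (snd (G p)))) (at p)"
      by (simp add: K_def[abs_def])
    then have "(K has_derivative (\<lambda>q. 0)) (at p)"
      by (simp add: matrix_mul_assoc I bounded_bilinear.minus_right[OF bounded_bilinear_matrix_mult])
    then show ?thesis by (rule has_derivative_at_withinI)
  qed
  from has_derivative_zero_constant[OF N(2) this] obtain K0 where K0: "\<And>p. p \<in> N \<Longrightarrow> K p = K0" by blast
  have EG: "snd (E p) = K0 ** snd (G p)" if p: "p \<in> N" for p
    using K0[OF p, symmetric] by (simp add: K_def matrix_mul_assoc[symmetric] matrix_inv_mult[OF invG[OF p]])
  \<comment> \<open>Since snd E = K0 ** snd G, the derivative of fst E is K0 applied to that of fst
    G.\<close>
  have "((\<lambda>p. fst (E p) - K0 *v fst (G p)) has_derivative (\<lambda>q. 0)) (at p within N)" if p: "p \<in> N" for p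
  proof -
    have "((\<lambda>p. fst (E p) - K0 *v fst (G p)) has_derivative (\<lambda>q. fst (snd (E p) *v t p q, snd (E p) ** m p q)
        - K0 *v fst (snd (G p) *v t p q, snd (G p) ** m p q))) (at p)"
      by (intro has_derivative_diff has_derivative_fst E'[OF p] G'[OF p]
          bounded_linear.has_derivative[OF bounded_bilinear.bounded_linear_right[OF bounded_bilinear_matrix_vector_mult]])
    then show ?thesis
      using EG[OF p] by (simp add: matrix_vector_mul_assoc has_derivative_at_withinI)
  qed
  from has_derivative_zero_constant[OF N(2) this] obtain b where b: "\<And>p. p \<in> N \<Longrightarrow> fst (E p) - K0 *v fst (G p) = b" by blast
  have ck: "cinv ?k (snd ?k w) = w" if "w \<in> U" for w using chart_cinv[OF P k] Uk that by blast
  \<comment> \<open>Evaluation at u, where D is the unit, identifies both constants.\<close>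
  have "K0 = snd (D (F u))" "b = fst (D (F u))"
    using EG[OF u(2)] b[OF u(2)] u by (simp_all add: E_def G_def ck)
  then show ?thesis
    using EG[OF w(2)] b[OF w(2)] w by (simp add: E_def G_def ck aff_mult_def prod_eq_iff algebra_simps)
qed

section \<open>Extension of local homomorphisms of simply connected groups\<close>

lemma (in group) mult_cancel_left:
  assumes "x \<in> carrier G" "y \<in> carrier G"
  shows "inv x \<otimes> (x \<otimes> y) = y" "x \<otimes> (inv x \<otimes> y) = y"
  using assms by (simp_all add: m_assoc[symmetric])

text \<open>The function r is total, and in \<open>r_mult\<close> only the factors lie in V; their
  product may leave it. Two small increments can therefore be combined without shrinking V.\<close>

locale local_group_hom =
  H: group H + A: group A for H (structure) and A (structure) +
  fixes T :: "'a topology" and r :: "'a \<Rightarrow> 'b" and V :: "'a set"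
  assumes topspace: "topspace T = carrier H"
    and continuous_mult: "continuous_map (prod_topology T T) T (\<lambda>(g, h). g \<otimes> h)"
    and continuous_inv: "continuous_map T T (\<lambda>g. inv g)"
    and V: "openin T V" "\<one> \<in> V"
    and r_closed: "v \<in> V \<Longrightarrow> r v \<in> carrier A"
    and r_mult: "g \<in> V \<Longrightarrow> h \<in> V \<Longrightarrow> r (g \<otimes> h) = r g \<otimes>\<^bsub>A\<^esub> r h"
begin

lemma V_carrier: "v \<in> V \<Longrightarrow> v \<in> carrier H"
  using V(1) openin_subset topspace by blast

lemma r_one: "r \<one> = \<one>\<^bsub>A\<^esub>"
  using r_mult[OF V(2) V(2)] r_closed[OF V(2)] A.l_cancel_one by auto

text \<open>A discrete substitute for integrating a logarithmic derivative: increments of \<Delta>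
  are the images under r of increments of K, uniformly for close parameters. The increments inv (K
  z) \<otimes> K z' are left invariant, so developments can be translated from the left.\<close>

definition develops :: "'z::metric_space set \<Rightarrow> ('z \<Rightarrow> 'a) \<Rightarrow> ('z \<Rightarrow> 'b) \<Rightarrow> bool" where
  "develops Q K \<Delta> \<longleftrightarrow> (\<forall>z\<in>Q. K z \<in> carrier H \<and> \<Delta> z \<in> carrier A) \<and>
     (\<exists>e>0. \<forall>z\<in>Q. \<forall>z'\<in>Q. dist z z' < e \<longrightarrow>
        inv (K z) \<otimes> K z' \<in> V \<and> \<Delta> z' = \<Delta> z \<otimes>\<^bsub>A\<^esub> r (inv (K z) \<otimes> K z'))"

lemma developsD: "develops Q K \<Delta> \<Longrightarrow> z \<in> Q \<Longrightarrow> K z \<in> carrier H" "develops Q K \<Delta> \<Longrightarrow> z \<in> Q \<Longrightarrow> \<Delta> z \<in> carrier A"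
  by (auto simp: develops_def)

lemma developsI:
  assumes "\<And>z. z \<in> Q \<Longrightarrow> K z \<in> carrier H" "\<And>z. z \<in> Q \<Longrightarrow> \<Delta> z \<in> carrier A" "e > 0"
    "\<And>z z'. z \<in> Q \<Longrightarrow> z' \<in> Q \<Longrightarrow> dist z z' < e \<Longrightarrow> inv (K z) \<otimes> K z' \<in> V"
    "\<And>z z'. z \<in> Q \<Longrightarrow> z' \<in> Q \<Longrightarrow> dist z z' < e \<Longrightarrow> \<Delta> z' = \<Delta> z \<otimes>\<^bsub>A\<^esub> r (inv (K z) \<otimes> K z')"
  shows "develops Q K \<Delta>"
  unfolding develops_def
  by (intro conjI ballI exI[of _ e] impI; (rule assms; assumption))

lemma developsE:
  assumes "develops Q K \<Delta>"
  obtains e where "e > 0" "\<And>z z'. z \<in> Q \<Longrightarrow> z' \<in> Q \<Longrightarrow> dist z z' < e \<Longrightarrow> inv (K z) \<otimes> K z' \<in> V"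
    "\<And>z z'. z \<in> Q \<Longrightarrow> z' \<in> Q \<Longrightarrow> dist z z' < e \<Longrightarrow> \<Delta> z' = \<Delta> z \<otimes>\<^bsub>A\<^esub> r (inv (K z) \<otimes> K z')"
  using assms unfolding develops_def by blast

lemma map_carrier: "continuous_map (top_of_set Q) T K \<Longrightarrow> z \<in> Q \<Longrightarrow> K z \<in> carrier H"
  using topspace by (auto simp: continuous_map_def)

lemma continuous_map_mult:
  assumes "continuous_map X T f" "continuous_map X T g"
  shows "continuous_map X T (\<lambda>x. f x \<otimes> g x)"
  using continuous_map_compose[OF _ continuous_mult, of X "\<lambda>x. (f x, g x)"] assms
  by (simp add: continuous_map_pairwise comp_def)

lemma continuous_map_inv: "continuous_map X T f \<Longrightarrow> continuous_map X T (\<lambda>x. inv (f x))"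
  using continuous_map_compose[OF _ continuous_inv, of X f] by (simp add: comp_def)

lemma continuous_map_reparam:
  assumes "continuous_map (top_of_set Q) T K" "continuous_on Q' f" "f ` Q' \<subseteq> Q"
  shows "continuous_map (top_of_set Q') T (\<lambda>z. K (f z))"
proof -
  have "continuous_map (top_of_set Q') (top_of_set Q) f"
    using assms(2,3) by (auto simp: continuous_map_in_subtopology)
  from continuous_map_compose[OF this assms(1)] show ?thesis by (simp add: comp_def)
qed

text \<open>The compact diagonal is at positive distance from the closed set of pairs whose
  increment is outside V.\<close>

lemma uniform_increments:
  fixes Q :: "'z::euclidean_space set"
  assumes Q: "compact Q" and K: "continuous_map (top_of_set Q) T K"
  shows "\<exists>e>0. \<forall>z\<in>Q. \<forall>z'\<in>Q. dist z z' < e \<longrightarrow> inv (K z) \<otimes> K z' \<in> V"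
proof -
  let ?\<Phi> = "\<lambda>p. inv (K (fst p)) \<otimes> K (snd p)"
  have "continuous_map (top_of_set (Q \<times> Q)) T ?\<Phi>"
    by (intro continuous_map_mult continuous_map_inv continuous_map_reparam[OF K]) (auto intro: continuous_intros)
  from openin_continuous_map_preimage[OF this V(1)]
  have "openin (top_of_set (Q \<times> Q)) {p \<in> Q \<times> Q. ?\<Phi> p \<in> V}" by simp
  then have "closedin (top_of_set (Q \<times> Q)) (Q \<times> Q - {p \<in> Q \<times> Q. ?\<Phi> p \<in> V})"
    using closedin_diff[OF closedin_topspace, of "top_of_set (Q \<times> Q)"] by simp
  then have C: "closed (Q \<times> Q - {p \<in> Q \<times> Q. ?\<Phi> p \<in> V})"
    using closedin_closed_eq compact_imp_closed[OF compact_Times[OF Q Q]] by blast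
  have "compact ((\<lambda>z. (z, z)) ` Q)"
    by (intro compact_continuous_image Q continuous_intros)
  moreover note C
  moreover have "(\<lambda>z. (z, z)) ` Q \<inter> (Q \<times> Q - {p \<in> Q \<times> Q. ?\<Phi> p \<in> V}) = {}"
    using map_carrier[OF K] V(2) by auto
  ultimately have "\<exists>d>0. \<forall>x\<in>(\<lambda>z. (z, z)) ` Q. \<forall>y\<in>Q \<times> Q - {p \<in> Q \<times> Q. ?\<Phi> p \<in> V}. d \<le> dist x y"
    by (rule separate_compact_closed)
  then obtain d where d: "d > 0"
    "\<And>x y. x \<in> (\<lambda>z. (z, z)) ` Q \<Longrightarrow> y \<in> Q \<times> Q - {p \<in> Q \<times> Q. ?\<Phi> p \<in> V} \<Longrightarrow> d \<le> dist x y"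
    by blast
  show ?thesis
  proof (intro exI[of _ d] conjI ballI impI)
    fix z z' assume z: "z \<in> Q" "z' \<in> Q" "dist z z' < d"
    then show "inv (K z) \<otimes> K z' \<in> V"
      using d(2)[of "(z, z)" "(z, z')"] by (auto simp: dist_Pair_Pair)
  qed (rule d)
qed

lemma increment_mult:
  assumes "x \<in> carrier H" "y \<in> carrier H" "z \<in> carrier H" "inv x \<otimes> y \<in> V" "inv y \<otimes> z \<in> V"
  shows "r (inv x \<otimes> z) = r (inv x \<otimes> y) \<otimes>\<^bsub>A\<^esub> r (inv y \<otimes> z)"
proof -
  have "inv x \<otimes> z = (inv x \<otimes> y) \<otimes> (inv y \<otimes> z)"
    using assms(1-3) by (simp add: H.m_assoc H.mult_cancel_left)
  then show ?thesis using r_mult[OF assms(4,5)] by simp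
qed

text \<open>The development of \<open>z\<close> is accumulated along the segment from 0 to \<open>z\<close>.\<close>

lemma ex_develops:
  fixes Q :: "'z::euclidean_space set"
  assumes Q: "compact Q" "convex Q" "0 \<in> Q" and K: "continuous_map (top_of_set Q) T K"
  shows "\<exists>\<Delta>. develops Q K \<Delta> \<and> \<Delta> 0 = \<one>\<^bsub>A\<^esub>"
proof -
  obtain e where e: "e > 0" "\<And>z z'. z \<in> Q \<Longrightarrow> z' \<in> Q \<Longrightarrow> dist z z' < e \<Longrightarrow> inv (K z) \<otimes> K z' \<in> V"
    using uniform_increments[OF Q(1) K] by metis
  obtain b where b: "\<And>z. z \<in> Q \<Longrightarrow> norm z \<le> b"
    using compact_imp_bounded[OF Q(1)] by (auto simp: bounded_iff)
  \<comment> \<open>Makes the mesh of each subdivided segment smaller than e / 2. If the ends z and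
    z' are also closer than e / 2, then node i on one segment is closer than e to nodes i and i + 1
    on the other.\<close>
  obtain N :: nat where N: "real N > 2 * b / e" using reals_Archimedean2 by blast
  define N' where "N' = Suc N"
  have N': "real N' > 0" "z \<in> Q \<Longrightarrow> norm z / real N' < e / 2" for z
  proof -
    show "real N' > 0" by (simp add: N'_def)
    assume "z \<in> Q"
    then have "norm z \<le> b" by (rule b)
    also have "b < e / 2 * real N'" using N e by (simp add: N'_def field_simps)
    finally show "norm z / real N' < e / 2" by (simp add: N'_def field_simps)
  qed
  define p where "p i z = (real i / real N') *\<^sub>R z" for i and z :: 'z
  have pQ: "p i z \<in> Q" if "z \<in> Q" "i \<le> N'" for i z
    using convexD_alt[OF Q(2,3) that(1), of "real i / real N'"] that(2) N'(1) by (simp add: p_def)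
  have pK: "K (p i z) \<in> carrier H" if "z \<in> Q" "i \<le> N'" for i z using map_carrier[OF K pQ[OF that]] .
  define c where "c z z' = r (inv (K z) \<otimes> K z')" for z z'
  define \<Delta> where "\<Delta> z = rec_nat \<one>\<^bsub>A\<^esub> (\<lambda>i a. a \<otimes>\<^bsub>A\<^esub> c (p i z) (p (Suc i) z))" for z
  have \<Delta>: "\<Delta> z 0 = \<one>\<^bsub>A\<^esub>" "\<Delta> z (Suc i) = \<Delta> z i \<otimes>\<^bsub>A\<^esub> c (p i z) (p (Suc i) z)" for z i
    by (simp_all add: \<Delta>_def)
  have close: "dist (p i z) (p j z') < e" if "z \<in> Q" "z' \<in> Q" "dist z z' < e / 2" "i \<le> N'" "j = i \<or> j = Suc i" for i j z z'
  proof -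
    have "dist (p i z) (p i z') = real i / real N' * dist z z'"
      by (simp add: p_def dist_norm scaleR_diff_right[symmetric])
    also have "\<dots> \<le> dist z z'" using that(4) N'(1) by (intro mult_left_le_one_le) auto
    finally have 1: "dist (p i z) (p i z') < e / 2" using that by simp
    have "p (Suc i) z' - p i z' = (1 / real N') *\<^sub>R z'"
      by (simp add: p_def scaleR_diff_left[symmetric] add_divide_distrib)
    then have "dist (p i z') (p (Suc i) z') = norm z' / real N'"
      unfolding dist_norm norm_minus_commute[of "p i z'"] by simp
    then have "dist (p i z') (p (Suc i) z') < e / 2" using N'(2)[OF that(2)] by simp
    then show ?thesis
      using 1 that(5) e(1) dist_triangle[of "p i z" "p (Suc i) z'" "p i z'"] by auto
  qed
  have inc: "inv (K (p i z)) \<otimes> K (p j z') \<in> V"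
    if "z \<in> Q" "z' \<in> Q" "dist z z' < e / 2" "i \<le> N'" "j \<le> N'" "j = i \<or> j = Suc i" for i j z z'
    using e(2)[OF pQ pQ close] that by blast
  have \<Delta>A: "i \<le> N' \<Longrightarrow> \<Delta> z i \<in> carrier A" if "z \<in> Q" for z i
  proof (induction i)
    case (Suc i)
    have "inv (K (p i z)) \<otimes> K (p (Suc i) z) \<in> V" using inc[of z z i "Suc i"] that e(1) Suc.prems by simp
    then show ?case using Suc r_closed by (simp add: \<Delta> c_def)
  qed (simp add: \<Delta>)
  \<comment> \<open>A ladder with rungs from \<open>p i z\<close> to \<open>p i z'\<close>. In each
    cell both ways around equal the increment along the diagonal from \<open>p i z\<close> to
    \<open>p (Suc i) z'\<close>, so the comparison moves from one rung to the next.\<close>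
  have main: "i \<le> N' \<Longrightarrow> \<Delta> z' i = \<Delta> z i \<otimes>\<^bsub>A\<^esub> c (p i z) (p i z')"
    if z: "z \<in> Q" "z' \<in> Q" "dist z z' < e / 2" for z z' i
  proof (induction i)
    case 0
    have "K 0 \<in> carrier H" using map_carrier[OF K Q(3)] .
    then show ?case by (simp add: \<Delta> p_def c_def r_one)
  next
    case (Suc i)
    then have i: "i \<le> N'" by simp
    have zz: "dist z z < e / 2" "dist z' z' < e / 2" using e by simp_all
    note V1 = inc[OF z(1,2,3) i i] inc[OF z(2,2) zz(2) i Suc.prems] inc[OF z(1,1) zz(1) i Suc.prems]
      inc[OF z(1,2,3) Suc.prems Suc.prems]
    note car = pK[OF z(1) i] pK[OF z(2) i] pK[OF z(1) Suc.prems] pK[OF z(2) Suc.prems]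
    note cl = \<Delta>A[OF z(1) i] r_closed V1
    have "\<Delta> z' (Suc i) = \<Delta> z i \<otimes>\<^bsub>A\<^esub> (c (p i z) (p i z') \<otimes>\<^bsub>A\<^esub> c (p i z') (p (Suc i) z'))"
      using Suc.IH[OF i] cl by (simp add: \<Delta> c_def A.m_assoc)
    also have "c (p i z) (p i z') \<otimes>\<^bsub>A\<^esub> c (p i z') (p (Suc i) z') = c (p i z) (p (Suc i) z')"
      unfolding c_def by (rule increment_mult[symmetric]) (use car V1 in auto)
    also have "\<dots> = c (p i z) (p (Suc i) z) \<otimes>\<^bsub>A\<^esub> c (p (Suc i) z) (p (Suc i) z')"
      unfolding c_def by (rule increment_mult) (use car V1 in auto)
    finally show ?case using cl by (simp add: \<Delta> c_def A.m_assoc)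
  qed
  have pN: "p N' z = z" for z using N'(1) by (simp add: p_def)
  show ?thesis
  proof (intro exI[of _ "\<lambda>z. \<Delta> z N'"] conjI)
    show "develops Q K (\<lambda>z. \<Delta> z N')"
    proof (rule developsI)
      show "e / 2 > 0" using e by simp
      fix z z' assume z: "z \<in> Q" "z' \<in> Q" "dist z z' < e / 2"
      show "inv (K z) \<otimes> K z' \<in> V" using e(2)[OF z(1,2)] z(3) e(1) by simp
      show "\<Delta> z' N' = \<Delta> z N' \<otimes>\<^bsub>A\<^esub> r (inv (K z) \<otimes> K z')"
        using main[OF z order_refl] by (simp only: pN c_def)
    qed (use map_carrier[OF K] \<Delta>A in auto)
    have "K 0 \<in> carrier H" using map_carrier[OF K Q(3)] .
    then have "\<Delta> 0 i = \<one>\<^bsub>A\<^esub>" for i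
      by (induction i) (simp_all add: \<Delta> p_def c_def r_one)
    then show "\<Delta> 0 N' = \<one>\<^bsub>A\<^esub>" .
  qed
qed

text \<open>The factor 2 admits curves in the unit square both of whose coordinates are 1-Lipschitz,
  such as the diagonal.\<close>

lemma develops_reparam:
  assumes "develops Q K \<Delta>" "f ` Q' \<subseteq> Q" "\<And>s t. s \<in> Q' \<Longrightarrow> t \<in> Q' \<Longrightarrow> dist (f s) (f t) \<le> 2 * dist s t"
  shows "develops Q' (\<lambda>t. K (f t)) (\<lambda>t. \<Delta> (f t))"
proof -
  obtain e where e: "e > 0" "\<And>z z'. z \<in> Q \<Longrightarrow> z' \<in> Q \<Longrightarrow> dist z z' < e \<Longrightarrow> inv (K z) \<otimes> K z' \<in> V"
    "\<And>z z'. z \<in> Q \<Longrightarrow> z' \<in> Q \<Longrightarrow> dist z z' < e \<Longrightarrow> \<Delta> z' = \<Delta> z \<otimes>\<^bsub>A\<^esub> r (inv (K z) \<otimes> K z')"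
    by (rule developsE[OF assms(1)]) (rule that)
  have fQ: "f t \<in> Q" if "t \<in> Q'" for t using assms(2) that by blast
  have d: "dist (f s) (f t) < e" if "s \<in> Q'" "t \<in> Q'" "dist s t < e / 2" for s t
    using assms(3)[OF that(1,2)] that(3) by simp
  show ?thesis
  proof (rule developsI)
    show "e / 2 > 0" using e by simp
  qed (use e(2,3)[OF fQ fQ d] developsD[OF assms(1) fQ] in blast)+
qed

lemma develops_translate:
  assumes "develops Q K \<Delta>" "x \<in> carrier H" "a \<in> carrier A"
  shows "develops Q (\<lambda>z. x \<otimes> K z) (\<lambda>z. a \<otimes>\<^bsub>A\<^esub> \<Delta> z)"
proof -
  have "inv (x \<otimes> K z) \<otimes> (x \<otimes> K z') = inv (K z) \<otimes> K z'" if "z \<in> Q" "z' \<in> Q" for z z'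
    using developsD(1)[OF assms(1)] that assms(2)
    by (simp add: H.inv_mult_group H.m_assoc H.mult_cancel_left)
  note eq = this
  obtain e where e: "e > 0" "\<And>z z'. z \<in> Q \<Longrightarrow> z' \<in> Q \<Longrightarrow> dist z z' < e \<Longrightarrow> inv (K z) \<otimes> K z' \<in> V"
    "\<And>z z'. z \<in> Q \<Longrightarrow> z' \<in> Q \<Longrightarrow> dist z z' < e \<Longrightarrow> \<Delta> z' = \<Delta> z \<otimes>\<^bsub>A\<^esub> r (inv (K z) \<otimes> K z')"
    by (rule developsE[OF assms(1)]) (rule that)
  show ?thesis
  proof (rule developsI[OF _ _ e(1)])
    fix z z' assume z: "z \<in> Q" "z' \<in> Q" "dist z z' < e"
    show "inv (x \<otimes> K z) \<otimes> (x \<otimes> K z') \<in> V" using eq[OF z(1,2)] e(2)[OF z] by simp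
    have "a \<otimes>\<^bsub>A\<^esub> \<Delta> z' = a \<otimes>\<^bsub>A\<^esub> (\<Delta> z \<otimes>\<^bsub>A\<^esub> r (inv (K z) \<otimes> K z'))" by (simp only: e(3)[OF z])
    then show "a \<otimes>\<^bsub>A\<^esub> \<Delta> z' = a \<otimes>\<^bsub>A\<^esub> \<Delta> z \<otimes>\<^bsub>A\<^esub> r (inv (x \<otimes> K z) \<otimes> (x \<otimes> K z'))"
      using eq[OF z(1,2)] A.m_assoc[OF assms(3) developsD(2)[OF assms(1) z(1)] r_closed[OF e(2)[OF z]]] by simp
  qed (use developsD[OF assms(1)] assms(2,3) in auto)
qed

text \<open>Both developments are multiplied on the right by the same increments, which cancel in
  the quotient; it is locally constant on a connected set. Equal initial values are not imposed,
  since the argument for loops compares two edges of a square.\<close>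

lemma develops_unique:
  assumes "connected Q" "develops Q K \<Delta>1" "develops Q K' \<Delta>2" "\<And>z. z \<in> Q \<Longrightarrow> K' z = K z" "z \<in> Q" "z' \<in> Q"
  shows "\<Delta>1 z \<otimes>\<^bsub>A\<^esub> inv\<^bsub>A\<^esub> (\<Delta>2 z) = \<Delta>1 z' \<otimes>\<^bsub>A\<^esub> inv\<^bsub>A\<^esub> (\<Delta>2 z')"
proof (rule connected_local_const[OF assms(1,5,6)], intro ballI)
  fix z assume z: "z \<in> Q"
  obtain e1 where e1: "e1 > 0" "\<And>z z'. z \<in> Q \<Longrightarrow> z' \<in> Q \<Longrightarrow> dist z z' < e1 \<Longrightarrow> inv (K z) \<otimes> K z' \<in> V"
    "\<And>z z'. z \<in> Q \<Longrightarrow> z' \<in> Q \<Longrightarrow> dist z z' < e1 \<Longrightarrow> \<Delta>1 z' = \<Delta>1 z \<otimes>\<^bsub>A\<^esub> r (inv (K z) \<otimes> K z')"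
    by (rule developsE[OF assms(2)]) (rule that)
  obtain e2 where e2: "e2 > 0" "\<And>z z'. z \<in> Q \<Longrightarrow> z' \<in> Q \<Longrightarrow> dist z z' < e2 \<Longrightarrow> inv (K' z) \<otimes> K' z' \<in> V"
    "\<And>z z'. z \<in> Q \<Longrightarrow> z' \<in> Q \<Longrightarrow> dist z z' < e2 \<Longrightarrow> \<Delta>2 z' = \<Delta>2 z \<otimes>\<^bsub>A\<^esub> r (inv (K' z) \<otimes> K' z')"
    by (rule developsE[OF assms(3)]) (rule that)
  have "\<Delta>1 z \<otimes>\<^bsub>A\<^esub> inv\<^bsub>A\<^esub> (\<Delta>2 z) = \<Delta>1 z' \<otimes>\<^bsub>A\<^esub> inv\<^bsub>A\<^esub> (\<Delta>2 z')"
    if z': "z' \<in> Q" "dist z z' < min e1 e2" for z'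
  proof -
    define c where "c = r (inv (K z) \<otimes> K z')"
    have d: "\<Delta>1 z' = \<Delta>1 z \<otimes>\<^bsub>A\<^esub> c" "\<Delta>2 z' = \<Delta>2 z \<otimes>\<^bsub>A\<^esub> c" "c \<in> carrier A"
      using e1(2,3)[OF z z'(1)] e2(3)[OF z z'(1)] z'(2) assms(4)[OF z] assms(4)[OF z'(1)] r_closed
      unfolding c_def by simp_all
    moreover have "\<Delta>1 z \<in> carrier A" "\<Delta>2 z \<in> carrier A" using developsD(2) assms(2,3) z by blast+
    ultimately show ?thesis
      by (simp add: A.inv_mult_group A.m_assoc A.mult_cancel_left)
  qed
  then show "\<forall>\<^sub>F z' in at z within Q. \<Delta>1 z \<otimes>\<^bsub>A\<^esub> inv\<^bsub>A\<^esub> (\<Delta>2 z) = \<Delta>1 z' \<otimes>\<^bsub>A\<^esub> inv\<^bsub>A\<^esub> (\<Delta>2 z')"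
    unfolding eventually_at using e1(1) e2(1)
    by (intro exI[of _ "min e1 e2"]) (auto simp: dist_commute)
qed

lemma develops_eq:
  assumes "connected Q" "develops Q K \<Delta>1" "develops Q K' \<Delta>2" "\<And>z. z \<in> Q \<Longrightarrow> K' z = K z"
    "z0 \<in> Q" "\<Delta>1 z0 = \<Delta>2 z0" "z \<in> Q"
  shows "\<Delta>1 z = \<Delta>2 z"
proof -
  note c = developsD(2)[OF assms(2)] developsD(2)[OF assms(3)]
  have "\<Delta>1 z \<otimes>\<^bsub>A\<^esub> inv\<^bsub>A\<^esub> (\<Delta>2 z) = \<one>\<^bsub>A\<^esub>"
    using develops_unique[OF assms(1-4,7,5)] assms(6) c[OF assms(5)] by simp
  then show ?thesis using c[OF assms(7)] by (metis A.inv_closed A.inv_equality A.inv_inv)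
qed

text \<open>A relation, since the value a may a priori depend on the path; simple connectedness
  later makes it a function of x.\<close>

definition extends :: "'a \<Rightarrow> 'b \<Rightarrow> bool" where
  "extends x a \<longleftrightarrow> (\<exists>\<gamma> \<delta>. pathin T \<gamma> \<and> \<gamma> 0 = \<one> \<and> \<gamma> 1 = x \<and>
     develops {0..1::real} \<gamma> \<delta> \<and> \<delta> 0 = \<one>\<^bsub>A\<^esub> \<and> \<delta> 1 = a)"

abbreviation "square \<equiv> {0..1::real} \<times> {0..1::real}"

lemma square: "compact square" "convex square" "0 \<in> square"
  by (auto intro: compact_Times convex_Times simp: zero_prod_def)

lemma extends_closed: "extends x a \<Longrightarrow> x \<in> carrier H \<and> a \<in> carrier A"
  unfolding extends_def using developsD[of "{0..1::real}" _ _ 1] by auto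

lemma develops_square:
  assumes "develops square K \<Delta>" "\<And>s t. \<bar>f s - f t\<bar> \<le> \<bar>s - t\<bar>" "\<And>s t. \<bar>g s - g t\<bar> \<le> \<bar>s - t\<bar>"
    "\<And>t. t \<in> {0..1} \<Longrightarrow> f t \<in> {0..1}" "\<And>t. t \<in> {0..1} \<Longrightarrow> g t \<in> {0..1}"
  shows "develops {0..1} (\<lambda>t. K (f t, g t)) (\<lambda>t. \<Delta> (f t, g t))"
proof (rule develops_reparam[OF assms(1)])
  fix s t :: real
  have "dist (f s, g s) (f t, g t) \<le> \<bar>f s - f t\<bar> + \<bar>g s - g t\<bar>"
    using sqrt_sum_squares_le_sum_abs[of "f s - f t" "g s - g t"] by (simp add: dist_Pair_Pair dist_real_def)
  then show "dist (f s, g s) (f t, g t) \<le> 2 * dist s t"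
    using assms(2,3)[of s t] by (simp add: dist_real_def)
qed (use assms(4,5) in auto)

text \<open>Develop the map (s, t) \<mapsto> \<gamma>1 s \<otimes> \<gamma>2 t on the square. Along
  the bottom and right edges the far corner receives the product of the values a and b, while along
  the diagonal it is the value of a path from the unit to x \<otimes> y.\<close>

lemma extends_mult:
  assumes "extends x a" "extends y b"
  shows "extends (x \<otimes> y) (a \<otimes>\<^bsub>A\<^esub> b)"
proof -
  obtain \<gamma>1 \<delta>1 where 1: "pathin T \<gamma>1" "\<gamma>1 0 = \<one>" "\<gamma>1 1 = x" "develops {0..1} \<gamma>1 \<delta>1" "\<delta>1 0 = \<one>\<^bsub>A\<^esub>" "\<delta>1 1 = a"
    using assms(1) unfolding extends_def by blast
  obtain \<gamma>2 \<delta>2 where 2: "pathin T \<gamma>2" "\<gamma>2 0 = \<one>" "\<gamma>2 1 = y" "develops {0..1} \<gamma>2 \<delta>2" "\<delta>2 0 = \<one>\<^bsub>A\<^esub>" "\<delta>2 1 = b"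
    using assms(2) unfolding extends_def by blast
  define K where "K z = \<gamma>1 (fst z) \<otimes> \<gamma>2 (snd z)" for z :: "real \<times> real"
  have "continuous_map (top_of_set square) T K"
    unfolding K_def[abs_def]
    by (intro continuous_map_mult continuous_map_reparam[OF 1(1)[unfolded pathin_def]]
        continuous_map_reparam[OF 2(1)[unfolded pathin_def]]) (auto intro: continuous_intros)
  from ex_develops[OF square this] obtain \<Delta> where \<Delta>: "develops square K \<Delta>" "\<Delta> 0 = \<one>\<^bsub>A\<^esub>" by blast
  have x: "x \<in> carrier H" "a \<in> carrier A" and y: "y \<in> carrier H" "b \<in> carrier A"
    using extends_closed assms by blast+
  have \<gamma>c: "\<gamma>1 t \<in> carrier H" "\<gamma>2 t \<in> carrier H" if "t \<in> {0..1}" for t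
    using developsD(1)[OF 1(4) that] developsD(1)[OF 2(4) that] .
  have bottom: "develops {0..1} (\<lambda>s. K (s, 0)) (\<lambda>s. \<Delta> (s, 0))"
    and right: "develops {0..1} (\<lambda>t. K (1, t)) (\<lambda>t. \<Delta> (1, t))"
    and diag: "develops {0..1} (\<lambda>t. K (t, t)) (\<lambda>t. \<Delta> (t, t))"
    using develops_square[OF \<Delta>(1), of "\<lambda>s. s" "\<lambda>s. 0"] develops_square[OF \<Delta>(1), of "\<lambda>s. 1" "\<lambda>s. s"]
      develops_square[OF \<Delta>(1), of "\<lambda>s. s" "\<lambda>s. s"] by simp_all
  have "\<Delta> (1, 0) = \<delta>1 1"
    by (rule develops_eq[OF _ bottom 1(4), of 0]) (use \<gamma>c 1 2 \<Delta>(2) in \<open>auto simp: K_def zero_prod_def\<close>)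
  then have corner: "\<Delta> (1, 0) = a" using 1 by simp
  have "\<Delta> (1, 1) = a \<otimes>\<^bsub>A\<^esub> \<delta>2 1"
    using develops_eq[OF _ right develops_translate[OF 2(4) x], of 0 1] corner 1(3) 2(5) x(2)
    by (simp add: K_def)
  then have end1: "\<Delta> (1, 1) = a \<otimes>\<^bsub>A\<^esub> b" using 2 by simp
  have "pathin T (\<lambda>t. K (t, t))"
    unfolding pathin_def K_def fst_conv snd_conv
    using 1(1) 2(1) unfolding pathin_def by (rule continuous_map_mult)
  then show ?thesis
    unfolding extends_def using diag end1 1 2 \<Delta>(2)
    by (intro exI[of _ "\<lambda>t. K (t, t)"] exI[of _ "\<lambda>t. \<Delta> (t, t)"]) (simp add: K_def zero_prod_def)
qed

text \<open>The increment rule covers ordered pairs in both directions, so reversed curves have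
  reversed developments; translating by inv x makes the curve start at the unit.\<close>

lemma extends_inv:
  assumes "extends x a"
  shows "extends (inv x) (inv\<^bsub>A\<^esub> a)"
proof -
  obtain \<gamma> \<delta> where 1: "pathin T \<gamma>" "\<gamma> 0 = \<one>" "\<gamma> 1 = x" "develops {0..1} \<gamma> \<delta>" "\<delta> 0 = \<one>\<^bsub>A\<^esub>" "\<delta> 1 = a"
    using assms unfolding extends_def by blast
  have x: "x \<in> carrier H" "a \<in> carrier A" using extends_closed[OF assms] by blast+
  have "develops {0..1} (\<lambda>t. \<gamma> (1 - t)) (\<lambda>t. \<delta> (1 - t))"
    by (rule develops_reparam[OF 1(4)]) (auto simp: dist_real_def abs_minus_commute)
  then have "develops {0..1} (\<lambda>t. inv x \<otimes> \<gamma> (1 - t)) (\<lambda>t. inv\<^bsub>A\<^esub> a \<otimes>\<^bsub>A\<^esub> \<delta> (1 - t))"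
    using x by (intro develops_translate) auto
  moreover have "pathin T (\<lambda>t. inv x \<otimes> \<gamma> (1 - t))"
    unfolding pathin_def
    by (intro continuous_map_mult continuous_map_reparam[OF 1(1)[unfolded pathin_def]])
      (auto simp: topspace x intro: continuous_intros)
  ultimately show ?thesis
    unfolding extends_def using 1 x
    by (intro exI[of _ "\<lambda>t. inv x \<otimes> \<gamma> (1 - t)"] exI[of _ "\<lambda>t. inv\<^bsub>A\<^esub> a \<otimes>\<^bsub>A\<^esub> \<delta> (1 - t)"]) simp
qed

text \<open>Along a path inside V the values of r themselves obey the increment rule.\<close>

lemma extends_V:
  assumes k: "pathin T k" "k 0 = \<one>" "k 1 = v" "k ` {0..1} \<subseteq> V"
  shows "extends v (r v)"
proof -
  obtain e where e: "e > 0" "\<forall>z\<in>{0..1}. \<forall>z'\<in>{0..1}. dist z z' < e \<longrightarrow> inv (k z) \<otimes> k z' \<in> V"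
    using uniform_increments[OF compact_Icc k(1)[unfolded pathin_def]] by blast
  have kV: "k t \<in> V" if "t \<in> {0..1}" for t using k(4) that by blast
  note kc = V_carrier[OF kV]
  have step: "r (k z') = r (k z) \<otimes>\<^bsub>A\<^esub> r (inv (k z) \<otimes> k z')" if "z \<in> {0..1}" "z' \<in> {0..1}" "dist z z' < e" for z z'
  proof -
    have "k z' = k z \<otimes> (inv (k z) \<otimes> k z')"
      using kc[OF that(1)] kc[OF that(2)] by (simp add: H.m_assoc[symmetric])
    moreover have "r (k z \<otimes> (inv (k z) \<otimes> k z')) = r (k z) \<otimes>\<^bsub>A\<^esub> r (inv (k z) \<otimes> k z')"
      using r_mult[OF kV[OF that(1)]] e(2) that by blast
    ultimately show ?thesis by simp
  qed
  have "develops {0..1} k (\<lambda>t. r (k t))"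
    by (rule developsI[OF kc r_closed[OF kV] e(1)]) (use e(2) step in blast)+
  then show ?thesis
    unfolding extends_def using k r_one by (intro exI[of _ k] exI[of _ "\<lambda>t. r (k t)"]) simp
qed

context
  assumes sc: "simply_connected_space T"
begin

lemma ex_extends:
  assumes "x \<in> carrier H"
  shows "\<exists>a. extends x a"
proof -
  obtain \<gamma> where \<gamma>: "pathin T \<gamma>" "\<gamma> 0 = \<one>" "\<gamma> 1 = x"
    using sc assms topspace H.one_closed unfolding simply_connected_space_def path_connected_space_def by metis
  from ex_develops[OF compact_Icc convex_real_interval(5) _ \<gamma>(1)[unfolded pathin_def]]
  obtain \<delta> where "develops {0..1} \<gamma> \<delta>" "\<delta> 0 = \<one>\<^bsub>A\<^esub>" by auto
  then show ?thesis unfolding extends_def using \<gamma> by blast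
qed

text \<open>In the development of a homotopy of loops the quotient of the values at the two ends of a loop
  does not depend on the loop.\<close>

lemma extends_one:
  assumes "extends \<one> a"
  shows "a = \<one>\<^bsub>A\<^esub>"
proof -
  obtain \<gamma> \<delta> where 1: "pathin T \<gamma>" "\<gamma> 0 = \<one>" "\<gamma> 1 = \<one>" "develops {0..1} \<gamma> \<delta>" "\<delta> 0 = \<one>\<^bsub>A\<^esub>" "\<delta> 1 = a"
    using assms unfolding extends_def by blast
  have "homotopic_with (\<lambda>r. r 1 = r 0) (top_of_set {0..1::real}) T \<gamma> (\<lambda>t. \<one>)"
    using sc 1 topspace unfolding simply_connected_space_def by simp
  then obtain h where h: "continuous_map (prod_topology (top_of_set {0..1::real}) (top_of_set {0..1::real})) T h"
    "\<And>t. h (0, t) = \<gamma> t" "\<And>t. h (1, t) = \<one>" "\<And>s. s \<in> {0..1} \<Longrightarrow> h (s, 1) = h (s, 0)"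
    unfolding homotopic_with_def by metis
  have hc: "continuous_map (top_of_set square) T h" using h(1) by simp
  from ex_develops[OF square hc] obtain \<Delta> where \<Delta>: "develops square h \<Delta>" "\<Delta> 0 = \<one>\<^bsub>A\<^esub>" by blast
  have left: "develops {0..1} (\<lambda>t. h (0, t)) (\<lambda>t. \<Delta> (0, t))"
    and right: "develops {0..1} (\<lambda>t. h (1, t)) (\<lambda>t. \<Delta> (1, t))"
    and bottom: "develops {0..1} (\<lambda>s. h (s, 0)) (\<lambda>s. \<Delta> (s, 0))"
    and top: "develops {0..1} (\<lambda>s. h (s, 1)) (\<lambda>s. \<Delta> (s, 1))"
    using develops_square[OF \<Delta>(1), of "\<lambda>s. 0" "\<lambda>s. s"] develops_square[OF \<Delta>(1), of "\<lambda>s. 1" "\<lambda>s. s"]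
      develops_square[OF \<Delta>(1), of "\<lambda>s. s" "\<lambda>s. 0"] develops_square[OF \<Delta>(1), of "\<lambda>s. s" "\<lambda>s. 1"]
    by simp_all
  have \<Delta>c: "\<Delta> (1, 0) \<in> carrier A" using developsD(2)[OF right, of 0] by simp
  \<comment> \<open>The edge belonging to the constant loop has a constant development, so the
    quotient of its end values is trivial, and with it the quotient for \<gamma>.\<close>
  have "develops {0..1::real} (\<lambda>t. \<one>) (\<lambda>t. \<Delta> (1, 0))"
    by (rule developsI[of _ _ _ 1]) (use \<Delta>c V(2) r_one in auto)
  from develops_eq[OF _ right this, of 0 1] have "\<Delta> (1, 1) = \<Delta> (1, 0)" using h(3) by simp
  moreover have "\<Delta> (0, 1) = \<delta> 1"
    by (rule develops_eq[OF _ left 1(4), of 0]) (use h(2) 1 \<Delta>(2) in \<open>auto simp: zero_prod_def\<close>)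
  moreover have "\<Delta> (0, 1) \<otimes>\<^bsub>A\<^esub> inv\<^bsub>A\<^esub> (\<Delta> (0, 0)) = \<Delta> (1, 1) \<otimes>\<^bsub>A\<^esub> inv\<^bsub>A\<^esub> (\<Delta> (1, 0))"
    by (rule develops_unique[OF _ top bottom]) (use h(4) in auto)
  ultimately show ?thesis
    using \<Delta>c \<Delta>(2) 1 extends_closed[OF assms] by (simp add: zero_prod_def)
qed

text \<open>If a and b are both values at x, then inv a times b is a value at the unit and so
  trivial. Uniqueness also turns \<open>extends_mult\<close> into the homomorphism property. The
  assumption on paths inside V makes the extension agree with r there.\<close>

theorem ex_extension:
  assumes "\<And>v. v \<in> V \<Longrightarrow> \<exists>k. pathin T k \<and> k 0 = \<one> \<and> k 1 = v \<and> k ` {0..1} \<subseteq> V"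
  shows "\<exists>\<rho>. \<rho> \<in> hom H A \<and> (\<forall>v\<in>V. \<rho> v = r v)"
proof -
  have unique: "a = b" if "extends x a" "extends x b" for x a b
  proof -
    have c: "x \<in> carrier H" "a \<in> carrier A" "b \<in> carrier A" using that extends_closed by blast+
    have "extends (inv x \<otimes> x) (inv\<^bsub>A\<^esub> a \<otimes>\<^bsub>A\<^esub> b)"
      by (rule extends_mult[OF extends_inv[OF that(1)] that(2)])
    then have "inv\<^bsub>A\<^esub> a \<otimes>\<^bsub>A\<^esub> b = \<one>\<^bsub>A\<^esub>" using extends_one c by simp
    then show ?thesis using c by (metis A.inv_equality A.inv_inv A.inv_closed)
  qed
  obtain \<rho> where \<rho>: "\<And>x. x \<in> carrier H \<Longrightarrow> extends x (\<rho> x)" using ex_extends by metis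
  have "\<rho> \<in> hom H A"
  proof (rule homI)
    show "\<rho> x \<in> carrier A" if "x \<in> carrier H" for x using extends_closed[OF \<rho>[OF that]] by blast
    show "\<rho> (x \<otimes> y) = \<rho> x \<otimes>\<^bsub>A\<^esub> \<rho> y" if "x \<in> carrier H" "y \<in> carrier H" for x y
      using unique[OF \<rho> extends_mult[OF \<rho> \<rho>]] that by simp
  qed
  moreover have "\<rho> v = r v" if v: "v \<in> V" for v
  proof -
    obtain k where "pathin T k" "k 0 = \<one>" "k 1 = v" "k ` {0..1} \<subseteq> V" using assms[OF v] by blast
    from unique[OF \<rho>[OF V_carrier[OF v]] extends_V[OF this]] show ?thesis .
  qed
  ultimately show ?thesis by blast
qed

end

end

section \<open>The affine group as automorphism group of the usual connection\<close>

definition AffGroup :: "((real^'n::finite) \<times> (real^'n^'n)) monoid" where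
  "AffGroup = \<lparr>carrier = {p. invertible (snd p)}, mult = aff_mult, one = (0, mat 1)\<rparr>"

lemma AffGroup_simps [simp]:
  "carrier AffGroup = {p. invertible (snd p)}" "p \<otimes>\<^bsub>AffGroup\<^esub> q = aff_mult p q" "\<one>\<^bsub>AffGroup\<^esub> = (0, mat 1)"
  by (simp_all add: AffGroup_def)

lemma aff_mult_assoc: "aff_mult (aff_mult p q) s = aff_mult p (aff_mult q s)"
  by (simp add: aff_mult_def matrix_linear_simps matrix_vector_mul_assoc matrix_mul_assoc add.assoc)

lemma snd_aff_mult: "snd (aff_mult p q) = snd p ** snd q"
  by (simp add: aff_mult_def)

lemma invertible_mat_one: "invertible (mat 1 :: real^'n::finite^'n)"
  by (auto simp: invertible_def intro!: exI[of _ "mat 1"])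

lemma aff_mult_one: "aff_mult p (0, mat 1) = p" "aff_mult (0, mat 1) p = p"
  by (simp_all add: aff_mult_def)

definition aff_inv :: "(real^'n::finite) \<times> (real^'n^'n) \<Rightarrow> (real^'n) \<times> (real^'n^'n)" where
  "aff_inv p = (- (matrix_inv (snd p) *v fst p), matrix_inv (snd p))"

lemma aff_inv:
  assumes "invertible (snd p)"
  shows "invertible (snd (aff_inv p))" "aff_mult (aff_inv p) p = (0, mat 1)" "aff_mult p (aff_inv p) = (0, mat 1)"
  using matrix_inv_mult[OF assms]
  by (auto simp: aff_inv_def aff_mult_def invertible_def matrix_vector_mul_assoc
      bounded_bilinear.minus_right[OF bounded_bilinear_matrix_vector_mult])

lemma group_AffGroup: "group (AffGroup :: ((real^'n::finite) \<times> (real^'n^'n)) monoid)"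
proof (rule groupI)
  fix p :: "(real^'n) \<times> (real^'n^'n)" assume "p \<in> carrier AffGroup"
  then show "\<exists>q\<in>carrier AffGroup. q \<otimes>\<^bsub>AffGroup\<^esub> p = \<one>\<^bsub>AffGroup\<^esub>"
    by (intro bexI[of _ "aff_inv p"]) (simp_all add: aff_inv)
qed (simp_all add: aff_mult_assoc aff_mult_one snd_aff_mult invertible_mult invertible_mat_one)

lemma smooth_on_aff_mult:
  assumes "smooth_on S f" "smooth_on S g"
  shows "smooth_on S (\<lambda>x. aff_mult (f x) (g x))"
  unfolding aff_mult_def
  by (rule smooth_on_Pair[OF smooth_on_add[OF smooth_on_fst[OF assms(1)] smooth_on_matrix_vector_mult[OF
          smooth_on_snd[OF assms(1)] smooth_on_fst[OF assms(2)]]] smooth_on_matrix_mult[OF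
          smooth_on_snd[OF assms(1)] smooth_on_snd[OF assms(2)]]])

section \<open>The frame bundle of the vector space and lifts of affine maps\<close>

abbreviation std_chart :: "(real^'n::finite, real^'n) chart" where
  "std_chart \<equiv> (UNIV, id)"

abbreviation std_frame_chart :: "((real^'n::finite, 'n) frame, (real^'n) \<times> (real^'n^'n)) chart" where
  "std_frame_chart \<equiv> frame_chart vector_mfd std_chart"

abbreviation "std_frames \<equiv> frames vector_mfd"
abbreviation "std_bundle \<equiv> frame_bundle vector_mfd"

lemmas M0 = smooth_atlas_vector_mfd[where 'e="real^'n::finite"]
lemmas P0 = smooth_atlas_frame_bundle[OF M0]

lemma std_chart_at: "c \<in> charts_at vector_mfd x \<longleftrightarrow> c = std_chart"
  by (auto simp: charts_at_iff vector_mfd_def)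

lemma std_chart_in: "std_chart \<in> atlas vector_mfd"
  by (simp add: vector_mfd_def)

lemma std_frame_chart_fst: "fst std_frame_chart = std_frames"
  by (simp add: frame_chart_simps)

lemma std_frame_chart_in: "std_frame_chart \<in> atlas std_bundle"
  by (simp add: frame_bundle_def vector_mfd_def)

lemma std_frame_chart_at: "w \<in> std_frames \<Longrightarrow> std_frame_chart \<in> charts_at std_bundle w"
  using std_frame_chart_in by (simp add: charts_at_iff std_frame_chart_fst)


lemma std_frame_chart_range: "snd std_frame_chart ` std_frames = UNIV \<times> {X. invertible X}"
  using frame_chart_range[OF M0 std_chart_in] by (simp add: std_frame_chart_fst)

lemma std_frame_chart_invertible: "w \<in> std_frames \<Longrightarrow> invertible (snd (snd std_frame_chart w))"
  using local_frame_chart(3)[OF M0 std_chart_in, of w] by (simp add: frame_chart_simps)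

lemma std_local_frame:
  assumes "invertible (snd q)"
  shows "local_frame vector_mfd std_chart q \<in> std_frames" "snd std_frame_chart (local_frame vector_mfd std_chart q) = q"
  using local_frame_in[OF M0 std_chart_in, of "fst q" "snd q"] assms by (simp_all add: std_frame_chart_fst)

lemma std_cinv: "invertible (snd q) \<Longrightarrow> cinv std_frame_chart q = local_frame vector_mfd std_chart q"
  using cinv_frame_chart[OF M0 std_chart_in, of q] by (auto simp: prod_eq_iff mem_Times_iff)

lemma std_frames_eqI: "w \<in> std_frames \<Longrightarrow> w' \<in> std_frames \<Longrightarrow> snd std_frame_chart w = snd std_frame_chart w' \<Longrightarrow> w = w'"
  using inj_onD[OF frame_chart_inj[OF M0 std_chart_in]] by (simp add: std_frame_chart_fst)

lemma std_frame_chart_right_action: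
  "snd std_frame_chart (right_action w a) = (fst (snd std_frame_chart w), snd (snd std_frame_chart w) ** a)"
  by (simp add: frame_chart_simps fst_right_action fmat_right_action)

lemma right_action_frames:
  assumes "w \<in> std_frames" "invertible a"
  shows "right_action w a \<in> std_frames"
proof -
  have "snd w j \<in> tangent_space vector_mfd (fst w)" for j by (rule frames_tangent[OF M0 assms(1)])
  then have "snd (right_action w a) j \<in> tangent_space vector_mfd (fst w)" for j
    unfolding right_action_def snd_conv frame_map_def by (intro tangent_space_sum[OF M0]) auto
  moreover have "invertible (fmat std_chart (right_action w a))"
    using frames_invertible[OF M0 assms(1), of std_chart] assms(2)
    by (simp add: fmat_right_action std_chart_at invertible_mult)
  ultimately show ?thesis
    using frames_iff[OF M0, of std_chart "fst w" "snd (right_action w a)"]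
    by (simp add: std_chart_at right_action_def fmat_def)
qed

text \<open>The global frame chart identifies the frames of the vector space with the affine group,
  and natural lifts of affine maps with left translations.\<close>

lemma affine_lift_local_frame:
  assumes "w \<in> std_frames"
  shows "affine_lift p w = local_frame vector_mfd std_chart (aff_mult p (snd std_frame_chart w))"
proof -
  have cinv: "inv_into UNIV (id :: real^'n \<Rightarrow> real^'n) z = z" for z by (simp add: inv_id)
  have some: "(SOME c. c \<in> charts_at vector_mfd x) = std_chart" for x :: "real^'n"
    by (simp add: std_chart_at)
  have D: "frechet_derivative (\<lambda>x. fst p + snd p *v x) (at x) = (\<lambda>v. snd p *v v)" for x
  proof (rule frechet_derivative_eqI)
    show "((\<lambda>x. fst p + snd p *v x) has_derivative (\<lambda>v. snd p *v v)) (at x)"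
      using has_derivative_add[OF has_derivative_const[of "fst p"] bounded_linear_imp_has_derivative[OF
          bounded_bilinear.bounded_linear_right[OF bounded_bilinear_matrix_vector_mult]], of "snd p" "at x"]
      by simp
  qed
  have D': "frechet_derivative (\<lambda>x. x) (at x) = (\<lambda>v. v)" for x :: "real^'n"
    by (rule frechet_derivative_eqI) (rule has_derivative_ident)
  have "tangent_map vector_mfd vector_mfd (\<lambda>x. snd p *v x + fst p) (fst w) (snd w j)
      = tvec vector_mfd std_chart (fst p + snd p *v fst w) (column j (snd p ** fmat std_chart w))" for j
    unfolding tangent_map_def tvec_def[OF M0] std_chart_at some Let_def column_matrix_mult column_fmat
    by (rule ext) (simp add: comp_def cinv D D' add.commute)
  then show ?thesis
    using assms by (simp add: affine_lift_def natural_lift_def local_frame_def aff_mult_def frame_chart_simps cinv add.commute)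
qed

lemma
  assumes "w \<in> std_frames" "invertible (snd p)"
  shows affine_lift_frames: "affine_lift p w \<in> std_frames"
    and affine_lift_chart: "snd std_frame_chart (affine_lift p w) = aff_mult p (snd std_frame_chart w)"
proof -
  have "invertible (snd (aff_mult p (snd std_frame_chart w)))"
    unfolding snd_aff_mult by (rule invertible_mult[OF assms(2) std_frame_chart_invertible[OF assms(1)]])
  from std_local_frame[OF this] show "affine_lift p w \<in> std_frames"
    "snd std_frame_chart (affine_lift p w) = aff_mult p (snd std_frame_chart w)"
    by (simp_all add: affine_lift_local_frame[OF assms(1)])
qed

lemma affine_lift_mult:
  assumes "invertible (snd p)" "invertible (snd q)"
  shows "compose std_frames (affine_lift p) (affine_lift q) = affine_lift (aff_mult p q)"
proof
  fix w
  show "compose std_frames (affine_lift p) (affine_lift q) w = affine_lift (aff_mult p q) w"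
  proof (cases "w \<in> std_frames")
    case True
    note q = affine_lift_frames[OF True assms(2)]
    have pq: "invertible (snd (aff_mult p q))" unfolding snd_aff_mult by (rule invertible_mult[OF assms])
    have "affine_lift p (affine_lift q w) = affine_lift (aff_mult p q) w"
      by (rule std_frames_eqI[OF affine_lift_frames[OF q assms(1)] affine_lift_frames[OF True pq]])
        (simp only: affine_lift_chart[OF q assms(1)] affine_lift_chart[OF True assms(2)] affine_lift_chart[OF True pq] aff_mult_assoc)
    then show ?thesis using True by (simp add: compose_def)
  qed (simp add: compose_def affine_lift_def)
qed

lemma affine_lift_one:
  assumes "w \<in> std_frames"
  shows "affine_lift (0, mat 1) w = w"
proof -
  have one: "invertible (snd (0 :: real^'a, mat 1 :: real^'a^'a))" by (simp add: invertible_mat_one)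
  show ?thesis
    by (rule std_frames_eqI[OF affine_lift_frames[OF assms one] assms])
      (simp only: affine_lift_chart[OF assms one] aff_mult_one)
qed

lemma affine_lift_inverse:
  assumes "invertible (snd p)" "w \<in> std_frames"
  shows "affine_lift (aff_inv p) (affine_lift p w) = w" "affine_lift p (affine_lift (aff_inv p) w) = w"
  using fun_cong[OF affine_lift_mult[OF aff_inv(1)[OF assms(1)] assms(1)], of w]
    fun_cong[OF affine_lift_mult[OF assms(1) aff_inv(1)[OF assms(1)]], of w]
    aff_inv[OF assms(1)] assms(2) affine_lift_one by (simp_all add: compose_def)

lemma affine_lift_inj:
  assumes "invertible (snd p)" "invertible (snd q)" "affine_lift p = affine_lift q"
  shows "p = q"
proof -
  \<comment> \<open>The standard frame at 0 has the unit of the affine group as coordinates, so the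
    coordinates of its image under the lift are p itself.\<close>
  define w :: "(real^'a, 'a) frame" where "w = local_frame vector_mfd std_chart (0, mat 1)"
  have w: "w \<in> std_frames" "snd std_frame_chart w = (0, mat 1)"
    using std_local_frame[of "(0, mat 1)"] by (simp_all add: w_def invertible_mat_one)
  have "aff_mult p (snd std_frame_chart w) = aff_mult q (snd std_frame_chart w)"
    by (simp only: assms(3) affine_lift_chart[OF w(1) assms(1), symmetric] affine_lift_chart[OF w(1) assms(2), symmetric])
  then show ?thesis by (simp only: w(2) aff_mult_one)
qed

lemma affine_lift_smooth_near:
  assumes w: "w \<in> std_frames" and p: "invertible (snd p)"
  shows "((snd std_frame_chart \<circ> affine_lift p \<circ> cinv std_frame_chart) has_derivative
      (\<lambda>q. (snd p *v fst q, snd p ** snd q))) (at (snd std_frame_chart w))" (is ?d)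
    and "smooth_near std_bundle std_bundle (affine_lift p) w"
proof -
  let ?S = "UNIV \<times> {X :: real^'a^'a. invertible X}"
  have o: "open ?S" by (intro open_Times open_UNIV open_invertible)
  have eq: "aff_mult p q = (snd std_frame_chart \<circ> affine_lift p \<circ> cinv std_frame_chart) q" if "q \<in> ?S" for q
  proof -
    have q: "invertible (snd q)" using that by auto
    show ?thesis
      by (simp only: comp_apply std_cinv[OF q] affine_lift_chart[OF std_local_frame(1)[OF q] p] std_local_frame(2)[OF q])
  qed
  have "smooth_on ?S (aff_mult p)"
    by (rule smooth_on_aff_mult[OF smooth_on_const[OF o] smooth_on_ident[OF o]])
  then have sm: "smooth_on ?S (snd std_frame_chart \<circ> affine_lift p \<circ> cinv std_frame_chart)"
    by (rule smooth_on_cong) (rule eq)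
  have wS: "snd std_frame_chart w \<in> ?S" using std_frame_chart_range w by blast
  have "bounded_linear (\<lambda>q :: (real^'a) \<times> (real^'a^'a). (snd p *v fst q, snd p ** snd q))"
    by (intro bounded_linear_Pair bounded_linear_compose[OF _ bounded_linear_fst] bounded_linear_compose[OF _ bounded_linear_snd]
        bounded_bilinear.bounded_linear_right[OF bounded_bilinear_matrix_vector_mult]
        bounded_bilinear.bounded_linear_right[OF bounded_bilinear_matrix_mult])
  from has_derivative_add[OF has_derivative_const[of "(fst p, 0)"] bounded_linear_imp_has_derivative[OF this]]
  have "(aff_mult p has_derivative (\<lambda>q. (snd p *v fst q, snd p ** snd q))) (at x)" for x
    by (simp add: aff_mult_def[abs_def])
  then show ?d
    by (rule has_derivative_transform_within_open[OF _ o wS]) (rule eq)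
  show "smooth_near std_bundle std_bundle (affine_lift p) w"
  proof (rule smooth_nearI[where F="affine_lift p", OF std_frame_chart_at[OF w] std_frame_chart_at[OF affine_lift_frames[OF w p]] wS _ sm])
    show "?S \<subseteq> snd std_frame_chart ` {y \<in> fst std_frame_chart. affine_lift p y \<in> fst std_frame_chart}"
      unfolding std_frame_chart_fst std_frame_chart_range[symmetric] using affine_lift_frames[OF _ p] by blast
  qed
qed

lemma christoffel_usual: "christoffel vector_mfd usual_connection std_chart z v \<eta> = 0"
proof -
  have "(\<lambda>y. tvec vector_mfd std_chart y \<eta> std_chart) = (\<lambda>y. \<eta>)"
    by (rule ext, rule tvec_chart[OF M0]) (simp add: std_chart_at)
  then show ?thesis by (simp add: christoffel_def usual_connection_def)
qed

lemma invertible_cancel: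
  fixes Y :: "real^'n::finite^'n"
  assumes "invertible Y" "Y *v a = Y *v b"
  shows "a = b"
  using arg_cong[OF assms(2), of "\<lambda>v. matrix_inv Y *v v"] matrix_inv_mult[OF assms(1)]
  by (simp add: matrix_vector_mul_assoc)

text \<open>For the usual connection \<Gamma> = 0, so X \<theta> = dz and X \<omega> = dX. Left
  translation multiplies X, dz and dX by the same invertible matrix, which cancels from both
  equations.\<close>

lemma affine_lift_Aut:
  assumes \<omega>0: "connection_form vector_mfd usual_connection \<omega>0" and p: "invertible (snd p)"
  shows "affine_lift p \<in> Aut vector_mfd \<omega>0"
  unfolding Aut_def
proof (intro CollectI conjI ballI allI impI)
  note pf = points_frame_bundle[OF M0]
  have b: "bij_betw (affine_lift p) std_frames std_frames"
    using affine_lift_inverse[OF p] affine_lift_frames[OF _ p] affine_lift_frames[OF _ aff_inv(1)[OF p]]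
    by (intro bij_betw_byWitness[where f'="affine_lift (aff_inv p)"]) blast+
  then show "affine_lift p \<in> Bij std_frames" by (simp add: Bij_def affine_lift_def)
  have sm: "smooth_map std_bundle std_bundle (affine_lift q)" if "invertible (snd q)" for q :: "(real^'a) \<times> (real^'a^'a)"
    using affine_lift_smooth_near(2)[OF _ that] by (intro smooth_mapI P0) (simp add: pf)
  show "diffeomorphism std_bundle std_bundle (affine_lift p)"
    unfolding diffeomorphism_def pf
    using sm[OF p] sm[OF aff_inv(1)[OF p]] affine_lift_inverse[OF p] by blast
  fix w :: "(real^'a, 'a) frame" assume w: "w \<in> std_frames"
  note Fw = affine_lift_frames[OF w p]
  show "affine_lift p (right_action w a) = right_action (affine_lift p w) a" if "invertible a" for a
    by (rule std_frames_eqI[OF affine_lift_frames[OF right_action_frames[OF w that] p] right_action_frames[OF Fw that]])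
      (simp add: affine_lift_chart[OF right_action_frames[OF w that] p] affine_lift_chart[OF w p]
        std_frame_chart_right_action aff_mult_def matrix_mul_assoc)
  fix Z assume Z: "Z \<in> tangent_space std_bundle w"
  let ?Z = "tangent_map std_bundle std_bundle (affine_lift p) w Z"
  have FZ: "?Z \<in> tangent_space std_bundle (affine_lift p w)"
    by (rule tangent_map_in_tangent_space[OF P0 P0 affine_lift_smooth_near(2)[OF w p] Z])
  have Zk: "?Z std_frame_chart = (snd p *v fst (Z std_frame_chart), snd p ** snd (Z std_frame_chart))"
    by (rule tangent_map_has_derivative[OF P0 Z std_frame_chart_at[OF w] std_frame_chart_at[OF Fw] affine_lift_smooth_near(1)[OF w p]])
  have c: "std_chart \<in> charts_at vector_mfd x" for x :: "real^'a" by (simp add: std_chart_at)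
  have fm: "fmat std_chart (affine_lift p w) = snd p ** fmat std_chart w"
    using affine_lift_chart[OF w p] by (simp add: frame_chart_simps aff_mult_def)
  have inv: "invertible (snd p ** fmat std_chart w)"
    using frames_invertible[OF M0 w c] p by (simp add: invertible_mult)
  have "column j (\<omega>0 (affine_lift p w) ?Z) = column j (\<omega>0 w Z)" for j
  proof (rule invertible_cancel[OF inv])
    have "(snd p ** fmat std_chart w) *v column j (\<omega>0 (affine_lift p w) ?Z) = column j (snd p ** snd (Z std_frame_chart))"
      using connection_form_chart[OF M0 \<omega>0 Fw c FZ, of j] unfolding christoffel_usual fm Zk snd_conv by simp
    also have "\<dots> = snd p *v column j (snd (Z std_frame_chart))" by (rule column_matrix_mult)
    also have "column j (snd (Z std_frame_chart)) = fmat std_chart w *v column j (\<omega>0 w Z)"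
      using connection_form_chart[OF M0 \<omega>0 w c Z, of j] unfolding christoffel_usual by simp
    finally show "(snd p ** fmat std_chart w) *v column j (\<omega>0 (affine_lift p w) ?Z)
        = (snd p ** fmat std_chart w) *v column j (\<omega>0 w Z)" by (simp only: matrix_vector_mul_assoc)
  qed
  then show "\<omega>0 (affine_lift p w) ?Z = \<omega>0 w Z" by (rule matrix_eq_columnsI)
  show "fundamental_form vector_mfd (affine_lift p w) ?Z = fundamental_form vector_mfd w Z"
  proof (rule invertible_cancel[OF inv])
    show "(snd p ** fmat std_chart w) *v fundamental_form vector_mfd (affine_lift p w) ?Z
        = (snd p ** fmat std_chart w) *v fundamental_form vector_mfd w Z"
      using fundamental_form_chart[OF M0 w c Z] fundamental_form_chart[OF M0 Fw c FZ]
      unfolding fm Zk fst_conv by (simp add: matrix_vector_mul_assoc[symmetric])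
  qed
qed

lemma affine_lift_hom:
  assumes \<omega>0: "connection_form vector_mfd usual_connection \<omega>0"
  shows "affine_lift \<in> hom AffGroup (AutGroup vector_mfd \<omega>0)"
proof (rule homI)
  fix p q :: "(real^'a) \<times> (real^'a^'a)" assume "p \<in> carrier AffGroup" "q \<in> carrier AffGroup"
  then have p: "invertible (snd p)" "invertible (snd q)" by simp_all
  show "affine_lift p \<in> carrier (AutGroup vector_mfd \<omega>0)"
    using affine_lift_Aut[OF \<omega>0 p(1)] by (simp add: AutGroup_def)
  have "affine_lift p \<in> Bij std_frames" "affine_lift q \<in> Bij std_frames"
    using affine_lift_Aut[OF \<omega>0] p by (auto simp: Aut_def)
  then show "affine_lift (p \<otimes>\<^bsub>AffGroup\<^esub> q) = affine_lift p \<otimes>\<^bsub>AutGroup vector_mfd \<omega>0\<^esub> affine_lift q"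
    using affine_lift_mult[OF p] by (simp add: AutGroup_def BijGroup_def)
qed

lemma affine_chart_lift:
  fixes p :: "(real^'n::finite) \<times> (real^'n^'n)"
  assumes "invertible (snd p)"
  shows "snd (affine_chart \<omega>0) (affine_lift p) = p"
proof -
  have "inj_on affine_lift {p :: (real^'n) \<times> (real^'n^'n). invertible (snd p)}"
    by (rule inj_onI) (rule affine_lift_inj, simp_all)
  then show ?thesis using assms by (simp add: affine_chart_def inv_into_f_f)
qed

text \<open>Membership of the image of w in U is an open condition on the pair (x, w), because the
  action is multiplication in the affine group. For w ranging over a compact K the tube lemma gives
  a neighbourhood of x.\<close>

lemma continuous_map_affine_lift:
  assumes \<omega>0: "connection_form vector_mfd usual_connection \<omega>0"
    and f: "continuous_map X euclidean f" and inv: "\<And>x. x \<in> topspace X \<Longrightarrow> invertible (snd (f x))"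
  shows "continuous_map X (compact_open (tops std_bundle) (tops std_bundle) (Aut vector_mfd \<omega>0)) (\<lambda>x. affine_lift (f x))"
  unfolding compact_open_def
proof (rule continuous_on_generated_topo)
  note pf = points_frame_bundle[OF M0]
  have chart: "continuous_map (tops std_bundle) euclidean (snd std_frame_chart)"
    unfolding continuous_map_def using chart_open_preimage[OF P0 std_frame_chart_in]
    by (auto simp: pf std_frame_chart_fst)
  have pair: "continuous_map (prod_topology X (tops std_bundle)) euclidean (\<lambda>z. (f (fst z), snd std_frame_chart (snd z)))"
    using continuous_map_pairedI[OF continuous_map_compose[OF continuous_map_fst f, of "tops std_bundle"]
      continuous_map_compose[OF continuous_map_snd chart, of X]]
    by (simp add: comp_def)
  have "continuous_on UNIV (\<lambda>z. aff_mult (fst z) (snd z) :: (real^'a) \<times> (real^'a^'a))"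
    by (rule smooth_on_continuous[OF smooth_on_aff_mult[OF smooth_on_fst[OF smooth_on_ident] smooth_on_snd[OF smooth_on_ident]]]) simp_all
  then have "continuous_map euclidean euclidean (\<lambda>z. aff_mult (fst z) (snd z) :: (real^'a) \<times> (real^'a^'a))" by simp
  from continuous_map_compose[OF pair this]
  have act: "continuous_map (prod_topology X (tops std_bundle)) euclidean (\<lambda>z. aff_mult (f (fst z)) (snd std_frame_chart (snd z)))"
    by (simp add: comp_def)
  show "(\<lambda>x. affine_lift (f x)) ` topspace X \<subseteq> \<Union>{{g \<in> Aut vector_mfd \<omega>0. g ` K \<subseteq> U} | K U. compactin (tops std_bundle) K \<and> openin (tops std_bundle) U}"
  proof
    fix g assume "g \<in> (\<lambda>x. affine_lift (f x)) ` topspace X"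
    then have "g \<in> Aut vector_mfd \<omega>0" using affine_lift_Aut[OF \<omega>0 inv] by blast
    \<comment> \<open>The subbasic set belonging to K = {} and U = {} is the whole of
      \<open>Aut\<close>, so every automorphism lies in the union of the generating sets.\<close>
    then have "g \<in> {g \<in> Aut vector_mfd \<omega>0. g ` {} \<subseteq> {}}" by simp
    then show "g \<in> \<Union>{{g \<in> Aut vector_mfd \<omega>0. g ` K \<subseteq> U} | K U. compactin (tops std_bundle) K \<and> openin (tops std_bundle) U}"
      using compactin_empty openin_empty by blast
  qed
  fix G assume "G \<in> {{g \<in> Aut vector_mfd \<omega>0. g ` K \<subseteq> U} | K U. compactin (tops std_bundle) K \<and> openin (tops std_bundle) U}"
  then obtain K U where K: "compactin (tops std_bundle) K" and U: "openin (tops std_bundle) U"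
    and G: "G = {g \<in> Aut vector_mfd \<omega>0. g ` K \<subseteq> U}" by blast
  have Uf: "U \<subseteq> std_frames" and Kf: "K \<subseteq> std_frames"
    using openin_subset[OF U] compactin_subset_topspace[OF K] pf by auto
  have oU: "open (snd std_frame_chart ` U)"
    by (rule chart_open_image[OF P0 std_frame_chart_in U]) (simp add: std_frame_chart_fst Uf)
  define W where "W = {z \<in> topspace (prod_topology X (tops std_bundle)). aff_mult (f (fst z)) (snd std_frame_chart (snd z)) \<in> snd std_frame_chart ` U}"
  have oW: "openin (prod_topology X (tops std_bundle)) W"
    unfolding W_def using openin_continuous_map_preimage[OF act] oU by simp
  have W: "(x, w) \<in> W \<longleftrightarrow> affine_lift (f x) w \<in> U" if x: "x \<in> topspace X" and w: "w \<in> std_frames" for x w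
  proof -
    note Fw = affine_lift_frames[OF w inv[OF x]]
    have "(x, w) \<in> W \<longleftrightarrow> snd std_frame_chart (affine_lift (f x) w) \<in> snd std_frame_chart ` U"
      using x w by (simp add: W_def pf affine_lift_chart[OF w inv[OF x]])
    also have "\<dots> \<longleftrightarrow> affine_lift (f x) w \<in> U"
      using std_frames_eqI[OF Fw] Uf by blast
    finally show ?thesis .
  qed
  show "openin X ((\<lambda>x. affine_lift (f x)) -` G \<inter> topspace X)"
  proof (rule openin_subopen[THEN iffD2], intro ballI)
    fix x assume x: "x \<in> (\<lambda>x. affine_lift (f x)) -` G \<inter> topspace X"
    then have xX: "x \<in> topspace X" and xK: "affine_lift (f x) ` K \<subseteq> U" by (auto simp: G)
    have "(x, w) \<in> W" if "w \<in> K" for w using W[OF xX, of w] that xK Kf by blast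
    then have "{x} \<times> K \<subseteq> W" by blast
    then obtain A B where AB: "openin X A" "openin (tops std_bundle) B" "x \<in> A" "K \<subseteq> B" "A \<times> B \<subseteq> W"
      using tube_lemma_right[OF oW K xX] by metis
    have "A \<subseteq> (\<lambda>x. affine_lift (f x)) -` G \<inter> topspace X"
    proof
      fix y assume y: "y \<in> A"
      then have yX: "y \<in> topspace X" using openin_subset[OF AB(1)] by blast
      have "affine_lift (f y) w \<in> U" if "w \<in> K" for w using W[OF yX, of w] that y AB(4,5) Kf by blast
      then show "y \<in> (\<lambda>x. affine_lift (f x)) -` G \<inter> topspace X"
        using affine_lift_Aut[OF \<omega>0 inv[OF yX]] yX by (simp add: G image_subset_iff)
    qed
    then show "\<exists>T. openin X T \<and> x \<in> T \<and> T \<subseteq> (\<lambda>x. affine_lift (f x)) -` G \<inter> topspace X" using AB by blast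
  qed
qed

text \<open>The single chart of the target turns the map back into f; only continuity for the
  compact-open topology needs a separate argument.\<close>

lemma smooth_map_affine_lift:
  fixes \<H> :: "('h, 'f::real_normed_vector) mfd" and f :: "'h \<Rightarrow> (real^'n::finite) \<times> (real^'n^'n)"
  assumes \<omega>0: "connection_form vector_mfd usual_connection \<omega>0" and \<H>: "smooth_atlas \<H>"
    and f: "smooth_map \<H> vector_mfd f" and inv: "\<And>x. x \<in> points \<H> \<Longrightarrow> invertible (snd (f x))"
  shows "smooth_map \<H> (affine_aut_mfd \<omega>0) (\<lambda>x. affine_lift (f x))"
  unfolding smooth_map_def
proof (intro conjI ballI)
  have "continuous_map (tops \<H>) euclidean f" using f by (simp add: smooth_map_def vector_mfd_def)
  then show "continuous_map (tops \<H>) (tops (affine_aut_mfd \<omega>0)) (\<lambda>x. affine_lift (f x))"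
    using continuous_map_affine_lift[OF \<omega>0 _ inv] by (simp add: affine_aut_mfd_def)
  fix c d assume c: "c \<in> atlas \<H>" and "d \<in> atlas (affine_aut_mfd \<omega>0)"
  then have d: "d = affine_chart \<omega>0" by (simp add: affine_aut_mfd_def)
  have S: "{x \<in> fst c. affine_lift (f x) \<in> fst d} = fst c"
    using affine_lift_Aut[OF \<omega>0 inv] chart_subset[OF \<H> c] by (auto simp: d affine_chart_def)
  have "smooth_on (snd c ` fst c) (f \<circ> cinv c)"
    using f c unfolding smooth_map_def by (auto simp: vector_mfd_def)
  then show "smooth_on (snd c ` {x \<in> fst c. affine_lift (f x) \<in> fst d}) (snd d \<circ> (\<lambda>x. affine_lift (f x)) \<circ> cinv c)"
    unfolding S
  proof (rule smooth_on_cong)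
    fix y assume "y \<in> snd c ` fst c"
    then have "cinv c y \<in> points \<H>" using cinv_image[OF \<H> c subset_refl] chart_subset[OF \<H> c] by blast
    then show "(f \<circ> cinv c) y = (snd d \<circ> (\<lambda>x. affine_lift (f x)) \<circ> cinv c) y"
      by (simp add: d affine_chart_lift inv)
  qed
qed

section \<open>The development homomorphism\<close>

lemma smooth_near_inclusion:
  assumes M: "smooth_atlas M" and W: "openin (tops M) W" "x \<in> W"
  shows "smooth_near (open_submfd M W) M (\<lambda>x. x) x"
  using smooth_near_open_submfd[OF M W smooth_near_id[OF M]] openin_subset[OF W(1)] W(2) by blast

lemma smooth_near_restriction:
  assumes M: "smooth_atlas M" and W: "openin (tops M) W" "x \<in> W"
  shows "smooth_near M (open_submfd M W) (\<lambda>x. x) x"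
proof -
  obtain c where c: "c \<in> charts_at M x" using ex_chart[OF M] openin_subset[OF W(1)] W(2) by blast
  then have c': "c \<in> atlas M" "x \<in> fst c" by (auto simp: charts_at_iff)
  have d: "(fst c \<inter> W, snd c) \<in> charts_at (open_submfd M W) x"
    using c' W by (auto simp: charts_at_iff open_submfd_def)
  have o: "open (snd c ` (fst c \<inter> W))"
    using chart_open_image[OF M c'(1), of "fst c \<inter> W"] chart_openin[OF M c'(1)] W by blast
  show ?thesis
  proof (rule smooth_nearI[where F="\<lambda>x. x", OF c d])
    show "smooth_on (snd c ` (fst c \<inter> W)) (snd (fst c \<inter> W, snd c) \<circ> (\<lambda>x. x) \<circ> cinv c)"
      by (rule smooth_on_cong[OF smooth_on_ident[OF o]]) (auto simp: chart_cinv[OF M c'(1)])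
  qed (use c' W in auto)
qed

lemma tangent_map_cong:
  assumes M: "smooth_atlas M" and N: "smooth_atlas N" and F: "smooth_near M N F x" and v: "v \<in> tangent_space M x"
    and W: "openin (tops M) W" "x \<in> W" "\<And>y. y \<in> W \<Longrightarrow> G y = F y"
  shows "tangent_map M N G x v = tangent_map M N F x v"
proof -
  have G: "smooth_near M N G x" by (rule smooth_near_cong[OF M F W])
  obtain c d where c: "c \<in> charts_at M x" and d: "d \<in> charts_at N (F x)"
    using F unfolding smooth_near_def by blast
  then have c': "c \<in> atlas M" "x \<in> fst c" and d': "d \<in> charts_at N (G x)" by (auto simp: charts_at_iff W)
  have o: "open (snd c ` (fst c \<inter> W))"
    using chart_open_image[OF M c'(1), of "fst c \<inter> W"] chart_openin[OF M c'(1)] W by blast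
  have "((snd d \<circ> G \<circ> cinv c) has_derivative frechet_derivative (snd d \<circ> F \<circ> cinv c) (at (snd c x))) (at (snd c x))"
    by (rule has_derivative_transform_within_open[OF smooth_near_has_derivative[OF M N F c d] o])
      (use c' W in \<open>auto simp: chart_cinv[OF M c'(1)]\<close>)
  from tangent_map_has_derivative[where F=G, OF M v c d' this] tangent_map_chart[OF M N F v c d]
  have "tangent_map M N G x v d = tangent_map M N F x v d" by simp
  moreover have "tangent_map M N G x v \<in> tangent_space N (F x)"
    using tangent_map_in_tangent_space[OF M N G v] W(3)[OF W(2)] by simp
  ultimately show ?thesis
    using tangent_space_eqI[OF N _ tangent_map_in_tangent_space[OF M N F v] d] by blast
qed

text \<open>V is the preimage of a coordinate ball centred at x, and segments from the centre stay
  in the ball. The paths remain inside V itself, as \<open>ex_extension\<close> demands.\<close>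

lemma ex_path_neighbourhood:
  assumes M: "smooth_atlas M" and W: "openin (tops M) W" "x \<in> W"
  shows "\<exists>V. openin (tops M) V \<and> x \<in> V \<and> V \<subseteq> W \<and>
    (\<forall>v\<in>V. \<exists>k. pathin (tops M) k \<and> k 0 = x \<and> k 1 = v \<and> k ` {0..1} \<subseteq> V)"
proof -
  obtain c where c: "c \<in> charts_at M x" using ex_chart[OF M] openin_subset[OF W(1)] W(2) by blast
  then have c': "c \<in> atlas M" "x \<in> fst c" by (auto simp: charts_at_iff)
  have "open (snd c ` (fst c \<inter> W))"
    using chart_open_image[OF M c'(1), of "fst c \<inter> W"] chart_openin[OF M c'(1)] W by blast
  then obtain e where e: "0 < e" "ball (snd c x) e \<subseteq> snd c ` (fst c \<inter> W)"
    using c' W unfolding open_contains_ball by blast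
  define V where "V = {y \<in> fst c. snd c y \<in> ball (snd c x) e}"
  have oV: "openin (tops M) V" unfolding V_def by (rule chart_open_preimage[OF M c'(1) open_ball])
  have xV: "x \<in> V" using c' e by (simp add: V_def)
  have VW: "V \<subseteq> W"
  proof
    fix y assume "y \<in> V"
    then have "y \<in> fst c" "snd c y \<in> snd c ` (fst c \<inter> W)" using e by (auto simp: V_def)
    then show "y \<in> W" using chart_image_iff(2)[OF M c'(1)] by blast
  qed
  have "\<exists>k. pathin (tops M) k \<and> k 0 = x \<and> k 1 = v \<and> k ` {0..1} \<subseteq> V" if v: "v \<in> V" for v
  proof -
    define l where "l = (\<lambda>t::real. snd c x + t *\<^sub>R (snd c v - snd c x))"
    define k where "k = (\<lambda>t. cinv c (l t))"
    have l: "l t \<in> ball (snd c x) e" if t: "t \<in> {0..1}" for t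
    proof -
      have "norm (t *\<^sub>R (snd c v - snd c x)) \<le> 1 * norm (snd c v - snd c x)"
        unfolding norm_scaleR by (rule mult_right_mono) (use t in auto)
      also have "\<dots> < e" using v by (simp add: V_def dist_norm norm_minus_commute)
      finally show ?thesis by (simp add: l_def dist_norm norm_minus_commute)
    qed
    then have "l t \<in> snd c ` (fst c \<inter> W)" if "t \<in> {0..1}" for t using e(2) that by blast
    then have k: "k t \<in> fst c" "snd c (k t) = l t" if "t \<in> {0..1}" for t
      using cinv_image[OF M c'(1), of "fst c \<inter> W" "l t"] that by (auto simp: k_def)
    then have kV: "k t \<in> V" if "t \<in> {0..1}" for t using l that by (simp add: V_def)
    have cont: "continuous_on {0..1} l" unfolding l_def by (intro continuous_intros)
    have "pathin (tops M) k"
      unfolding pathin_def continuous_map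
    proof (intro conjI allI impI)
      show "k ` topspace (top_of_set {0..1}) \<subseteq> points M"
        using kV openin_subset[OF oV] by auto
      fix A assume A: "openin (tops M) A"
      have oA: "open (snd c ` (fst c \<inter> A))"
        using chart_open_image[OF M c'(1), of "fst c \<inter> A"] chart_openin[OF M c'(1)] A by blast
      have "k t \<in> A \<longleftrightarrow> l t \<in> snd c ` (fst c \<inter> A)" if "t \<in> {0..1}" for t
        using chart_image_iff(2)[OF M c'(1) k(1)[OF that], of A] k(2)[OF that] by simp
      then have "{t \<in> topspace (top_of_set {0..1}). k t \<in> A} = {0..1} \<inter> l -` (snd c ` (fst c \<inter> A))" by auto
      then show "openin (top_of_set {0..1}) {t \<in> topspace (top_of_set {0..1}). k t \<in> A}"
        using continuous_openin_preimage_gen[OF cont oA] by simp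
    qed
    moreover have "k 0 = x" "k 1 = v" using c' v by (simp_all add: k_def l_def chart_cinv[OF M] V_def)
    ultimately show ?thesis using kV by blast
  qed
  then show ?thesis using oV xV VW by blast
qed

text \<open>Manifolds are locally path connected. This makes the unit component an open
  submanifold.\<close>

lemma openin_connected_component:
  assumes M: "smooth_atlas M"
  shows "openin (tops M) (connected_component_of_set (tops M) x)"
proof (subst openin_subopen, intro ballI)
  fix y assume y: "y \<in> connected_component_of_set (tops M) x"
  then have "y \<in> points M" using connected_component_of_subset_topspace by fastforce
  with ex_path_neighbourhood[OF M openin_topspace this] obtain V where V: "openin (tops M) V" "y \<in> V"
    "\<And>v. v \<in> V \<Longrightarrow> \<exists>k. pathin (tops M) k \<and> k 0 = y \<and> k 1 = v \<and> k ` {0..1} \<subseteq> V" by blast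
  have "V \<subseteq> connected_component_of_set (tops M) x"
  proof
    fix v assume "v \<in> V"
    then have "path_component_of (tops M) y v" using V(3) unfolding path_component_of_def by blast
    then have "connected_component_of (tops M) y v" using path_component_subset_connected_component_of[of "tops M" y] by auto
    then show "v \<in> connected_component_of_set (tops M) x" using y connected_component_of_trans by auto
  qed
  then show "\<exists>T. openin (tops M) T \<and> y \<in> T \<and> T \<subseteq> connected_component_of_set (tops M) x" using V by blast
qed

text \<open>The action of the covering group on frames through p. Joint continuity serves to choose
  neighbourhoods of the unit and of a frame together; smoothness of orbits serves to differentiate
  at the unit.\<close>

locale automorphic_action = H: group H for H :: "'h monoid" (structure) +
  fixes M :: "('m, real^'n::finite) mfd" and \<omega> :: "('m, 'n) frame \<Rightarrow> ('m, 'n) frame_tvec \<Rightarrow> real^'n^'n"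
    and \<H> :: "('h, 'f::real_normed_vector) mfd" and p :: "'h \<Rightarrow> ('m, 'n) frame \<Rightarrow> ('m, 'n) frame"
  assumes M: "smooth_atlas M" and H: "smooth_atlas \<H>" and points_H: "points \<H> = carrier H"
    and smooth_mult: "smooth_map (prod_mfd \<H> \<H>) \<H> (\<lambda>(g, h). g \<otimes> h)"
    and smooth_inv: "smooth_map \<H> \<H> (\<lambda>g. inv g)"
    and action_Aut: "h \<in> carrier H \<Longrightarrow> p h \<in> Aut M \<omega>"
    and action_one: "w \<in> frames M \<Longrightarrow> p \<one> w = w"
    and action_mult: "g \<in> carrier H \<Longrightarrow> h \<in> carrier H \<Longrightarrow> w \<in> frames M \<Longrightarrow> p (g \<otimes> h) w = p g (p h w)"
    and action_continuous: "continuous_map (prod_topology (tops \<H>) (tops (frame_bundle M))) (tops (frame_bundle M)) (\<lambda>z. p (fst z) (snd z))"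
    and action_smooth: "h \<in> carrier H \<Longrightarrow> w \<in> frames M \<Longrightarrow> smooth_near \<H> (frame_bundle M) (\<lambda>h. p h w) h"
begin

lemmas P = smooth_atlas_frame_bundle[OF M]


lemma smooth_near_action:
  assumes "h \<in> carrier H" "w \<in> frames M"
  shows "smooth_near (frame_bundle M) (frame_bundle M) (p h) w"
proof (rule smooth_mapD[OF P P])
  show "smooth_map (frame_bundle M) (frame_bundle M) (p h)"
    using action_Aut[OF assms(1)] by (simp add: Aut_def diffeomorphism_def)
qed (simp add: assms points_frame_bundle[OF M])

text \<open>Joint continuity gives neighbourhoods A of the unit and B of u such that A moves B into
  U. Inside B and U a coordinate ball N supplies the convexity that
  \<open>development_automorphism\<close> needs, and V consists of elements of A that keep u over N.
  That lemma is then applied to the automorphism \<open>p g\<close> at the frame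
  \<open>p h u\<close>.\<close>

lemma ex_local_hom:
  assumes D: "development M \<omega> c U D" and u: "u \<in> U" "D u = (0, mat 1)"
  obtains V where "openin (tops \<H>) V" "\<one> \<in> V" "\<And>v. v \<in> V \<Longrightarrow> p v u \<in> U"
    "\<And>v. v \<in> V \<Longrightarrow> \<exists>k. pathin (tops \<H>) k \<and> k 0 = \<one> \<and> k 1 = v \<and> k ` {0..1} \<subseteq> V"
    "\<And>g h. g \<in> V \<Longrightarrow> h \<in> V \<Longrightarrow> D (p (g \<otimes> h) u) = aff_mult (D (p g u)) (D (p h u))"
proof -
  let ?k = "frame_chart M c" and ?P = "frame_bundle M"
  note pf = points_frame_bundle[OF M]
  have k: "?k \<in> atlas ?P" and oU: "openin (tops ?P) U" and Uk: "U \<subseteq> fst ?k"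
    using D by (auto simp: development_def frame_bundle_def)
  have uf: "u \<in> frames M" using u(1) Uk chart_subset[OF P k] pf by blast
  define W where "W = {z \<in> topspace (prod_topology (tops \<H>) (tops ?P)). p (fst z) (snd z) \<in> U}"
  have "openin (prod_topology (tops \<H>) (tops ?P)) W"
    unfolding W_def by (rule openin_continuous_map_preimage[OF action_continuous oU])
  moreover have "(\<one>, u) \<in> W"
    unfolding W_def topspace_prod_topology using uf u(1) action_one[OF uf] by (simp add: points_H pf)
  ultimately obtain A B where A: "openin (tops \<H>) A" "\<one> \<in> A" and B: "openin (tops ?P) B" "u \<in> B" and AB: "A \<times> B \<subseteq> W"
    unfolding openin_prod_topology_alt by blast
  have "open (snd ?k ` (B \<inter> U))"
    by (rule chart_open_image[OF P k openin_Int[OF B(1) oU]]) (use Uk in blast)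
  then obtain e where e: "0 < e" "ball (snd ?k u) e \<subseteq> snd ?k ` (B \<inter> U)"
    using u(1) B(2) unfolding open_contains_ball by blast
  define N where "N = ball (snd ?k u) e"
  have N: "open N" "convex N" "N \<subseteq> snd ?k ` U" and uN: "snd ?k u \<in> N" using e by (auto simp: N_def)
  define B0 where "B0 = {w \<in> fst ?k. snd ?k w \<in> N}"
  have B0: "openin (tops ?P) B0" unfolding B0_def by (rule chart_open_preimage[OF P k N(1)])
  have B0U: "w \<in> B \<and> w \<in> U" if "w \<in> B0" for w
  proof -
    have w: "w \<in> fst ?k" "snd ?k w \<in> snd ?k ` (B \<inter> U)" using that e(2) by (auto simp: B0_def N_def)
    have "fst ?k \<inter> (B \<inter> U) = B \<inter> U" using Uk by blast
    then show ?thesis using chart_image_iff(2)[OF P k w(1), of "B \<inter> U"] w(2) by simp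
  qed
  have orbit: "continuous_map (tops \<H>) (tops ?P) (\<lambda>h. p h u)"
  proof -
    have "continuous_map (tops \<H>) (prod_topology (tops \<H>) (tops ?P)) (\<lambda>h. (h, u))"
      by (rule continuous_map_pairedI) (simp_all add: pf uf)
    from continuous_map_compose[OF this action_continuous] show ?thesis by (simp add: comp_def)
  qed
  have "openin (tops \<H>) (A \<inter> {h \<in> points \<H>. p h u \<in> B0})"
    by (rule openin_Int[OF A(1) openin_continuous_map_preimage[OF orbit B0]])
  moreover have "\<one> \<in> A \<inter> {h \<in> points \<H>. p h u \<in> B0}"
    using A(2) uN u(1) Uk by (auto simp: points_H action_one[OF uf] B0_def)
  from ex_path_neighbourhood[OF H calculation this]
  obtain V where V: "openin (tops \<H>) V" "\<one> \<in> V" "V \<subseteq> A \<inter> {h \<in> points \<H>. p h u \<in> B0}"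
    and path: "\<And>v. v \<in> V \<Longrightarrow> \<exists>k. pathin (tops \<H>) k \<and> k 0 = \<one> \<and> k 1 = v \<and> k ` {0..1} \<subseteq> V"
    by (elim exE conjE) blast
  have VH: "v \<in> carrier H" "p v u \<in> B0" "v \<in> A" if "v \<in> V" for v using V(3) that points_H by auto
  have mult: "D (p (g \<otimes> h) u) = aff_mult (D (p g u)) (D (p h u))" if g: "g \<in> V" and h: "h \<in> V" for g h
  proof -
    have "D (p g (p h u)) = aff_mult (D (p g u)) (D (p h u))"
    proof (rule development_automorphism[OF M D N, where F="p g", OF _ _ u(1) uN u(2)])
      show "p h u \<in> U" "snd ?k (p h u) \<in> N" using VH[OF h] B0U by (auto simp: B0_def)
    next
      fix w assume w: "w \<in> U" "snd ?k w \<in> N"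
      then have "w \<in> B0" using Uk by (auto simp: B0_def)
      then have "(g, w) \<in> W" using B0U VH[OF g] AB by blast
      moreover have "w \<in> frames M" using w(1) Uk chart_subset[OF P k] pf by blast
      ultimately show "p g w \<in> U \<and> smooth_near ?P ?P (p g) w"
        using smooth_near_action VH[OF g] by (simp add: W_def)
    next
      fix w Z assume w: "w \<in> U" and Z: "Z \<in> tangent_space ?P w"
      have "w \<in> frames M" using w Uk chart_subset[OF P k] pf by blast
      then show "\<omega> (p g w) (tangent_map ?P ?P (p g) w Z) = \<omega> w Z \<and>
        fundamental_form M (p g w) (tangent_map ?P ?P (p g) w Z) = fundamental_form M w Z"
        using action_Aut[OF VH(1)[OF g]] Z unfolding Aut_def by blast
    qed
    then show ?thesis using action_mult[OF VH(1)[OF g] VH(1)[OF h] uf] by simp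
  qed
  then show ?thesis
    using that[OF V(1,2) _ path] VH(2) B0U by blast
qed

text \<open>Near the unit \<rho> is D composed with the orbit map of u, hence smooth there. Near any
  other h it is smooth because \<rho> g = \<rho> (g \<otimes> inv h) times \<rho> h.\<close>

lemma ex_affine_hom:
  assumes D: "development M \<omega> c U D" and u: "u \<in> U" "D u = (0, mat 1)" and sc: "simply_connected_space (tops \<H>)"
  shows "\<exists>\<rho>. \<rho> \<in> hom H AffGroup \<and> smooth_map \<H> vector_mfd \<rho> \<and>
    (\<exists>V. openin (tops \<H>) V \<and> \<one> \<in> V \<and> (\<forall>v\<in>V. p v u \<in> U \<and> \<rho> v = D (p v u)))"
proof -
  let ?k = "frame_chart M c" and ?P = "frame_bundle M"
  have k: "?k \<in> atlas ?P" and Uk: "U \<subseteq> fst ?k"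
    and smD: "smooth_on (snd ?k ` U) (D \<circ> cinv ?k)" and inv: "\<And>w. w \<in> U \<Longrightarrow> invertible (snd (D w))"
    using D by (auto simp: development_def frame_bundle_def)
  have uk: "?k \<in> charts_at ?P u" using k u(1) Uk by (auto simp: charts_at_iff)
  have uf: "u \<in> frames M" using charts_at_points[OF P uk] points_frame_bundle[OF M] by simp
  obtain V where V: "openin (tops \<H>) V" "\<one> \<in> V" and VU: "\<And>v. v \<in> V \<Longrightarrow> p v u \<in> U"
    and path: "\<And>v. v \<in> V \<Longrightarrow> \<exists>k. pathin (tops \<H>) k \<and> k 0 = \<one> \<and> k 1 = v \<and> k ` {0..1} \<subseteq> V"
    and mult: "\<And>g h. g \<in> V \<Longrightarrow> h \<in> V \<Longrightarrow> D (p (g \<otimes> h) u) = aff_mult (D (p g u)) (D (p h u))"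
    by (rule ex_local_hom[OF D u], rule that, assumption, assumption, simp_all)
  interpret L: local_group_hom H AffGroup "tops \<H>" "\<lambda>h. D (p h u)" V
  proof (intro local_group_hom.intro local_group_hom_axioms.intro group_AffGroup H.is_group)
    show "continuous_map (prod_topology (tops \<H>) (tops \<H>)) (tops \<H>) (\<lambda>(g, h). g \<otimes> h)"
      using smooth_mult by (simp add: smooth_map_def prod_mfd_def)
    show "continuous_map (tops \<H>) (tops \<H>) (\<lambda>g. inv g)" using smooth_inv by (simp add: smooth_map_def)
  qed (simp_all add: points_H V inv VU mult)
  obtain \<rho> where \<rho>: "\<rho> \<in> hom H AffGroup" and \<rho>V: "\<And>v. v \<in> V \<Longrightarrow> \<rho> v = D (p v u)"
    using L.ex_extension[OF sc path] by blast
  have one: "\<one> \<in> carrier H" by simp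
  have "smooth_near ?P vector_mfd D u"
    by (rule smooth_nearI[where F=D and d="(UNIV, id)" and T="snd ?k ` U", OF uk])
      (use u(1) Uk smD in \<open>auto simp: charts_at_iff vector_mfd_def\<close>)
  then have "smooth_near ?P vector_mfd D (p \<one> u)" using action_one[OF uf] by simp
  from smooth_near_compose[where F="\<lambda>h. p h u", OF H P smooth_atlas_vector_mfd action_smooth[OF one uf] this]
  have "smooth_near \<H> vector_mfd (\<lambda>h. D (p h u)) \<one>" .
  then have near_one: "smooth_near \<H> vector_mfd \<rho> \<one>" by (rule smooth_near_cong[OF H _ V]) (rule \<rho>V)
  have right_mult: "smooth_near vector_mfd vector_mfd (\<lambda>q. aff_mult q b) a" for a b :: "(real^'n) \<times> (real^'n^'n)"
  proof (rule smooth_nearI[where F="\<lambda>q. aff_mult q b" and c="(UNIV, id)" and d="(UNIV, id)" and T=UNIV])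
    have "smooth_on UNIV (\<lambda>q. aff_mult q b)"
      by (rule smooth_on_aff_mult[OF smooth_on_ident smooth_on_const]) simp_all
    then show "smooth_on UNIV (snd (UNIV, id) \<circ> (\<lambda>q. aff_mult q b) \<circ> cinv (UNIV, id))" by (simp add: comp_def inv_id)
  qed (simp_all add: charts_at_iff vector_mfd_def)
  have "smooth_map \<H> vector_mfd \<rho>"
  proof (rule smooth_mapI[OF H smooth_atlas_vector_mfd])
    fix h assume "h \<in> points \<H>"
    then have h: "h \<in> carrier H" "inv h \<in> carrier H" by (simp_all add: points_H)
    then have "smooth_near \<H> \<H> (\<lambda>g. g \<otimes> inv h) h"
      using smooth_near_prod_left[OF H H H smooth_mult, of h "inv h"] by (simp add: points_H)
    moreover have "smooth_near \<H> vector_mfd \<rho> (h \<otimes> inv h)" using near_one h by simp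
    ultimately have "smooth_near \<H> vector_mfd (\<lambda>g. \<rho> (g \<otimes> inv h)) h"
      by (rule smooth_near_compose[where F="\<lambda>g. g \<otimes> inv h", OF H H smooth_atlas_vector_mfd])
    from smooth_near_compose[where F="\<lambda>g. \<rho> (g \<otimes> inv h)" and G="\<lambda>q. aff_mult q (\<rho> h)", OF H smooth_atlas_vector_mfd smooth_atlas_vector_mfd this right_mult]
    show "smooth_near \<H> vector_mfd \<rho> h"
    proof (rule smooth_near_cong[OF H _ openin_topspace])
      show "h \<in> points \<H>" by fact
      fix g assume "g \<in> points \<H>"
      then have g: "g \<in> carrier H" by (simp add: points_H)
      have "\<rho> ((g \<otimes> inv h) \<otimes> h) = aff_mult (\<rho> (g \<otimes> inv h)) (\<rho> h)"
        using hom_mult[OF \<rho>, of "g \<otimes> inv h" h] g h by simp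
      then show "\<rho> g = aff_mult (\<rho> (g \<otimes> inv h)) (\<rho> h)"
        using g h by (simp add: H.m_assoc)
    qed
  qed
  then show ?thesis
    by (intro exI[of _ \<rho>] exI[of _ V] conjI ballI \<rho> V VU \<rho>V)
qed

text \<open>Near the unit the homomorphism, read in the global chart, is h \<mapsto> D (p h u). The
  chain rule gives dD at u applied to Z, and the left factor \<open>snd (D u)\<close> in dD is the
  identity.\<close>

lemma tangent_map_affine_lift:
  fixes \<omega>0 :: "(real^'n, 'n) frame \<Rightarrow> (real^'n, 'n) frame_tvec \<Rightarrow> real^'n^'n"
  assumes D: "development M \<omega> c U D" and u: "u \<in> U" "D u = (0, mat 1)"
    and \<omega>0: "connection_form vector_mfd usual_connection \<omega>0"
    and V: "openin (tops \<H>) V" "\<one> \<in> V" "\<And>v. v \<in> V \<Longrightarrow> p v u \<in> U \<and> \<rho> v = D (p v u)"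
    and \<xi>: "\<xi> \<in> tangent_space \<H> \<one>"
  defines "Z \<equiv> tangent_map \<H> (frame_bundle M) (\<lambda>h. p h u) \<one> \<xi>"
  shows "tangent_map \<H> (affine_aut_mfd \<omega>0) (\<lambda>h. affine_lift (\<rho> h)) \<one> \<xi> (affine_chart \<omega>0)
    = (fundamental_form M u Z, \<omega> u Z)"
proof -
  let ?k = "frame_chart M c" and ?P = "frame_bundle M"
  have k: "?k \<in> atlas ?P" and Uk: "U \<subseteq> fst ?k"
    and smD: "smooth_on (snd ?k ` U) (D \<circ> cinv ?k)" and inv: "\<And>w. w \<in> U \<Longrightarrow> invertible (snd (D w))"
    using D by (auto simp: development_def frame_bundle_def)
  have uk: "?k \<in> charts_at ?P u" using k u(1) Uk by (auto simp: charts_at_iff)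
  have uf: "u \<in> frames M" using charts_at_points[OF P uk] points_frame_bundle[OF M] by simp
  note one = action_one[OF uf]
  have sm: "smooth_near \<H> ?P (\<lambda>h. p h u) \<one>" by (rule action_smooth[OF _ uf]) simp
  have uk1: "?k \<in> charts_at ?P (p \<one> u)" using uk one by simp
  have Zu: "Z \<in> tangent_space ?P u"
    using tangent_map_in_tangent_space[OF H P sm \<xi>] one by (simp add: Z_def)
  obtain e where e: "e \<in> charts_at \<H> \<one>" using ex_chart[OF H, of \<one>] by (auto simp: points_H)
  then have e': "e \<in> atlas \<H>" "\<one> \<in> fst e" by (auto simp: charts_at_iff)
  define A where "A = frechet_derivative (snd ?k \<circ> (\<lambda>h. p h u) \<circ> cinv e) (at (snd e \<one>))"
  define B where "B = frechet_derivative (D \<circ> cinv ?k) (at (snd ?k u))"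
  have ZA: "Z ?k = A (\<xi> e)"
    unfolding Z_def A_def by (rule tangent_map_chart[OF H P sm \<xi> e uk1])
  have dA: "((snd ?k \<circ> (\<lambda>h. p h u) \<circ> cinv e) has_derivative A) (at (snd e \<one>))"
    unfolding A_def by (rule smooth_near_has_derivative[OF H P sm e uk1])
  have "(snd ?k \<circ> (\<lambda>h. p h u) \<circ> cinv e) (snd e \<one>) = snd ?k u"
    by (simp add: chart_cinv[OF H e'] one)
  then have dB: "((D \<circ> cinv ?k) has_derivative B) (at ((snd ?k \<circ> (\<lambda>h. p h u) \<circ> cinv e) (snd e \<one>)))"
    unfolding B_def using smooth_on_has_derivative[OF smD, of "snd ?k u"] u(1) by simp
  have o: "open (snd e ` (fst e \<inter> V))"
    using chart_open_image[OF H e'(1), of "fst e \<inter> V"] chart_openin[OF H e'(1)] V(1) by blast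
  have "((snd (affine_chart \<omega>0) \<circ> (\<lambda>h. affine_lift (\<rho> h)) \<circ> cinv e) has_derivative (\<lambda>v. B (A v))) (at (snd e \<one>))"
  proof (rule has_derivative_transform_within_open[OF has_derivative_compose[OF dA dB] o])
    show "snd e \<one> \<in> snd e ` (fst e \<inter> V)" using e' V(2) by blast
    fix y assume "y \<in> snd e ` (fst e \<inter> V)"
    then have x: "cinv e y \<in> V" using cinv_image[OF H e'(1), of "fst e \<inter> V"] by blast
    then have "p (cinv e y) u \<in> U" and \<rho>: "\<rho> (cinv e y) = D (p (cinv e y) u)" using V(3) by blast+
    then have "p (cinv e y) u \<in> fst ?k" "invertible (snd (\<rho> (cinv e y)))" using Uk inv by auto
    then show "(D \<circ> cinv ?k) ((snd ?k \<circ> (\<lambda>h. p h u) \<circ> cinv e) y)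
        = (snd (affine_chart \<omega>0) \<circ> (\<lambda>h. affine_lift (\<rho> h)) \<circ> cinv e) y"
      by (simp add: chart_cinv[OF P k] affine_chart_lift \<rho>)
  qed
  moreover have "affine_chart \<omega>0 \<in> charts_at (affine_aut_mfd \<omega>0) (affine_lift (\<rho> \<one>))"
    using affine_lift_Aut[OF \<omega>0 inv[of "p \<one> u"]] V(2,3)
    by (simp add: charts_at_iff affine_aut_mfd_def affine_chart_def)
  ultimately have "tangent_map \<H> (affine_aut_mfd \<omega>0) (\<lambda>h. affine_lift (\<rho> h)) \<one> \<xi> (affine_chart \<omega>0) = B (A (\<xi> e))"
    by (intro tangent_map_has_derivative[where F="\<lambda>h. affine_lift (\<rho> h)", OF H \<xi> e])
  also have "\<dots> = (snd (D u) *v fundamental_form M u Z, snd (D u) ** \<omega> u Z)"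
    using D u(1) Zu unfolding development_def B_def ZA[symmetric] by blast
  also have "\<dots> = (fundamental_form M u Z, \<omega> u Z)" by (simp add: u(2))
  finally show ?thesis .
qed

end

text \<open>Let q be the inverse of p on the sheet through the unit. Pushing \<zeta> forward by q
  gives a vector upstairs that induces the same field, since p (q F) = F for F near the
  unit.\<close>

lemma covering_induced_field:
  fixes \<G> :: "('p \<Rightarrow> 'p, 'e::real_normed_vector) mfd" and \<H> :: "('h, 'f::real_normed_vector) mfd"
    and Q :: "('p, 'q::real_normed_vector) mfd"
  assumes Q: "smooth_atlas Q" and G: "smooth_atlas \<G>" and H: "smooth_atlas \<H>" and C: "openin (tops \<G>) C"
    and p: "smooth_covering \<H> (open_submfd \<G> C) p" and one: "\<one>\<^bsub>H\<^esub> \<in> points \<H>" "p \<one>\<^bsub>H\<^esub> = \<one>\<^bsub>K\<^esub>"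
    and orbit_G: "\<And>w. w \<in> points Q \<Longrightarrow> smooth_near \<G> Q (\<lambda>F. F w) \<one>\<^bsub>K\<^esub>"
    and orbit_H: "\<And>w. w \<in> points Q \<Longrightarrow> smooth_near \<H> Q (\<lambda>h. p h w) \<one>\<^bsub>H\<^esub>"
    and \<zeta>: "\<zeta> \<in> tangent_space \<G> \<one>\<^bsub>K\<^esub>"
  shows "induced_field K \<G> Q (\<lambda>F. F) \<zeta> \<in> induced_field H \<H> Q p ` tangent_space \<H> \<one>\<^bsub>H\<^esub>"
proof -
  let ?G = "open_submfd \<G> C"
  note GC = smooth_atlas_open_submfd[OF G C]
  have K1: "\<one>\<^bsub>K\<^esub> \<in> points ?G"
  proof -
    have "p ` points \<H> = points ?G" using p by (simp add: smooth_covering_def)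
    with imageI[OF one(1), of p] show ?thesis by (simp only: one(2))
  qed
  then have KC: "\<one>\<^bsub>K\<^esub> \<in> C" by (simp add: open_submfd_def)
  obtain T \<V> where T: "\<one>\<^bsub>K\<^esub> \<in> T" "openin (tops ?G) T" and \<V>: "\<Union>\<V> = {x \<in> points \<H>. p x \<in> T}"
    and \<V>o: "\<forall>V\<in>\<V>. openin (tops \<H>) V" and diffeo: "\<forall>V\<in>\<V>. diffeomorphism (open_submfd \<H> V) (open_submfd ?G T) p"
    using bspec[OF p[unfolded smooth_covering_def, THEN conjunct2, THEN conjunct2] K1] by (elim exE conjE)
  have "\<one>\<^bsub>H\<^esub> \<in> \<Union>\<V>" unfolding \<V> using one T by simp
  then obtain V where V: "V \<in> \<V>" "\<one>\<^bsub>H\<^esub> \<in> V" by blast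
  have oV: "openin (tops \<H>) V" using \<V>o V by blast
  have oT: "openin (tops \<G>) T" using openin_trans_full[OF _ C] T(2) by (simp add: open_submfd_def)
  have ptT: "points (open_submfd ?G T) = T" using openin_subset[OF T(2)] by (auto simp: open_submfd_def)
  have ptV: "points (open_submfd \<H> V) = V" using openin_subset[OF oV] by (auto simp: open_submfd_def)
  obtain q where q: "smooth_map (open_submfd ?G T) (open_submfd \<H> V) q"
    and qp: "\<And>x. x \<in> V \<Longrightarrow> q (p x) = x" and pq: "\<And>y. y \<in> T \<Longrightarrow> p (q y) = y"
    using bspec[OF diffeo V(1), unfolded diffeomorphism_def ptT ptV] by (elim exE conjE) blast
  have q1: "q \<one>\<^bsub>K\<^esub> = \<one>\<^bsub>H\<^esub>" using qp[OF V(2)] one by simp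
  have sq: "smooth_near \<G> \<H> q \<one>\<^bsub>K\<^esub>"
  proof -
    note VH = smooth_atlas_open_submfd[OF H oV] and TG = smooth_atlas_open_submfd[OF GC T(2)]
    have 1: "smooth_near \<G> (open_submfd ?G T) (\<lambda>y. y) \<one>\<^bsub>K\<^esub>"
      by (rule smooth_near_compose[where F="\<lambda>y. y" and G="\<lambda>y. y", OF G GC TG smooth_near_restriction[OF G C KC] smooth_near_restriction[OF GC T(2,1)]])
    have 2: "smooth_near (open_submfd ?G T) (open_submfd \<H> V) q \<one>\<^bsub>K\<^esub>"
      by (rule smooth_mapD[OF TG VH q]) (simp add: ptT T(1))
    have 3: "smooth_near (open_submfd \<H> V) \<H> (\<lambda>x. x) (q \<one>\<^bsub>K\<^esub>)"
      unfolding q1 by (rule smooth_near_inclusion[OF H oV V(2)])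
    show ?thesis
      by (rule smooth_near_compose[where F="\<lambda>y. y" and G=q, OF G TG H 1 smooth_near_compose[where F=q and G="\<lambda>x. x", OF TG VH H 2 3]])
  qed
  define \<xi> where "\<xi> = tangent_map \<G> \<H> q \<one>\<^bsub>K\<^esub> \<zeta>"
  have "\<xi> \<in> tangent_space \<H> \<one>\<^bsub>H\<^esub>"
    using tangent_map_in_tangent_space[OF G H sq \<zeta>] by (simp add: \<xi>_def q1)
  moreover have "tangent_map \<G> Q (\<lambda>F. F w) \<one>\<^bsub>K\<^esub> \<zeta> = tangent_map \<H> Q (\<lambda>h. p h w) \<one>\<^bsub>H\<^esub> \<xi>" if w: "w \<in> points Q" for w
  proof -
    have "tangent_map \<G> Q (\<lambda>F. p (q F) w) \<one>\<^bsub>K\<^esub> \<zeta> = tangent_map \<H> Q (\<lambda>h. p h w) (q \<one>\<^bsub>K\<^esub>) \<xi>"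
      unfolding \<xi>_def
      by (rule tangent_map_compose[where F=q and G="\<lambda>h. p h w", OF G H Q sq _ \<zeta>]) (use orbit_H[OF w] q1 in simp)
    moreover have "tangent_map \<G> Q (\<lambda>F. p (q F) w) \<one>\<^bsub>K\<^esub> \<zeta> = tangent_map \<G> Q (\<lambda>F. F w) \<one>\<^bsub>K\<^esub> \<zeta>"
      by (rule tangent_map_cong[OF G Q orbit_G[OF w] \<zeta> oT T(1)]) (simp add: pq)
    ultimately show ?thesis by (simp add: q1)
  qed
  then have "induced_field K \<G> Q (\<lambda>F. F) \<zeta> = induced_field H \<H> Q p \<xi>"
    unfolding induced_field_def by (rule restrict_ext)
  ultimately show ?thesis by (simp only: imageI)
qed

theorem corollary2p2:
  fixes M :: "('m, real^'n::finite) mfd"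
    and cov :: "('m, real^'n) cov_deriv"
    and \<omega> :: "('m, 'n) frame \<Rightarrow> ('m, 'n) frame_tvec \<Rightarrow> real^'n^'n"
    and \<omega>0 :: "(real^'n, 'n) frame \<Rightarrow> (real^'n, 'n) frame_tvec \<Rightarrow> real^'n^'n"
    and u :: "('m, 'n) frame"
    and \<G> :: "(('m, 'n) frame \<Rightarrow> ('m, 'n) frame, 'e::real_normed_vector) mfd"
    and H :: "'h monoid"
    and \<H> :: "('h, 'f::real_normed_vector) mfd"
    and p :: "'h \<Rightarrow> ('m, 'n) frame \<Rightarrow> ('m, 'n) frame"
  assumes "smooth_manifold M" and "connected_space (tops M)"
    and "linear_connection M cov" and "flat_affine M cov"
    and "connection_form M cov \<omega>"
    and "u \<in> frames M"
    and "connection_form vector_mfd usual_connection \<omega>0"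
    and "aut_lie_structure M cov \<omega> \<G>"
    and "universal_covering_group H \<H>
           ((AutGroup M \<omega>)\<lparr>carrier := unit_component (AutGroup M \<omega>) \<G>\<rparr>)
           (open_submfd \<G> (unit_component (AutGroup M \<omega>) \<G>)) p"
  shows "\<exists>\<rho>. lie_group_hom H \<H> (AutGroup vector_mfd \<omega>0) (affine_aut_mfd \<omega>0) \<rho> \<and>
           (\<forall>Z\<in>complete_affine_lifts M cov.
              let \<xi> = inv_into (tangent_space \<H> \<one>\<^bsub>H\<^esub>) (induced_field H \<H> (frame_bundle M) p) Z
              in tangent_map \<H> (affine_aut_mfd \<omega>0) \<rho> \<one>\<^bsub>H\<^esub> \<xi> (affine_chart \<omega>0)
                 = (fundamental_form M u (Z u), \<omega> u (Z u)))"
proof -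
  define C where "C = unit_component (AutGroup M \<omega>) \<G>"
  let ?P = "frame_bundle M" and ?K = "AutGroup M \<omega>"
  have M: "smooth_atlas M" by (rule smooth_manifold_smooth_atlas[OF assms(1)])
  interpret flat_manifold M cov
    by unfold_locales (rule M assms(3) assms(4))+
  note P = smooth_atlas_frame_bundle[OF M] and pf = points_frame_bundle[OF M]
  note lie = assms(8)[unfolded aut_lie_structure_def] and cover = assms(9)[unfolded universal_covering_group_def, folded C_def]
  have G: "smooth_atlas \<G>" and ptG: "points \<G> = Aut M \<omega>"
    using lie[THEN conjunct1, unfolded lie_group_def] by (simp_all add: smooth_manifold_smooth_atlas AutGroup_def)
  have H: "smooth_atlas \<H>" and ptH: "points \<H> = carrier H" and grH: "group H"
    using cover by (simp_all add: lie_group_def smooth_manifold_smooth_atlas)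
  interpret H: group H by (rule grH)
  have evaluation: "smooth_map (prod_mfd \<G> ?P) ?P (\<lambda>(F, w). F w)" using lie by blast
  have C: "openin (tops \<G>) C" unfolding C_def unit_component_def by (rule openin_connected_component[OF G])
  have phom: "p \<in> hom H (?K\<lparr>carrier := C\<rparr>)" and pcov: "smooth_covering \<H> (open_submfd \<G> C) p" using cover by blast+
  have pC: "p h \<in> C" if "h \<in> carrier H" for h using hom_in_carrier[OF phom that] by simp
  have pA: "p h \<in> Aut M \<omega>" if "h \<in> carrier H" for h using pC[OF that] openin_subset[OF C] ptG by blast
  have pB: "p h \<in> Bij (frames M)" if "h \<in> carrier H" for h using pA[OF that] by (simp add: Aut_def)
  have pm: "p (g \<otimes>\<^bsub>H\<^esub> h) = compose (frames M) (p g) (p h)" if "g \<in> carrier H" "h \<in> carrier H" for g h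
    using hom_mult[OF phom that] pB that by (simp add: AutGroup_def BijGroup_def)
  have one: "\<one>\<^bsub>H\<^esub> \<in> carrier H" by simp
  \<comment> \<open>The image of the unit is an idempotent bijection of the frames, hence the
    identity.\<close>
  have p1: "p \<one>\<^bsub>H\<^esub> w = w" if w: "w \<in> frames M" for w
  proof -
    have b: "bij_betw (p \<one>\<^bsub>H\<^esub>) (frames M) (frames M)" using pB[OF one] by (simp add: Bij_def)
    have "p \<one>\<^bsub>H\<^esub> (p \<one>\<^bsub>H\<^esub> w) = p \<one>\<^bsub>H\<^esub> w" using fun_cong[OF pm[OF one one], of w] w by (simp add: compose_def)
    then show ?thesis using inj_onD[OF bij_betw_imp_inj_on[OF b] _ bij_betwE[OF b, rule_format, OF w] w] by blast
  qed
  have pK: "p \<one>\<^bsub>H\<^esub> = \<one>\<^bsub>?K\<^esub>"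
  proof
    fix w
    have "p \<one>\<^bsub>H\<^esub> \<in> extensional (frames M)" using pB[OF one] by (simp add: Bij_def)
    then show "p \<one>\<^bsub>H\<^esub> w = \<one>\<^bsub>?K\<^esub> w"
      using p1[of w] extensional_arb[of "p \<one>\<^bsub>H\<^esub>" "frames M" w]
      by (cases "w \<in> frames M") (simp_all add: AutGroup_def BijGroup_def)
  qed
  have sp: "smooth_near \<H> \<G> p h" if h: "h \<in> carrier H" for h
  proof -
    have "smooth_near \<H> (open_submfd \<G> C) p h"
      using smooth_mapD[OF H smooth_atlas_open_submfd[OF G C]] pcov h by (simp add: smooth_covering_def ptH)
    from smooth_near_compose[where F=p and G="\<lambda>F. F", OF H smooth_atlas_open_submfd[OF G C] G this smooth_near_inclusion[OF G C pC[OF h]]]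
    show ?thesis .
  qed
  have orbit_G: "smooth_near \<G> ?P (\<lambda>F. F w) F" if "F \<in> Aut M \<omega>" "w \<in> frames M" for F w
    using smooth_near_prod_left[OF G P P evaluation, of F w] that ptG pf by simp
  have orbit_H: "smooth_near \<H> ?P (\<lambda>h. p h w) h" if h: "h \<in> carrier H" and w: "w \<in> frames M" for h w
    by (rule smooth_near_compose[where F=p and G="\<lambda>F. F w", OF H G P sp[OF h] orbit_G[OF pA[OF h] w]])
  interpret automorphic_action H M \<omega> \<H> p
  proof (unfold_locales, rule M, rule H, rule ptH)
    show "smooth_map (prod_mfd \<H> \<H>) \<H> (\<lambda>(g, h). g \<otimes>\<^bsub>H\<^esub> h)" "smooth_map \<H> \<H> (\<lambda>g. inv\<^bsub>H\<^esub> g)"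
      using cover by (simp_all add: lie_group_def)
    have "continuous_map (tops \<H>) (tops \<G>) p"
      using pcov by (simp add: smooth_covering_def smooth_map_def open_submfd_def continuous_map_in_subtopology)
    then have "continuous_map (prod_topology (tops \<H>) (tops ?P)) (prod_topology (tops \<G>) (tops ?P)) (\<lambda>z. (p (fst z), snd z))"
      using continuous_map_pairedI[OF continuous_map_compose[OF continuous_map_fst] continuous_map_snd] by (simp add: comp_def)
    moreover have "continuous_map (prod_topology (tops \<G>) (tops ?P)) (tops ?P) (\<lambda>(F, w). F w)"
      using evaluation by (simp add: smooth_map_def prod_mfd_def)
    ultimately show "continuous_map (prod_topology (tops \<H>) (tops ?P)) (tops ?P) (\<lambda>z. p (fst z) (snd z))"
      using continuous_map_compose by (fastforce simp: comp_def)
  qed (simp_all add: pA p1 pm compose_def orbit_H)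
  obtain c U D where u: "u \<in> U" "D u = (0, mat 1)" and D: "development M \<omega> c U D"
    using ex_frame_development[OF assms(5,6)] by blast
  have sc: "simply_connected_space (tops \<H>)" using cover by blast
  obtain \<rho> V where \<rho>: "\<rho> \<in> hom H AffGroup" "smooth_map \<H> vector_mfd \<rho>"
    and V: "openin (tops \<H>) V" "\<one>\<^bsub>H\<^esub> \<in> V" "\<And>v. v \<in> V \<Longrightarrow> p v u \<in> U \<and> \<rho> v = D (p v u)"
    using ex_affine_hom[OF D u sc] by blast
  have inv: "invertible (snd (\<rho> h))" if "h \<in> carrier H" for h
    using hom_in_carrier[OF \<rho>(1) that] by simp
  show ?thesis
  proof (intro exI[of _ "\<lambda>h. affine_lift (\<rho> h)"] conjI ballI)
    have "(\<lambda>h. affine_lift (\<rho> h)) \<in> hom H (AutGroup vector_mfd \<omega>0)"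
      using hom_compose[OF \<rho>(1) affine_lift_hom[OF assms(7)]] by (simp add: comp_def)
    moreover have "smooth_map \<H> (affine_aut_mfd \<omega>0) (\<lambda>h. affine_lift (\<rho> h))"
      by (rule smooth_map_affine_lift[OF assms(7) H \<rho>(2)]) (simp add: inv ptH)
    ultimately show "lie_group_hom H \<H> (AutGroup vector_mfd \<omega>0) (affine_aut_mfd \<omega>0) (\<lambda>h. affine_lift (\<rho> h))"
      by (simp add: lie_group_hom_def)
    fix Z assume "Z \<in> complete_affine_lifts M cov"
    \<comment> \<open>The identification of the Lie algebra in \<open>aut_lie_structure\<close>
      provides a vector at the unit of the full automorphism group, which is then transferred to the
      covering group.\<close>
    then obtain \<zeta> where \<zeta>: "\<zeta> \<in> tangent_space \<G> \<one>\<^bsub>?K\<^esub>" "Z = induced_field ?K \<G> ?P (\<lambda>F. F) \<zeta>"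
      using lie unfolding bij_betw_def by blast
    let ?f = "induced_field H \<H> ?P p" and ?T = "tangent_space \<H> \<one>\<^bsub>H\<^esub>"
    have "Z \<in> ?f ` ?T"
      unfolding \<zeta>(2)
    proof (rule covering_induced_field[OF P G H C pcov _ pK _ _ \<zeta>(1)])
      show "\<one>\<^bsub>H\<^esub> \<in> points \<H>" by (simp add: ptH)
      show "smooth_near \<G> ?P (\<lambda>F. F w) \<one>\<^bsub>?K\<^esub>" "smooth_near \<H> ?P (\<lambda>h. p h w) \<one>\<^bsub>H\<^esub>" if "w \<in> points ?P" for w
        using that orbit_G[of "\<one>\<^bsub>?K\<^esub>" w] orbit_H[OF one, of w] pA[OF one] by (simp_all add: pf pK)
    qed
    note in_T = inv_into_into[OF this] and f_inv = f_inv_into_f[OF this]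
    \<comment> \<open>The derivative of the homomorphism at \<xi> depends on \<xi> only through the
      value at u of the field it induces, so whichever preimage of Z is selected by
      \<open>inv_into\<close> gives the stated pair.\<close>
    have "?f \<xi> u = tangent_map \<H> ?P (\<lambda>h. p h u) \<one>\<^bsub>H\<^esub> \<xi>" for \<xi>
      using assms(6) by (simp add: induced_field_def pf)
    from this[of "inv_into ?T ?f Z"] f_inv
    have "tangent_map \<H> ?P (\<lambda>h. p h u) \<one>\<^bsub>H\<^esub> (inv_into ?T ?f Z) = Z u" by simp
    with tangent_map_affine_lift[OF D u assms(7) V in_T]
    show "let \<xi> = inv_into ?T ?f Z
        in tangent_map \<H> (affine_aut_mfd \<omega>0) (\<lambda>h. affine_lift (\<rho> h)) \<one>\<^bsub>H\<^esub> \<xi> (affine_chart \<omega>0)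
          = (fundamental_form M u (Z u), \<omega> u (Z u))"
      by (simp only: Let_def)
  qed
qed

end
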